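(* Consider the infinite-horizon ($T=\infty$), time-invariant linear-quadratic game with $N$ decision makers described in the context, and let $F^i$, $(G^i_n)_{n\in\mathbb{N}_0}$, $H^i$, $\mathcal{D},(\mathcal{G}^p_n)_{n\in\mathbb{N}_0},\mathcal{H}^p,\mathcal{A},(\mathcal{G}^X_n)_{n\in\mathbb{N}_0},\mathcal{H}^X,\mathcal{C}$ be the constants defined there from the problem data. With $X_t=(x_t^i)_{i\in[0,N]}$ and $W_t=(w_t^i)_{i\in[0,N]}$, assume: (1) (i) $A^0$ is stable and $(A^i,B^i)$ is stabilizable for all $i\in[1,N]$; (ii) $X_0,W_0,W_1,\dots,\xi_0,\xi_1,\dots$ are mutually independent and have finite second-order moments; (iii) $(W_t)_{t\in\mathbb{N}_0}$ and $(\xi_t)_{t\in\mathbb{N}_0}$ are each independent and identically distributed. (2) For any $\hat X_0$, the infinite system of linear equations $$\hat{y}_{t} = \mathcal{D} \hat{X}_{t} + \sum_{n\in\mathbb{N}_0} \mathcal{G}_n^{p} \hat{y}_{t+n} +\mathcal{H}^p +E[\xi_0],\qquad \hat{X}_{t+1} = \mathcal{A} \hat{X}_{t} + \sum_{n\in\mathbb{N}_0} \mathcal{G}_n^X \hat{y}_{t+n} + \mathcal{H}^X+ \mathcal{C} \hat{y}_{t} + E[W_0],\qquad t\in\mathbb{N}_0,$$ has a unique solution $(\hat y_t)_{t\in\mathbb{N}_0}$, which is necessarily of the form $\hat y_t=a_t\hat X_0+b_t$, $t\in\mathbb{N}_0$, with $a_t,b_t$ not depending on $\hat X_0$; and $(a_t)_{t\in\mathbb{N}_0}$,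 $(b_t)_{t\in\mathbb{N}_0}$ are uniformly bounded. Put $\mathcal{G}^{p}:=\sum_{n} \mathcal{G}_n^{p} a_n$, $\check{\mathcal{H}}^p := \sum_{n} \mathcal{G}_n^{p} b_n + \mathcal{H}^p$, $\mathcal{G}^{X}:=\sum_{n} \mathcal{G}_n^{X} a_n$, $\check{\mathcal{H}}^X := \sum_{n} \mathcal{G}_n^{X} b_n + \mathcal{H}^X$, $G^i:=\sum_{n} G_n^i a_n$, $\check{H}^i:=\sum_{n} G_n^i b_n + H^i$ (sums over $n\in\mathbb{N}_0$). Let $(\bar y_t)_{t\in\mathbb{N}_0}$ be generated by $\bar{y}_t = \mathcal{D} \bar{X}_t + \mathcal{G}^{p} E[\bar{X}_t|\bar{Y}_{t-1}] + \check{\mathcal{H}}^p +\bar{\xi}_t$, $\bar{X}_{t+1} = \mathcal{A} \bar{X}_t + \mathcal{G}^X E[\bar{X}_t|\bar{Y}_{t-1}] + \check{\mathcal{H}}^X+ \mathcal{C} \bar{y}_t + \bar{W}_t$, where $\bar Y_{t-1}=(\bar y_k)_{k\in[0,t)}$ and $(\bar X_0,(\bar\xi_t)_{t},(\bar W_t)_{t})$ has the same distribution as $(X_0,(\xi_t)_{t},(W_t)_{t})$, let $\hat{\bar X}_{t|t-1}(\cdot)$ denote the map $\bar Y_{t-1}\mapsto E[\bar X_t|\bar Y_{t-1}]$, and let $s$ be the joint strategy $s_t^i(I_t^i,Y_{t-1})=F^ix_t^i+G^i\hat{\bar X}_{t|t-1}(Y_{t-1})+\check H^i$, $i\in[1,N]$,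 $t\in\mathbb{N}_0$. Assume further that (i) $\big(X_0,(\xi_t)_{t\in\mathbb{N}_0},(W_t)_{t\in\mathbb{N}_0}\big)$ is Gaussian, (ii) $\mathcal{D}\Sigma\mathcal{D}'+\mathrm{cov}[\xi_0]$ is invertible, and (iii) $\mathrm{cov}[X_0]=\Sigma$, where $\Sigma$ solves $$\Sigma = \mathcal{A}\big(\Sigma - \Sigma \mathcal{D}' (\mathcal{D}\Sigma\mathcal{D}'+\mathrm{cov}[\xi_0])^{-1} \mathcal{D} \Sigma \big) \mathcal{A}' + \mathrm{cov}[W_0].$$ Then, provided $(y_t)_{t\in[0,\infty)}$ generated under $s$ satisfies $\sup_{t\in[0,\infty)}E[|y_t|^2]<\infty$, the strategy $s$ is an SEBEU (subjective equilibrium under beliefs of exogenous uncertainty) in pure strategies and can be implemented by the linear time-invariant system: for $i\in[1,N]$, $t\in\mathbb{N}_0$, $$s_t^i(I_t^i,Y_{t-1}) = F^i x_t^i+G^i \hat{\bar{X}}_{t|t-1} + \check{H}^i,$$ $$\hat{\bar{X}}_{t+1|t} = \mathcal{A} \hat{\bar{X}}_{t|t-1} + \mathcal{G}^X \hat{\bar{X}}_{t|t-1} + \check{\mathcal{H}}^X+ \mathcal{C} y_t + E[W_0] + \mathcal{A}\Sigma \mathcal{D}' (\mathcal{D}\Sigma \mathcal{D}'+\mathrm{cov}[\xi_0])^{-1} \big(y_t-(\mathcal{D} + \mathcal{G}^{p}) \hat{\bar{X}}_{t|t-1} - \check{\mathcal{H}}^p - E[\xi_0]\big),$$ initialized at $\hat{\bar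 X}_{0|-1}=E[X_0]$.
   Context: Notation. $\mathbb{N}_0=\{0,1,\dots\}$, $[1,N]=\{1,\dots,N\}$, $[0,N]=\{0,\dots,N\}$, $[0,\infty)=\mathbb{N}_0$ for time indices, $[0,t)=\{0,\dots,t-1\}$; $|x|_Q^2=x'Qx$; $'$ is transpose; $A\succ0$, $A\succeq0$ mean positive (semi)definite; $\mathrm{cov}[\cdot]$ is the covariance matrix; $\mathcal{P}(\cdot)$ is the set of Borel probability measures. A matrix is stable in the discrete-time sense. All vectors are columns. A solution of an infinite linear system is a sequence for which all series involved converge and all equations hold. Game. There are $N\in\mathbb{N}$ decision makers DM$^1,\dots,$DM$^N$. DM$^i$ has state $x_t^i\in\mathbb{R}^{n_x^i}$, control $u_t^i\in\mathbb{R}^{n_u^i}$, disturbance $w_t^i\in\mathbb{R}^{n_x^i}$; environment variables are $y_t\in\mathbb{Y}=\mathbb{R}^{n_y}$, with $\xi_t\in\mathbb{R}^{n_y}$; the environment dynamics has state $x_t^0$ and disturbance $w_t^0$ in $\mathbb{R}^{n_x^0}$. For $t\in\mathbb{N}_0$, $$x_{t+1}^i=A^ix_t^i+B^iu_t^i+C^iy_t+w_t^i,\quad i\in[1,N],$$ $$x_{t+1}^0=A^0x_t^0+\sum_{i\in[1,N]}(B^{1,i}u_t^i+B^{2,i}x_t^i)+w_t^0,\qquad y_t=Dx_t^0+\sum_{i\in[1,N]}(E^{1,i}u_t^i+E^{2,i}x_t^i)+\xi_t,$$ with possibly random initial states $x_0^i$, $i\in[0,N]$, and given constant matrices of appropriate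 dimensions. DM$^i$ has stage cost $$c^i(x^i,u^i,y)=|x^i|^2_{Q^i}+|u^i|^2_{R^i}+2y'(K^iu^i+L^ix^i),\quad Q^i\succ0,\ R^i\succ0,$$ no terminal cost, and discount factor $\beta^i\in[0,1)$. Strategies. At time $t$ DM$^i$ has access to $(I_t^i,Y_{t-1})$, where $I_t^i=((x_k^i)_{k\in[0,t]},(u_k^i)_{k\in[0,t)})$ and $Y_{t-1}=(y_k)_{k\in[0,t)}$. A pure strategy $s^i=(s_t^i)_{t\in\mathbb{N}_0}$ of DM$^i$ is a collection of measurable maps giving $u_t^i=s_t^i(I_t^i,Y_{t-1})$; $\mathbb{S}^i$ is the set of these, $\mathbb{S}=\mathbb{S}^1\times\cdots\times\mathbb{S}^N$. Subjective cost. For $s^i\in\mathbb{S}^i$ and a deterministic sequence $\bar Z=(\bar z_t)_{t\in\mathbb{N}_0}\in\mathbb{Y}^{[0,\infty)}$, $$J^i(s^i,\bar Z)=E\Big[\sum_{t\in\mathbb{N}_0}(\beta^i)^tc^i(x_t^i,u_t^i,\bar z_t)\Big],$$ where $x_{t+1}^i=A^ix_t^i+B^iu_t^i+C^i\bar z_t+w_t^i$ and $u_t^i=s_t^i(I_t^i,(\bar z_k)_{k\in[0,t)})$. For $\zeta\in\mathcal{P}(\mathbb{Y}^{[0,\infty)})$, $E^{\zeta}[J^i(s^i,\cdot)]$ is the expectation of $J^i(s^i,\cdot)$ when the sequence has law $\zeta$ (i.e. the environment variables are an exogenous sequence with law $\zeta$, independent of all other primitive random variables). SEBEU. A joint strategy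 $s=(s^1,\dots,s^N)\in\mathbb{S}$ is a subjective equilibrium under beliefs of exogenous uncertainty (SEBEU) in pure strategies if there exist beliefs $\zeta^1,\dots,\zeta^N\in\mathcal{P}(\mathbb{Y}^{[0,\infty)})$ with (i) $E^{\zeta^i}[J^i(s^i,\cdot)]\le E^{\zeta^i}[J^i(\tilde s^i,\cdot)]$ for all $i\in[1,N]$, $\tilde s^i\in\mathbb{S}^i$; and (ii) $\zeta^i=\zeta_s$ for all $i\in[1,N]$, where $\zeta_s$ is the law of $(y_t)_{t\in\mathbb{N}_0}$ generated endogenously by the game dynamics when all DMs use $s$. Optimal-response constants. For each $i$ (superscript $i$ omitted on the right-hand sides), let $M\succeq0$ be the unique positive semidefinite solution of $$M=Q+\beta A'(M-\beta MBS^{-1}B'M)A,\qquad S=R+\beta B'MB,$$ (which exists since $(A,B)$ is stabilizable and $Q\succ0$), and $$F^i=-\beta S^{-1}B'MA,\qquad G_0^i=-S^{-1}(K'+\beta B'MC),$$ $$G_n^i=-\beta S^{-1}B'(\beta(A+BF)')^{n-1}\big((F'K'+L')+\beta(A+BF)'MC\big),\ n\ge1,$$ $$H^i=-\beta S^{-1}B'(I-\beta(A+BF)')^{-1}M\,E[w_0].$$ Aggregate constants (with respect to $X_t=(x_t^0,x_t^1,\dots,x_t^N)$ stacked as a column): $\mathcal{D}=[D,\ E^{1,1}F^1+E^{2,1},\dots,E^{1,N}F^N+E^{2,N}]$; $\mathcal{G}^p_n=\sum_jE^{1,j}G_n^j$; $\mathcal{H}^p=\sum_jE^{1,j}H^j$;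 $\mathcal{A}$ has first block row $[A^0,\ B^{1,1}F^1+B^{2,1},\dots,B^{1,N}F^N+B^{2,N}]$ and, for $j\in[1,N]$, the block row of $x^j$ has only nonzero block $A^j+B^jF^j$ in the column of $x^j$; $\mathcal{G}^X_n$ is the column stack of $\sum_jB^{1,j}G_n^j,\ B^1G_n^1,\dots,B^NG_n^N$; $\mathcal{H}^X$ is the column stack of $\sum_jB^{1,j}H^j,\ B^1H^1,\dots,B^NH^N$; $\mathcal{C}$ is the column stack of $0,C^1,\dots,C^N$. (Sums over $j\in[1,N]$.) *)

theory Defs
  imports
    "HOL-Probability.Probability"
    "Jordan_Normal_Form.Gauss_Jordan_Elimination"
    "Jordan_Normal_Form.Char_Poly"
begin

text \<open>The dimensions of states and controls differ between decision makers, so vectors and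
  matrices are those of \<^theory>\<open>Jordan_Normal_Form.Matrix\<close>, whose dimensions are values.\<close>

unbundle no vec_syntax
unbundle no inner_syntax
hide_type (open) Finite_Cartesian_Product.vec
hide_const (open) Finite_Cartesian_Product.vec Finite_Cartesian_Product.mat
  Finite_Cartesian_Product.row Finite_Cartesian_Product.rows

type_synonym rvec = "real Matrix.vec"
type_synonym rmat = "real Matrix.mat"

section \<open>Matrices\<close>

abbreviation tr :: "rmat \<Rightarrow> rmat" where "tr \<equiv> transpose_mat"

text \<open>Only applied to matrices that are invertible.\<close>
abbreviation inv_mat :: "rmat \<Rightarrow> rmat" where "inv_mat S \<equiv> the (mat_inverse S)"

definition pos_semidef :: "nat \<Rightarrow> rmat \<Rightarrow> bool" where
  "pos_semidef n Q \<longleftrightarrow> Q \<in> carrier_mat n n \<and> tr Q = Q \<and>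
     (\<forall>v\<in>carrier_vec n. 0 \<le> v \<bullet> (Q *\<^sub>v v))"

definition pos_def :: "nat \<Rightarrow> rmat \<Rightarrow> bool" where
  "pos_def n Q \<longleftrightarrow> Q \<in> carrier_mat n n \<and> tr Q = Q \<and>
     (\<forall>v\<in>carrier_vec n. v \<noteq> 0\<^sub>v n \<longrightarrow> 0 < v \<bullet> (Q *\<^sub>v v))"

text \<open>Discrete-time stability. Equivalent to \<open>spectral_radius < 1\<close>, but also meaningful in dimension 0.\<close>
definition stable_mat :: "rmat \<Rightarrow> bool" where
  "stable_mat A \<longleftrightarrow> (\<forall>z. eigenvalue (map_mat complex_of_real A) z \<longrightarrow> cmod z < 1)"

definition stabilizable :: "rmat \<Rightarrow> rmat \<Rightarrow> bool" where
  "stabilizable A B \<longleftrightarrow> (\<exists>K\<in>carrier_mat (dim_col B) (dim_row A). stable_mat (A + B * K))"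

definition hcat :: "nat \<Rightarrow> rmat list \<Rightarrow> rmat" where
  "hcat nr As = mat_of_cols nr (concat (map cols As))"

definition vcat :: "nat \<Rightarrow> rmat list \<Rightarrow> rmat" where
  "vcat nc As = mat_of_rows nc (concat (map rows As))"

definition sum_vec :: "nat \<Rightarrow> ('i \<Rightarrow> rvec) \<Rightarrow> 'i set \<Rightarrow> rvec" where
  "sum_vec n f I = vec n (\<lambda>k. \<Sum>i\<in>I. f i $ k)"

definition sum_mat :: "nat \<Rightarrow> nat \<Rightarrow> ('i \<Rightarrow> rmat) \<Rightarrow> 'i set \<Rightarrow> rmat" where
  "sum_mat r c f I = mat r c (\<lambda>kl. \<Sum>i\<in>I. f i $$ kl)"

definition summable_vec :: "nat \<Rightarrow> (nat \<Rightarrow> rvec) \<Rightarrow> bool" where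
  "summable_vec d f \<longleftrightarrow> (\<forall>k<d. summable (\<lambda>n. f n $ k))"

definition suminf_vec :: "nat \<Rightarrow> (nat \<Rightarrow> rvec) \<Rightarrow> rvec" where
  "suminf_vec d f = vec d (\<lambda>k. \<Sum>n. f n $ k)"

definition suminf_mat :: "nat \<Rightarrow> nat \<Rightarrow> (nat \<Rightarrow> rmat) \<Rightarrow> rmat" where
  "suminf_mat r c f = mat r c (\<lambda>kl. \<Sum>n. f n $$ kl)"

section \<open>Random vectors\<close>

text \<open>The Borel measurable space of \<open>\<real>\<^sup>n\<close>.\<close>
definition borel_vec :: "nat \<Rightarrow> rvec measure" where
  "borel_vec n =
     vimage_algebra (carrier_vec n) (\<lambda>v. \<lambda>k\<in>{..<n}. v $ k) (\<Pi>\<^sub>M k\<in>{..<n}. borel)"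

definition mean_vec :: "'a measure \<Rightarrow> nat \<Rightarrow> ('a \<Rightarrow> rvec) \<Rightarrow> rvec" where
  "mean_vec M n X = vec n (\<lambda>k. \<integral>\<omega>. X \<omega> $ k \<partial>M)"

definition cov_mat :: "'a measure \<Rightarrow> nat \<Rightarrow> ('a \<Rightarrow> rvec) \<Rightarrow> rmat" where
  "cov_mat M n X = mat n n (\<lambda>(k, l).
     \<integral>\<omega>. (X \<omega> $ k - mean_vec M n X $ k) * (X \<omega> $ l - mean_vec M n X $ l) \<partial>M)"

definition finite_second_moment :: "'a measure \<Rightarrow> nat \<Rightarrow> ('a \<Rightarrow> rvec) \<Rightarrow> bool" where
  "finite_second_moment M n X \<longleftrightarrow> (\<forall>k<n. integrable M (\<lambda>\<omega>. (X \<omega> $ k)\<^sup>2))"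

definition cond_exp_vec :: "'a measure \<Rightarrow> 'a measure \<Rightarrow> nat \<Rightarrow> ('a \<Rightarrow> rvec) \<Rightarrow> 'a \<Rightarrow> rvec" where
  "cond_exp_vec M F n X \<omega> = vec n (\<lambda>k. real_cond_exp M F (\<lambda>\<omega>'. X \<omega>' $ k) \<omega>)"

text \<open>The \<open>\<sigma>\<close>-algebra generated by \<open>y\<^sub>0, \<dots>, y\<^bsub>t-1\<^esub>\<close>.\<close>
definition past_algebra :: "'a measure \<Rightarrow> nat \<Rightarrow> (nat \<Rightarrow> 'a \<Rightarrow> rvec) \<Rightarrow> nat \<Rightarrow> 'a measure" where
  "past_algebra M n y t =
     vimage_algebra (space M) (\<lambda>\<omega>. \<lambda>k\<in>{..<t}. y k \<omega>) (\<Pi>\<^sub>M k\<in>{..<t}. borel_vec n)"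

text \<open>Degenerate (constant) Gaussian variables are included, since covariances may be singular.\<close>
definition gaussian_rv :: "'a measure \<Rightarrow> ('a \<Rightarrow> real) \<Rightarrow> bool" where
  "gaussian_rv M X \<longleftrightarrow> X \<in> borel_measurable M \<and>
     (\<exists>\<mu> \<sigma>. 0 \<le> \<sigma> \<and> distr M borel X =
        (if \<sigma> = 0 then return borel \<mu> else density lborel (normal_density \<mu> \<sigma>)))"

definition jointly_gaussian :: "'a measure \<Rightarrow> 'i set \<Rightarrow> ('i \<Rightarrow> 'a \<Rightarrow> real) \<Rightarrow> bool" where
  "jointly_gaussian M I V \<longleftrightarrow>
     (\<forall>J c. finite J \<and> J \<subseteq> I \<longrightarrow> gaussian_rv M (\<lambda>\<omega>. \<Sum>j\<in>J. c j * V j \<omega>))"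

text \<open>Expectation of an extended real function. As \<open>\<infinity> - \<infinity> = \<infinity>\<close> in \<^typ>\<open>ereal\<close>, it is \<open>\<infinity>\<close> when the
  positive and the negative part both have infinite integral.\<close>
definition ereal_expectation :: "'a measure \<Rightarrow> ('a \<Rightarrow> ereal) \<Rightarrow> ereal" where
  "ereal_expectation M f =
     enn2ereal (\<integral>\<^sup>+\<omega>. e2ennreal (f \<omega>) \<partial>M) - enn2ereal (\<integral>\<^sup>+\<omega>. e2ennreal (- f \<omega>) \<partial>M)"

section \<open>The game\<close>

text \<open>Index 0 is the environment, \<open>1, \<dots>, N\<close> are the decision makers, and \<open>B1, B2, E1, E2\<close> stand for
  \<open>B\<^bsup>1,i\<^esup>\<close>, \<open>B\<^bsup>2,i\<^esup>\<close>, \<open>E\<^bsup>1,i\<^esup>\<close>, \<open>E\<^bsup>2,i\<^esup>\<close>.\<close>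
record lq_game =
  nDM :: nat
  nx :: "nat \<Rightarrow> nat"
  nu :: "nat \<Rightarrow> nat"
  ny :: nat
  mA :: "nat \<Rightarrow> rmat"
  mB :: "nat \<Rightarrow> rmat"
  mC :: "nat \<Rightarrow> rmat"
  mB1 :: "nat \<Rightarrow> rmat"
  mB2 :: "nat \<Rightarrow> rmat"
  mD :: rmat
  mE1 :: "nat \<Rightarrow> rmat"
  mE2 :: "nat \<Rightarrow> rmat"
  mQ :: "nat \<Rightarrow> rmat"
  mR :: "nat \<Rightarrow> rmat"
  mK :: "nat \<Rightarrow> rmat"
  mL :: "nat \<Rightarrow> rmat"
  disc :: "nat \<Rightarrow> real"

definition lq_game_data :: "lq_game \<Rightarrow> bool" where
  "lq_game_data g \<longleftrightarrow> 1 \<le> nDM g \<and>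
     mA g 0 \<in> carrier_mat (nx g 0) (nx g 0) \<and> mD g \<in> carrier_mat (ny g) (nx g 0) \<and>
     (\<forall>i\<in>{1..nDM g}.
        mA g i \<in> carrier_mat (nx g i) (nx g i) \<and>
        mB g i \<in> carrier_mat (nx g i) (nu g i) \<and>
        mC g i \<in> carrier_mat (nx g i) (ny g) \<and>
        mB1 g i \<in> carrier_mat (nx g 0) (nu g i) \<and>
        mB2 g i \<in> carrier_mat (nx g 0) (nx g i) \<and>
        mE1 g i \<in> carrier_mat (ny g) (nu g i) \<and>
        mE2 g i \<in> carrier_mat (ny g) (nx g i) \<and>
        mK g i \<in> carrier_mat (ny g) (nu g i) \<and>
        mL g i \<in> carrier_mat (ny g) (nx g i) \<and>
        pos_def (nx g i) (mQ g i) \<and> pos_def (nu g i) (mR g i) \<and>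
        0 \<le> disc g i \<and> disc g i < 1)"

definition stage_cost :: "lq_game \<Rightarrow> nat \<Rightarrow> rvec \<Rightarrow> rvec \<Rightarrow> rvec \<Rightarrow> real" where
  "stage_cost g i x u y =
     x \<bullet> (mQ g i *\<^sub>v x) + u \<bullet> (mR g i *\<^sub>v u) + 2 * (y \<bullet> (mK g i *\<^sub>v u + mL g i *\<^sub>v x))"

text \<open>At time \<open>t\<close> the arguments of a strategy are \<open>(x\<^sub>k)\<^bsub>k\<le>t\<^esub>\<close>, \<open>(u\<^sub>k)\<^bsub>k<t\<^esub>\<close> and \<open>(y\<^sub>k)\<^bsub>k<t\<^esub>\<close>, as
  extensional functions.\<close>
type_synonym info = "(nat \<Rightarrow> rvec) \<times> (nat \<Rightarrow> rvec) \<times> (nat \<Rightarrow> rvec)"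
type_synonym strategy = "nat \<Rightarrow> info \<Rightarrow> rvec"

definition info :: "nat \<Rightarrow> (nat \<Rightarrow> rvec) \<Rightarrow> (nat \<Rightarrow> rvec) \<Rightarrow> (nat \<Rightarrow> rvec) \<Rightarrow> info" where
  "info t x u y = (restrict x {..t}, restrict u {..<t}, restrict y {..<t})"

definition strategies :: "lq_game \<Rightarrow> nat \<Rightarrow> strategy set" where
  "strategies g i = {\<sigma>. \<forall>t. \<sigma> t \<in>
     (\<Pi>\<^sub>M k\<in>{..t}. borel_vec (nx g i)) \<Otimes>\<^sub>M (\<Pi>\<^sub>M k\<in>{..<t}. borel_vec (nu g i)) \<Otimes>\<^sub>M
       (\<Pi>\<^sub>M k\<in>{..<t}. borel_vec (ny g)) \<rightarrow>\<^sub>M borel_vec (nu g i)}"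

subsection \<open>Subjective cost\<close>

text \<open>Private state and control paths under an exogenous environment sequence \<open>z\<close>: after \<open>t\<close> steps the
  first component is determined up to time \<open>t\<close> and the second before time \<open>t\<close>; the remaining values
  are placeholders.\<close>
primrec subj_hist ::
  "lq_game \<Rightarrow> nat \<Rightarrow> strategy \<Rightarrow> rvec \<Rightarrow> (nat \<Rightarrow> rvec) \<Rightarrow> (nat \<Rightarrow> rvec) \<Rightarrow> nat
    \<Rightarrow> (nat \<Rightarrow> rvec) \<times> (nat \<Rightarrow> rvec)" where
  "subj_hist g i \<sigma> x0 w z 0 = ((\<lambda>_. x0), (\<lambda>_. 0\<^sub>v (nu g i)))"
| "subj_hist g i \<sigma> x0 w z (Suc t) =
    (let (x, u) = subj_hist g i \<sigma> x0 w z t; ut = \<sigma> t (info t x u z)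
     in (x(Suc t := mA g i *\<^sub>v x t + mB g i *\<^sub>v ut + mC g i *\<^sub>v z t + w t), u(t := ut)))"

definition "subj_x g i \<sigma> x0 w z t = fst (subj_hist g i \<sigma> x0 w z t) t"
definition "subj_u g i \<sigma> x0 w z t = snd (subj_hist g i \<sigma> x0 w z (Suc t)) t"

lemma subj_hist_past:
  assumes "k \<le> t"
  shows "fst (subj_hist g i \<sigma> x0 w z t) k = subj_x g i \<sigma> x0 w z k"
    and "k < t \<Longrightarrow> snd (subj_hist g i \<sigma> x0 w z t) k = subj_u g i \<sigma> x0 w z k"
  using assms
  by (induction t)
    (auto simp: subj_x_def subj_u_def Let_def le_Suc_eq less_Suc_eq split: prod.splits)

lemma subj_equations:
  "subj_x g i \<sigma> x0 w z 0 = x0"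
  "subj_u g i \<sigma> x0 w z t = \<sigma> t (info t (subj_x g i \<sigma> x0 w z) (subj_u g i \<sigma> x0 w z) z)"
  "subj_x g i \<sigma> x0 w z (Suc t) =
     mA g i *\<^sub>v subj_x g i \<sigma> x0 w z t + mB g i *\<^sub>v subj_u g i \<sigma> x0 w z t + mC g i *\<^sub>v z t + w t"
proof -
  have *: "info t (fst (subj_hist g i \<sigma> x0 w z t)) (snd (subj_hist g i \<sigma> x0 w z t)) z =
      info t (subj_x g i \<sigma> x0 w z) (subj_u g i \<sigma> x0 w z) z"
    by (auto simp: info_def restrict_def subj_hist_past fun_eq_iff)
  show "subj_x g i \<sigma> x0 w z 0 = x0" by (simp add: subj_x_def)
  show u: "subj_u g i \<sigma> x0 w z t = \<sigma> t (info t (subj_x g i \<sigma> x0 w z) (subj_u g i \<sigma> x0 w z) z)"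
    by (simp add: subj_u_def Let_def case_prod_unfold flip: *)
  show "subj_x g i \<sigma> x0 w z (Suc t) =
      mA g i *\<^sub>v subj_x g i \<sigma> x0 w z t + mB g i *\<^sub>v subj_u g i \<sigma> x0 w z t + mC g i *\<^sub>v z t + w t"
    by (subst u) (simp add: subj_x_def[of g i \<sigma> x0 w z "Suc t"] Let_def case_prod_unfold * subj_hist_past)
qed

text \<open>The limit superior is the value of the series whenever it converges in \<open>[-\<infinity>, \<infinity>]\<close>. This is the
  case if \<open>(disc g i)\<^sup>t \<bar>z\<^sub>t\<bar>\<^sup>2\<close> is summable, as \<open>stage_cost\<close> is then minorized by a multiple
  of \<open>- \<bar>z\<^sub>t\<bar>\<^sup>2\<close>.\<close>
definition path_cost ::
  "lq_game \<Rightarrow> nat \<Rightarrow> strategy \<Rightarrow> rvec \<Rightarrow> (nat \<Rightarrow> rvec) \<Rightarrow> (nat \<Rightarrow> rvec) \<Rightarrow> ereal" where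
  "path_cost g i \<sigma> x0 w z = limsup (\<lambda>T. ereal (\<Sum>t<T. disc g i ^ t *
     stage_cost g i (subj_x g i \<sigma> x0 w z t) (subj_u g i \<sigma> x0 w z t) (z t)))"

text \<open>The primitive random variables are \<open>x0 i\<close>, \<open>w i t\<close> and \<open>xi t\<close> on the probability space \<open>M\<close>.\<close>

definition subj_cost :: "lq_game \<Rightarrow> 'a measure \<Rightarrow> (nat \<Rightarrow> 'a \<Rightarrow> rvec) \<Rightarrow> (nat \<Rightarrow> nat \<Rightarrow> 'a \<Rightarrow> rvec)
    \<Rightarrow> nat \<Rightarrow> strategy \<Rightarrow> (nat \<Rightarrow> rvec) \<Rightarrow> ereal" where
  "subj_cost g M x0 w i \<sigma> z =
     ereal_expectation M (\<lambda>\<omega>. path_cost g i \<sigma> (x0 i \<omega>) (\<lambda>t. w i t \<omega>) z)"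

subsection \<open>Endogenous environment and equilibrium\<close>

text \<open>State, control and environment paths of the game, with the same placeholders as above.\<close>
primrec game_hist ::
  "lq_game \<Rightarrow> (nat \<Rightarrow> strategy) \<Rightarrow> (nat \<Rightarrow> rvec) \<Rightarrow> (nat \<Rightarrow> nat \<Rightarrow> rvec) \<Rightarrow> (nat \<Rightarrow> rvec) \<Rightarrow> nat
    \<Rightarrow> (nat \<Rightarrow> nat \<Rightarrow> rvec) \<times> (nat \<Rightarrow> nat \<Rightarrow> rvec) \<times> (nat \<Rightarrow> rvec)" where
  "game_hist g s x0 w xi 0 = ((\<lambda>i _. x0 i), (\<lambda>i _. 0\<^sub>v (nu g i)), (\<lambda>_. 0\<^sub>v (ny g)))"
| "game_hist g s x0 w xi (Suc t) =
    (let (x, u, y) = game_hist g s x0 w xi t;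
         ut = (\<lambda>i. s i t (info t (x i) (u i) y));
         yt = mD g *\<^sub>v x 0 t +
           sum_vec (ny g) (\<lambda>i. mE1 g i *\<^sub>v ut i + mE2 g i *\<^sub>v x i t) {1..nDM g} + xi t;
         xt' = (\<lambda>i. if i = 0
           then mA g 0 *\<^sub>v x 0 t +
             sum_vec (nx g 0) (\<lambda>j. mB1 g j *\<^sub>v ut j + mB2 g j *\<^sub>v x j t) {1..nDM g} + w 0 t
           else mA g i *\<^sub>v x i t + mB g i *\<^sub>v ut i + mC g i *\<^sub>v yt + w i t)
     in (\<lambda>i. (x i)(Suc t := xt' i), \<lambda>i. (u i)(t := ut i), y(t := yt)))"

definition "game_x g s x0 w xi i t = fst (game_hist g s x0 w xi t) i t"
definition "game_u g s x0 w xi i t = fst (snd (game_hist g s x0 w xi (Suc t))) i t"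
definition "game_y g s x0 w xi t = snd (snd (game_hist g s x0 w xi (Suc t))) t"

lemma game_hist_past:
  assumes "k \<le> t"
  shows "fst (game_hist g s x0 w xi t) i k = game_x g s x0 w xi i k"
    and "k < t \<Longrightarrow> fst (snd (game_hist g s x0 w xi t)) i k = game_u g s x0 w xi i k"
    and "k < t \<Longrightarrow> snd (snd (game_hist g s x0 w xi t)) k = game_y g s x0 w xi k"
  using assms
  by (induction t)
    (auto simp: game_x_def game_u_def game_y_def Let_def le_Suc_eq less_Suc_eq split: prod.splits)

lemma game_equations:
  fixes g s x0 w xi
  defines "x \<equiv> game_x g s x0 w xi" and "u \<equiv> game_u g s x0 w xi" and "y \<equiv> game_y g s x0 w xi"
  shows "x i 0 = x0 i"
    and "u i t = s i t (info t (x i) (u i) y)"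
    and "y t = mD g *\<^sub>v x 0 t +
           sum_vec (ny g) (\<lambda>i. mE1 g i *\<^sub>v u i t + mE2 g i *\<^sub>v x i t) {1..nDM g} + xi t"
    and "x 0 (Suc t) = mA g 0 *\<^sub>v x 0 t +
           sum_vec (nx g 0) (\<lambda>j. mB1 g j *\<^sub>v u j t + mB2 g j *\<^sub>v x j t) {1..nDM g} + w 0 t"
    and "0 < i \<Longrightarrow>
         x i (Suc t) = mA g i *\<^sub>v x i t + mB g i *\<^sub>v u i t + mC g i *\<^sub>v y t + w i t"
proof -
  let ?h = "game_hist g s x0 w xi t"
  have *: "info t (fst ?h i) (fst (snd ?h) i) (snd (snd ?h)) = info t (x i) (u i) y" for i
    by (auto simp: info_def restrict_def game_hist_past x_def u_def y_def fun_eq_iff)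
  have xt: "fst ?h i t = x i t" for i by (simp add: x_def game_hist_past)
  have step: "u i t = fst (snd (game_hist g s x0 w xi (Suc t))) i t"
    "y t = snd (snd (game_hist g s x0 w xi (Suc t))) t"
    "x i (Suc t) = fst (game_hist g s x0 w xi (Suc t)) i (Suc t)" for i
    by (simp_all only: x_def u_def y_def game_x_def game_u_def game_y_def)
  note simps = game_hist.simps Let_def case_prod_unfold fst_conv snd_conv fun_upd_same
  show "x i 0 = x0 i" by (simp add: x_def game_x_def)
  show u: "u i t = s i t (info t (x i) (u i) y)" for i
    by (simp only: step(1)) (simp only: simps *)
  show y: "y t = mD g *\<^sub>v x 0 t +
      sum_vec (ny g) (\<lambda>i. mE1 g i *\<^sub>v u i t + mE2 g i *\<^sub>v x i t) {1..nDM g} + xi t"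
    unfolding u by (simp only: step(2)) (simp only: simps * xt)
  show "x 0 (Suc t) = mA g 0 *\<^sub>v x 0 t +
      sum_vec (nx g 0) (\<lambda>j. mB1 g j *\<^sub>v u j t + mB2 g j *\<^sub>v x j t) {1..nDM g} + w 0 t"
    unfolding u by (simp only: step(3)) (simp only: simps * xt if_True refl)
  show "x i (Suc t) = mA g i *\<^sub>v x i t + mB g i *\<^sub>v u i t + mC g i *\<^sub>v y t + w i t" if "0 < i"
    unfolding u y using that
    by (simp only: step(3)) (simp only: simps * xt if_False neq0_conv[symmetric])
qed

definition env_process :: "lq_game \<Rightarrow> (nat \<Rightarrow> 'a \<Rightarrow> rvec) \<Rightarrow> (nat \<Rightarrow> nat \<Rightarrow> 'a \<Rightarrow> rvec)
    \<Rightarrow> (nat \<Rightarrow> 'a \<Rightarrow> rvec) \<Rightarrow> (nat \<Rightarrow> strategy) \<Rightarrow> nat \<Rightarrow> 'a \<Rightarrow> rvec" where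
  "env_process g x0 w xi s t \<omega> =
     game_y g s (\<lambda>i. x0 i \<omega>) (\<lambda>i k. w i k \<omega>) (\<lambda>k. xi k \<omega>) t"

abbreviation env_space :: "lq_game \<Rightarrow> (nat \<Rightarrow> rvec) measure" where
  "env_space g \<equiv> \<Pi>\<^sub>M t\<in>UNIV. borel_vec (ny g)"

definition env_law :: "lq_game \<Rightarrow> 'a measure \<Rightarrow> (nat \<Rightarrow> 'a \<Rightarrow> rvec) \<Rightarrow> (nat \<Rightarrow> nat \<Rightarrow> 'a \<Rightarrow> rvec)
    \<Rightarrow> (nat \<Rightarrow> 'a \<Rightarrow> rvec) \<Rightarrow> (nat \<Rightarrow> strategy) \<Rightarrow> (nat \<Rightarrow> rvec) measure" where
  "env_law g M x0 w xi s = distr M (env_space g) (\<lambda>\<omega> t. env_process g x0 w xi s t \<omega>)"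

definition sebeu :: "lq_game \<Rightarrow> 'a measure \<Rightarrow> (nat \<Rightarrow> 'a \<Rightarrow> rvec) \<Rightarrow> (nat \<Rightarrow> nat \<Rightarrow> 'a \<Rightarrow> rvec)
    \<Rightarrow> (nat \<Rightarrow> 'a \<Rightarrow> rvec) \<Rightarrow> (nat \<Rightarrow> strategy) \<Rightarrow> bool" where
  "sebeu g M x0 w xi s \<longleftrightarrow>
     (\<forall>i\<in>{1..nDM g}. s i \<in> strategies g i) \<and>
     (\<exists>\<zeta>. (\<forall>i\<in>{1..nDM g}. \<zeta> i \<in> space (prob_algebra (env_space g))) \<and>
          (\<forall>i\<in>{1..nDM g}. \<forall>\<sigma>\<in>strategies g i.
             ereal_expectation (\<zeta> i) (subj_cost g M x0 w i (s i))
               \<le> ereal_expectation (\<zeta> i) (subj_cost g M x0 w i \<sigma>)) \<and>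
          (\<forall>i\<in>{1..nDM g}. \<zeta> i = env_law g M x0 w xi s))"

section \<open>Constants\<close>

definition riccati :: "lq_game \<Rightarrow> nat \<Rightarrow> rmat \<Rightarrow> bool" where
  "riccati g i P \<longleftrightarrow>
    (let A = mA g i; B = mB g i; \<beta> = disc g i; S = mR g i + \<beta> \<cdot>\<^sub>m (tr B * P * B)
     in P = mQ g i + \<beta> \<cdot>\<^sub>m (tr A * (P - \<beta> \<cdot>\<^sub>m (P * B * inv_mat S * tr B * P)) * A))"

definition cM :: "lq_game \<Rightarrow> nat \<Rightarrow> rmat" where
  "cM g i = (THE P. pos_semidef (nx g i) P \<and> riccati g i P)"

definition cSinv :: "lq_game \<Rightarrow> nat \<Rightarrow> rmat" where
  "cSinv g i = inv_mat (mR g i + disc g i \<cdot>\<^sub>m (tr (mB g i) * cM g i * mB g i))"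

definition cF :: "lq_game \<Rightarrow> nat \<Rightarrow> rmat" where
  "cF g i = (- disc g i) \<cdot>\<^sub>m (cSinv g i * tr (mB g i) * cM g i * mA g i)"

text \<open>The closed-loop matrix \<open>A\<^sup>i + B\<^sup>i F\<^sup>i\<close>.\<close>
definition cAF :: "lq_game \<Rightarrow> nat \<Rightarrow> rmat" where
  "cAF g i = mA g i + mB g i * cF g i"

definition cG :: "lq_game \<Rightarrow> nat \<Rightarrow> nat \<Rightarrow> rmat" where
  "cG g i n =
    (if n = 0
     then - (cSinv g i * (tr (mK g i) + disc g i \<cdot>\<^sub>m (tr (mB g i) * cM g i * mC g i)))
     else (- disc g i) \<cdot>\<^sub>m (cSinv g i * tr (mB g i) * ((disc g i \<cdot>\<^sub>m tr (cAF g i)) ^\<^sub>m (n - 1)) *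
       ((tr (cF g i) * tr (mK g i) + tr (mL g i)) + disc g i \<cdot>\<^sub>m (tr (cAF g i) * cM g i * mC g i))))"

text \<open>Below \<open>ew i\<close> is the mean of \<open>w\<^sub>0\<^sup>i\<close>, \<open>exi\<close> the mean of \<open>\<xi>\<^sub>0\<close> and \<open>eX\<close> the mean of \<open>X\<^sub>0\<close>.\<close>

definition cH :: "lq_game \<Rightarrow> (nat \<Rightarrow> rvec) \<Rightarrow> nat \<Rightarrow> rvec" where
  "cH g ew i = (- disc g i) \<cdot>\<^sub>v
     ((cSinv g i * tr (mB g i) * inv_mat (1\<^sub>m (nx g i) - disc g i \<cdot>\<^sub>m tr (cAF g i)) * cM g i) *\<^sub>v ew i)"

definition nX :: "lq_game \<Rightarrow> nat" where
  "nX g = (\<Sum>i\<le>nDM g. nx g i)"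

definition stack :: "lq_game \<Rightarrow> (nat \<Rightarrow> rvec) \<Rightarrow> rvec" where
  "stack g v = vec_of_list (concat (map (\<lambda>i. list_of_vec (v i)) [0..<Suc (nDM g)]))"

definition agg_D :: "lq_game \<Rightarrow> rmat" where
  "agg_D g = hcat (ny g) (mD g # map (\<lambda>j. mE1 g j * cF g j + mE2 g j) [1..<Suc (nDM g)])"

definition agg_Gp :: "lq_game \<Rightarrow> nat \<Rightarrow> rmat" where
  "agg_Gp g n = sum_mat (ny g) (ny g) (\<lambda>j. mE1 g j * cG g j n) {1..nDM g}"

definition agg_Hp :: "lq_game \<Rightarrow> (nat \<Rightarrow> rvec) \<Rightarrow> rvec" where
  "agg_Hp g ew = sum_vec (ny g) (\<lambda>j. mE1 g j *\<^sub>v cH g ew j) {1..nDM g}"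

definition agg_A :: "lq_game \<Rightarrow> rmat" where
  "agg_A g = four_block_mat
     (mA g 0) (hcat (nx g 0) (map (\<lambda>j. mB1 g j * cF g j + mB2 g j) [1..<Suc (nDM g)]))
     (0\<^sub>m (nX g - nx g 0) (nx g 0)) (diag_block_mat (map (cAF g) [1..<Suc (nDM g)]))"

definition agg_GX :: "lq_game \<Rightarrow> nat \<Rightarrow> rmat" where
  "agg_GX g n = vcat (ny g)
     (sum_mat (nx g 0) (ny g) (\<lambda>j. mB1 g j * cG g j n) {1..nDM g} #
      map (\<lambda>j. mB g j * cG g j n) [1..<Suc (nDM g)])"

definition agg_HX :: "lq_game \<Rightarrow> (nat \<Rightarrow> rvec) \<Rightarrow> rvec" where
  "agg_HX g ew = stack g (\<lambda>i. if i = 0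
     then sum_vec (nx g 0) (\<lambda>j. mB1 g j *\<^sub>v cH g ew j) {1..nDM g}
     else mB g i *\<^sub>v cH g ew i)"

definition agg_C :: "lq_game \<Rightarrow> rmat" where
  "agg_C g = vcat (ny g) (0\<^sub>m (nx g 0) (ny g) # map (mC g) [1..<Suc (nDM g)])"

text \<open>\<open>y\<close> solves the infinite linear system started at \<open>X0\<close>.\<close>
definition hat_solution :: "lq_game \<Rightarrow> (nat \<Rightarrow> rvec) \<Rightarrow> rvec \<Rightarrow> rvec \<Rightarrow> (nat \<Rightarrow> rvec) \<Rightarrow> bool" where
  "hat_solution g ew exi X0 y \<longleftrightarrow>
     (\<forall>t. y t \<in> carrier_vec (ny g)) \<and>
     (\<exists>X. X 0 = X0 \<and>
       (\<forall>t. X t \<in> carrier_vec (nX g) \<and>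
          summable_vec (ny g) (\<lambda>n. agg_Gp g n *\<^sub>v y (t + n)) \<and>
          summable_vec (nX g) (\<lambda>n. agg_GX g n *\<^sub>v y (t + n)) \<and>
          y t = agg_D g *\<^sub>v X t + suminf_vec (ny g) (\<lambda>n. agg_Gp g n *\<^sub>v y (t + n))
            + agg_Hp g ew + exi \<and>
          X (Suc t) = agg_A g *\<^sub>v X t + suminf_vec (nX g) (\<lambda>n. agg_GX g n *\<^sub>v y (t + n))
            + agg_HX g ew + agg_C g *\<^sub>v y t + stack g ew))"

text \<open>With \<open>a, b\<close> from the solution \<open>a\<^sub>t X\<^sub>0 + b\<^sub>t\<close> of the system, \<open>lim_Gp\<close>, \<open>lim_Hp\<close>, \<open>lim_GX\<close>, \<open>lim_HX\<close>,
  \<open>lim_G\<close>, \<open>lim_H\<close> are \<open>\<G>\<^sup>p\<close>, the checked \<open>\<H>\<^sup>p\<close>, \<open>\<G>\<^sup>X\<close>, the checked \<open>\<H>\<^sup>X\<close>, \<open>G\<^sup>i\<close> and the checked \<open>H\<^sup>i\<close>.\<close>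

definition lim_Gp :: "lq_game \<Rightarrow> (nat \<Rightarrow> rmat) \<Rightarrow> rmat" where
  "lim_Gp g a = suminf_mat (ny g) (nX g) (\<lambda>n. agg_Gp g n * a n)"

definition lim_Hp :: "lq_game \<Rightarrow> (nat \<Rightarrow> rvec) \<Rightarrow> (nat \<Rightarrow> rvec) \<Rightarrow> rvec" where
  "lim_Hp g ew b = suminf_vec (ny g) (\<lambda>n. agg_Gp g n *\<^sub>v b n) + agg_Hp g ew"

definition lim_GX :: "lq_game \<Rightarrow> (nat \<Rightarrow> rmat) \<Rightarrow> rmat" where
  "lim_GX g a = suminf_mat (nX g) (nX g) (\<lambda>n. agg_GX g n * a n)"

definition lim_HX :: "lq_game \<Rightarrow> (nat \<Rightarrow> rvec) \<Rightarrow> (nat \<Rightarrow> rvec) \<Rightarrow> rvec" where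
  "lim_HX g ew b = suminf_vec (nX g) (\<lambda>n. agg_GX g n *\<^sub>v b n) + agg_HX g ew"

definition lim_G :: "lq_game \<Rightarrow> (nat \<Rightarrow> rmat) \<Rightarrow> nat \<Rightarrow> rmat" where
  "lim_G g a i = suminf_mat (nu g i) (nX g) (\<lambda>n. cG g i n * a n)"

definition lim_H :: "lq_game \<Rightarrow> (nat \<Rightarrow> rvec) \<Rightarrow> (nat \<Rightarrow> rvec) \<Rightarrow> nat \<Rightarrow> rvec" where
  "lim_H g ew b i = suminf_vec (nu g i) (\<lambda>n. cG g i n *\<^sub>v b n) + cH g ew i"

section \<open>Strategy, auxiliary process and filter\<close>

text \<open>The joint strategy built on an estimator \<open>h t\<close> of the aggregate state from \<open>(y\<^sub>k)\<^bsub>k<t\<^esub>\<close>.\<close>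
definition est_strategy :: "lq_game \<Rightarrow> (nat \<Rightarrow> rvec) \<Rightarrow> (nat \<Rightarrow> rmat) \<Rightarrow> (nat \<Rightarrow> rvec)
    \<Rightarrow> (nat \<Rightarrow> (nat \<Rightarrow> rvec) \<Rightarrow> rvec) \<Rightarrow> nat \<Rightarrow> strategy" where
  "est_strategy g ew a b h i t =
     (\<lambda>(x, u, y). cF g i *\<^sub>v x t + lim_G g a i *\<^sub>v h t y + lim_H g ew b i)"

text \<open>The auxiliary process on a probability space \<open>M'\<close>; \<open>X 0\<close>, \<open>xi\<close>, \<open>W\<close> are its primitive variables.\<close>
definition aux_process :: "lq_game \<Rightarrow> (nat \<Rightarrow> rvec) \<Rightarrow> (nat \<Rightarrow> rmat) \<Rightarrow> (nat \<Rightarrow> rvec) \<Rightarrow> 'b measure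
    \<Rightarrow> (nat \<Rightarrow> 'b \<Rightarrow> rvec) \<Rightarrow> (nat \<Rightarrow> 'b \<Rightarrow> rvec) \<Rightarrow> (nat \<Rightarrow> 'b \<Rightarrow> rvec) \<Rightarrow> (nat \<Rightarrow> 'b \<Rightarrow> rvec) \<Rightarrow> bool" where
  "aux_process g ew a b M' X y xi W \<longleftrightarrow>
     (\<forall>t. X t \<in> M' \<rightarrow>\<^sub>M borel_vec (nX g) \<and> y t \<in> M' \<rightarrow>\<^sub>M borel_vec (ny g) \<and>
          xi t \<in> M' \<rightarrow>\<^sub>M borel_vec (ny g) \<and> W t \<in> M' \<rightarrow>\<^sub>M borel_vec (nX g)) \<and>
     (AE \<omega> in M'. \<forall>t.
        y t \<omega> = agg_D g *\<^sub>v X t \<omega>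
          + lim_Gp g a *\<^sub>v cond_exp_vec M' (past_algebra M' (ny g) y t) (nX g) (X t) \<omega>
          + lim_Hp g ew b + xi t \<omega> \<and>
        X (Suc t) \<omega> = agg_A g *\<^sub>v X t \<omega>
          + lim_GX g a *\<^sub>v cond_exp_vec M' (past_algebra M' (ny g) y t) (nX g) (X t) \<omega>
          + lim_HX g ew b + agg_C g *\<^sub>v y t \<omega> + W t \<omega>)"

text \<open>\<open>h t\<close> is a version of the map taking \<open>(y\<^sub>k)\<^bsub>k<t\<^esub>\<close> to the conditional expectation of \<open>X t\<close>.\<close>
definition cond_exp_map :: "lq_game \<Rightarrow> 'b measure \<Rightarrow> (nat \<Rightarrow> 'b \<Rightarrow> rvec) \<Rightarrow> (nat \<Rightarrow> 'b \<Rightarrow> rvec)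
    \<Rightarrow> (nat \<Rightarrow> (nat \<Rightarrow> rvec) \<Rightarrow> rvec) \<Rightarrow> bool" where
  "cond_exp_map g M' X y h \<longleftrightarrow>
     (\<forall>t. h t \<in> (\<Pi>\<^sub>M k\<in>{..<t}. borel_vec (ny g)) \<rightarrow>\<^sub>M borel_vec (nX g) \<and>
       (AE \<omega> in M'. h t (\<lambda>k\<in>{..<t}. y k \<omega>) =
          cond_exp_vec M' (past_algebra M' (ny g) y t) (nX g) (X t) \<omega>))"

text \<open>\<open>V\<close> is the covariance of \<open>\<xi>\<^sub>0\<close>; the output at time \<open>t\<close> depends on \<open>y\<close> only through \<open>(y\<^sub>k)\<^bsub>k<t\<^esub>\<close>.\<close>
primrec lti_filter :: "lq_game \<Rightarrow> (nat \<Rightarrow> rvec) \<Rightarrow> rvec \<Rightarrow> (nat \<Rightarrow> rmat) \<Rightarrow> (nat \<Rightarrow> rvec) \<Rightarrow> rvec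
    \<Rightarrow> rmat \<Rightarrow> rmat \<Rightarrow> nat \<Rightarrow> (nat \<Rightarrow> rvec) \<Rightarrow> rvec" where
  "lti_filter g ew exi a b eX \<Sigma> V 0 y = eX"
| "lti_filter g ew exi a b eX \<Sigma> V (Suc t) y =
    (let xh = lti_filter g ew exi a b eX \<Sigma> V t y
     in agg_A g *\<^sub>v xh + lim_GX g a *\<^sub>v xh + lim_HX g ew b + agg_C g *\<^sub>v y t + stack g ew
        + (agg_A g * \<Sigma> * tr (agg_D g) * inv_mat (agg_D g * \<Sigma> * tr (agg_D g) + V)) *\<^sub>v
            (y t - (agg_D g + lim_Gp g a) *\<^sub>v xh - lim_Hp g ew b - exi))"

section \<open>Primitive random variables\<close>

datatype prim = Init | Dist nat | Obs nat

fun prim_dim :: "lq_game \<Rightarrow> prim \<Rightarrow> nat" where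
  "prim_dim g Init = nX g"
| "prim_dim g (Dist t) = nX g"
| "prim_dim g (Obs t) = ny g"

fun prim_var :: "('a \<Rightarrow> rvec) \<Rightarrow> (nat \<Rightarrow> 'a \<Rightarrow> rvec) \<Rightarrow> (nat \<Rightarrow> 'a \<Rightarrow> rvec) \<Rightarrow> prim \<Rightarrow> 'a \<Rightarrow> rvec" where
  "prim_var X0 W xi Init = X0"
| "prim_var X0 W xi (Dist t) = W t"
| "prim_var X0 W xi (Obs t) = xi t"

text \<open>Joint law of \<open>(X\<^sub>0, (\<xi>\<^sub>t)\<^sub>t, (W\<^sub>t)\<^sub>t)\<close>.\<close>
definition prim_law :: "lq_game \<Rightarrow> 'a measure \<Rightarrow> ('a \<Rightarrow> rvec) \<Rightarrow> (nat \<Rightarrow> 'a \<Rightarrow> rvec) \<Rightarrow> (nat \<Rightarrow> 'a \<Rightarrow> rvec)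
    \<Rightarrow> (rvec \<times> (nat \<Rightarrow> rvec) \<times> (nat \<Rightarrow> rvec)) measure" where
  "prim_law g M X0 xi W =
     distr M (borel_vec (nX g) \<Otimes>\<^sub>M (\<Pi>\<^sub>M t\<in>UNIV. borel_vec (ny g)) \<Otimes>\<^sub>M (\<Pi>\<^sub>M t\<in>UNIV. borel_vec (nX g)))
       (\<lambda>\<omega>. (X0 \<omega>, (\<lambda>t. xi t \<omega>), (\<lambda>t. W t \<omega>)))"

end

theory Submission imports Defs "Jordan_Normal_Form.Spectral_Radius" begin

text \<open>
  Why the strategy is an equilibrium. Fix a decision maker who believes that the environment is an
  exogenous sequence with the law that the game itself generates. The subjective problem is then a
  discounted linear-quadratic regulator with an exogenous input, whose cost is strictly convex in the
  private path, so first-order conditions along a martingale structure are sufficient. Write the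
  costate as \<open>M x + r\<close>, where \<open>M\<close> solves the Riccati equation and the offset \<open>r\<close> is a geometrically
  weighted sum of the predicted future environment. The identity \<open>stage_identity\<close> expresses the
  difference between the stage cost of any other strategy and that of the candidate as a nonnegative
  quadratic form, a telescoping costate term, and terms that are linear in the innovation of the
  environment and in the centred disturbance. The linear terms have mean zero because the deviation at
  time \<open>t\<close> depends on the past only (\<open>innovation_orth\<close>, \<open>noise_orth\<close>), and the telescoping term
  vanishes in the limit (\<open>xs_decay\<close>, \<open>lam_decay\<close>). Summation gives \<open>comparison\<close>.

  Why the anticipations are rational. By uniqueness the infinite linear system is Markovian: the
  solution started one step later is the shifted solution (\<open>hat_step\<close>). Hence the predictions
  \<open>a\<^sub>k f + b\<^sub>k\<close> computed from the state estimate \<open>f\<close> are consistent over time, and they are the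
  conditional means of the future environment once \<open>f\<close> is the conditional mean of the aggregate state.
  For the linear filter, stationarity of the covariance (\<open>Sg_cov\<close>) makes the estimation error and
  the innovations uncorrelated with the past; as everything is an affine image of a Gaussian family,
  uncorrelated implies orthogonal to every event of the past (\<open>gaussian_orth\<close>, \<open>orth_event\<close>).

  Why the filter implements the estimator. The auxiliary process solves a recursion in its own
  conditional expectations. Induction over time shows that these are the filter outputs and that the
  process is a fixed measurable function of the primitive variables, so equality of the primitive laws
  transfers the identity to the game (\<open>est_eq\<close>). Both strategies therefore generate the same
  environment and have the same subjective costs, and the equilibrium property proved for the filter
  strategy carries over.

  Costs are compared on the product of two copies of the probability space, the first one driving the
  environment and the second one the private noise. A multiple of \<open>\<bar>z\<^sub>t\<bar>\<^sup>2\<close> is added to each stage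
  cost; it makes the series nonnegative and it is the same for all strategies.
\<close>

section \<open>Vectors and quadratic forms\<close>

lemma mv_add: "dim_vec x = dim_col A ==> dim_vec y = dim_col A ==> A *\<^sub>v (x + y) = A *\<^sub>v x + A *\<^sub>v (y :: rvec)"
 by (rule mult_add_distrib_mat_vec[of A "dim_row A" "dim_col A"]) (auto intro: carrier_vecI)
lemma mv_diff: "dim_vec x = dim_col A ==> dim_vec y = dim_col A ==> A *\<^sub>v (x - y) = A *\<^sub>v x - A *\<^sub>v (y :: rvec)"
 by (rule mult_minus_distrib_mat_vec[of A "dim_row A" "dim_col A"]) (auto intro: carrier_vecI)
lemma mv_smult: "dim_vec x = dim_col A ==> A *\<^sub>v (k \<cdot>\<^sub>v x) = k \<cdot>\<^sub>v (A *\<^sub>v (x :: rvec))"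
 by (rule mult_mat_vec[of A "dim_row A" "dim_col A"]) (auto intro: carrier_vecI)
lemma add_mv: "dim_row A = dim_row B ==> dim_col A = dim_col B ==> dim_vec x = dim_col B ==>
  (A + B) *\<^sub>v x = A *\<^sub>v x + B *\<^sub>v (x :: rvec)"
 by (rule add_mult_distrib_mat_vec[of A "dim_row A" "dim_col A"]) (auto intro: carrier_vecI carrier_matI)
lemma diff_mv: "dim_row A = dim_row B ==> dim_col A = dim_col B ==> dim_vec x = dim_col B ==>
  (A - B) *\<^sub>v x = A *\<^sub>v x - B *\<^sub>v (x :: rvec)"
 by (rule minus_mult_distrib_mat_vec[of A "dim_row A" "dim_col A"]) (auto intro: carrier_vecI carrier_matI)
lemma smult_mv: "dim_vec x = dim_col A ==> (k \<cdot>\<^sub>m A) *\<^sub>v x = k \<cdot>\<^sub>v (A *\<^sub>v (x :: rvec))"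
 by (intro eq_vecI) (auto simp: scalar_prod_def sum_distrib_left mult_ac)
lemma uminus_mv: "dim_vec x = dim_col A ==> (- A) *\<^sub>v x = (- 1) \<cdot>\<^sub>v (A *\<^sub>v (x :: rvec))"
 by (intro eq_vecI) (auto simp: scalar_prod_def sum_negf)
lemma mult_mv: "dim_col A = dim_row B ==> dim_vec x = dim_col B ==> (A * B) *\<^sub>v x = A *\<^sub>v (B *\<^sub>v (x :: rvec))"
 by (rule assoc_mult_mat_vec[of A "dim_row A" "dim_col A" B "dim_col B"]) (auto intro: carrier_vecI carrier_matI)
lemma one_mv: "dim_vec x = n ==> 1\<^sub>m n *\<^sub>v x = (x :: rvec)"
 by (rule one_mult_mat_vec) (auto intro: carrier_vecI)
lemma sp_add_right: "dim_vec y = dim_vec z ==> x \<bullet> (y + z) = x \<bullet> y + x \<bullet> (z :: rvec)"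
 by (simp add: scalar_prod_def sum.distrib algebra_simps)
lemma sp_diff_right: "dim_vec y = dim_vec z ==> x \<bullet> (y - z) = x \<bullet> y - x \<bullet> (z :: rvec)"
 by (simp add: scalar_prod_def sum_subtractf algebra_simps)
lemma sp_smult_right: "x \<bullet> (k \<cdot>\<^sub>v y) = k * (x \<bullet> (y :: rvec))"
 by (simp add: scalar_prod_def sum_distrib_left mult_ac)
lemma sp_add_left: "dim_vec x = dim_vec z ==> dim_vec y = dim_vec z ==> (x + y) \<bullet> z = x \<bullet> z + y \<bullet> (z :: rvec)"
 by (simp add: scalar_prod_def sum.distrib algebra_simps)
lemma sp_diff_left: "dim_vec x = dim_vec z ==> dim_vec y = dim_vec z ==> (x - y) \<bullet> z = x \<bullet> z - y \<bullet> (z :: rvec)"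
 by (simp add: scalar_prod_def sum_subtractf algebra_simps)
lemma sp_smult_left: "dim_vec x = dim_vec y ==> (k \<cdot>\<^sub>v x) \<bullet> y = k * (x \<bullet> (y :: rvec))"
 by (simp add: scalar_prod_def sum_distrib_left mult_ac)

lemmas mv_simps = mv_add mv_diff mv_smult add_mv diff_mv smult_mv uminus_mv mult_mv one_mv
lemmas sp_simps = sp_add_right sp_diff_right sp_smult_right sp_add_left sp_diff_left sp_smult_left

lemma transpose_sp: "dim_vec x = dim_row A ==> dim_vec y = dim_col A ==> (tr A *\<^sub>v x) \<bullet> y = x \<bullet> (A *\<^sub>v y)"
 for x y :: rvec
proof -
 assume "dim_vec x = dim_row A" "dim_vec y = dim_col A"
 then have "(tr A *\<^sub>v x) \<bullet> y = (\<Sum>j<dim_col A. \<Sum>i<dim_row A. A $$ (i,j) * x $ i * y $ j)"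
  by (auto simp: scalar_prod_def lessThan_atLeast0 sum_distrib_right col_def intro!: sum.cong)
 also have "\<dots> = (\<Sum>i<dim_row A. \<Sum>j<dim_col A. A $$ (i,j) * x $ i * y $ j)" by (rule sum.swap)
 also have "\<dots> = x \<bullet> (A *\<^sub>v y)" using \<open>dim_vec x = _\<close> \<open>dim_vec y = _\<close>
  by (auto simp: scalar_prod_def lessThan_atLeast0 sum_distrib_left row_def mult_ac intro!: sum.cong)
 finally show ?thesis .
qed

lemma sp_comm: "dim_vec x = dim_vec y ==> x \<bullet> y = y \<bullet> (x :: rvec)"
 by (simp add: scalar_prod_def mult.commute)

lemma sym_sp: assumes "tr P = P" "P \<in> carrier_mat n n" "dim_vec x = n" "dim_vec y = n"
 shows "x \<bullet> (P *\<^sub>v y) = y \<bullet> (P *\<^sub>v (x :: rvec))"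
proof -
 have "x \<bullet> (P *\<^sub>v y) = (tr P *\<^sub>v x) \<bullet> y" using assms by (intro transpose_sp[symmetric]) auto
 then show ?thesis using assms by (simp add: sp_comm)
qed

lemma sp_self: "x \<bullet> x = (\<Sum>i<dim_vec x. (x $ i)\<^sup>2)" for x :: rvec
 by (simp add: scalar_prod_def power2_eq_square lessThan_atLeast0)
lemma sp_self_nonneg: "0 \<le> x \<bullet> (x :: rvec)"
 by (simp add: sp_self sum_nonneg)
lemma comp_le_sp_self: "i < dim_vec x ==> (x $ i)\<^sup>2 \<le> x \<bullet> (x :: rvec)"
 unfolding sp_self by (intro member_le_sum) auto
lemma sp_cauchy: assumes "dim_vec x = dim_vec y" shows "(x \<bullet> y)\<^sup>2 \<le> (x \<bullet> x) * (y \<bullet> (y :: rvec))"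
 using Cauchy_Schwarz_ineq_sum[of "\<lambda>i. x $ i" "\<lambda>i. y $ i" "{0..<dim_vec y}"] assms
 by (simp add: scalar_prod_def power2_eq_square)
lemma sp_young: assumes "dim_vec x = dim_vec y" shows "2 * \<bar>x \<bullet> y\<bar> \<le> x \<bullet> x + y \<bullet> (y :: rvec)"
proof -
 have "0 \<le> (x + y) \<bullet> (x + y)" "0 \<le> (x - y) \<bullet> (x - y)" by (rule sp_self_nonneg)+
 then show ?thesis using assms sp_comm[of x y] by (simp add: sp_simps)
qed

text \<open>The squared Frobenius norm, as a bound for the squared operator norm.\<close>
definition fro :: "rmat => real" where
 "fro A = (\<Sum>i<dim_row A. \<Sum>j<dim_col A. (A $$ (i,j))\<^sup>2)"
lemma fro_nonneg: "0 \<le> fro A" by (simp add: fro_def sum_nonneg)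

lemma fro_bound: assumes "dim_vec x = dim_col A" shows "(A *\<^sub>v x) \<bullet> (A *\<^sub>v x) \<le> fro A * (x \<bullet> (x :: rvec))"
proof -
 have "((A *\<^sub>v x) $ i)\<^sup>2 \<le> (\<Sum>j<dim_col A. (A $$ (i,j))\<^sup>2) * (x \<bullet> x)" if "i < dim_row A" for i
  using sp_cauchy[of "row A i" x] that assms by (simp add: sp_self)
 then show ?thesis unfolding fro_def sum_distrib_right sp_self[of "A *\<^sub>v x"]
  by (auto intro!: sum_mono)
qed

lemma form_bound: assumes "dim_vec x = dim_col A" "dim_row A = dim_col A"
 shows "\<bar>x \<bullet> (A *\<^sub>v x)\<bar> \<le> sqrt (fro A) * (x \<bullet> (x :: rvec))"
proof -
 have "(x \<bullet> (A *\<^sub>v x))\<^sup>2 \<le> (x \<bullet> x) * ((A *\<^sub>v x) \<bullet> (A *\<^sub>v x))"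
  using assms by (intro sp_cauchy) auto
 also have "\<dots> \<le> (x \<bullet> x) * (fro A * (x \<bullet> x))" using assms
  by (intro mult_left_mono fro_bound sp_self_nonneg) auto
 also have "\<dots> = (sqrt (fro A) * (x \<bullet> x))\<^sup>2" by (simp add: power_mult_distrib fro_nonneg power2_eq_square)
 finally show ?thesis
  by (rule abs_le_square_iff[THEN iffD2, THEN order_trans]) (simp add: sp_self_nonneg fro_nonneg)
qed

text \<open>The partial function \<open>mat_inverse\<close> returns a genuine inverse as soon as the kernel is
 trivial.\<close>
lemma inj_inverse:
 assumes S: "S \<in> carrier_mat n n" and inj: "!!v. v \<in> carrier_vec n ==> S *\<^sub>v v = 0\<^sub>v n ==> v = 0\<^sub>v n"
 shows "inv_mat S \<in> carrier_mat n n" "S * inv_mat S = 1\<^sub>m n" "inv_mat S * S = 1\<^sub>m n"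
proof -
 have "det S \<noteq> 0" using det_0_iff_vec_prod_zero_field[OF S] inj by auto
 then have "S \<in> Units (ring_mat TYPE(real) n undefined)" by (rule det_non_zero_imp_unit[OF S])
 then obtain T where "mat_inverse S = Some T" using mat_inverse(1)[OF S, of undefined] by (cases "mat_inverse S") auto
 with mat_inverse(2)[OF S this] show "inv_mat S \<in> carrier_mat n n" "S * inv_mat S = 1\<^sub>m n" "inv_mat S * S = 1\<^sub>m n"
  by auto
qed

lemma inverse_unique:
 assumes "S \<in> carrier_mat n n" "T \<in> carrier_mat n n" "T' \<in> carrier_mat n n" "T * S = 1\<^sub>m n" "S * T' = 1\<^sub>m n"
 shows "T = (T' :: rmat)"
proof -
 have "T = T * (S * T')" using assms by simp
 also have "\<dots> = (T * S) * T'" using assms by (intro assoc_mult_mat[symmetric]) auto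
 finally show ?thesis using assms by simp
qed

lemma sym_inverse:
 assumes S: "S \<in> carrier_mat n n" "tr S = S" and T: "T \<in> carrier_mat n n" "S * T = 1\<^sub>m n" "T * S = 1\<^sub>m n"
 shows "tr T = T"
proof -
 have "tr T * S = 1\<^sub>m n" using transpose_mult[of S n n T n] S T by simp
 then show ?thesis using S T by (auto intro: inverse_unique[of S n "tr T" T])
qed

lemma pd_inverse:
 assumes "pos_def n S"
 shows "inv_mat S \<in> carrier_mat n n" "S * inv_mat S = 1\<^sub>m n" "inv_mat S * S = 1\<^sub>m n" "tr (inv_mat S) = inv_mat S"
proof -
 have S: "S \<in> carrier_mat n n" "tr S = S" using assms by (auto simp: pos_def_def)
 have "v = 0\<^sub>v n" if "v \<in> carrier_vec n" "S *\<^sub>v v = 0\<^sub>v n" for v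
 proof (rule ccontr)
  assume "v \<noteq> 0\<^sub>v n"
  with assms that have "0 < v \<bullet> 0\<^sub>v n" by (auto simp: pos_def_def)
  then show False using that by simp
 qed
 note * = inj_inverse[OF S(1) this]
 show "inv_mat S \<in> carrier_mat n n" "S * inv_mat S = 1\<^sub>m n" "inv_mat S * S = 1\<^sub>m n" by (rule *; assumption)+
 then show "tr (inv_mat S) = inv_mat S" by (intro sym_inverse[OF S])
qed

text \<open>Cauchy-Schwarz for a form that may be degenerate.\<close>
lemma psd_cauchy:
 assumes P: "pos_semidef n P" and xy: "x \<in> carrier_vec n" "y \<in> carrier_vec n"
 shows "(x \<bullet> (P *\<^sub>v y))\<^sup>2 \<le> (x \<bullet> (P *\<^sub>v x)) * (y \<bullet> (P *\<^sub>v y))"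
proof -
 have c: "P \<in> carrier_mat n n" "tr P = P" using P by (auto simp: pos_semidef_def)
 let ?a = "x \<bullet> (P *\<^sub>v x)" and ?b = "x \<bullet> (P *\<^sub>v y)" and ?c = "y \<bullet> (P *\<^sub>v y)"
 have sym: "y \<bullet> (P *\<^sub>v x) = ?b" using xy by (intro sym_sp[OF c(2,1)]) auto
 have q: "0 \<le> ?a + 2 * t * ?b + t\<^sup>2 * ?c" for t
 proof -
  have "0 \<le> (x + t \<cdot>\<^sub>v y) \<bullet> (P *\<^sub>v (x + t \<cdot>\<^sub>v y))" using P xy by (auto simp: pos_semidef_def)
  then show ?thesis using c xy sym by (simp add: mv_simps sp_simps algebra_simps power2_eq_square)
 qed
 have c0: "0 \<le> ?c" "0 \<le> ?a" using P xy by (auto simp: pos_semidef_def)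
 show ?thesis
 proof (cases "?c = 0")
  case True
  have "?b = 0"
  proof (rule ccontr)
   assume b: "?b \<noteq> 0"
   from q[of "- (?a + 1) / (2 * ?b)"] True b show False by (simp add: field_simps)
  qed
  then show ?thesis using c0 by simp
 next
  case False
  then have "0 < ?c" using c0 by simp
  with q[of "- ?b / ?c"] show ?thesis by (simp add: power2_eq_square field_simps)
 qed
qed

lemma pd_psd: "pos_def n Q ==> pos_semidef n Q"
 unfolding pos_def_def pos_semidef_def by (metis less_eq_real_def mult_mat_vec_carrier scalar_prod_left_zero)

text \<open>Cauchy-Schwarz for \<open>Q\<close>, applied to \<open>v\<close> and \<open>Q\<^sup>-\<^sup>1
 v\<close>, bounds \<open>(v \<bullet> v)\<^sup>2\<close> by \<open>v \<bullet> Q v\<close> times a multiple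
 of \<open>v \<bullet> v\<close>.\<close>
lemma pd_coercive:
 assumes "pos_def n Q" shows "\<exists>q>0. \<forall>v\<in>carrier_vec n. q * (v \<bullet> v) \<le> v \<bullet> (Q *\<^sub>v v)"
proof -
 have Q: "Q \<in> carrier_mat n n" using assms by (auto simp: pos_def_def)
 define T where "T = inv_mat Q"
 have T: "T \<in> carrier_mat n n" "Q * T = 1\<^sub>m n" using pd_inverse[OF assms] by (auto simp: T_def)
 define c where "c = sqrt (fro T) + 1"
 have c: "c > 0" by (simp add: c_def add_nonneg_pos fro_nonneg)
 have "v \<bullet> v \<le> c * (v \<bullet> (Q *\<^sub>v v))" if v: "v \<in> carrier_vec n" for v
 proof -
  have QT: "Q *\<^sub>v (T *\<^sub>v v) = v"
   using Q T v by (subst mult_mv[symmetric]) (auto simp: one_mv)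
  have nn: "0 \<le> v \<bullet> (Q *\<^sub>v v)" using pd_psd[OF assms] v by (auto simp: pos_semidef_def)
  have "(v \<bullet> v)\<^sup>2 \<le> (v \<bullet> (Q *\<^sub>v v)) * ((T *\<^sub>v v) \<bullet> v)"
   using psd_cauchy[OF pd_psd[OF assms] v, of "T *\<^sub>v v"] T v by (simp add: QT)
  also have "(T *\<^sub>v v) \<bullet> v = v \<bullet> (T *\<^sub>v v)" using T v by (intro sp_comm) auto
  also have "(v \<bullet> (Q *\<^sub>v v)) * \<dots> \<le> (v \<bullet> (Q *\<^sub>v v)) * (c * (v \<bullet> v))"
  proof (intro mult_left_mono nn)
   have "v \<bullet> (T *\<^sub>v v) \<le> sqrt (fro T) * (v \<bullet> v)" using form_bound[of v T] T v by auto
   then show "v \<bullet> (T *\<^sub>v v) \<le> c * (v \<bullet> v)" using sp_self_nonneg[of v] by (simp add: c_def algebra_simps)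
  qed
  finally have "(v \<bullet> v) * (v \<bullet> v) \<le> (c * (v \<bullet> (Q *\<^sub>v v))) * (v \<bullet> v)" by (simp add: power2_eq_square mult_ac)
  then show ?thesis using sp_self_nonneg[of v] nn c by (cases "v \<bullet> v = 0") auto
 qed
 then show ?thesis using c by (intro exI[of _ "1 / c"]) (auto simp: field_simps)
qed

lemma polarization:
 assumes X: "X \<in> carrier_mat n n" "tr X = X" and ij: "i < n" "j < n"
 shows "2 * X $$ (i,j) = (unit_vec n i + unit_vec n j) \<bullet> (X *\<^sub>v (unit_vec n i + unit_vec n j))
  - unit_vec n i \<bullet> (X *\<^sub>v unit_vec n i) - unit_vec n j \<bullet> (X *\<^sub>v (unit_vec n j :: rvec))"
proof -
 let ?i = "unit_vec n i :: rvec" and ?j = "unit_vec n j :: rvec"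
 have "?j \<bullet> (X *\<^sub>v ?i) = ?i \<bullet> (X *\<^sub>v ?j)" by (rule sym_sp[OF X(2,1)]) auto
 moreover have "?i \<bullet> (X *\<^sub>v ?j) = X $$ (i,j)"
  using X ij by (auto simp: scalar_prod_left_unit)
 ultimately show ?thesis using X by (simp add: mv_simps sp_simps)
qed

text \<open>By polarization a symmetric matrix is recovered from its quadratic form, so matrix equations may be
 checked on forms.\<close>
lemma form_eq_imp_eq:
 assumes "P \<in> carrier_mat n n" "tr P = P" "P' \<in> carrier_mat n n" "tr P' = P'"
  and eq: "!!v. v \<in> carrier_vec n ==> v \<bullet> (P *\<^sub>v v) = v \<bullet> (P' *\<^sub>v v)"
 shows "P = (P' :: rmat)"
proof (rule eq_matI)
 fix i j assume "i < dim_row P'" "j < dim_col P'"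
 then have ij: "i < n" "j < n" using assms by auto
 show "P $$ (i,j) = P' $$ (i,j)"
  using polarization[OF assms(1,2) ij] polarization[OF assms(3,4) ij] eq[of "unit_vec n i"]
   eq[of "unit_vec n j"] eq[of "unit_vec n i + unit_vec n j"] by simp
qed (use assms in auto)

text \<open>All eigenvalues lie in the open unit disc, so the spectral radius is below one and the powers are bounded.\<close>
lemma stable_powers_bounded:
 assumes A: "A \<in> carrier_mat n n" and st: "stable_mat A"
 shows "\<exists>c. \<forall>t. \<forall>v\<in>carrier_vec n. ((A ^\<^sub>m t) *\<^sub>v v) \<bullet> ((A ^\<^sub>m t) *\<^sub>v v) \<le> c * (v \<bullet> (v :: rvec))"
proof -
 let ?C = "map_mat complex_of_real A"
 have C: "?C \<in> carrier_mat n n" using A by simp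
 have "\<exists>c. \<forall>t. norm_bound (?C ^\<^sub>m t) c"
 proof (cases "n = 0")
  case True
  then show ?thesis using C by (auto simp: norm_bound_def)
 next
  case False
  have "spectral_radius ?C < 1"
   using spectral_radius_mem_max(1)[OF C] False st by (auto simp: stable_mat_def spectrum_def)
  then show ?thesis
   using spectral_radius_jnf_norm_bound_less_1[OF C] jordan_nf_exists[OF C] char_poly_factorized[OF C] by blast
 qed
 then obtain c where c: "!!t. norm_bound (?C ^\<^sub>m t) c" by blast
 have "fro (A ^\<^sub>m t) \<le> real n * (real n * c\<^sup>2)" for t
 proof -
  have d: "A ^\<^sub>m t \<in> carrier_mat n n" using A by simp
  have "((A ^\<^sub>m t) $$ (i,j))\<^sup>2 \<le> c\<^sup>2" if "i < n" "j < n" for i j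
  proof -
   have "?C ^\<^sub>m t = map_mat complex_of_real (A ^\<^sub>m t)" by (rule of_real_hom.mat_hom_pow[OF A, symmetric])
   with c[of t] have "norm (map_mat complex_of_real (A ^\<^sub>m t) $$ (i,j)) \<le> c" using that d carrier_matD[OF A]
    by (auto simp: norm_bound_def split: if_splits)
   then have "\<bar>(A ^\<^sub>m t) $$ (i,j)\<bar> \<le> c" using that d carrier_matD[OF A] by (simp split: if_splits)
   then show ?thesis by (simp add: abs_le_square_iff[symmetric])
  qed
  then have "fro (A ^\<^sub>m t) \<le> (\<Sum>i<n. \<Sum>j<n. c\<^sup>2)" unfolding fro_def carrier_matD[OF d] by (intro sum_mono) auto
  then show ?thesis by simp
 qed
 moreover have "((A ^\<^sub>m t) *\<^sub>v v) \<bullet> ((A ^\<^sub>m t) *\<^sub>v v) \<le> fro (A ^\<^sub>m t) * (v \<bullet> v)" if "v \<in> carrier_vec n" for t v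
  using A that pow_carrier_mat[OF A, of t] by (intro fro_bound) auto
 ultimately show ?thesis
  by (intro exI[of _ "real n * (real n * c\<^sup>2)"] allI ballI) (meson mult_right_mono order_trans sp_self_nonneg)
qed

lemma sp_self_sum_bound:
 assumes "dim_vec x = dim_vec y" shows "(x + y) \<bullet> (x + y) \<le> 2 * (x \<bullet> x) + 2 * (y \<bullet> (y :: rvec))"
 using sp_young[of x y] assms sp_comm[of x y] by (simp add: sp_simps)

lemma tr_smult: "tr (k \<cdot>\<^sub>m A) = k \<cdot>\<^sub>m tr A" by (intro eq_matI) auto
lemma tr_mult: "dim_col A = dim_row B ==> tr (A * B) = tr B * tr A"
 by (rule transpose_mult[of A "dim_row A" "dim_col A" B "dim_col B"]) (auto intro: carrier_matI)
lemma mat_assoc: "dim_col A = dim_row B ==> dim_col B = dim_row C ==> (A * B) * C = A * (B * (C :: rmat))"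
 by (rule assoc_mult_mat[of A "dim_row A" "dim_col A" B "dim_col B" C "dim_col C"]) (auto intro: carrier_matI)
lemma tr_add: "dim_row A = dim_row B ==> dim_col A = dim_col B ==> tr (A + B) = tr A + tr (B :: rmat)"
 by (intro eq_matI) auto
lemma tr_diff: "dim_row A = dim_row B ==> dim_col A = dim_col B ==> tr (A - B) = tr A - tr (B :: rmat)"
 by (intro eq_matI) auto
lemma psd_nonneg: "pos_semidef n P ==> dim_vec v = n ==> 0 \<le> v \<bullet> (P *\<^sub>v v)"
 unfolding pos_semidef_def by (auto intro: carrier_vecI)
lemmas tr_simps = tr_smult tr_mult tr_add tr_diff

section \<open>The discounted Riccati equation\<close>

locale lqr =
 fixes n m :: nat and A B Q R :: rmat and \<beta> :: real
 assumes A: "A \<in> carrier_mat n n" and B: "B \<in> carrier_mat n m"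
  and Q: "pos_def n Q" and R: "pos_def m R"
  and \<beta>: "0 \<le> \<beta>" "\<beta> < 1"
begin

definition "Smat P = R + \<beta> \<cdot>\<^sub>m (tr B * P * B)"
definition "gain P = (- \<beta>) \<cdot>\<^sub>m (inv_mat (Smat P) * tr B * P * A)"
definition "ric P = Q + \<beta> \<cdot>\<^sub>m (tr A * (P - \<beta> \<cdot>\<^sub>m (P * B * inv_mat (Smat P) * tr B * P)) * A)"
definition "cst P x u = x \<bullet> (Q *\<^sub>v x) + u \<bullet> (R *\<^sub>v u) + \<beta> * ((A *\<^sub>v x + B *\<^sub>v u) \<bullet> (P *\<^sub>v (A *\<^sub>v x + B *\<^sub>v u)))"

lemma carriers: "dim_row A = n" "dim_col A = n" "dim_row B = n" "dim_col B = m"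
 "dim_row Q = n" "dim_col Q = n" "dim_row R = m" "dim_col R = m" "tr Q = Q" "tr R = R"
 "Q \<in> carrier_mat n n" "R \<in> carrier_mat m m"
 using A B Q R by (auto simp: pos_def_def)

lemma Smat_pd: assumes P: "pos_semidef n P" shows "pos_def m (Smat P)"
 unfolding pos_def_def
proof (intro conjI ballI impI)
 have c: "P \<in> carrier_mat n n" "tr P = P" using P by (auto simp: pos_semidef_def)
 show "Smat P \<in> carrier_mat m m" using c B carriers by (auto simp: Smat_def)
 show "tr (Smat P) = Smat P"
  unfolding Smat_def using carriers c by (simp add: tr_simps mat_assoc)
 fix v :: rvec assume v: "v \<in> carrier_vec m" "v \<noteq> 0\<^sub>v m"
 then have "0 < v \<bullet> (R *\<^sub>v v)" using R by (auto simp: pos_def_def)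
 moreover have "0 \<le> (B *\<^sub>v v) \<bullet> (P *\<^sub>v (B *\<^sub>v v))" using B by (intro psd_nonneg[OF P]) auto
 moreover have "v \<bullet> (Smat P *\<^sub>v v) = v \<bullet> (R *\<^sub>v v) + \<beta> * ((B *\<^sub>v v) \<bullet> (P *\<^sub>v (B *\<^sub>v v)))"
  using carriers c v transpose_sp[of "P *\<^sub>v (B *\<^sub>v v)" B v]
   sp_comm[of v "tr B *\<^sub>v (P *\<^sub>v (B *\<^sub>v v))"] sp_comm[of "P *\<^sub>v (B *\<^sub>v v)" "B *\<^sub>v v"]
  by (simp add: Smat_def mv_simps sp_simps)
 ultimately show "0 < v \<bullet> (Smat P *\<^sub>v v)" using \<beta> by (simp add: add_pos_nonneg)
qed

context
 fixes P assumes P: "pos_semidef n P"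
begin

lemma Pc: "P \<in> carrier_mat n n" "tr P = P" "dim_row P = n" "dim_col P = n"
 using P by (auto simp: pos_semidef_def)

lemma Sinv: "inv_mat (Smat P) \<in> carrier_mat m m" "Smat P * inv_mat (Smat P) = 1\<^sub>m m"
 "inv_mat (Smat P) * Smat P = 1\<^sub>m m" "tr (inv_mat (Smat P)) = inv_mat (Smat P)"
 "Smat P \<in> carrier_mat m m" "tr (Smat P) = Smat P"
 using pd_inverse[OF Smat_pd[OF P]] Smat_pd[OF P] by (auto simp: pos_def_def)

lemma dims [simp]: "dim_row (inv_mat (Smat P)) = m" "dim_col (inv_mat (Smat P)) = m"
 "dim_row (Smat P) = m" "dim_col (Smat P) = m" "dim_row (gain P) = m" "dim_col (gain P) = n"
 "dim_row (ric P) = n" "dim_col (ric P) = n"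
 using Sinv Pc carriers by (auto simp: gain_def ric_def)

lemma gain_eq:
 assumes x: "dim_vec x = n"
 shows "gain P *\<^sub>v x = (- \<beta>) \<cdot>\<^sub>v (inv_mat (Smat P) *\<^sub>v (tr B *\<^sub>v (P *\<^sub>v (A *\<^sub>v x))))"
  and "Smat P *\<^sub>v (gain P *\<^sub>v x) = (- \<beta>) \<cdot>\<^sub>v (tr B *\<^sub>v (P *\<^sub>v (A *\<^sub>v x)))"
proof -
 show 1: "gain P *\<^sub>v x = (- \<beta>) \<cdot>\<^sub>v (inv_mat (Smat P) *\<^sub>v (tr B *\<^sub>v (P *\<^sub>v (A *\<^sub>v x))))"
  using x carriers Pc by (simp add: gain_def mv_simps)
 have "Smat P *\<^sub>v (inv_mat (Smat P) *\<^sub>v (tr B *\<^sub>v (P *\<^sub>v (A *\<^sub>v x)))) = tr B *\<^sub>v (P *\<^sub>v (A *\<^sub>v x))"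
  using carriers Sinv by (subst mult_mv[symmetric]) (auto simp: one_mv)
 then show "Smat P *\<^sub>v (gain P *\<^sub>v x) = (- \<beta>) \<cdot>\<^sub>v (tr B *\<^sub>v (P *\<^sub>v (A *\<^sub>v x)))"
  unfolding 1 using carriers by (simp add: mv_simps)
qed

text \<open>Completion of the square; all optimality properties of the gain follow from it.\<close>
lemma cst_eq:
 assumes x: "dim_vec x = n" and u: "dim_vec u = m"
 shows "cst P x u = x \<bullet> (ric P *\<^sub>v x) + (u - gain P *\<^sub>v x) \<bullet> (Smat P *\<^sub>v (u - gain P *\<^sub>v x))"
proof -
 define T where "T = inv_mat (Smat P)"
 define b where "b = tr B *\<^sub>v (P *\<^sub>v (A *\<^sub>v x))"
 have d: "dim_row T = m" "dim_col T = m" "dim_vec b = m" by (auto simp: T_def b_def carriers)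
 have Su: "u \<bullet> (Smat P *\<^sub>v u) = u \<bullet> (R *\<^sub>v u) + \<beta> * ((B *\<^sub>v u) \<bullet> (P *\<^sub>v (B *\<^sub>v u)))"
  using carriers Pc u transpose_sp[of "P *\<^sub>v (B *\<^sub>v u)" B u]
   sp_comm[of u "tr B *\<^sub>v (P *\<^sub>v (B *\<^sub>v u))"] sp_comm[of "P *\<^sub>v (B *\<^sub>v u)" "B *\<^sub>v u"]
  by (simp add: Smat_def mv_simps sp_simps)
 have ub: "(B *\<^sub>v u) \<bullet> (P *\<^sub>v (A *\<^sub>v x)) = u \<bullet> b"
  using transpose_sp[of "P *\<^sub>v (A *\<^sub>v x)" B u] carriers Pc u x
   sp_comm[of "P *\<^sub>v (A *\<^sub>v x)" "B *\<^sub>v u"] sp_comm[of b u] d by (simp add: b_def)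
 have sym: "(A *\<^sub>v x) \<bullet> (P *\<^sub>v (B *\<^sub>v u)) = (B *\<^sub>v u) \<bullet> (P *\<^sub>v (A *\<^sub>v x))"
  using carriers by (intro sym_sp[OF Pc(2,1)]) auto
 have 1: "cst P x u = x \<bullet> (Q *\<^sub>v x) + u \<bullet> (Smat P *\<^sub>v u) + 2 * \<beta> * (u \<bullet> b)
   + \<beta> * ((A *\<^sub>v x) \<bullet> (P *\<^sub>v (A *\<^sub>v x)))"
  unfolding cst_def Su ub[symmetric] using carriers Pc x u sym by (simp add: mv_simps sp_simps algebra_simps)
 have "x \<bullet> (tr A *\<^sub>v (P *\<^sub>v (A *\<^sub>v x))) = (A *\<^sub>v x) \<bullet> (P *\<^sub>v (A *\<^sub>v x))"
  using carriers Pc x transpose_sp[of "P *\<^sub>v (A *\<^sub>v x)" A x]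
   sp_comm[of x "tr A *\<^sub>v (P *\<^sub>v (A *\<^sub>v x))"] sp_comm[of "P *\<^sub>v (A *\<^sub>v x)" "A *\<^sub>v x"] by simp
 moreover have "x \<bullet> (tr A *\<^sub>v (P *\<^sub>v (B *\<^sub>v (T *\<^sub>v b)))) = b \<bullet> (T *\<^sub>v b)"
 proof -
  have "x \<bullet> (tr A *\<^sub>v (P *\<^sub>v (B *\<^sub>v (T *\<^sub>v b)))) = (A *\<^sub>v x) \<bullet> (P *\<^sub>v (B *\<^sub>v (T *\<^sub>v b)))"
   using carriers Pc x transpose_sp[of "P *\<^sub>v (B *\<^sub>v (T *\<^sub>v b))" A x]
    sp_comm[of x "tr A *\<^sub>v (P *\<^sub>v (B *\<^sub>v (T *\<^sub>v b)))"] sp_comm[of "P *\<^sub>v (B *\<^sub>v (T *\<^sub>v b))" "A *\<^sub>v x"] by simp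
  also have "\<dots> = (B *\<^sub>v (T *\<^sub>v b)) \<bullet> (P *\<^sub>v (A *\<^sub>v x))" using carriers by (intro sym_sp[OF Pc(2,1)]) auto
  also have "\<dots> = (P *\<^sub>v (A *\<^sub>v x)) \<bullet> (B *\<^sub>v (T *\<^sub>v b))" using carriers Pc by (intro sp_comm) auto
  also have "\<dots> = b \<bullet> (T *\<^sub>v b)" unfolding b_def using carriers Pc d
   by (intro transpose_sp[symmetric]) auto
  finally show ?thesis .
 qed
 ultimately have 2: "x \<bullet> (ric P *\<^sub>v x) = x \<bullet> (Q *\<^sub>v x) + \<beta> * ((A *\<^sub>v x) \<bullet> (P *\<^sub>v (A *\<^sub>v x))) - \<beta>\<^sup>2 * (b \<bullet> (T *\<^sub>v b))"
  using carriers Pc x d by (simp add: ric_def mv_simps sp_simps T_def[symmetric] b_def[symmetric] power2_eq_square algebra_simps)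
 have g: "gain P *\<^sub>v x = (- \<beta>) \<cdot>\<^sub>v (T *\<^sub>v b)" "Smat P *\<^sub>v (gain P *\<^sub>v x) = (- \<beta>) \<cdot>\<^sub>v b"
  using gain_eq[OF x] by (auto simp: T_def b_def)
 define w where "w = gain P *\<^sub>v x"
 have w: "dim_vec w = m" by (simp add: w_def)
 have "w \<bullet> (Smat P *\<^sub>v u) = u \<bullet> (Smat P *\<^sub>v w)"
  using u w Sinv by (intro sym_sp[OF Sinv(6,5)]) auto
 moreover have "w \<bullet> b = - \<beta> * (b \<bullet> (T *\<^sub>v b))" using d g(1) sp_comm[of "T *\<^sub>v b" b] by (simp add: w_def sp_simps)
 moreover have "(u - w) \<bullet> (Smat P *\<^sub>v (u - w)) =
   u \<bullet> (Smat P *\<^sub>v u) - u \<bullet> (Smat P *\<^sub>v w) - w \<bullet> (Smat P *\<^sub>v u) + w \<bullet> (Smat P *\<^sub>v w)"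
  using u w by (simp add: mv_simps sp_simps)
 ultimately have "(u - w) \<bullet> (Smat P *\<^sub>v (u - w)) =
  u \<bullet> (Smat P *\<^sub>v u) + 2 * \<beta> * (u \<bullet> b) + \<beta>\<^sup>2 * (b \<bullet> (T *\<^sub>v b))"
  using u d g(2) by (simp add: w_def[symmetric] sp_simps power2_eq_square algebra_simps)
 with 1 2 show ?thesis by (simp add: w_def)
qed

lemma cst_ge: assumes "dim_vec x = n" "dim_vec u = m" shows "x \<bullet> (ric P *\<^sub>v x) \<le> cst P x u"
 using cst_eq[OF assms] psd_nonneg[OF pd_psd[OF Smat_pd[OF P]], of "u - gain P *\<^sub>v x"] assms by simp

lemma cst_gain: assumes "dim_vec x = n" shows "x \<bullet> (ric P *\<^sub>v x) = cst P x (gain P *\<^sub>v x)"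
proof -
 have "gain P *\<^sub>v x - gain P *\<^sub>v x = 0\<^sub>v m" using assms by auto
 moreover have "0\<^sub>v m \<bullet> (Smat P *\<^sub>v 0\<^sub>v m) = 0" by (intro scalar_prod_left_zero carrier_vecI) simp
 ultimately show ?thesis using cst_eq[of x "gain P *\<^sub>v x"] assms by simp
qed

lemma cst_nonneg: assumes "dim_vec x = n" "dim_vec u = m"
 shows "0 \<le> cst P x u" "x \<bullet> (Q *\<^sub>v x) \<le> cst P x u" "u \<bullet> (R *\<^sub>v u) \<le> cst P x u"
proof -
 have "0 \<le> x \<bullet> (Q *\<^sub>v x)" "0 \<le> u \<bullet> (R *\<^sub>v u)" using pd_psd[OF Q] pd_psd[OF R] assms
  by (auto intro: psd_nonneg)
 moreover have "0 \<le> \<beta> * ((A *\<^sub>v x + B *\<^sub>v u) \<bullet> (P *\<^sub>v (A *\<^sub>v x + B *\<^sub>v u)))"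
  using \<beta> assms carriers by (intro mult_nonneg_nonneg psd_nonneg[OF P]) auto
 ultimately show "0 \<le> cst P x u" "x \<bullet> (Q *\<^sub>v x) \<le> cst P x u" "u \<bullet> (R *\<^sub>v u) \<le> cst P x u" by (auto simp: cst_def)
qed

lemma ric_psd: "pos_semidef n (ric P)"
 unfolding pos_semidef_def
proof (intro conjI ballI)
 show "ric P \<in> carrier_mat n n" by (intro carrier_matI) auto
 define T where "T = inv_mat (Smat P)"
 have T: "T \<in> carrier_mat m m" "tr T = T" using Sinv by (auto simp: T_def)
 then have "dim_row T = m" "dim_col T = m" by auto
 then show "tr (ric P) = ric P" unfolding ric_def T_def[symmetric] using carriers Pc T(2)
  by (simp add: tr_simps mat_assoc)
 fix v :: rvec assume "v \<in> carrier_vec n"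
 then show "0 \<le> v \<bullet> (ric P *\<^sub>v v)" using cst_gain[of v] cst_nonneg[of v "gain P *\<^sub>v v"] by auto
qed

end

text \<open>\<open>ric P\<close> is the minimum over controls of a cost that is monotone in \<open>P\<close>.\<close>
lemma ric_mono:
 assumes P: "pos_semidef n P" "pos_semidef n P'" and le: "!!x. dim_vec x = n ==> x \<bullet> (P *\<^sub>v x) \<le> x \<bullet> (P' *\<^sub>v x)"
  and x: "dim_vec x = n"
 shows "x \<bullet> (ric P *\<^sub>v x) \<le> x \<bullet> (ric P' *\<^sub>v x)"
proof -
 have "x \<bullet> (ric P *\<^sub>v x) \<le> cst P x (gain P' *\<^sub>v x)" using P x by (intro cst_ge) auto
 also have "\<dots> \<le> cst P' x (gain P' *\<^sub>v x)" unfolding cst_def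
  using le[of "A *\<^sub>v x + B *\<^sub>v (gain P' *\<^sub>v x)"] carriers \<beta> by (simp add: mult_left_mono)
 finally show ?thesis using cst_gain[OF P(2) x] by simp
qed

primrec vi :: "nat => rmat" where
 "vi 0 = 0\<^sub>m n n"
| "vi (Suc k) = ric (vi k)"

lemma vi_psd: "pos_semidef n (vi k)"
proof (induction k)
 case 0
 have "v \<bullet> (0\<^sub>m n n *\<^sub>v v) = 0" if "v \<in> carrier_vec n" for v :: rvec
  using that by (simp add: scalar_prod_def)
 then show ?case by (auto simp: pos_semidef_def)
qed (auto intro: ric_psd)

lemma vi_mono: "dim_vec x = n ==> x \<bullet> (vi k *\<^sub>v x) \<le> x \<bullet> (vi (Suc k) *\<^sub>v x)"
proof (induction k arbitrary: x)
 case 0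
 have "x \<bullet> (0\<^sub>m n n *\<^sub>v x) = 0" using 0 by (simp add: scalar_prod_def)
 then show ?case using psd_nonneg[OF vi_psd[of "Suc 0"] 0] by simp
next
 case (Suc k)
 show ?case using ric_mono[OF vi_psd[of k] vi_psd[of "Suc k"] _ Suc.prems] Suc.IH by simp
qed

text \<open>A stabilizing linear feedback has bounded closed-loop powers, so with \<open>\<beta> < 1\<close>
 its discounted cost is finite, and it dominates all value iterates.\<close>
lemma vi_bounded:
 assumes "stabilizable A B" shows "\<exists>c. \<forall>k x. dim_vec x = n --> x \<bullet> (vi k *\<^sub>v x) \<le> c * (x \<bullet> x)"
proof -
 obtain K where K: "K \<in> carrier_mat m n" and st: "stable_mat (A + B * K)"
  using assms carriers by (auto simp: stabilizable_def)
 have Kd: "dim_row K = m" "dim_col K = n" using K by auto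
 let ?C = "A + B * K"
 have C: "?C \<in> carrier_mat n n" using K B A by auto
 obtain c where c: "!!t v. v \<in> carrier_vec n ==> ((?C ^\<^sub>m t) *\<^sub>v v) \<bullet> ((?C ^\<^sub>m t) *\<^sub>v v) \<le> c * (v \<bullet> v)"
  using stable_powers_bounded[OF C st] by blast
 define l where "l = sqrt (fro Q) + sqrt (fro R) * fro K"
 have l0: "0 \<le> l" by (simp add: l_def fro_nonneg)
 have step: "x \<bullet> (vi (Suc k) *\<^sub>v x) \<le> l * (x \<bullet> x) + \<beta> * ((?C *\<^sub>v x) \<bullet> (vi k *\<^sub>v (?C *\<^sub>v x)))" if x: "dim_vec x = n" for k x
 proof -
  have "x \<bullet> (vi (Suc k) *\<^sub>v x) \<le> cst (vi k) x (K *\<^sub>v x)" using cst_ge[OF vi_psd x, of "K *\<^sub>v x" k] Kd by simp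
  also have "\<dots> = x \<bullet> (Q *\<^sub>v x) + (K *\<^sub>v x) \<bullet> (R *\<^sub>v (K *\<^sub>v x)) + \<beta> * ((?C *\<^sub>v x) \<bullet> (vi k *\<^sub>v (?C *\<^sub>v x)))"
   using carriers Kd x by (simp add: cst_def mv_simps)
  also have "x \<bullet> (Q *\<^sub>v x) \<le> sqrt (fro Q) * (x \<bullet> x)" using form_bound[of x Q] carriers x by simp
  also have "(K *\<^sub>v x) \<bullet> (R *\<^sub>v (K *\<^sub>v x)) \<le> sqrt (fro R) * ((K *\<^sub>v x) \<bullet> (K *\<^sub>v x))"
   using form_bound[of "K *\<^sub>v x" R] carriers Kd by simp
  also have "\<dots> \<le> sqrt (fro R) * (fro K * (x \<bullet> x))"
   using fro_bound[of x K] x Kd by (intro mult_left_mono) (auto simp: fro_nonneg)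
  finally show ?thesis by (simp add: l_def algebra_simps)
 qed
 have "x \<bullet> (vi k *\<^sub>v x) \<le> (\<Sum>t<k. \<beta> ^ t * (l * (((?C ^\<^sub>m t) *\<^sub>v x) \<bullet> ((?C ^\<^sub>m t) *\<^sub>v x))))" if "dim_vec x = n" for k x
  using that
 proof (induction k arbitrary: x)
  case 0 then show ?case by (simp add: scalar_prod_def)
 next
  case (Suc k)
  have p: "(?C ^\<^sub>m t) *\<^sub>v (?C *\<^sub>v x) = (?C ^\<^sub>m Suc t) *\<^sub>v x" for t
   using C Suc.prems Kd carriers by (simp add: mult_mv)
  have "\<beta> * ((?C *\<^sub>v x) \<bullet> (vi k *\<^sub>v (?C *\<^sub>v x))) \<le>
   \<beta> * (\<Sum>t<k. \<beta> ^ t * (l * (((?C ^\<^sub>m Suc t) *\<^sub>v x) \<bullet> ((?C ^\<^sub>m Suc t) *\<^sub>v x))))"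
   using Suc.IH[of "?C *\<^sub>v x"] C \<beta> unfolding p by (intro mult_left_mono) auto
  with step[OF Suc.prems, of k] show ?case
   unfolding sum.lessThan_Suc_shift using Suc.prems carriers Kd
   by (simp add: sum_distrib_left mult.assoc one_mv del: pow_mat.simps(2))
 qed
 moreover have "(\<Sum>t<k. \<beta> ^ t * (l * (((?C ^\<^sub>m t) *\<^sub>v x) \<bullet> ((?C ^\<^sub>m t) *\<^sub>v x)))) \<le> (l * \<bar>c\<bar> / (1 - \<beta>)) * (x \<bullet> x)"
  if x: "dim_vec x = n" for k x
 proof -
  have "(\<Sum>t<k. \<beta> ^ t * (l * (((?C ^\<^sub>m t) *\<^sub>v x) \<bullet> ((?C ^\<^sub>m t) *\<^sub>v x)))) \<le> (\<Sum>t<k. \<beta> ^ t * (l * (\<bar>c\<bar> * (x \<bullet> x))))"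
  proof (intro sum_mono mult_left_mono l0)
   fix t
   have "((?C ^\<^sub>m t) *\<^sub>v x) \<bullet> ((?C ^\<^sub>m t) *\<^sub>v x) \<le> c * (x \<bullet> x)" using c x by (auto intro: carrier_vecI)
   also have "\<dots> \<le> \<bar>c\<bar> * (x \<bullet> x)" by (intro mult_right_mono sp_self_nonneg) auto
   finally show "((?C ^\<^sub>m t) *\<^sub>v x) \<bullet> ((?C ^\<^sub>m t) *\<^sub>v x) \<le> \<bar>c\<bar> * (x \<bullet> x)" .
  qed (use \<beta> in auto)
  also have "\<dots> = (\<Sum>t<k. \<beta> ^ t) * (l * (\<bar>c\<bar> * (x \<bullet> x)))" by (simp add: sum_distrib_right)
  also have "\<dots> \<le> (1 / (1 - \<beta>)) * (l * (\<bar>c\<bar> * (x \<bullet> x)))"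
  proof (intro mult_right_mono)
   show "(\<Sum>t<k. \<beta> ^ t) \<le> 1 / (1 - \<beta>)"
    using \<beta> sum_le_suminf[of "\<lambda>t. \<beta> ^ t" "{..<k}"] by (simp add: suminf_geometric summable_geometric)
  qed (simp add: l0 sp_self_nonneg)
  finally show ?thesis by simp
 qed
 ultimately show ?thesis by (meson order_trans)
qed

lemma form_expand: assumes "dim_vec x = n" "M \<in> carrier_mat n n"
 shows "x \<bullet> (M *\<^sub>v x) = (\<Sum>i<n. \<Sum>j<n. M $$ (i,j) * x $ i * (x :: rvec) $ j)"
 using assms by (auto simp: scalar_prod_def lessThan_atLeast0 sum_distrib_left row_def mult_ac intro!: sum.cong)

text \<open>The value iterates started at 0 increase and are bounded, so their forms converge; by polarization
 the entries converge, and the limit is a fixed point.\<close>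
lemma riccati_exists:
 assumes stab: "stabilizable A B" shows "\<exists>P. pos_semidef n P \<and> ric P = P"
proof -
 obtain c where c: "!!k x. dim_vec x = n ==> x \<bullet> (vi k *\<^sub>v x) \<le> c * (x \<bullet> x)" using vi_bounded[OF stab] by blast
 have vc: "vi k \<in> carrier_mat n n" "tr (vi k) = vi k" for k using vi_psd[of k] by (auto simp: pos_semidef_def)
 have conv_form: "convergent (\<lambda>k. x \<bullet> (vi k *\<^sub>v x))" if x: "dim_vec x = n" for x
 proof -
  have "incseq (\<lambda>k. x \<bullet> (vi k *\<^sub>v x))" using vi_mono[OF x] by (intro incseq_SucI)
  moreover have "\<forall>k. x \<bullet> (vi k *\<^sub>v x) \<le> c * (x \<bullet> x)" using c[OF x] by simp
  ultimately show ?thesis by (metis incseq_convergent convergentI)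
 qed
 have conv: "convergent (\<lambda>k. vi k $$ (i,j))" if ij: "i < n" "j < n" for i j
 proof -
  have "vi k $$ (i,j) = ((unit_vec n i + unit_vec n j) \<bullet> (vi k *\<^sub>v (unit_vec n i + unit_vec n j))
    - unit_vec n i \<bullet> (vi k *\<^sub>v unit_vec n i) - unit_vec n j \<bullet> (vi k *\<^sub>v unit_vec n j)) * (1 / 2)" for k
   using polarization[OF vc ij, of k] by simp
  then show ?thesis by (simp only:, intro convergent_diff convergent_mult convergent_const conv_form) auto
 qed
 define P where "P = mat n n (\<lambda>(i,j). lim (\<lambda>k. vi k $$ (i,j)))"
 have Pc: "P \<in> carrier_mat n n" by (simp add: P_def)
 have lim: "(\<lambda>k. vi k $$ (i,j)) \<longlonglongrightarrow> P $$ (i,j)" if "i < n" "j < n" for i j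
  using conv[OF that] that by (simp add: P_def convergent_LIMSEQ_iff)
 have Ps: "tr P = P"
 proof (rule eq_matI)
  fix i j assume "i < dim_row P" "j < dim_col P"
  then have ij: "i < n" "j < n" using Pc by auto
  have "vi k $$ (i,j) = vi k $$ (j,i)" for k
   using vc(1)[of k] ij index_transpose_mat(1)[of i "vi k" j] unfolding vc(2) by auto
  with lim[OF ij] lim[OF ij(2,1)] have "P $$ (i,j) = P $$ (j,i)" by (simp add: LIMSEQ_unique)
  then show "tr P $$ (i,j) = P $$ (i,j)" using ij Pc by simp
 qed (use Pc in auto)
 have lform: "(\<lambda>k. x \<bullet> (vi k *\<^sub>v x)) \<longlonglongrightarrow> x \<bullet> (P *\<^sub>v x)" if x: "dim_vec x = n" for x
  unfolding form_expand[OF x vc(1)] form_expand[OF x Pc] by (intro tendsto_sum tendsto_mult lim tendsto_const) auto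
 have le: "x \<bullet> (vi k *\<^sub>v x) \<le> x \<bullet> (P *\<^sub>v x)" if x: "dim_vec x = n" for x k
  by (rule incseq_le[OF _ lform[OF x]]) (use vi_mono[OF x] in \<open>intro incseq_SucI\<close>)
 have P: "pos_semidef n P" unfolding pos_semidef_def
  using Pc Ps le psd_nonneg[OF vi_psd] by (metis carrier_vecD order_trans)
 have "x \<bullet> (ric P *\<^sub>v x) = x \<bullet> (P *\<^sub>v x)" if "x \<in> carrier_vec n" for x
 proof (rule antisym)
  from that have x: "dim_vec x = n" by auto
  let ?g = "gain P *\<^sub>v x"
  have gd: "dim_vec ?g = m" using dims[OF P] by simp
  have "(\<lambda>k. cst (vi k) x ?g) \<longlonglongrightarrow> cst P x ?g"
   unfolding cst_def by (intro tendsto_intros lform) (use carriers in auto)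
  moreover have "x \<bullet> (vi (Suc k) *\<^sub>v x) \<le> cst (vi k) x ?g" for k
   using cst_ge[OF vi_psd x gd, of k] by simp
  ultimately have "x \<bullet> (P *\<^sub>v x) \<le> cst P x ?g"
   using LIMSEQ_le[OF LIMSEQ_Suc[OF lform[OF x]]] by blast
  then show "x \<bullet> (P *\<^sub>v x) \<le> x \<bullet> (ric P *\<^sub>v x)" using cst_gain[OF P x] by simp
  obtain r where r: "r > 0" "!!u. u \<in> carrier_vec m ==> r * (u \<bullet> u) \<le> u \<bullet> (R *\<^sub>v u)"
   using pd_coercive[OF R] by blast
  define K where "K = 2 * (fro A * (x \<bullet> x)) + 2 * (fro B * (x \<bullet> (P *\<^sub>v x) / r))"
  have "x \<bullet> (ric P *\<^sub>v x) \<le> x \<bullet> (P *\<^sub>v x) + sqrt (fro (P - vi k)) * K" for k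
  proof -
   let ?u = "gain (vi k) *\<^sub>v x"
   let ?v = "A *\<^sub>v x + B *\<^sub>v ?u"
   have ud: "dim_vec ?u = m" using dims[OF vi_psd] by simp
   have vd: "dim_vec ?v = n" using carriers by simp
   have s: "x \<bullet> (vi (Suc k) *\<^sub>v x) = cst (vi k) x ?u" using cst_gain[OF vi_psd x] by simp
   have "?u \<bullet> ?u \<le> x \<bullet> (P *\<^sub>v x) / r"
   proof -
    have "r * (?u \<bullet> ?u) \<le> ?u \<bullet> (R *\<^sub>v ?u)" by (rule r(2)[OF carrier_vecI[OF ud]])
    also have "\<dots> \<le> cst (vi k) x ?u" using cst_nonneg[OF vi_psd x ud] by simp
    also have "\<dots> \<le> x \<bullet> (P *\<^sub>v x)" using s le[OF x, of "Suc k"] by simp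
    finally show ?thesis using r by (simp add: field_simps)
   qed
   then have "fro B * (?u \<bullet> ?u) \<le> fro B * (x \<bullet> (P *\<^sub>v x) / r)" by (intro mult_left_mono fro_nonneg)
   then have "?v \<bullet> ?v \<le> K"
    using sp_self_sum_bound[of "A *\<^sub>v x" "B *\<^sub>v ?u"] fro_bound[of x A] fro_bound[of ?u B] x ud carriers
    unfolding K_def by simp
   moreover have "?v \<bullet> (P *\<^sub>v ?v) - ?v \<bullet> (vi k *\<^sub>v ?v) \<le> sqrt (fro (P - vi k)) * (?v \<bullet> ?v)"
    using form_bound[of ?v "P - vi k"] vd Pc vc(1)[of k]
    by (simp add: diff_mv[of P "vi k" ?v] sp_diff_right carrier_matD[OF Pc] carrier_matD[OF vc(1)])
   ultimately have d: "?v \<bullet> (P *\<^sub>v ?v) - ?v \<bullet> (vi k *\<^sub>v ?v) \<le> sqrt (fro (P - vi k)) * K"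
    by (smt (verit) fro_nonneg mult_left_mono real_sqrt_ge_zero)
   have d0: "0 \<le> ?v \<bullet> (P *\<^sub>v ?v) - ?v \<bullet> (vi k *\<^sub>v ?v)" using le[OF vd, of k] by simp
   have "x \<bullet> (ric P *\<^sub>v x) \<le> cst P x ?u" using cst_ge[OF P x ud] .
   also have "\<dots> = cst (vi k) x ?u + \<beta> * (?v \<bullet> (P *\<^sub>v ?v) - ?v \<bullet> (vi k *\<^sub>v ?v))"
    by (simp add: cst_def algebra_simps)
   also have "\<dots> \<le> x \<bullet> (P *\<^sub>v x) + 1 * (?v \<bullet> (P *\<^sub>v ?v) - ?v \<bullet> (vi k *\<^sub>v ?v))"
    using s le[OF x, of "Suc k"] d0 \<beta> by (intro add_mono mult_right_mono) auto
   finally show ?thesis using d by simp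
  qed
  moreover have "(\<lambda>k. x \<bullet> (P *\<^sub>v x) + sqrt (fro (P - vi k)) * K) \<longlonglongrightarrow> x \<bullet> (P *\<^sub>v x) + sqrt 0 * K"
  proof (intro tendsto_intros)
   have "(\<lambda>k. \<Sum>i<n. \<Sum>j<n. (P $$ (i,j) - vi k $$ (i,j))\<^sup>2) \<longlonglongrightarrow> (\<Sum>i<n. \<Sum>j<n. (P $$ (i,j) - P $$ (i,j))\<^sup>2)"
    by (intro tendsto_sum tendsto_power tendsto_diff tendsto_const lim) auto
   moreover have "fro (P - vi k) = (\<Sum>i<n. \<Sum>j<n. (P $$ (i,j) - vi k $$ (i,j))\<^sup>2)" for k
    unfolding fro_def using Pc vc(1)[of k] by (auto intro!: sum.cong)
   ultimately show "(\<lambda>k. fro (P - vi k)) \<longlonglongrightarrow> 0" by simp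
  qed
  ultimately show "x \<bullet> (ric P *\<^sub>v x) \<le> x \<bullet> (P *\<^sub>v x)"
   using LIMSEQ_le_const by fastforce
 qed
 then have "ric P = P" using ric_psd[OF P] P by (auto simp: pos_semidef_def intro: form_eq_imp_eq[of "ric P" n P])
 with P show ?thesis by blast
qed

definition "cloop P = A + B * gain P"

context
 fixes P assumes P: "pos_semidef n P" and fixp: "ric P = P"
begin

lemma closed_dims [simp]: "dim_row (cloop P) = n" "dim_col (cloop P) = n"
 using dims[OF P] carriers by (auto simp: cloop_def)

lemma closed_mv: "dim_vec x = n ==> cloop P *\<^sub>v x = A *\<^sub>v x + B *\<^sub>v (gain P *\<^sub>v x)"
 using dims[OF P] carriers by (simp add: cloop_def mv_simps)

lemma closed_cost: assumes x: "dim_vec x = n"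
 shows "x \<bullet> (P *\<^sub>v x) = x \<bullet> (Q *\<^sub>v x) + (gain P *\<^sub>v x) \<bullet> (R *\<^sub>v (gain P *\<^sub>v x))
  + \<beta> * ((cloop P *\<^sub>v x) \<bullet> (P *\<^sub>v (cloop P *\<^sub>v x)))"
 using cst_gain[OF P x] fixp closed_mv[OF x] by (simp add: cst_def)

lemma fix_coercive: "\<exists>q>0. \<forall>x. dim_vec x = n --> q * (x \<bullet> x) \<le> x \<bullet> (P *\<^sub>v x)"
proof -
 obtain q where q: "q > 0" "!!v. v \<in> carrier_vec n ==> q * (v \<bullet> v) \<le> v \<bullet> (Q *\<^sub>v v)"
  using pd_coercive[OF Q] by blast
 have "q * (x \<bullet> x) \<le> x \<bullet> (P *\<^sub>v x)" if x: "dim_vec x = n" for x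
 proof -
  have "q * (x \<bullet> x) \<le> x \<bullet> (Q *\<^sub>v x)" by (rule q(2)[OF carrier_vecI[OF x]])
  also have "\<dots> \<le> cst P x (gain P *\<^sub>v x)" using dims[OF P] by (intro cst_nonneg(2)[OF P x]) simp
  also have "\<dots> = x \<bullet> (P *\<^sub>v x)" using cst_gain[OF P x] fixp by simp
  finally show ?thesis .
 qed
 then show ?thesis using q by blast
qed

text \<open>Along the optimal feedback \<open>x \<bullet> P x\<close> loses at least \<open>x \<bullet> Q
 x\<close>, which is a fixed fraction of it.\<close>
lemma closed_contraction:
 "\<exists>\<rho>. 0 \<le> \<rho> \<and> \<rho> < 1 \<and> (\<forall>x. dim_vec x = n --> \<beta> * ((cloop P *\<^sub>v x) \<bullet> (P *\<^sub>v (cloop P *\<^sub>v x))) \<le> \<rho> * (x \<bullet> (P *\<^sub>v x)))"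
proof -
 obtain q where q: "q > 0" "!!v. v \<in> carrier_vec n ==> q * (v \<bullet> v) \<le> v \<bullet> (Q *\<^sub>v v)"
  using pd_coercive[OF Q] by blast
 define c where "c = sqrt (fro P) + q"
 have c: "c > 0" "q \<le> c" using q by (auto simp: c_def add_nonneg_pos fro_nonneg)
 have "\<beta> * ((cloop P *\<^sub>v x) \<bullet> (P *\<^sub>v (cloop P *\<^sub>v x))) \<le> (1 - q / c) * (x \<bullet> (P *\<^sub>v x))" if x: "dim_vec x = n" for x
 proof -
  have "x \<bullet> (P *\<^sub>v x) \<le> sqrt (fro P) * (x \<bullet> x)" using form_bound[of x P] Pc[OF P] x by simp
  also have "\<dots> \<le> c * (x \<bullet> x)" using q by (intro mult_right_mono sp_self_nonneg) (simp add: c_def)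
  finally have "(q / c) * (x \<bullet> (P *\<^sub>v x)) \<le> (q / c) * (c * (x \<bullet> x))" using q c by (intro mult_left_mono) auto
  also have "\<dots> = q * (x \<bullet> x)" using c by simp
  also have "\<dots> \<le> x \<bullet> (Q *\<^sub>v x)" by (rule q(2)[OF carrier_vecI[OF x]])
  finally have "(q / c) * (x \<bullet> (P *\<^sub>v x)) \<le> x \<bullet> (Q *\<^sub>v x)" .
  moreover have "0 \<le> (gain P *\<^sub>v x) \<bullet> (R *\<^sub>v (gain P *\<^sub>v x))"
   using dims[OF P] by (intro psd_nonneg[OF pd_psd[OF R]]) auto
  ultimately show ?thesis using closed_cost[OF x] by (simp add: algebra_simps)
 qed
 then show ?thesis using q c by (intro exI[of _ "1 - q / c"]) auto
qed

end

text \<open>The gain of \<open>P'\<close> is suboptimal for \<open>P\<close>. So the difference of the two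
 forms is at most \<open>\<beta>\<close> times its value one step later along the closed loop of
 \<open>P'\<close>, where iteration sends it to 0.\<close>
lemma riccati_unique:
 assumes P: "pos_semidef n P" "ric P = P" and P': "pos_semidef n P'" "ric P' = P'"
 shows "P = P'"
proof -
 have le: "x \<bullet> (P *\<^sub>v x) \<le> x \<bullet> (P' *\<^sub>v x)"
  if P: "pos_semidef n P" "ric P = P" and P': "pos_semidef n P'" "ric P' = P'" and x: "dim_vec x = n" for P P' x
 proof -
  obtain \<rho> where \<rho>: "0 \<le> \<rho>" "\<rho> < 1" "!!x. dim_vec x = n ==>
    \<beta> * ((cloop P' *\<^sub>v x) \<bullet> (P' *\<^sub>v (cloop P' *\<^sub>v x))) \<le> \<rho> * (x \<bullet> (P' *\<^sub>v x))"
   using closed_contraction[OF P'] by blast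
  obtain q where q: "q > 0" "!!x. dim_vec x = n ==> q * (x \<bullet> x) \<le> x \<bullet> (P' *\<^sub>v x)"
   using fix_coercive[OF P'] by blast
  define K where "K = sqrt (fro P) / q"
  have K: "0 \<le> K" using q by (simp add: K_def fro_nonneg)
  have "x \<bullet> (P *\<^sub>v x) - x \<bullet> (P' *\<^sub>v x) \<le> K * \<rho> ^ t * (x \<bullet> (P' *\<^sub>v x))" if "dim_vec x = n" for t x
   using that
  proof (induction t arbitrary: x)
   case (0 x)
   have "x \<bullet> (P *\<^sub>v x) \<le> sqrt (fro P) * (x \<bullet> x)" using form_bound[of x P] Pc[OF P(1)] 0 by simp
   also have "\<dots> = K * (q * (x \<bullet> x))" using q by (simp add: K_def)
   also have "\<dots> \<le> K * (x \<bullet> (P' *\<^sub>v x))" using q(2)[OF 0] K by (intro mult_left_mono)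
   finally show ?case using psd_nonneg[OF P'(1) 0] by simp
  next
   case (Suc t x)
   let ?y = "cloop P' *\<^sub>v x"
   have y: "dim_vec ?y = n" using closed_dims[OF P'] by simp
   have "x \<bullet> (P *\<^sub>v x) \<le> cst P x (gain P' *\<^sub>v x)"
    using cst_ge[OF P(1) Suc.prems, of "gain P' *\<^sub>v x"] P(2) dims[OF P'(1)] by simp
   then have "x \<bullet> (P *\<^sub>v x) - x \<bullet> (P' *\<^sub>v x) \<le> \<beta> * (?y \<bullet> (P *\<^sub>v ?y) - ?y \<bullet> (P' *\<^sub>v ?y))"
    using closed_cost[OF P' Suc.prems] closed_mv[OF P' Suc.prems] by (simp add: cst_def algebra_simps)
   also have "\<dots> \<le> \<beta> * (K * \<rho> ^ t * (?y \<bullet> (P' *\<^sub>v ?y)))" using Suc.IH[OF y] \<beta> by (intro mult_left_mono)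
   also have "\<dots> = (K * \<rho> ^ t) * (\<beta> * (?y \<bullet> (P' *\<^sub>v ?y)))" by simp
   also have "\<dots> \<le> (K * \<rho> ^ t) * (\<rho> * (x \<bullet> (P' *\<^sub>v x)))"
    using \<rho>(3)[OF Suc.prems] K \<rho>(1) by (intro mult_left_mono) auto
   finally show ?case by (simp add: mult_ac)
  qed
  then have "\<forall>t. x \<bullet> (P *\<^sub>v x) - x \<bullet> (P' *\<^sub>v x) \<le> K * \<rho> ^ t * (x \<bullet> (P' *\<^sub>v x))" using x by blast
  moreover have "(\<lambda>t. K * \<rho> ^ t * (x \<bullet> (P' *\<^sub>v x))) \<longlonglongrightarrow> K * 0 * (x \<bullet> (P' *\<^sub>v x))"
   using \<rho> by (intro tendsto_intros LIMSEQ_realpow_zero) auto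
  ultimately have "x \<bullet> (P *\<^sub>v x) - x \<bullet> (P' *\<^sub>v x) \<le> K * 0 * (x \<bullet> (P' *\<^sub>v x))"
   by (intro LIMSEQ_le_const) auto
  then show ?thesis by simp
 qed
 show ?thesis
 proof (rule form_eq_imp_eq[of P n P'])
  fix v :: rvec assume "v \<in> carrier_vec n"
  then have v: "dim_vec v = n" by auto
  show "v \<bullet> (P *\<^sub>v v) = v \<bullet> (P' *\<^sub>v v)" using le[OF P P' v] le[OF P' P v] by simp
 qed (use P P' in \<open>auto simp: pos_semidef_def\<close>)
qed

end

section \<open>Geometric decay\<close>

definition geo :: "nat => nat => (nat => rmat) => bool" where
 "geo r c U \<longleftrightarrow> (\<forall>k. U k \<in> carrier_mat r c) \<and>
  (\<exists>C \<rho>. 0 \<le> C \<and> 0 \<le> \<rho> \<and> \<rho> < 1 \<and> (\<forall>k. \<forall>i<r. \<forall>j<c. \<bar>U k $$ (i,j)\<bar> \<le> C * \<rho> ^ k))"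

lemma geoI: "(!!k. U k \<in> carrier_mat r c) ==> 0 \<le> C ==> 0 \<le> \<rho> ==> \<rho> < 1 ==>
  (!!k i j. i < r ==> j < c ==> \<bar>U k $$ (i,j)\<bar> \<le> C * \<rho> ^ k) ==> geo r c U"
 unfolding geo_def by blast

lemma geoD: assumes "geo r c U"
 obtains C \<rho> where "0 \<le> C" "0 \<le> \<rho>" "\<rho> < 1" "!!k i j. i < r ==> j < c ==> \<bar>U k $$ (i,j)\<bar> \<le> C * \<rho> ^ k"
  "!!k. U k \<in> carrier_mat r c"
 using assms unfolding geo_def by blast

lemma geo_left: assumes U: "geo r c U" and A: "A \<in> carrier_mat r' r" shows "geo r' c (\<lambda>k. A * U k)"
proof -
 obtain C \<rho> where *: "0 \<le> C" "0 \<le> \<rho>" "\<rho> < 1" "!!k i j. i < r ==> j < c ==> \<bar>U k $$ (i,j)\<bar> \<le> C * \<rho> ^ k"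
  "!!k. U k \<in> carrier_mat r c" using geoD[OF U] by metis
 define D where "D = (\<Sum>i<r'. \<Sum>l<r. \<bar>A $$ (i,l)\<bar>)"
 have D: "0 \<le> D" by (simp add: D_def sum_nonneg)
 have "\<bar>(A * U k) $$ (i,j)\<bar> \<le> (D * C) * \<rho> ^ k" if ij: "i < r'" "j < c" for k i j
 proof -
  have "\<bar>(A * U k) $$ (i,j)\<bar> = \<bar>\<Sum>l<r. A $$ (i,l) * U k $$ (l,j)\<bar>"
   using ij A *(5)[of k] by (simp add: scalar_prod_def lessThan_atLeast0)
  also have "\<dots> \<le> (\<Sum>l<r. \<bar>A $$ (i,l)\<bar> * (C * \<rho> ^ k))"
   using *(4) ij by (intro order_trans[OF sum_abs] sum_mono) (auto simp: abs_mult intro!: mult_left_mono)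
  also have "\<dots> = (\<Sum>l<r. \<bar>A $$ (i,l)\<bar>) * (C * \<rho> ^ k)" by (simp add: sum_distrib_right)
  also have "(\<Sum>l<r. \<bar>A $$ (i,l)\<bar>) \<le> D" unfolding D_def
   using ij by (intro member_le_sum[of i "{..<r'}" "\<lambda>i. \<Sum>l<r. \<bar>A $$ (i,l)\<bar>"]) (auto simp: sum_nonneg)
  finally show ?thesis using * by (simp add: mult_right_mono mult.assoc)
 qed
 then show ?thesis using * A D by (intro geoI[of _ _ _ "D * C" \<rho>]) (auto intro: mult_carrier_mat)
qed

lemma geo_tr: "geo r c U ==> geo c r (\<lambda>k. tr (U k))"
proof -
 assume U: "geo r c U"
 obtain C \<rho> where *: "0 \<le> C" "0 \<le> \<rho>" "\<rho> < 1" "!!k i j. i < r ==> j < c ==> \<bar>U k $$ (i,j)\<bar> \<le> C * \<rho> ^ k"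
  "!!k. U k \<in> carrier_mat r c" using geoD[OF U] by metis
 have "\<bar>tr (U k) $$ (i, j)\<bar> \<le> C * \<rho> ^ k" if "i < c" "j < r" for k i j
  using *(4)[OF that(2,1), of k] *(5)[of k] that by auto
 then show ?thesis using * by (intro geoI[of _ _ _ C \<rho>]) auto
qed

lemma geo_right: assumes U: "geo r c U" and A: "A \<in> carrier_mat c c'" shows "geo r c' (\<lambda>k. U k * A)"
proof -
 have "geo r c' (\<lambda>k. tr (tr A * tr (U k)))"
  using A by (intro geo_tr geo_left[OF geo_tr[OF U]]) auto
 moreover have "tr (tr A * tr (U k)) = U k * A" for k
  using A U by (subst tr_mult) (auto simp: geo_def)
 ultimately show ?thesis by simp
qed

lemma geo_smult: assumes "geo r c U" shows "geo r c (\<lambda>k. x \<cdot>\<^sub>m U k)"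
proof -
 obtain C \<rho> where *: "0 \<le> C" "0 \<le> \<rho>" "\<rho> < 1" "!!k i j. i < r ==> j < c ==> \<bar>U k $$ (i,j)\<bar> \<le> C * \<rho> ^ k"
  "!!k. U k \<in> carrier_mat r c" using geoD[OF assms] by metis
 have "\<bar>(x \<cdot>\<^sub>m U k) $$ (i,j)\<bar> \<le> (\<bar>x\<bar> * C) * \<rho> ^ k" if "i < r" "j < c" for k i j
  using *(4)[OF that, of k] *(5)[of k] that by (simp add: abs_mult mult_left_mono mult.assoc)
 then show ?thesis using * by (intro geoI[of _ _ _ "\<bar>x\<bar> * C" \<rho>]) auto
qed

lemma geo_shift: assumes U: "U 0 \<in> carrier_mat r c" "geo r c (\<lambda>k. U (Suc k))" shows "geo r c U"
proof -
 obtain C \<rho> where *: "0 \<le> C" "0 \<le> \<rho>" "\<rho> < 1" "!!k i j. i < r ==> j < c ==> \<bar>U (Suc k) $$ (i,j)\<bar> \<le> C * \<rho> ^ k"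
  "!!k. U (Suc k) \<in> carrier_mat r c" using geoD[OF U(2)] by metis
 define \<sigma> where "\<sigma> = (\<rho> + 1) / 2"
 have \<sigma>: "0 < \<sigma>" "\<sigma> < 1" "\<rho> \<le> \<sigma>" using * by (auto simp: \<sigma>_def)
 define D where "D = (\<Sum>i<r. \<Sum>l<c. \<bar>U 0 $$ (i,l)\<bar>)"
 have D: "0 \<le> D" by (simp add: D_def sum_nonneg)
 have "\<bar>U k $$ (i,j)\<bar> \<le> (D + C / \<sigma>) * \<sigma> ^ k" if ij: "i < r" "j < c" for k i j
 proof (cases k)
  case 0
  have "\<bar>U 0 $$ (i,j)\<bar> \<le> (\<Sum>l<c. \<bar>U 0 $$ (i,l)\<bar>)" using ij by (intro member_le_sum) auto
  also have "\<dots> \<le> D" unfolding D_def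
   using ij by (intro member_le_sum[of i "{..<r}" "\<lambda>i. \<Sum>l<c. \<bar>U 0 $$ (i,l)\<bar>"]) (auto simp: sum_nonneg)
  also have "\<dots> \<le> D + C / \<sigma>" using * \<sigma> by simp
  finally show ?thesis using 0 by simp
 next
  case (Suc l)
  have "\<bar>U k $$ (i,j)\<bar> \<le> C * \<sigma> ^ l" unfolding Suc
   using *(4)[OF ij, of l] power_mono[OF \<sigma>(3) *(2), of l] *(1) by (meson mult_left_mono order_trans)
  also have "\<dots> = C / \<sigma> * \<sigma> ^ k" using \<sigma> Suc by simp
  also have "\<dots> \<le> (D + C / \<sigma>) * \<sigma> ^ k" using D \<sigma> by (intro mult_right_mono) auto
  finally show ?thesis .
 qed
 moreover have "U k \<in> carrier_mat r c" for k using U(1) *(5) by (cases k) auto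
 ultimately show ?thesis using * D \<sigma> by (intro geoI[of _ _ _ "D + C / \<sigma>" \<sigma>]) auto
qed

definition bdd_vec :: "nat => (nat => rvec) => bool" where
 "bdd_vec p v \<longleftrightarrow> (\<forall>k. v k \<in> carrier_vec p) \<and> (\<exists>c. \<forall>k. \<forall>l<p. \<bar>v k $ l\<bar> \<le> c)"

lemma bdd_vec_Suc: "bdd_vec p v ==> bdd_vec p (\<lambda>k. v (Suc k))"
 unfolding bdd_vec_def by blast

lemma geo_summable_entry: assumes U: "geo r c U" and ij: "i < r" "j < c" and b: "!!k. \<bar>f k\<bar> \<le> B"
 shows "summable (\<lambda>k. U k $$ (i,j) * f k)" "summable (\<lambda>k. \<bar>U k $$ (i,j) * f k\<bar>)"
proof -
 obtain C \<rho> where *: "0 \<le> C" "0 \<le> \<rho>" "\<rho> < 1" "!!k i j. i < r ==> j < c ==> \<bar>U k $$ (i,j)\<bar> \<le> C * \<rho> ^ k"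
  using geoD[OF U] by metis
 have "summable (\<lambda>k. (C * \<rho> ^ k) * B)" using * by (intro summable_mult summable_mult2 summable_geometric) auto
 moreover have "\<bar>U k $$ (i,j) * f k\<bar> \<le> (C * \<rho> ^ k) * B" for k
  using *(4)[OF ij, of k] b[of k] *(1,2) unfolding abs_mult by (intro mult_mono) auto
 ultimately show "summable (\<lambda>k. \<bar>U k $$ (i,j) * f k\<bar>)"
  by (intro summable_comparison_test[of "\<lambda>k. \<bar>U k $$ (i,j) * f k\<bar>" "\<lambda>k. (C * \<rho> ^ k) * B"]) auto
 then show "summable (\<lambda>k. U k $$ (i,j) * f k)" by (rule summable_rabs_cancel)
qed

lemma geo_summable: assumes U: "geo r c U" and v: "bdd_vec c v" shows "summable_vec r (\<lambda>k. U k *\<^sub>v v k)"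
 unfolding summable_vec_def
proof (intro allI impI)
 fix i assume i: "i < r"
 obtain b where b: "!!k l. l < c ==> \<bar>v k $ l\<bar> \<le> b" using v by (auto simp: bdd_vec_def)
 have "(U k *\<^sub>v v k) $ i = (\<Sum>j<c. U k $$ (i,j) * v k $ j)" for k
 proof -
  have "U k \<in> carrier_mat r c" "v k \<in> carrier_vec c" using U v by (auto simp: geo_def bdd_vec_def)
  then show ?thesis using i by (auto simp: scalar_prod_def lessThan_atLeast0 intro!: sum.cong)
 qed
 moreover have "summable (\<lambda>k. \<Sum>j<c. U k $$ (i,j) * v k $ j)"
  by (intro summable_sum geo_summable_entry(1)[OF U i _ b]) auto
 ultimately show "summable (\<lambda>k. (U k *\<^sub>v v k) $ i)" by simp
qed

lemma suminf_vec_dim [simp]: "dim_vec (suminf_vec d f) = d" "suminf_vec d f \<in> carrier_vec d" by (simp_all add: suminf_vec_def)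

lemma suminf_vec_head: assumes "summable_vec d f" "f 0 \<in> carrier_vec d"
 shows "suminf_vec d f = f 0 + suminf_vec d (\<lambda>k. f (Suc k))"
proof (rule eq_vecI)
 fix i assume "i < dim_vec (f 0 + suminf_vec d (\<lambda>k. f (Suc k)))"
 then have i: "i < d" by simp
 show "suminf_vec d f $ i = (f 0 + suminf_vec d (\<lambda>k. f (Suc k))) $ i"
  using suminf_split_head[of "\<lambda>k. f k $ i"] assms i by (simp add: suminf_vec_def summable_vec_def)
qed (use assms in auto)

lemma suminf_vec_mult: assumes s: "summable_vec c f" and f: "!!k. f k \<in> carrier_vec c" and A: "A \<in> carrier_mat r c"
 shows "suminf_vec r (\<lambda>k. A *\<^sub>v f k) = A *\<^sub>v suminf_vec c f" "summable_vec r (\<lambda>k. A *\<^sub>v f k)"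
proof -
 have e: "(A *\<^sub>v f k) $ i = (\<Sum>j<c. A $$ (i,j) * f k $ j)" if "i < r" for i k
  using f[of k] A that by (auto simp: scalar_prod_def lessThan_atLeast0 intro!: sum.cong)
 have sj: "summable (\<lambda>k. A $$ (i,j) * f k $ j)" if "j < c" for i j
  using s that by (intro summable_mult) (auto simp: summable_vec_def)
 show "summable_vec r (\<lambda>k. A *\<^sub>v f k)" unfolding summable_vec_def
  using sj by (auto simp: e intro!: summable_sum)
 show "suminf_vec r (\<lambda>k. A *\<^sub>v f k) = A *\<^sub>v suminf_vec c f"
 proof (rule eq_vecI)
  fix i assume "i < dim_vec (A *\<^sub>v suminf_vec c f)"
  then have i: "i < r" using A by simp
  have "suminf_vec r (\<lambda>k. A *\<^sub>v f k) $ i = (\<Sum>k. \<Sum>j<c. A $$ (i,j) * f k $ j)" using i by (simp add: suminf_vec_def e)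
  also have "\<dots> = (\<Sum>j<c. \<Sum>k. A $$ (i,j) * f k $ j)" using sj by (intro suminf_sum) auto
  also have "\<dots> = (\<Sum>j<c. A $$ (i,j) * suminf_vec c f $ j)"
   using s by (intro sum.cong refl) (auto simp: suminf_vec_def summable_vec_def suminf_mult)
  also have "\<dots> = (A *\<^sub>v suminf_vec c f) $ i" using A i by (auto simp: scalar_prod_def lessThan_atLeast0 suminf_vec_def intro!: sum.cong)
  finally show "suminf_vec r (\<lambda>k. A *\<^sub>v f k) $ i = (A *\<^sub>v suminf_vec c f) $ i" .
 qed (use A in auto)
qed

lemma pow_comm: "X \<in> carrier_mat n n ==> (X ^\<^sub>m k) * X = X * (X ^\<^sub>m k :: rmat)"
proof (induction k)
 case (Suc k)
 have "(X ^\<^sub>m Suc k) * X = (X * (X ^\<^sub>m k)) * X" using Suc by simp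
 also have "\<dots> = X * ((X ^\<^sub>m k) * X)" using Suc.prems by (intro mat_assoc) auto
 finally show ?case by simp
qed auto

lemma tr_pow: assumes "X \<in> carrier_mat n n" shows "tr (X ^\<^sub>m k) = (tr X) ^\<^sub>m (k :: nat)"
proof (induction k)
 case 0 then show ?case using assms by simp
next
 case (Suc k)
 have "tr (X ^\<^sub>m Suc k) = tr X * (tr X ^\<^sub>m k)" using assms pow_carrier_mat[OF assms, of k] Suc by (simp add: tr_mult)
 then show ?case using pow_comm[of "tr X" n k] assms by simp
qed

section \<open>The regulator of one decision maker\<close>

locale dm =
 fixes g :: lq_game and i :: nat
 assumes game: "lq_game_data g" and i: "i \<in> {1..nDM g}" and stab: "stabilizable (mA g i) (mB g i)"
begin

abbreviation "n \<equiv> nx g i"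
abbreviation "m \<equiv> nu g i"
abbreviation "p \<equiv> ny g"
abbreviation "\<beta> \<equiv> disc g i"

sublocale lqr n m "mA g i" "mB g i" "mQ g i" "mR g i" \<beta>
 using game i by unfold_locales (auto simp: lq_game_data_def)

lemma more_dims: "dim_row (mC g i) = n" "dim_col (mC g i) = p" "dim_row (mK g i) = p" "dim_col (mK g i) = m"
 "dim_row (mL g i) = p" "dim_col (mL g i) = n"
 using game i by (auto simp: lq_game_data_def)

lemma riccati_ric: "riccati g i P \<longleftrightarrow> ric P = P"
 unfolding riccati_def Let_def ric_def Smat_def by (auto simp: eq_commute)

lemma cM: "pos_semidef n (cM g i)" "ric (cM g i) = cM g i"
proof -
 have "\<exists>!P. pos_semidef n P \<and> riccati g i P"
  using riccati_exists[OF stab] riccati_unique unfolding riccati_ric by blast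
 from theI'[OF this] show "pos_semidef n (cM g i)" "ric (cM g i) = cM g i"
  unfolding cM_def riccati_ric by auto
qed

definition "Sm = Smat (cM g i)"

lemma cSinv_eq: "cSinv g i = inv_mat Sm" by (simp add: cSinv_def Sm_def Smat_def)
lemma cF_eq: "cF g i = gain (cM g i)" by (simp add: cF_def gain_def cSinv_eq Sm_def)
lemma cAF_eq: "cAF g i = cloop (cM g i)" by (simp add: cAF_def cloop_def cF_eq)

lemma gm_dims: "dim_row (cM g i) = n" "dim_col (cM g i) = n" "tr (cM g i) = cM g i" "cM g i \<in> carrier_mat n n"
 "dim_row (cSinv g i) = m" "dim_col (cSinv g i) = m" "dim_row (cF g i) = m" "dim_col (cF g i) = n"
 "dim_row (cAF g i) = n" "dim_col (cAF g i) = n" "dim_row Sm = m" "dim_col Sm = m" "tr Sm = Sm" "Sm \<in> carrier_mat m m"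
 using Pc[OF cM(1)] dims[OF cM(1)] Sinv[OF cM(1)] closed_dims[OF cM]
 by (auto simp: Sm_def cSinv_eq cF_eq cAF_eq)

lemmas alld = carriers(1-8) more_dims gm_dims(1,2,5-12)
declare alld [simp]

lemma cAF_mv: "dim_vec x = n ==> cAF g i *\<^sub>v x = mA g i *\<^sub>v x + mB g i *\<^sub>v (cF g i *\<^sub>v x)"
 using closed_mv[OF cM] by (simp add: cAF_eq cF_eq)

lemma Sm_mv: "dim_vec u = m ==> Sm *\<^sub>v u = mR g i *\<^sub>v u + \<beta> \<cdot>\<^sub>v (tr (mB g i) *\<^sub>v (cM g i *\<^sub>v (mB g i *\<^sub>v u)))"
 by (simp add: Sm_def Smat_def mv_simps)

lemma Sm_inv: "dim_vec u = m ==> Sm *\<^sub>v (cSinv g i *\<^sub>v u) = u"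
 using Sinv(2)[OF cM(1)] by (subst mult_mv[symmetric]) (auto simp: cSinv_eq[symmetric] Sm_def[symmetric] one_mv)

lemma Sm_F: "dim_vec x = n ==> Sm *\<^sub>v (cF g i *\<^sub>v x) = (- \<beta>) \<cdot>\<^sub>v (tr (mB g i) *\<^sub>v (cM g i *\<^sub>v (mA g i *\<^sub>v x)))"
 using gain_eq(2)[OF cM(1)] by (simp add: Sm_def cF_eq)

lemma F_S: assumes "dim_vec x = n" "dim_vec u = m"
 shows "\<beta> * ((mA g i *\<^sub>v x) \<bullet> (cM g i *\<^sub>v (mB g i *\<^sub>v u))) = - ((cF g i *\<^sub>v x) \<bullet> (Sm *\<^sub>v u))"
proof -
 have "(cF g i *\<^sub>v x) \<bullet> (Sm *\<^sub>v u) = u \<bullet> (Sm *\<^sub>v (cF g i *\<^sub>v x))"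
  using assms by (intro sym_sp[OF gm_dims(13,14)]) auto
 also have "\<dots> = - \<beta> * (u \<bullet> (tr (mB g i) *\<^sub>v (cM g i *\<^sub>v (mA g i *\<^sub>v x))))" using assms by (simp add: Sm_F sp_simps)
 also have "u \<bullet> (tr (mB g i) *\<^sub>v (cM g i *\<^sub>v (mA g i *\<^sub>v x))) = (tr (mB g i) *\<^sub>v (cM g i *\<^sub>v (mA g i *\<^sub>v x))) \<bullet> u"
  using assms by (intro sp_comm) auto
 also have "\<dots> = (cM g i *\<^sub>v (mA g i *\<^sub>v x)) \<bullet> (mB g i *\<^sub>v u)" using assms by (intro transpose_sp) auto
 also have "\<dots> = (mB g i *\<^sub>v u) \<bullet> (cM g i *\<^sub>v (mA g i *\<^sub>v x))" by (rule sp_comm) simp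
 also have "\<dots> = (mA g i *\<^sub>v x) \<bullet> (cM g i *\<^sub>v (mB g i *\<^sub>v u))" by (rule sym_sp[OF gm_dims(3,4)]) simp_all
 finally show ?thesis by simp
qed

lemma M_mv: assumes x: "dim_vec x = n"
 shows "cM g i *\<^sub>v x = mQ g i *\<^sub>v x + \<beta> \<cdot>\<^sub>v (tr (mA g i) *\<^sub>v (cM g i *\<^sub>v (cAF g i *\<^sub>v x)))"
proof -
 let ?M = "cM g i" and ?T = "cSinv g i"
 have F: "cF g i *\<^sub>v x = (- \<beta>) \<cdot>\<^sub>v (?T *\<^sub>v (tr (mB g i) *\<^sub>v (?M *\<^sub>v (mA g i *\<^sub>v x))))"
  using gain_eq(1)[OF cM(1) x] by (simp add: cF_eq cSinv_eq Sm_def)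
 have "?M *\<^sub>v x = ric ?M *\<^sub>v x" using cM by simp
 also have "\<dots> = mQ g i *\<^sub>v x + \<beta> \<cdot>\<^sub>v (tr (mA g i) *\<^sub>v (?M *\<^sub>v (mA g i *\<^sub>v x)
   - \<beta> \<cdot>\<^sub>v (?M *\<^sub>v (mB g i *\<^sub>v (?T *\<^sub>v (tr (mB g i) *\<^sub>v (?M *\<^sub>v (mA g i *\<^sub>v x))))))))"
  unfolding ric_def Sm_def[symmetric] cSinv_eq[symmetric] using x by (simp add: mv_simps)
 also have "?M *\<^sub>v (mA g i *\<^sub>v x) - \<beta> \<cdot>\<^sub>v (?M *\<^sub>v (mB g i *\<^sub>v (?T *\<^sub>v (tr (mB g i) *\<^sub>v (?M *\<^sub>v (mA g i *\<^sub>v x))))))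
   = ?M *\<^sub>v (cAF g i *\<^sub>v x)"
  unfolding cAF_mv[OF x] F using x by (simp add: mv_simps) (intro eq_vecI, auto)
 finally show ?thesis .
qed

definition "Tm = \<beta> \<cdot>\<^sub>m tr (cAF g i)"
definition "Gam = (tr (cF g i) * tr (mK g i) + tr (mL g i)) + \<beta> \<cdot>\<^sub>m (tr (cAF g i) * cM g i * mC g i)"

lemma Tm_dims: "dim_row Tm = n" "dim_col Tm = n" "Tm \<in> carrier_mat n n" "dim_row Gam = n" "dim_col Gam = p" "Gam \<in> carrier_mat n p"
 by (auto simp: Tm_def Gam_def intro: carrier_matI)

text \<open>As \<open>\<beta> \<le> 1\<close>, the matrix \<open>\<beta> (A + B F)\<close> contracts the form
 of \<open>M\<close> by the factor \<open>\<rho>\<close>, and this form is equivalent to the norm;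
 \<open>Tm\<close> is its transpose.\<close>
lemma Tm_geo: "geo n n (\<lambda>k. Tm ^\<^sub>m k)"
proof -
 let ?X = "\<beta> \<cdot>\<^sub>m cAF g i"
 have X: "?X \<in> carrier_mat n n" by (auto intro: carrier_matI)
 obtain \<rho> where \<rho>: "0 \<le> \<rho>" "\<rho> < 1" "!!x. dim_vec x = n ==>
   \<beta> * ((cAF g i *\<^sub>v x) \<bullet> (cM g i *\<^sub>v (cAF g i *\<^sub>v x))) \<le> \<rho> * (x \<bullet> (cM g i *\<^sub>v x))"
  using closed_contraction[OF cM] unfolding cAF_eq by blast
 obtain q where q: "q > 0" "!!x. dim_vec x = n ==> q * (x \<bullet> x) \<le> x \<bullet> (cM g i *\<^sub>v x)"
  using fix_coercive[OF cM] by blast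
 have d: "((?X ^\<^sub>m k) *\<^sub>v x) \<bullet> (cM g i *\<^sub>v ((?X ^\<^sub>m k) *\<^sub>v x)) \<le> \<rho> ^ k * (x \<bullet> (cM g i *\<^sub>v x))" if "dim_vec x = n" for k x
  using that
 proof (induction k arbitrary: x)
  case 0 then show ?case by (simp add: one_mv)
 next
  case (Suc k)
  let ?y = "cAF g i *\<^sub>v x"
  have e: "(?X ^\<^sub>m Suc k) *\<^sub>v x = (?X ^\<^sub>m k) *\<^sub>v (?X *\<^sub>v x)"
   using X Suc.prems by (simp add: mult_mv)
  have 1: "((?X ^\<^sub>m k) *\<^sub>v (?X *\<^sub>v x)) \<bullet> (cM g i *\<^sub>v ((?X ^\<^sub>m k) *\<^sub>v (?X *\<^sub>v x))) \<le> \<rho> ^ k * ((?X *\<^sub>v x) \<bullet> (cM g i *\<^sub>v (?X *\<^sub>v x)))"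
   by (intro Suc.IH) simp
  have "(?X *\<^sub>v x) \<bullet> (cM g i *\<^sub>v (?X *\<^sub>v x)) = \<beta> * (\<beta> * (?y \<bullet> (cM g i *\<^sub>v ?y)))"
   using Suc.prems by (simp add: mv_simps sp_simps)
  also have "\<dots> \<le> 1 * (\<beta> * (?y \<bullet> (cM g i *\<^sub>v ?y)))"
   using \<beta> psd_nonneg[OF cM(1), of ?y] by (intro mult_right_mono mult_nonneg_nonneg) auto
  also have "\<dots> \<le> \<rho> * (x \<bullet> (cM g i *\<^sub>v x))" using \<rho>(3)[OF Suc.prems] by simp
  finally have "\<rho> ^ k * ((?X *\<^sub>v x) \<bullet> (cM g i *\<^sub>v (?X *\<^sub>v x))) \<le> \<rho> ^ k * (\<rho> * (x \<bullet> (cM g i *\<^sub>v x)))"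
   using \<rho>(1) by (intro mult_left_mono) auto
  with 1 show ?case unfolding e by (simp add: mult_ac)
 qed
 define c where "c = (\<Sum>j<n. unit_vec n j \<bullet> (cM g i *\<^sub>v unit_vec n j)) / q"
 have cj: "unit_vec n j \<bullet> (cM g i *\<^sub>v unit_vec n j) / q \<le> c" if "j < n" for j
  unfolding c_def using that q psd_nonneg[OF cM(1)]
  by (intro divide_right_mono member_le_sum[of j _ "\<lambda>j. unit_vec n j \<bullet> (cM g i *\<^sub>v unit_vec n j)"]) auto
 have c0: "0 \<le> c" unfolding c_def using q psd_nonneg[OF cM(1)] by (intro divide_nonneg_pos sum_nonneg) auto
 have "geo n n (\<lambda>k. ?X ^\<^sub>m k)"
 proof (rule geoI[of _ _ _ "sqrt c" "sqrt \<rho>"])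
  fix k a b assume ab: "a < n" "b < n"
  have Xk: "?X ^\<^sub>m k \<in> carrier_mat n n" using X by simp
  let ?y = "(?X ^\<^sub>m k) *\<^sub>v unit_vec n b"
  have yd: "dim_vec ?y = n" using carrier_matD(1)[OF Xk] by simp
  have "(?X ^\<^sub>m k) $$ (a,b) = ?y $ a" using ab Xk by (auto simp: scalar_prod_right_unit)
  then have "((?X ^\<^sub>m k) $$ (a,b))\<^sup>2 \<le> ?y \<bullet> ?y" using comp_le_sp_self[of a ?y] ab yd by simp
  also have "\<dots> \<le> ?y \<bullet> (cM g i *\<^sub>v ?y) / q" using q(2)[OF yd] q(1) by (simp add: field_simps)
  also have "\<dots> \<le> \<rho> ^ k * (unit_vec n b \<bullet> (cM g i *\<^sub>v unit_vec n b)) / q" using d[of "unit_vec n b" k] q by (intro divide_right_mono) auto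
  also have "\<dots> \<le> \<rho> ^ k * c" using cj[OF ab(2)] \<rho> by (simp add: mult_left_mono flip: times_divide_eq_right)
  also have "\<dots> = (sqrt c * sqrt \<rho> ^ k)\<^sup>2" using c0 \<rho> by (simp add: power_mult_distrib flip: power_mult) (simp add: mult.commute[of k] power_mult)
  finally show "\<bar>(?X ^\<^sub>m k) $$ (a,b)\<bar> \<le> sqrt c * sqrt \<rho> ^ k"
   by (rule abs_le_square_iff[THEN iffD2, THEN order_trans]) (simp add: c0 \<rho>)
 qed (use X c0 \<rho> in auto)
 moreover have "tr (?X ^\<^sub>m k) = Tm ^\<^sub>m k" for k using tr_pow[OF X] by (simp add: Tm_def tr_smult)
 ultimately show ?thesis using geo_tr by fastforce
qed

lemma one_minus_Tm: "inv_mat (1\<^sub>m n - Tm) \<in> carrier_mat n n" "(1\<^sub>m n - Tm) * inv_mat (1\<^sub>m n - Tm) = 1\<^sub>m n"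
proof -
 have c: "1\<^sub>m n - Tm \<in> carrier_mat n n" using Tm_dims by auto
 have "v = 0\<^sub>v n" if v: "v \<in> carrier_vec n" "(1\<^sub>m n - Tm) *\<^sub>v v = 0\<^sub>v n" for v
 proof -
  have vd: "dim_vec v = n" using v by auto
  have "v - Tm *\<^sub>v v = 0\<^sub>v n" using v Tm_dims by (simp add: mv_simps)
  then have "v $ k - (Tm *\<^sub>v v) $ k = 0" if "k < n" for k
   using that Tm_dims vd by (metis dim_mult_mat_vec index_minus_vec(1) index_zero_vec(1))
  then have Tv: "Tm *\<^sub>v v = v" using vd Tm_dims by (intro eq_vecI) auto
  have Tk: "(Tm ^\<^sub>m k) *\<^sub>v v = v" for k
  proof (induction k)
   case (Suc k) then show ?case using Tm_dims vd by (simp add: mult_mv Tv)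
  qed (use vd Tm_dims in \<open>simp add: one_mv\<close>)
  have "v $ a = 0" if a: "a < n" for a
  proof -
   have "bdd_vec n (\<lambda>_. v)" unfolding bdd_vec_def using v
    by (auto intro!: exI[of _ "\<Sum>l<n. \<bar>v $ l\<bar>"] member_le_sum)
   from geo_summable[OF Tm_geo this] have "summable (\<lambda>k. ((Tm ^\<^sub>m k) *\<^sub>v v) $ a)" using a by (simp add: summable_vec_def)
   then have "summable (\<lambda>k::nat. v $ a)" unfolding Tk .
   then show ?thesis by (simp only: summable_const_iff)
  qed
  then show ?thesis using v by (intro eq_vecI) auto
 qed
 from inj_inverse[OF c this] show "inv_mat (1\<^sub>m n - Tm) \<in> carrier_mat n n" "(1\<^sub>m n - Tm) * inv_mat (1\<^sub>m n - Tm) = 1\<^sub>m n" by auto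
qed

lemma cG_0: "cG g i 0 = - (cSinv g i * (tr (mK g i) + \<beta> \<cdot>\<^sub>m (tr (mB g i) * cM g i * mC g i)))" by (simp add: cG_def)
lemma cG_Suc: "cG g i (Suc k) = (- \<beta>) \<cdot>\<^sub>m (cSinv g i * tr (mB g i) * (Tm ^\<^sub>m k) * Gam)"
 by (simp add: cG_def Tm_def Gam_def)

lemma cG_geo: "geo m p (cG g i)"
proof (rule geo_shift)
 show "cG g i 0 \<in> carrier_mat m p" by (auto simp: cG_0 intro: carrier_matI)
 show "geo m p (\<lambda>k. cG g i (Suc k))" unfolding cG_Suc using Tm_dims
  by (intro geo_smult geo_right[OF _ Tm_dims(6)] geo_left[OF Tm_geo]) (auto intro: carrier_matI)
qed

text \<open>The costate is \<open>M x + rr\<close>, where \<open>rr\<close> is the offset generated by an anticipated environment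
 path; \<open>gg\<close> is the corresponding feedforward control and \<open>qv\<close> the contribution of the disturbance mean.\<close>
definition qv :: "(nat => rvec) => rvec" where
 "qv ew = inv_mat (1\<^sub>m n - Tm) *\<^sub>v (cM g i *\<^sub>v ew i)"
definition rr :: "(nat => rvec) => (nat => rvec) => rvec" where
 "rr ew v = suminf_vec n (\<lambda>k. ((Tm ^\<^sub>m k) * Gam) *\<^sub>v v k) + (qv ew - cM g i *\<^sub>v ew i)"
definition gg :: "(nat => rvec) => (nat => rvec) => rvec" where
 "gg ew v = suminf_vec m (\<lambda>k. cG g i k *\<^sub>v v k) + cH g ew i"

context
 fixes ew v :: "nat => rvec" assumes ew: "dim_vec (ew i) = n" and v: "bdd_vec p v"
begin

lemma qv_eq: "dim_vec (qv ew) = n" "qv ew = cM g i *\<^sub>v ew i + Tm *\<^sub>v qv ew"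
proof -
 show d: "dim_vec (qv ew) = n" using one_minus_Tm by (auto simp: qv_def)
 have "(1\<^sub>m n - Tm) *\<^sub>v qv ew = cM g i *\<^sub>v ew i"
  unfolding qv_def using one_minus_Tm ew Tm_dims by (subst mult_mv[symmetric]) (auto simp: one_mv)
 then have "qv ew - Tm *\<^sub>v qv ew = cM g i *\<^sub>v ew i" using d Tm_dims by (simp add: mv_simps)
 then have "cM g i *\<^sub>v ew i + Tm *\<^sub>v qv ew = (qv ew - Tm *\<^sub>v qv ew) + Tm *\<^sub>v qv ew" by simp
 also have "\<dots> = qv ew" using d Tm_dims by (intro eq_vecI) auto
 finally show "qv ew = cM g i *\<^sub>v ew i + Tm *\<^sub>v qv ew" ..
qed

lemma rr_dim: "dim_vec (rr ew v) = n" by (simp add: rr_def)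
lemma gg_dim: "dim_vec (gg ew v) = m" by (simp add: gg_def cH_def)

text \<open>The backward costate recursion: splitting off the first term of the series.\<close>
lemma rr_step: "rr ew v = Gam *\<^sub>v v 0 + Tm *\<^sub>v (cM g i *\<^sub>v ew i + rr ew (\<lambda>k. v (Suc k)))"
proof -
 let ?f = "\<lambda>k. ((Tm ^\<^sub>m k) * Gam) *\<^sub>v v k" and ?h = "\<lambda>k. ((Tm ^\<^sub>m k) * Gam) *\<^sub>v v (Suc k)"
 have vd: "dim_vec (v k) = p" for k using v by (auto simp: bdd_vec_def)
 have gs: "geo n p (\<lambda>k. (Tm ^\<^sub>m k) * Gam)" using geo_right[OF Tm_geo Tm_dims(6)] .
 have Tk: "dim_row (Tm ^\<^sub>m k) = n" "dim_col (Tm ^\<^sub>m k) = n" for k using Tm_dims by auto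
 have hc: "?h k \<in> carrier_vec n" for k using Tk by (intro carrier_vecI) simp
 have fS: "?f (Suc k) = Tm *\<^sub>v ?h k" for k
 proof -
  have "Tm ^\<^sub>m Suc k = Tm * (Tm ^\<^sub>m k)" using pow_comm[OF Tm_dims(3), of k] by simp
  then show ?thesis using Tk Tm_dims vd by (simp add: mult_mv del: pow_mat.simps)
 qed
 have "suminf_vec n ?f = ?f 0 + suminf_vec n (\<lambda>k. ?f (Suc k))"
  using geo_summable[OF gs v] Tk by (intro suminf_vec_head) (auto intro: carrier_vecI)
 also have "suminf_vec n (\<lambda>k. ?f (Suc k)) = Tm *\<^sub>v suminf_vec n ?h"
  unfolding fS using geo_summable[OF gs bdd_vec_Suc[OF v]] hc Tm_dims by (intro suminf_vec_mult) auto
 finally have s: "suminf_vec n ?f = Gam *\<^sub>v v 0 + Tm *\<^sub>v suminf_vec n ?h" using Tm_dims vd by (simp add: mult_mv one_mv)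
 have "Tm *\<^sub>v (cM g i *\<^sub>v ew i + rr ew (\<lambda>k. v (Suc k))) = Tm *\<^sub>v suminf_vec n ?h + Tm *\<^sub>v qv ew"
  unfolding rr_def using Tm_dims qv_eq(1) by (simp add: mv_simps) (intro eq_vecI, auto)
 moreover have "rr ew v = Gam *\<^sub>v v 0 + Tm *\<^sub>v suminf_vec n ?h + Tm *\<^sub>v qv ew"
 proof -
  have "qv ew - cM g i *\<^sub>v ew i = Tm *\<^sub>v qv ew"
   using Tm_dims qv_eq(1) by (subst qv_eq(2)) (intro eq_vecI, auto)
  then show ?thesis unfolding rr_def s by simp
 qed
 ultimately show ?thesis using Tm_dims by (intro eq_vecI) auto
qed

text \<open>The feedforward term is the stationary point of the one-step problem given the costate offset of
 the next step.\<close>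
lemma gg_eq: "Sm *\<^sub>v gg ew v = (- 1) \<cdot>\<^sub>v (tr (mK g i) *\<^sub>v v 0 + \<beta> \<cdot>\<^sub>v (tr (mB g i) *\<^sub>v (cM g i *\<^sub>v (mC g i *\<^sub>v v 0)))
  + \<beta> \<cdot>\<^sub>v (tr (mB g i) *\<^sub>v (cM g i *\<^sub>v ew i + rr ew (\<lambda>k. v (Suc k)))))"
proof -
 let ?h = "\<lambda>k. ((Tm ^\<^sub>m k) * Gam) *\<^sub>v v (Suc k)" and ?U = "(- \<beta>) \<cdot>\<^sub>m (cSinv g i * tr (mB g i))"
 have vd: "dim_vec (v k) = p" for k using v by (auto simp: bdd_vec_def)
 have gs: "geo n p (\<lambda>k. (Tm ^\<^sub>m k) * Gam)" using geo_right[OF Tm_geo Tm_dims(6)] .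
 have Tk: "dim_row (Tm ^\<^sub>m k) = n" "dim_col (Tm ^\<^sub>m k) = n" for k using Tm_dims by auto
 have hc: "?h k \<in> carrier_vec n" for k using Tk by (intro carrier_vecI) simp
 have fS: "cG g i (Suc k) *\<^sub>v v (Suc k) = ?U *\<^sub>v ?h k" for k
  using Tk Tm_dims vd by (simp add: cG_Suc mv_simps)
 have "suminf_vec m (\<lambda>k. cG g i k *\<^sub>v v k) = cG g i 0 *\<^sub>v v 0 + suminf_vec m (\<lambda>k. cG g i (Suc k) *\<^sub>v v (Suc k))"
  using geo_summable[OF cG_geo v] by (intro suminf_vec_head) (auto simp: cG_0 intro: carrier_vecI)
 also have "suminf_vec m (\<lambda>k. cG g i (Suc k) *\<^sub>v v (Suc k)) = ?U *\<^sub>v suminf_vec n ?h"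
  unfolding fS using geo_summable[OF gs bdd_vec_Suc[OF v]] hc by (intro suminf_vec_mult) (auto intro: carrier_matI)
 finally have s: "gg ew v = cG g i 0 *\<^sub>v v 0 + ?U *\<^sub>v suminf_vec n ?h + cH g ew i" unfolding gg_def by simp
 define e where "e = suminf_vec n ?h"
 have ed: "dim_vec e = n" by (simp add: e_def)
 have H: "cH g ew i = (- \<beta>) \<cdot>\<^sub>v (cSinv g i *\<^sub>v (tr (mB g i) *\<^sub>v qv ew))"
  using ew one_minus_Tm by (simp add: cH_def qv_def mv_simps Tm_def[symmetric])
 have 1: "rr ew (\<lambda>k. v (Suc k)) = e + (qv ew - cM g i *\<^sub>v ew i)" by (simp add: rr_def e_def)
 have "gg ew v = cSinv g i *\<^sub>v ((- 1) \<cdot>\<^sub>v (tr (mK g i) *\<^sub>v v 0 + \<beta> \<cdot>\<^sub>v (tr (mB g i) *\<^sub>v (cM g i *\<^sub>v (mC g i *\<^sub>v v 0)))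
  + \<beta> \<cdot>\<^sub>v (tr (mB g i) *\<^sub>v (cM g i *\<^sub>v ew i + rr ew (\<lambda>k. v (Suc k))))))"
  unfolding s H cG_0 1 e_def[symmetric] using ed vd ew qv_eq(1)
  by (simp add: mv_simps) (intro eq_vecI, auto simp: algebra_simps)
 then show ?thesis by (simp add: Sm_inv)
qed

end
end

section \<open>Stacked vectors and block matrices\<close>

definition vstack :: "rvec list => rvec" where "vstack vs = vec_of_list (concat (map list_of_vec vs))"

lemma vec_of_list_append: "vec_of_list (xs @ ys) = vec_of_list xs @\<^sub>v vec_of_list ys"
 by (intro eq_vecI) (auto simp: append_vec_def Let_def nth_append vec_of_list_index)

lemma vstack_simps [simp]: "vstack [] = 0\<^sub>v 0" "vstack (v # vs) = v @\<^sub>v vstack vs"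
 by (auto simp: vstack_def vec_of_list_append vec_list)

lemma dim_vstack [simp]: "dim_vec (vstack vs) = (\<Sum>v\<leftarrow>vs. dim_vec v)"
 by (induction vs) auto

lemma stack_vstack: "stack g v = vstack (map v [0..<Suc (nDM g)])"
 by (simp add: stack_def vstack_def o_def)

lemma upt_Cons: "[0..<Suc k] = 0 # [1..<Suc k]" by (simp add: upt_rec)

lemma stack_Cons: "stack g v = v 0 @\<^sub>v vstack (map v [1..<Suc (nDM g)])"
 unfolding stack_vstack upt_Cons by simp

lemma append_index: "k < dim_vec v + dim_vec w ==> (v @\<^sub>v w) $ k = (if k < dim_vec v then v $ k else w $ (k - dim_vec v))"
 by (simp add: append_vec_def Let_def)

lemma vstack_nth: "i < length vs ==> k < dim_vec (vs ! i) ==>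
  vstack vs $ ((\<Sum>v\<leftarrow>take i vs. dim_vec v) + k) = vs ! i $ k"
proof (induction vs arbitrary: i)
 case (Cons v vs)
 show ?case
 proof (cases i)
  case 0
  then show ?thesis using Cons.prems by (auto simp: append_index)
 next
  case (Suc j)
  have le: "(\<Sum>v\<leftarrow>take j vs. dim_vec v) + dim_vec (vs ! j) \<le> (\<Sum>v\<leftarrow>vs. dim_vec v)"
  proof -
   have "j < length vs" using Cons.prems Suc by simp
   then have "vs = take j vs @ vs ! j # drop (Suc j) vs" by (rule id_take_nth_drop)
   then have "(\<Sum>v\<leftarrow>vs. dim_vec v) = (\<Sum>v\<leftarrow>take j vs @ vs ! j # drop (Suc j) vs. dim_vec v)" by simp
   then show ?thesis unfolding map_append sum_list_append by simp
  qed
  then show ?thesis using Suc Cons by (simp add: append_index)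
 qed
qed auto

lemma append_add: "dim_vec v = dim_vec v' ==> dim_vec w = dim_vec w' ==> (v @\<^sub>v w) + (v' @\<^sub>v w') = (v + v') @\<^sub>v (w + w' :: rvec)"
 by (intro eq_vecI) (auto simp: append_index)

lemma vstack_add: "(!!i. i \<in> set js ==> dim_vec (v i) = dim_vec (w i)) ==>
  vstack (map v js) + vstack (map w js) = vstack (map (\<lambda>i. v i + w i) js)"
proof (induction js)
 case (Cons i js)
 have e: "dim_vec (vstack (map v js)) = dim_vec (vstack (map w js))"
  unfolding dim_vstack map_map o_def using Cons.prems by (intro arg_cong[of _ _ sum_list] map_cong) auto
 show ?case using Cons by (simp add: append_add[OF _ e] del: dim_vstack)
qed auto

lemma sum_lessThan_add: "(\<Sum>j<a+b. f j) = (\<Sum>j<a. f j) + (\<Sum>j<b. f (a + j) :: 'a :: comm_monoid_add)" for a b :: nat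
 by (induction b) (simp_all add: add.assoc)

lemma vec_cong: "(!!k. k < n ==> f k = h k) ==> vec n f = vec n h" by (intro eq_vecI) auto

lemma hcat_mv:
 assumes "dim_row A = r" "dim_vec v = dim_col A" and that: "dim_vec w = dim_col (hcat r As)"
 shows "hcat r (A # As) *\<^sub>v (v @\<^sub>v w) = A *\<^sub>v v + hcat r As *\<^sub>v (w :: rvec)"
proof (rule eq_vecI)
 fix i assume "i < dim_vec (A *\<^sub>v v + hcat r As *\<^sub>v w)"
 then have i: "i < r" by (simp add: hcat_def)
 let ?cs = "concat (map cols As)" and ?d = "dim_col A"
 have l: "dim_vec w = length ?cs" using that by (simp add: hcat_def)
 have "(hcat r (A # As) *\<^sub>v (v @\<^sub>v w)) $ i = (\<Sum>j<?d + length ?cs. (cols A @ ?cs) ! j $ i * (v @\<^sub>v w) $ j)"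
  using i assms l by (simp add: hcat_def scalar_prod_def lessThan_atLeast0 mat_of_cols_index)
 also have "\<dots> = (\<Sum>j<?d. (cols A @ ?cs) ! j $ i * (v @\<^sub>v w) $ j) + (\<Sum>j<length ?cs. (cols A @ ?cs) ! (?d + j) $ i * (v @\<^sub>v w) $ (?d + j))"
  by (rule sum_lessThan_add)
 also have "\<dots> = (\<Sum>j<?d. A $$ (i,j) * v $ j) + (\<Sum>j<length ?cs. ?cs ! j $ i * w $ j)"
  using i assms l by (intro arg_cong2[of _ _ _ _ "(+)"] sum.cong) (auto simp: nth_append append_index)
 also have "\<dots> = (A *\<^sub>v v + hcat r As *\<^sub>v w) $ i"
  using i assms l by (simp add: hcat_def scalar_prod_def lessThan_atLeast0 mat_of_cols_index)
 finally show "(hcat r (A # As) *\<^sub>v (v @\<^sub>v w)) $ i = (A *\<^sub>v v + hcat r As *\<^sub>v w) $ i" .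
qed (use assms in \<open>simp add: hcat_def\<close>)

lemma dim_hcat [simp]: "dim_row (hcat r As) = r" "dim_col (hcat r As) = (\<Sum>A\<leftarrow>As. dim_col A)"
 by (simp_all add: hcat_def length_concat o_def)

lemma dim_vcat [simp]: "dim_col (vcat c As) = c" "dim_row (vcat c As) = (\<Sum>A\<leftarrow>As. dim_row A)"
 by (simp_all add: vcat_def length_concat o_def)

lemma hcat_vstack:
 assumes "!!j. j \<in> set js ==> dim_row (f j) = r \<and> dim_vec (v j) = dim_col (f j)"
 shows "hcat r (map f js) *\<^sub>v vstack (map v js) = vec r (\<lambda>k. \<Sum>j\<leftarrow>js. (f j *\<^sub>v v j) $ k)"
 using assms
proof (induction js)
 case Nil show ?case by (intro eq_vecI) (auto simp: hcat_def scalar_prod_def)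
next
 case (Cons j js)
 have d: "(\<Sum>x\<leftarrow>js. dim_vec (v x)) = (\<Sum>x\<leftarrow>js. dim_col (f x))" using Cons.prems by (intro arg_cong[of _ _ sum_list] map_cong) auto
 show ?case using Cons by (simp add: hcat_mv o_def d) (intro eq_vecI, auto)
qed

lemma vcat_mv:
 assumes "dim_col A = c" "dim_vec x = c"
 shows "vcat c (A # As) *\<^sub>v x = (A *\<^sub>v x) @\<^sub>v (vcat c As *\<^sub>v (x :: rvec))"
proof (rule eq_vecI)
 fix i assume "i < dim_vec ((A *\<^sub>v x) @\<^sub>v (vcat c As *\<^sub>v x))"
 then have i: "i < dim_row A + length (concat (map rows As))" by (simp add: vcat_def)
 have j: "x $ j = x $ j" for j ..
 show "(vcat c (A # As) *\<^sub>v x) $ i = ((A *\<^sub>v x) @\<^sub>v (vcat c As *\<^sub>v x)) $ i"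
 proof (cases "i < dim_row A")
  case True
  then show ?thesis using i assms
   by (auto simp: vcat_def append_index scalar_prod_def mat_of_rows_index nth_append intro!: sum.cong)
 next
  case False
  then show ?thesis using i assms
   by (auto simp: vcat_def append_index scalar_prod_def mat_of_rows_index nth_append intro!: sum.cong)
 qed
qed (use assms in \<open>simp add: vcat_def\<close>)

lemma vcat_vstack:
 assumes "!!j. j \<in> set js ==> dim_col (f j) = c" "dim_vec x = c"
 shows "vcat c (map f js) *\<^sub>v x = vstack (map (\<lambda>j. f j *\<^sub>v x) js)"
 using assms
proof (induction js)
 case Nil show ?case by (intro eq_vecI) (auto simp: vcat_def)
qed (simp add: vcat_mv)

lemma diag_block_vstack:
 assumes "!!j. j \<in> set js ==> dim_row (f j) = dim_col (f j) \<and> dim_vec (v j) = dim_col (f j)"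
 shows "diag_block_mat (map f js) *\<^sub>v vstack (map v js) = vstack (map (\<lambda>j. f j *\<^sub>v (v j :: rvec)) js)"
  "dim_row (diag_block_mat (map f js)) = (\<Sum>j\<leftarrow>js. dim_col (f j))" "dim_col (diag_block_mat (map f js)) = (\<Sum>j\<leftarrow>js. dim_col (f j))"
 using assms
proof (induction js)
 case Nil { case 1 show ?case by (intro eq_vecI) auto next case 2 show ?case by simp next case 3 show ?case by simp }
next
 case (Cons j js)
 have IH: "diag_block_mat (map f js) *\<^sub>v vstack (map v js) = vstack (map (\<lambda>j. f j *\<^sub>v v j) js)"
  "dim_row (diag_block_mat (map f js)) = (\<Sum>j\<leftarrow>js. dim_col (f j))" "dim_col (diag_block_mat (map f js)) = (\<Sum>j\<leftarrow>js. dim_col (f j))"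
  if "!!j. j \<in> set js ==> dim_row (f j) = dim_col (f j) \<and> dim_vec (v j) = dim_col (f j)"
  using Cons.IH that by blast+
 {
  case 1
  have d: "(\<Sum>x\<leftarrow>js. dim_vec (v x)) = (\<Sum>x\<leftarrow>js. dim_col (f x))" using 1 by (intro arg_cong[of _ _ sum_list] map_cong) auto
  have "diag_block_mat (map f (j # js)) *\<^sub>v vstack (map v (j # js)) =
   (f j *\<^sub>v v j + 0\<^sub>m (dim_row (f j)) (dim_col (diag_block_mat (map f js))) *\<^sub>v vstack (map v js)) @\<^sub>v
   (0\<^sub>m (dim_row (diag_block_mat (map f js))) (dim_col (f j)) *\<^sub>v v j + diag_block_mat (map f js) *\<^sub>v vstack (map v js))"
   unfolding list.map vstack_simps diag_block_mat.simps Let_def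
   using 1 IH(2,3) d by (subst four_block_mat_mult_vec[of _ "dim_row (f j)" "dim_col (f j)" _ "dim_col (diag_block_mat (map f js))" _ "dim_row (diag_block_mat (map f js))"])
    (auto intro!: carrier_vecI carrier_matI simp: o_def)
  also have "f j *\<^sub>v v j + 0\<^sub>m (dim_row (f j)) (dim_col (diag_block_mat (map f js))) *\<^sub>v vstack (map v js) = f j *\<^sub>v v j"
   using 1 IH(3) d by (intro eq_vecI) (auto simp: scalar_prod_def o_def)
  also have "0\<^sub>m (dim_row (diag_block_mat (map f js))) (dim_col (f j)) *\<^sub>v v j + diag_block_mat (map f js) *\<^sub>v vstack (map v js)
   = diag_block_mat (map f js) *\<^sub>v vstack (map v js)"
   using 1 by (intro eq_vecI) (auto simp: scalar_prod_def)
  also have "\<dots> = vstack (map (\<lambda>j. f j *\<^sub>v v j) js)" using 1 IH(1) by auto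
  finally show ?case by simp
 next
  case 2 then show ?case using IH(2) by (auto simp: Let_def)
 next
  case 3 then show ?case using IH(3) by (auto simp: Let_def)
 }
qed

section \<open>Aggregate matrices applied to stacked vectors\<close>

lemma sum_list_upt: "(\<Sum>j\<leftarrow>[1..<Suc N]. f j) = (\<Sum>j\<in>{1..N}. (f j :: 'a :: comm_monoid_add))"
 by (simp only: interv_sum_list_conv_sum_set_nat set_upt atLeastLessThanSuc_atLeastAtMost)

lemma nX_eq: "nX g = nx g 0 + (\<Sum>j\<in>{1..nDM g}. nx g j)"
 by (simp add: nX_def atMost_atLeast0 sum.atLeast_Suc_atMost)

lemma sum_vec_dim [simp]: "dim_vec (sum_vec n f I) = n" by (simp add: sum_vec_def)
lemma sum_vec_index: "k < n ==> sum_vec n f I $ k = (\<Sum>i\<in>I. f i $ k)" by (simp add: sum_vec_def)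

lemma sum_vec_add: "(!!j. j \<in> I ==> dim_vec (v j) = n \<and> dim_vec (w j) = n) ==> sum_vec n v I + sum_vec n w I = sum_vec n (\<lambda>j. v j + w j) I"
 by (intro eq_vecI) (auto simp: sum_vec_index sum.distrib)

lemma sum_mat_mv: assumes "!!j. j \<in> I ==> dim_row (f j) = r \<and> dim_col (f j) = c" "dim_vec x = c"
 shows "sum_mat r c f I *\<^sub>v x = sum_vec r (\<lambda>j. f j *\<^sub>v x) I"
proof (rule eq_vecI)
 fix k assume "k < dim_vec (sum_vec r (\<lambda>j. f j *\<^sub>v x) I)"
 then have k: "k < r" by simp
 have "(sum_mat r c f I *\<^sub>v x) $ k = (\<Sum>l<c. \<Sum>j\<in>I. f j $$ (k,l) * x $ l)"
  using k assms(2) by (simp add: sum_mat_def scalar_prod_def lessThan_atLeast0 sum_distrib_right)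
 also have "\<dots> = (\<Sum>j\<in>I. \<Sum>l<c. f j $$ (k,l) * x $ l)" by (rule sum.swap)
 also have "\<dots> = (\<Sum>j\<in>I. (f j *\<^sub>v x) $ k)"
  using k assms by (intro sum.cong) (auto simp: scalar_prod_def lessThan_atLeast0)
 finally show "(sum_mat r c f I *\<^sub>v x) $ k = sum_vec r (\<lambda>j. f j *\<^sub>v x) I $ k" using k by (simp add: sum_vec_index)
qed (auto simp: sum_mat_def)

text \<open>The aggregate matrices are only ever applied to stacked vectors; the lemmas below turn each of them
 into a family of blockwise equations.\<close>
locale game =
 fixes g :: lq_game
 assumes game: "lq_game_data g" and stab: "!!i. i \<in> {1..nDM g} ==> stabilizable (mA g i) (mB g i)"
begin

abbreviation "N \<equiv> nDM g"
abbreviation "p \<equiv> ny g"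

lemma dm: "i \<in> {1..N} ==> dm g i" using game stab by unfold_locales auto

lemma gdims [simp]: "dim_row (mA g 0) = nx g 0" "dim_col (mA g 0) = nx g 0" "dim_row (mD g) = p" "dim_col (mD g) = nx g 0"
 using game by (auto simp: lq_game_data_def)
lemma gdims_i: assumes "i \<in> {1..N}" shows
 "dim_row (mA g i) = nx g i" "dim_col (mA g i) = nx g i" "dim_row (mB g i) = nx g i" "dim_col (mB g i) = nu g i"
 "dim_row (mC g i) = nx g i" "dim_col (mC g i) = p" "dim_row (mB1 g i) = nx g 0" "dim_col (mB1 g i) = nu g i"
 "dim_row (mB2 g i) = nx g 0" "dim_col (mB2 g i) = nx g i" "dim_row (mE1 g i) = p" "dim_col (mE1 g i) = nu g i"
 "dim_row (mE2 g i) = p" "dim_col (mE2 g i) = nx g i" "dim_row (cF g i) = nu g i" "dim_col (cF g i) = nx g i"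
 "dim_row (cAF g i) = nx g i" "dim_col (cAF g i) = nx g i" "dim_row (cG g i k) = nu g i" "dim_col (cG g i k) = p"
 "dim_vec (cH g ew i) = nu g i"
 using assms game dm.gm_dims[OF dm[OF assms]] dm.cG_geo[OF dm[OF assms]] by (auto simp: lq_game_data_def geo_def cH_def)

lemma stack_dim: "(!!i. i \<le> N ==> dim_vec (v i) = nx g i) ==> dim_vec (stack g v) = nX g"
 unfolding stack_Cons nX_eq using sum_list_upt[of "\<lambda>j. dim_vec (v j)" N] by (simp add: o_def)

lemma stack_add: "(!!i. i \<le> N ==> dim_vec (v i) = dim_vec (w i)) ==> stack g v + stack g w = stack g (\<lambda>i. v i + w i)"
 unfolding stack_vstack by (intro vstack_add) auto

lemma stack_cong: "(!!i. i \<le> N ==> v i = w i) ==> stack g v = stack g w"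
 unfolding stack_vstack by (intro arg_cong[of _ _ vstack] map_cong) auto

lemma agg_D_stack: assumes v: "!!i. i \<le> N ==> dim_vec (v i) = nx g i"
 shows "agg_D g *\<^sub>v stack g v = mD g *\<^sub>v v 0 + sum_vec p (\<lambda>j. mE1 g j *\<^sub>v (cF g j *\<^sub>v v j) + mE2 g j *\<^sub>v v j) {1..N}"
proof -
 let ?f = "\<lambda>j. mE1 g j * cF g j + mE2 g j"
 have f: "dim_row (?f j) = p \<and> dim_vec (v j) = dim_col (?f j)" if "j \<in> set [1..<Suc N]" for j
 proof -
  from that have "j \<in> {1..N}" by auto
  then show ?thesis using v[of j] by (simp add: gdims_i)
 qed
 have d: "(\<Sum>x\<leftarrow>[1..<Suc N]. dim_vec (v x)) = (\<Sum>x\<leftarrow>[1..<Suc N]. dim_col (?f x))"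
  using f by (intro arg_cong[of _ _ sum_list] map_cong) auto
 have "agg_D g *\<^sub>v stack g v = mD g *\<^sub>v v 0 + hcat p (map ?f [1..<Suc N]) *\<^sub>v vstack (map v [1..<Suc N])"
  unfolding agg_D_def stack_Cons using v[of 0] d by (intro hcat_mv) (auto simp: o_def simp del: upt_Suc)
 also have "hcat p (map ?f [1..<Suc N]) *\<^sub>v vstack (map v [1..<Suc N]) = vec p (\<lambda>k. \<Sum>j\<leftarrow>[1..<Suc N]. (?f j *\<^sub>v v j) $ k)"
  using f by (rule hcat_vstack)
 also have "\<dots> = sum_vec p (\<lambda>j. mE1 g j *\<^sub>v (cF g j *\<^sub>v v j) + mE2 g j *\<^sub>v v j) {1..N}"
  unfolding sum_vec_def sum_list_upt using v by (intro vec_cong sum.cong refl) (auto simp: gdims_i mv_simps)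
 finally show ?thesis .
qed

lemma agg_A_stack: assumes v: "!!i. i \<le> N ==> dim_vec (v i) = nx g i"
 shows "agg_A g *\<^sub>v stack g v = stack g (\<lambda>i. if i = 0
  then mA g 0 *\<^sub>v v 0 + sum_vec (nx g 0) (\<lambda>j. mB1 g j *\<^sub>v (cF g j *\<^sub>v v j) + mB2 g j *\<^sub>v v j) {1..N}
  else cAF g i *\<^sub>v v i)"
proof -
 let ?f = "\<lambda>j. mB1 g j * cF g j + mB2 g j" and ?js = "[1..<Suc N]"
 have f: "dim_row (?f j) = nx g 0 \<and> dim_vec (v j) = dim_col (?f j)" if "j \<in> set ?js" for j
 proof -
  from that have "j \<in> {1..N}" by auto
  then show ?thesis using v[of j] by (simp add: gdims_i)
 qed
 have c: "dim_row (cAF g j) = dim_col (cAF g j) \<and> dim_vec (v j) = dim_col (cAF g j)" if "j \<in> set ?js" for j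
 proof -
  from that have "j \<in> {1..N}" by auto
  then show ?thesis using v[of j] by (simp add: gdims_i)
 qed
 have d: "(\<Sum>x\<leftarrow>?js. dim_col (?f x)) = nX g - nx g 0"
  unfolding nX_eq sum_list_upt by (simp add: gdims_i)
 have d1: "(\<Sum>x\<leftarrow>?js. dim_col (cAF g x)) = nX g - nx g 0"
  unfolding nX_eq sum_list_upt by (simp add: gdims_i)
 have d2: "(\<Sum>x\<leftarrow>?js. dim_vec (v x)) = nX g - nx g 0"
  unfolding nX_eq sum_list_upt using v by simp
 note dd = diag_block_vstack(2,3)[of ?js "cAF g" v, OF c, unfolded d1]
 have "agg_A g *\<^sub>v stack g v = (mA g 0 *\<^sub>v v 0 + hcat (nx g 0) (map ?f ?js) *\<^sub>v vstack (map v ?js)) @\<^sub>v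
   (0\<^sub>m (nX g - nx g 0) (nx g 0) *\<^sub>v v 0 + diag_block_mat (map (cAF g) ?js) *\<^sub>v vstack (map v ?js))"
  unfolding agg_A_def stack_Cons using v[of 0] d d2 dd
  by (intro four_block_mat_mult_vec[of _ "nx g 0" "nx g 0" _ "nX g - nx g 0" _ "nX g - nx g 0"])
   (auto intro!: carrier_matI carrier_vecI simp: o_def simp del: upt_Suc)
 also have "hcat (nx g 0) (map ?f ?js) *\<^sub>v vstack (map v ?js) = vec (nx g 0) (\<lambda>k. \<Sum>j\<leftarrow>?js. (?f j *\<^sub>v v j) $ k)"
  using f by (rule hcat_vstack)
 also have "\<dots> = sum_vec (nx g 0) (\<lambda>j. mB1 g j *\<^sub>v (cF g j *\<^sub>v v j) + mB2 g j *\<^sub>v v j) {1..N}"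
  unfolding sum_vec_def sum_list_upt using v by (intro vec_cong sum.cong refl) (auto simp: gdims_i mv_simps)
 also have "diag_block_mat (map (cAF g) ?js) *\<^sub>v vstack (map v ?js) = vstack (map (\<lambda>j. cAF g j *\<^sub>v v j) ?js)"
  using c by (rule diag_block_vstack)
 also have "0\<^sub>m (nX g - nx g 0) (nx g 0) *\<^sub>v v 0 + \<dots> = \<dots>"
 proof -
  have "(\<Sum>x\<leftarrow>?js. dim_row (cAF g x)) = nX g - nx g 0" unfolding d1[symmetric] using c by (intro arg_cong[of _ _ sum_list] map_cong) auto
  then show ?thesis using v[of 0] by (intro eq_vecI) (auto simp: o_def scalar_prod_def simp del: upt_Suc)
 qed
 also have "map (\<lambda>j. cAF g j *\<^sub>v v j) ?js = map (\<lambda>i. if i = 0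
  then mA g 0 *\<^sub>v v 0 + sum_vec (nx g 0) (\<lambda>j. mB1 g j *\<^sub>v (cF g j *\<^sub>v v j) + mB2 g j *\<^sub>v v j) {1..N}
  else cAF g i *\<^sub>v v i) ?js" by (intro map_cong) auto
 finally show ?thesis unfolding stack_Cons by simp
qed

lemma agg_C_mv: assumes y: "dim_vec y = p"
 shows "agg_C g *\<^sub>v y = stack g (\<lambda>i. if i = 0 then 0\<^sub>v (nx g 0) else mC g i *\<^sub>v y)"
proof -
 have "agg_C g *\<^sub>v y = (0\<^sub>m (nx g 0) p *\<^sub>v y) @\<^sub>v (vcat p (map (mC g) [1..<Suc N]) *\<^sub>v y)"
  unfolding agg_C_def using y by (intro vcat_mv) auto
 also have "0\<^sub>m (nx g 0) p *\<^sub>v y = 0\<^sub>v (nx g 0)" using y by (intro eq_vecI) (auto simp: scalar_prod_def)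
 also have "vcat p (map (mC g) [1..<Suc N]) *\<^sub>v y = vstack (map (\<lambda>j. mC g j *\<^sub>v y) [1..<Suc N])"
  using y by (intro vcat_vstack) (auto simp: gdims_i)
 also have "map (\<lambda>j. mC g j *\<^sub>v y) [1..<Suc N] = map (\<lambda>i. if i = 0 then 0\<^sub>v (nx g 0) else mC g i *\<^sub>v y) [1..<Suc N]"
  by (intro map_cong) auto
 finally show ?thesis unfolding stack_Cons by simp
qed

lemma agg_GX_mv: assumes y: "dim_vec y = p"
 shows "agg_GX g k *\<^sub>v y = stack g (\<lambda>i. if i = 0 then sum_vec (nx g 0) (\<lambda>j. mB1 g j *\<^sub>v (cG g j k *\<^sub>v y)) {1..N} else mB g i *\<^sub>v (cG g i k *\<^sub>v y))"
proof -
 have "agg_GX g k *\<^sub>v y = (sum_mat (nx g 0) p (\<lambda>j. mB1 g j * cG g j k) {1..N} *\<^sub>v y) @\<^sub>v (vcat p (map (\<lambda>j. mB g j * cG g j k) [1..<Suc N]) *\<^sub>v y)"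
  unfolding agg_GX_def using y by (intro vcat_mv) (auto simp: sum_mat_def)
 also have "sum_mat (nx g 0) p (\<lambda>j. mB1 g j * cG g j k) {1..N} *\<^sub>v y = sum_vec (nx g 0) (\<lambda>j. (mB1 g j * cG g j k) *\<^sub>v y) {1..N}"
  using y by (intro sum_mat_mv) (auto simp: gdims_i)
 also have "\<dots> = sum_vec (nx g 0) (\<lambda>j. mB1 g j *\<^sub>v (cG g j k *\<^sub>v y)) {1..N}"
  unfolding sum_vec_def using y by (intro vec_cong sum.cong refl) (auto simp: gdims_i mv_simps)
 also have "vcat p (map (\<lambda>j. mB g j * cG g j k) [1..<Suc N]) *\<^sub>v y = vstack (map (\<lambda>j. (mB g j * cG g j k) *\<^sub>v y) [1..<Suc N])"
  using y by (intro vcat_vstack) (auto simp: gdims_i)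
 also have "map (\<lambda>j. (mB g j * cG g j k) *\<^sub>v y) [1..<Suc N] = map (\<lambda>i. if i = 0 then sum_vec (nx g 0) (\<lambda>j. mB1 g j *\<^sub>v (cG g j k *\<^sub>v y)) {1..N} else mB g i *\<^sub>v (cG g i k *\<^sub>v y)) [1..<Suc N]"
  using y by (intro map_cong) (auto simp: gdims_i mv_simps)
 finally show ?thesis unfolding stack_Cons by simp
qed

lemma agg_Gp_mv: assumes y: "dim_vec y = p"
 shows "agg_Gp g k *\<^sub>v y = sum_vec p (\<lambda>j. mE1 g j *\<^sub>v (cG g j k *\<^sub>v y)) {1..N}"
proof -
 have "agg_Gp g k *\<^sub>v y = sum_vec p (\<lambda>j. (mE1 g j * cG g j k) *\<^sub>v y) {1..N}"
  unfolding agg_Gp_def using y by (intro sum_mat_mv) (auto simp: gdims_i)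
 also have "\<dots> = sum_vec p (\<lambda>j. mE1 g j *\<^sub>v (cG g j k *\<^sub>v y)) {1..N}"
  unfolding sum_vec_def using y by (intro vec_cong sum.cong refl) (auto simp: gdims_i mv_simps)
 finally show ?thesis .
qed

lemma agg_dims [simp]: "dim_row (agg_D g) = p" "dim_col (agg_D g) = nX g" "dim_row (agg_A g) = nX g" "dim_col (agg_A g) = nX g"
 "dim_row (agg_C g) = nX g" "dim_col (agg_C g) = p" "dim_row (agg_GX g k) = nX g" "dim_col (agg_GX g k) = p"
 "dim_row (agg_Gp g k) = p" "dim_col (agg_Gp g k) = p"
proof -
 have s: "(\<Sum>x\<leftarrow>[Suc 0..<Suc N]. f x) = nX g - nx g 0" if "!!j. j \<in> {1..N} ==> f j = nx g j" for f :: "nat => nat"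
  unfolding nX_eq sum_list_upt[unfolded One_nat_def] using that by simp
 have le: "nx g 0 \<le> nX g" by (simp add: nX_eq)
 show "dim_row (agg_D g) = p" by (simp add: agg_D_def)
 have "(\<Sum>x\<leftarrow>[Suc 0..<Suc N]. dim_col (mE2 g x)) = nX g - nx g 0" by (rule s) (simp add: gdims_i)
 then show "dim_col (agg_D g) = nX g" unfolding agg_D_def using le by (simp add: o_def del: upt_Suc)
 have d: "dim_row (diag_block_mat (map (cAF g) [1..<Suc N])) = nX g - nx g 0 \<and> dim_col (diag_block_mat (map (cAF g) [1..<Suc N])) = nX g - nx g 0"
 proof -
  have "(\<Sum>x\<leftarrow>[Suc 0..<Suc N]. dim_col (cAF g x)) = nX g - nx g 0" by (rule s) (simp add: gdims_i)
  moreover have "dim_row (cAF g j) = dim_col (cAF g j) \<and> dim_vec (0\<^sub>v (nx g j) :: rvec) = dim_col (cAF g j)" if "j \<in> set [1..<Suc N]" for j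
  proof -
   from that have "j \<in> {1..N}" by auto
   then show ?thesis by (simp add: gdims_i)
  qed
  note diag_block_vstack(2,3)[of "[1..<Suc N]" "cAF g" "\<lambda>j. 0\<^sub>v (nx g j)", OF this]
  ultimately show ?thesis by simp
 qed
 show "dim_row (agg_A g) = nX g" "dim_col (agg_A g) = nX g" unfolding agg_A_def using le d by auto
 have "(\<Sum>x\<leftarrow>[Suc 0..<Suc N]. dim_row (mC g x)) = nX g - nx g 0" by (rule s) (simp add: gdims_i)
 then show "dim_row (agg_C g) = nX g" "dim_col (agg_C g) = p" unfolding agg_C_def using le by (auto simp: o_def simp del: upt_Suc)
 have "(\<Sum>x\<leftarrow>[Suc 0..<Suc N]. dim_row (mB g x)) = nX g - nx g 0" by (rule s) (simp add: gdims_i)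
 then show "dim_row (agg_GX g k) = nX g" "dim_col (agg_GX g k) = p" unfolding agg_GX_def using le by (auto simp: o_def sum_mat_def simp del: upt_Suc)
 show "dim_row (agg_Gp g k) = p" "dim_col (agg_Gp g k) = p" by (auto simp: agg_Gp_def sum_mat_def)
qed

end

lemma vstack_index:
 assumes "l < (\<Sum>i\<leftarrow>js. d i)"
 shows "\<exists>i\<in>set js. \<exists>k<d i. \<forall>v :: nat => rvec. (\<forall>i\<in>set js. dim_vec (v i) = d i) --> vstack (map v js) $ l = v i $ k"
 using assms
proof (induction js arbitrary: l)
 case (Cons j js)
 have e: "dim_vec (vstack (map v js)) = (\<Sum>i\<leftarrow>js. d i)" if "\<forall>i\<in>set js. dim_vec (v i) = d i" for v
  unfolding dim_vstack map_map o_def using that by (intro arg_cong[of _ _ sum_list] map_cong) auto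
 show ?case
 proof (cases "l < d j")
  case True
  then have "vstack (map v (j # js)) $ l = v j $ l" if "\<forall>i\<in>set (j # js). dim_vec (v i) = d i" for v
   using that e[of v] by (simp add: append_index del: dim_vstack)
  then show ?thesis using True by auto
 next
  case False
  obtain i k where ik: "i \<in> set js" "k < d i"
   "!!v. (\<forall>i\<in>set js. dim_vec (v i) = d i) ==> vstack (map v js) $ (l - d j) = v i $ k"
  proof -
   have "l - d j < (\<Sum>i\<leftarrow>js. d i)" using Cons.prems False by simp
   from Cons.IH[OF this] show ?thesis using that by blast
  qed
  have "vstack (map v (j # js)) $ l = v i $ k" if "\<forall>i\<in>set (j # js). dim_vec (v i) = d i" for v
   using that e[of v] ik(3)[of v] False Cons.prems by (simp add: append_index del: dim_vstack)
  then show ?thesis using ik by auto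
 qed
qed simp

context game
begin

text \<open>Each entry of a stack is an entry of a block whose position does not depend on the vectors; this
 reduces statements on stacks to statements on blocks.\<close>
lemma stack_index:
 assumes "l < nX g"
 obtains i k where "i \<le> N" "k < nx g i" "!!v. (!!i. i \<le> N ==> dim_vec (v i) = nx g i) ==> stack g v $ l = v i $ k"
proof -
 have "(\<Sum>i\<leftarrow>[0..<Suc N]. nx g i) = nX g"
  unfolding upt_Cons using sum_list_upt[of "nx g" N] by (simp add: nX_eq)
 then have "l < (\<Sum>i\<leftarrow>[0..<Suc N]. nx g i)" using assms by simp
 then obtain i k where ik: "i \<in> set [0..<Suc N]" "k < nx g i"
  "!!v. (\<forall>i\<in>set [0..<Suc N]. dim_vec (v i) = nx g i) ==> vstack (map v [0..<Suc N]) $ l = v i $ k"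
  using vstack_index[of l "nx g" "[0..<Suc N]"] by blast
 show ?thesis
 proof (rule that)
  show "i \<le> N" using ik(1) by auto
  show "k < nx g i" by (rule ik)
  show "stack g v $ l = v i $ k" if "!!i. i \<le> N ==> dim_vec (v i) = nx g i" for v
   unfolding stack_vstack by (rule ik(3)) (use that in auto)
 qed
qed

definition block :: "nat => rvec => rvec" where
 "block i X = vec (nx g i) (\<lambda>k. X $ ((\<Sum>j<i. nx g j) + k))"

lemma block_stack:
 assumes v: "!!i. i \<le> N ==> dim_vec (v i) = nx g i" and i: "i \<le> N" shows "block i (stack g v) = v i"
proof (rule eq_vecI)
 fix k assume "k < dim_vec (v i)"
 then have k: "k < nx g i" using v i by simp
 have t: "(\<Sum>v\<leftarrow>take i (map v [0..<Suc N]). dim_vec v) = (\<Sum>j<i. nx g j)"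
 proof -
  have "(\<Sum>v\<leftarrow>take i (map v [0..<Suc N]). dim_vec v) = (\<Sum>j\<leftarrow>[0..<i]. dim_vec (v j))"
   using i by (simp add: take_map take_upt o_def del: upt_Suc)
  also have "\<dots> = (\<Sum>j<i. dim_vec (v j))" by (simp add: interv_sum_list_conv_sum_set_nat lessThan_atLeast0)
  finally show ?thesis using v i by simp
 qed
 have nth: "map v [0..<Suc N] ! i = v i" using i by (simp add: nth_map_upt del: upt_Suc)
 have "vstack (map v [0..<Suc N]) $ ((\<Sum>v\<leftarrow>take i (map v [0..<Suc N]). dim_vec v) + k) = map v [0..<Suc N] ! i $ k"
  using i k v nth by (intro vstack_nth) (auto simp del: upt_Suc)
 then show "block i (stack g v) $ k = v i $ k" using k unfolding stack_vstack t nth by (simp add: block_def)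
qed (use v i in \<open>simp add: block_def\<close>)

lemma suminf_vec_sum_vec:
 assumes "!!j. j \<in> I ==> summable_vec r (f j)"
 shows "suminf_vec r (\<lambda>k. sum_vec r (\<lambda>j. f j k) I) = sum_vec r (\<lambda>j. suminf_vec r (f j)) I"
  "summable_vec r (\<lambda>k. sum_vec r (\<lambda>j. f j k) I)"
 using assms by (auto simp: summable_vec_def suminf_vec_def sum_vec_def intro!: summable_sum suminf_sum eq_vecI)

lemma suminf_vec_stack:
 assumes d: "!!k i. i \<le> N ==> dim_vec (f k i) = nx g i" and s: "!!i. i \<le> N ==> summable_vec (nx g i) (\<lambda>k. f k i)"
 shows "suminf_vec (nX g) (\<lambda>k. stack g (f k)) = stack g (\<lambda>i. suminf_vec (nx g i) (\<lambda>k. f k i))"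
  "summable_vec (nX g) (\<lambda>k. stack g (f k))"
proof -
 have "suminf_vec (nX g) (\<lambda>k. stack g (f k)) $ l = stack g (\<lambda>i. suminf_vec (nx g i) (\<lambda>k. f k i)) $ l \<and> summable (\<lambda>k. stack g (f k) $ l)"
  if l: "l < nX g" for l
 proof -
  obtain i k where ik: "i \<le> N" "k < nx g i" "!!v. (!!i. i \<le> N ==> dim_vec (v i) = nx g i) ==> stack g v $ l = v i $ k"
   using stack_index[OF l] by blast
  have "stack g (f n) $ l = f n i $ k" for n using d by (intro ik(3)) auto
  moreover have "stack g (\<lambda>i. suminf_vec (nx g i) (\<lambda>k. f k i)) $ l = suminf_vec (nx g i) (\<lambda>k. f k i) $ k"
   by (intro ik(3)) auto
  ultimately show ?thesis using l ik s[OF ik(1)] by (simp add: suminf_vec_def summable_vec_def)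
 qed
 then show "suminf_vec (nX g) (\<lambda>k. stack g (f k)) = stack g (\<lambda>i. suminf_vec (nx g i) (\<lambda>k. f k i))"
  "summable_vec (nX g) (\<lambda>k. stack g (f k))"
  by (auto intro!: eq_vecI simp: stack_dim summable_vec_def)
qed

lemma geo_cG: "i \<in> {1..N} ==> geo (nu g i) p (cG g i)"
 using dm.cG_geo[OF dm] .

lemma summable_cG: assumes "i \<in> {1..N}" "bdd_vec p v" "A \<in> carrier_mat r (nu g i)"
 shows "summable_vec r (\<lambda>k. A *\<^sub>v (cG g i k *\<^sub>v v k))"
  "suminf_vec r (\<lambda>k. A *\<^sub>v (cG g i k *\<^sub>v v k)) = A *\<^sub>v suminf_vec (nu g i) (\<lambda>k. cG g i k *\<^sub>v v k)"
proof -
 have "cG g i k *\<^sub>v v k \<in> carrier_vec (nu g i)" for k using gdims_i[OF assms(1)] by (intro carrier_vecI) simp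
 from suminf_vec_mult[OF geo_summable[OF geo_cG[OF assms(1)] assms(2)] this assms(3)]
 show "summable_vec r (\<lambda>k. A *\<^sub>v (cG g i k *\<^sub>v v k))"
  "suminf_vec r (\<lambda>k. A *\<^sub>v (cG g i k *\<^sub>v v k)) = A *\<^sub>v suminf_vec (nu g i) (\<lambda>k. cG g i k *\<^sub>v v k)" by blast+
qed

text \<open>Series over the aggregate gains are the series over the individual gains, so both converge for
 bounded inputs.\<close>
lemma agg_sums: assumes v: "bdd_vec p v"
 shows "suminf_vec p (\<lambda>k. agg_Gp g k *\<^sub>v v k) = sum_vec p (\<lambda>j. mE1 g j *\<^sub>v suminf_vec (nu g j) (\<lambda>k. cG g j k *\<^sub>v v k)) {1..N}"
  "summable_vec p (\<lambda>k. agg_Gp g k *\<^sub>v v k)"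
  "suminf_vec (nX g) (\<lambda>k. agg_GX g k *\<^sub>v v k) = stack g (\<lambda>i. if i = 0
    then sum_vec (nx g 0) (\<lambda>j. mB1 g j *\<^sub>v suminf_vec (nu g j) (\<lambda>k. cG g j k *\<^sub>v v k)) {1..N}
    else mB g i *\<^sub>v suminf_vec (nu g i) (\<lambda>k. cG g i k *\<^sub>v v k))"
  "summable_vec (nX g) (\<lambda>k. agg_GX g k *\<^sub>v v k)"
proof -
 have vd: "dim_vec (v k) = p" for k using v by (auto simp: bdd_vec_def)
 have E1: "mE1 g j \<in> carrier_mat p (nu g j)" "mB1 g j \<in> carrier_mat (nx g 0) (nu g j)" "mB g j \<in> carrier_mat (nx g j) (nu g j)"
  if "j \<in> {1..N}" for j using gdims_i[OF that] by (auto intro: carrier_matI)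
 show "summable_vec p (\<lambda>k. agg_Gp g k *\<^sub>v v k)"
  unfolding agg_Gp_mv[OF vd] using summable_cG(1)[OF _ v E1(1)] by (intro suminf_vec_sum_vec(2))
 show "suminf_vec p (\<lambda>k. agg_Gp g k *\<^sub>v v k) = sum_vec p (\<lambda>j. mE1 g j *\<^sub>v suminf_vec (nu g j) (\<lambda>k. cG g j k *\<^sub>v v k)) {1..N}"
  unfolding agg_Gp_mv[OF vd] using summable_cG[OF _ v E1(1)]
  by (subst suminf_vec_sum_vec(1)) (auto simp: sum_vec_def)
 let ?f = "\<lambda>k i. if i = 0 then sum_vec (nx g 0) (\<lambda>j. mB1 g j *\<^sub>v (cG g j k *\<^sub>v v k)) {1..N} else mB g i *\<^sub>v (cG g i k *\<^sub>v v k)"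
 have s0: "summable_vec (nx g 0) (\<lambda>k. sum_vec (nx g 0) (\<lambda>j. mB1 g j *\<^sub>v (cG g j k *\<^sub>v v k)) {1..N})"
  using summable_cG(1)[OF _ v E1(2)] by (intro suminf_vec_sum_vec(2))
 have s: "summable_vec (nx g i) (\<lambda>k. ?f k i)" if "i \<le> N" for i
  using s0 summable_cG(1)[of i v "mB g i" "nx g i"] v E1(3)[of i] that by (cases "i = 0") auto
 have d: "dim_vec (?f k i) = nx g i" if "i \<le> N" for i k using that gdims_i[of i] by auto
 show "summable_vec (nX g) (\<lambda>k. agg_GX g k *\<^sub>v v k)"
  unfolding agg_GX_mv[OF vd] using d s by (intro suminf_vec_stack(2))
 show "suminf_vec (nX g) (\<lambda>k. agg_GX g k *\<^sub>v v k) = stack g (\<lambda>i. if i = 0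
    then sum_vec (nx g 0) (\<lambda>j. mB1 g j *\<^sub>v suminf_vec (nu g j) (\<lambda>k. cG g j k *\<^sub>v v k)) {1..N}
    else mB g i *\<^sub>v suminf_vec (nu g i) (\<lambda>k. cG g i k *\<^sub>v v k))"
  unfolding agg_GX_mv[OF vd]
 proof (subst suminf_vec_stack(1))
  show "dim_vec (?f k i) = nx g i" if "i \<le> N" for i k using d that .
  show "summable_vec (nx g i) (\<lambda>k. ?f k i)" if "i \<le> N" for i using s that .
 next
  show "stack g (\<lambda>i. suminf_vec (nx g i) (\<lambda>k. ?f k i)) = stack g (\<lambda>i. if i = 0
    then sum_vec (nx g 0) (\<lambda>j. mB1 g j *\<^sub>v suminf_vec (nu g j) (\<lambda>k. cG g j k *\<^sub>v v k)) {1..N}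
    else mB g i *\<^sub>v suminf_vec (nu g i) (\<lambda>k. cG g i k *\<^sub>v v k))"
 proof (rule stack_cong)
  fix i assume i: "i \<le> N"
  show "suminf_vec (nx g i) (\<lambda>k. ?f k i) = (if i = 0
    then sum_vec (nx g 0) (\<lambda>j. mB1 g j *\<^sub>v suminf_vec (nu g j) (\<lambda>k. cG g j k *\<^sub>v v k)) {1..N}
    else mB g i *\<^sub>v suminf_vec (nu g i) (\<lambda>k. cG g i k *\<^sub>v v k))"
  proof (cases "i = 0")
   case True
   have "suminf_vec (nx g 0) (\<lambda>k. sum_vec (nx g 0) (\<lambda>j. mB1 g j *\<^sub>v (cG g j k *\<^sub>v v k)) {1..N}) =
    sum_vec (nx g 0) (\<lambda>j. suminf_vec (nx g 0) (\<lambda>k. mB1 g j *\<^sub>v (cG g j k *\<^sub>v v k))) {1..N}"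
    using summable_cG(1)[OF _ v E1(2)] by (intro suminf_vec_sum_vec(1))
   also have "\<dots> = sum_vec (nx g 0) (\<lambda>j. mB1 g j *\<^sub>v suminf_vec (nu g j) (\<lambda>k. cG g j k *\<^sub>v v k)) {1..N}"
    unfolding sum_vec_def using summable_cG(2)[OF _ v E1(2)] by (intro vec_cong sum.cong) auto
   finally show ?thesis using True by simp
  next
   case False
   then show ?thesis using summable_cG(2)[of i v "mB g i" "nx g i"] v E1(3)[of i] i by auto
  qed
 qed
 qed
qed

end

locale hat = game +
 fixes ew :: "nat => rvec" and exi :: rvec and a :: "nat => rmat" and b :: "nat => rvec"
 assumes ew: "!!i. i \<le> nDM g ==> dim_vec (ew i) = nx g i" and exi: "dim_vec exi = ny g"
  and hat_unique: "!!Xh0. Xh0 \<in> carrier_vec (nX g) ==> \<exists>!yh. hat_solution g ew exi Xh0 yh"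
  and hat_carrier: "!!t. a t \<in> carrier_mat (ny g) (nX g)" "!!t. b t \<in> carrier_vec (ny g)"
  and hat_affine: "!!Xh0 yh t. Xh0 \<in> carrier_vec (nX g) ==> hat_solution g ew exi Xh0 yh
   ==> yh t = a t *\<^sub>v Xh0 + b t"
  and hat_bounded: "\<exists>c. \<forall>t. \<forall>k<ny g. \<bar>b t $ k\<bar> \<le> c \<and> (\<forall>l<nX g. \<bar>a t $$ (k, l)\<bar> \<le> c)"
begin

text \<open>Below, \<open>vv x\<close> is the environment anticipated from the state estimate \<open>x\<close>,
 \<open>pred\<close> its current value, and \<open>nextX\<close> the resulting estimate of the next state
 before correction.\<close>
definition "vv x k = a k *\<^sub>v x + b k"
definition "GG i x = lim_G g a i *\<^sub>v x + lim_H g ew b i"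
definition "pred x = vv x 0"
definition "nextX x = agg_A g *\<^sub>v x + lim_GX g a *\<^sub>v x + lim_HX g ew b + agg_C g *\<^sub>v pred x + stack g ew"

lemma ab_dims [simp]: "dim_row (a t) = p" "dim_col (a t) = nX g" "dim_vec (b t) = p"
 using hat_carrier[of t] by auto

lemma lim_dims [simp]: "dim_row (lim_Gp g a) = p" "dim_col (lim_Gp g a) = nX g" "dim_vec (lim_Hp g ew b) = p"
 "dim_row (lim_GX g a) = nX g" "dim_col (lim_GX g a) = nX g" 
 "dim_row (lim_G g a i) = nu g i" "dim_col (lim_G g a i) = nX g"
 by (auto simp: lim_Gp_def suminf_mat_def lim_Hp_def agg_Hp_def lim_GX_def lim_G_def)

lemma agg_HX_dim [simp]: "dim_vec (agg_HX g ew) = nX g" unfolding agg_HX_def by (rule stack_dim) (auto simp: gdims_i)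
lemma lim_dims2 [simp]: "dim_vec (lim_HX g ew b) = nX g" "dim_vec (stack g ew) = nX g"
 using stack_dim[of ew] ew by (auto simp: lim_HX_def)
lemma lim_H_dim: "i \<in> {1..N} ==> dim_vec (lim_H g ew b i) = nu g i"
 by (auto simp: lim_H_def gdims_i)
lemma GG_dim: "i \<in> {1..N} ==> dim_vec (GG i x) = nu g i"
 by (auto simp: GG_def lim_H_dim)
lemma vv_dim [simp]: "dim_vec (vv x k) = p" "dim_vec (pred x) = p" "dim_vec (nextX x) = nX g" by (auto simp: vv_def pred_def nextX_def)

lemma b_bdd: "bdd_vec p b" using hat_bounded hat_carrier unfolding bdd_vec_def by blast
lemma a_bdd: "l < nX g ==> bdd_vec p (\<lambda>k. col (a k) l)"
 using hat_bounded hat_carrier unfolding bdd_vec_def by (metis ab_dims(1) ab_dims(2) col_dim index_col)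

lemma vv_bdd: assumes x: "dim_vec x = nX g" shows "bdd_vec p (vv x)"
proof -
 obtain c where c: "!!t k. k < p ==> \<bar>b t $ k\<bar> \<le> c" "!!t k l. k < p ==> l < nX g ==> \<bar>a t $$ (k, l)\<bar> \<le> c"
  using hat_bounded by blast
 have "\<bar>vv x k $ l\<bar> \<le> (\<Sum>j<nX g. c * \<bar>x $ j\<bar>) + c" if l: "l < p" for k l
 proof -
  have "vv x k $ l = (\<Sum>j<nX g. a k $$ (l,j) * x $ j) + b k $ l"
   using l x by (simp add: vv_def scalar_prod_def lessThan_atLeast0)
  moreover have "\<bar>\<Sum>j<nX g. a k $$ (l,j) * x $ j\<bar> \<le> (\<Sum>j<nX g. c * \<bar>x $ j\<bar>)"
   using c(2)[OF l] by (intro order_trans[OF sum_abs] sum_mono) (auto simp: abs_mult intro!: mult_right_mono)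
  ultimately show ?thesis using c(1)[OF l, of k] by linarith
 qed
 then show ?thesis unfolding bdd_vec_def by (auto intro: carrier_vecI)
qed

lemma suminf_vv:
 assumes U: "!!k. U k \<in> carrier_mat r p" and s: "!!v. bdd_vec p v ==> summable_vec r (\<lambda>k. U k *\<^sub>v v k)"
  and x: "dim_vec x = nX g"
 shows "suminf_vec r (\<lambda>k. U k *\<^sub>v vv x k) = suminf_mat r (nX g) (\<lambda>k. U k * a k) *\<^sub>v x + suminf_vec r (\<lambda>k. U k *\<^sub>v b k)"
proof (rule eq_vecI)
 fix i assume "i < dim_vec (suminf_mat r (nX g) (\<lambda>k. U k * a k) *\<^sub>v x + suminf_vec r (\<lambda>k. U k *\<^sub>v b k))"
 then have i: "i < r" by simp
 have Ud: "dim_row (U k) = r" "dim_col (U k) = p" for k using U[of k] by auto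
 have e: "(U k *\<^sub>v vv x k) $ i = (\<Sum>l<nX g. (U k * a k) $$ (i,l) * x $ l) + (U k *\<^sub>v b k) $ i" for k
 proof -
  have "U k *\<^sub>v vv x k = (U k * a k) *\<^sub>v x + U k *\<^sub>v b k" using x Ud by (simp add: vv_def mv_simps)
  then show ?thesis using i Ud x by (simp add: scalar_prod_def lessThan_atLeast0 row_def)
 qed
 have sl: "summable (\<lambda>k. (U k * a k) $$ (i,l))" if l: "l < nX g" for l
 proof -
  have "(U k * a k) $$ (i,l) = (U k *\<^sub>v col (a k) l) $ i" for k using i l Ud by simp
  then show ?thesis using s[OF a_bdd[OF l]] i by (simp add: summable_vec_def)
 qed
 have "suminf_vec r (\<lambda>k. U k *\<^sub>v vv x k) $ i = (\<Sum>k. (\<Sum>l<nX g. (U k * a k) $$ (i,l) * x $ l) + (U k *\<^sub>v b k) $ i)"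
  using i by (simp add: suminf_vec_def e)
 also have "\<dots> = (\<Sum>k. \<Sum>l<nX g. (U k * a k) $$ (i,l) * x $ l) + (\<Sum>k. (U k *\<^sub>v b k) $ i)"
  using s[OF b_bdd] i sl by (intro suminf_add[symmetric] summable_sum summable_mult2) (auto simp: summable_vec_def)
 also have "(\<Sum>k. \<Sum>l<nX g. (U k * a k) $$ (i,l) * x $ l) = (\<Sum>l<nX g. \<Sum>k. (U k * a k) $$ (i,l) * x $ l)"
  using sl by (intro suminf_sum summable_mult2) auto
 also have "\<dots> = (\<Sum>l<nX g. (\<Sum>k. (U k * a k) $$ (i,l)) * x $ l)"
  using sl by (intro sum.cong refl suminf_mult2[symmetric]) auto
 finally show "suminf_vec r (\<lambda>k. U k *\<^sub>v vv x k) $ i = (suminf_mat r (nX g) (\<lambda>k. U k * a k) *\<^sub>v x + suminf_vec r (\<lambda>k. U k *\<^sub>v b k)) $ i"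
  using i x by (simp add: suminf_mat_def suminf_vec_def scalar_prod_def lessThan_atLeast0 row_def)
qed (simp add: suminf_mat_def)

lemma GG_gg: assumes i: "i \<in> {1..N}" and x: "dim_vec x = nX g"
 shows "GG i x = suminf_vec (nu g i) (\<lambda>k. cG g i k *\<^sub>v vv x k) + cH g ew i" "GG i x = dm.gg g i ew (vv x)"
proof -
 have "suminf_vec (nu g i) (\<lambda>k. cG g i k *\<^sub>v vv x k) = lim_G g a i *\<^sub>v x + suminf_vec (nu g i) (\<lambda>k. cG g i k *\<^sub>v b k)"
  unfolding lim_G_def using geo_cG[OF i] x by (intro suminf_vv geo_summable) (auto simp: geo_def)
 then show 1: "GG i x = suminf_vec (nu g i) (\<lambda>k. cG g i k *\<^sub>v vv x k) + cH g ew i"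
  unfolding GG_def lim_H_def using i x by (intro eq_vecI) (auto simp: gdims_i)
 show "GG i x = dm.gg g i ew (vv x)" unfolding 1 dm.gg_def[OF dm[OF i]] ..
qed

lemma sum_vec_cong: "(!!j. j \<in> I ==> f j = h j) ==> sum_vec r f I = sum_vec r h I"
 unfolding sum_vec_def by (intro vec_cong sum.cong) auto

lemma lim_Gp_eq: assumes x: "dim_vec x = nX g"
 shows "lim_Gp g a *\<^sub>v x + lim_Hp g ew b = suminf_vec p (\<lambda>k. agg_Gp g k *\<^sub>v vv x k) + agg_Hp g ew"
  "lim_Gp g a *\<^sub>v x + lim_Hp g ew b = sum_vec p (\<lambda>j. mE1 g j *\<^sub>v GG j x) {1..N}"
proof -
 have "suminf_vec p (\<lambda>k. agg_Gp g k *\<^sub>v vv x k) = lim_Gp g a *\<^sub>v x + suminf_vec p (\<lambda>k. agg_Gp g k *\<^sub>v b k)"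
  unfolding lim_Gp_def using x agg_sums(2) by (intro suminf_vv) (auto intro: carrier_matI)
 then show 1: "lim_Gp g a *\<^sub>v x + lim_Hp g ew b = suminf_vec p (\<lambda>k. agg_Gp g k *\<^sub>v vv x k) + agg_Hp g ew"
  unfolding lim_Hp_def using x by (intro eq_vecI) (auto simp: agg_Hp_def)
 have "\<dots> = sum_vec p (\<lambda>j. mE1 g j *\<^sub>v suminf_vec (nu g j) (\<lambda>k. cG g j k *\<^sub>v vv x k) + mE1 g j *\<^sub>v cH g ew j) {1..N}"
  unfolding agg_sums(1)[OF vv_bdd[OF x]] agg_Hp_def by (intro sum_vec_add) (auto simp: gdims_i)
 also have "\<dots> = sum_vec p (\<lambda>j. mE1 g j *\<^sub>v GG j x) {1..N}"
  by (intro sum_vec_cong) (simp add: GG_gg(1)[OF _ x] gdims_i mv_simps)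
 finally show "lim_Gp g a *\<^sub>v x + lim_Hp g ew b = sum_vec p (\<lambda>j. mE1 g j *\<^sub>v GG j x) {1..N}" unfolding 1 .
qed

lemma lim_GX_eq: assumes x: "dim_vec x = nX g"
 shows "lim_GX g a *\<^sub>v x + lim_HX g ew b = suminf_vec (nX g) (\<lambda>k. agg_GX g k *\<^sub>v vv x k) + agg_HX g ew"
  "lim_GX g a *\<^sub>v x + lim_HX g ew b = stack g (\<lambda>i. if i = 0 then sum_vec (nx g 0) (\<lambda>j. mB1 g j *\<^sub>v GG j x) {1..N} else mB g i *\<^sub>v GG i x)"
proof -
 have "suminf_vec (nX g) (\<lambda>k. agg_GX g k *\<^sub>v vv x k) = lim_GX g a *\<^sub>v x + suminf_vec (nX g) (\<lambda>k. agg_GX g k *\<^sub>v b k)"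
  unfolding lim_GX_def using x agg_sums(4) by (intro suminf_vv) (auto intro: carrier_matI)
 then show 1: "lim_GX g a *\<^sub>v x + lim_HX g ew b = suminf_vec (nX g) (\<lambda>k. agg_GX g k *\<^sub>v vv x k) + agg_HX g ew"
  unfolding lim_HX_def using x by (intro eq_vecI) auto
 have "\<dots> = stack g (\<lambda>i. if i = 0 then sum_vec (nx g 0) (\<lambda>j. mB1 g j *\<^sub>v GG j x) {1..N} else mB g i *\<^sub>v GG i x)"
  unfolding agg_sums(3)[OF vv_bdd[OF x]] agg_HX_def
 proof (subst stack_add, goal_cases)
  case 2
  show ?case
  proof (rule stack_cong, goal_cases)
   case (1 i)
   show ?case
   proof (cases "i = 0")
    case True
    have "sum_vec (nx g 0) (\<lambda>j. mB1 g j *\<^sub>v suminf_vec (nu g j) (\<lambda>k. cG g j k *\<^sub>v vv x k)) {1..N} + sum_vec (nx g 0) (\<lambda>j. mB1 g j *\<^sub>v cH g ew j) {1..N}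
     = sum_vec (nx g 0) (\<lambda>j. mB1 g j *\<^sub>v suminf_vec (nu g j) (\<lambda>k. cG g j k *\<^sub>v vv x k) + mB1 g j *\<^sub>v cH g ew j) {1..N}"
     by (intro sum_vec_add) (auto simp: gdims_i)
    also have "\<dots> = sum_vec (nx g 0) (\<lambda>j. mB1 g j *\<^sub>v GG j x) {1..N}"
     by (intro sum_vec_cong) (simp add: GG_gg(1)[OF _ x] gdims_i mv_simps)
    finally show ?thesis using True by simp
   next
    case False
    then have i: "i \<in> {1..N}" using 1 by auto
    show ?thesis using False by (simp add: GG_gg(1)[OF i x] gdims_i[OF i] mv_simps)
   qed
  qed
 qed (auto simp: gdims_i)
 then show "lim_GX g a *\<^sub>v x + lim_HX g ew b = stack g (\<lambda>i. if i = 0 then sum_vec (nx g 0) (\<lambda>j. mB1 g j *\<^sub>v GG j x) {1..N} else mB g i *\<^sub>v GG i x)"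
  unfolding 1 .
qed

text \<open>Shifting a solution of the infinite system by one step gives a solution started from the next
 state; by uniqueness it is the one described by \<open>a\<close> and \<open>b\<close> there.\<close>
lemma hat_step:
 assumes x: "dim_vec x = nX g"
 shows "pred x = agg_D g *\<^sub>v x + (lim_Gp g a *\<^sub>v x + lim_Hp g ew b) + exi"
  and "vv (nextX x) k = vv x (Suc k)"
proof -
 have xc: "x \<in> carrier_vec (nX g)" using x by (auto intro: carrier_vecI)
 obtain yh where yh: "hat_solution g ew exi x yh" using hat_unique[OF xc] by blast
 have yv: "yh = vv x" using hat_affine[OF xc yh] by (auto simp: vv_def)
 obtain X where X: "X 0 = x" and Xt: "!!t. X t \<in> carrier_vec (nX g)"
   "!!t. summable_vec p (\<lambda>n. agg_Gp g n *\<^sub>v yh (t + n))" "!!t. summable_vec (nX g) (\<lambda>n. agg_GX g n *\<^sub>v yh (t + n))"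
   "!!t. yh t = agg_D g *\<^sub>v X t + suminf_vec p (\<lambda>n. agg_Gp g n *\<^sub>v yh (t + n)) + agg_Hp g ew + exi"
   "!!t. X (Suc t) = agg_A g *\<^sub>v X t + suminf_vec (nX g) (\<lambda>n. agg_GX g n *\<^sub>v yh (t + n)) + agg_HX g ew + agg_C g *\<^sub>v yh t + stack g ew"
  using yh unfolding hat_solution_def by blast
 have "yh 0 = agg_D g *\<^sub>v x + suminf_vec p (\<lambda>n. agg_Gp g n *\<^sub>v vv x n) + agg_Hp g ew + exi"
  using Xt(4)[of 0] X by (simp add: yv)
 then show "pred x = agg_D g *\<^sub>v x + (lim_Gp g a *\<^sub>v x + lim_Hp g ew b) + exi"
  unfolding lim_Gp_eq(1)[OF x] yv pred_def using x by (intro eq_vecI) (auto simp: agg_Hp_def exi)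
 have "X 1 = agg_A g *\<^sub>v x + suminf_vec (nX g) (\<lambda>n. agg_GX g n *\<^sub>v vv x n) + agg_HX g ew + agg_C g *\<^sub>v vv x 0 + stack g ew"
  using Xt(5)[of 0] X by (simp add: yv)
 also have "\<dots> = agg_A g *\<^sub>v x + (lim_GX g a *\<^sub>v x + lim_HX g ew b) + agg_C g *\<^sub>v vv x 0 + stack g ew"
  unfolding lim_GX_eq(1)[OF x] using x by (intro eq_vecI) auto
 also have "\<dots> = nextX x" unfolding nextX_def pred_def using x by (intro eq_vecI) auto
 finally have X1: "X 1 = nextX x" .
 have "hat_solution g ew exi (nextX x) (\<lambda>t. yh (Suc t))"
  unfolding hat_solution_def
 proof (intro conjI exI[of _ "\<lambda>t. X (Suc t)"] allI)
  show "yh (Suc t) \<in> carrier_vec p" for t unfolding yv by (intro carrier_vecI) simp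
  show "X (Suc 0) = nextX x" using X1 by simp
  fix t
  show "X (Suc t) \<in> carrier_vec (nX g)" by (rule Xt)
  show "summable_vec p (\<lambda>n. agg_Gp g n *\<^sub>v yh (Suc (t + n)))" using Xt(2)[of "Suc t"] by simp
  show "summable_vec (nX g) (\<lambda>n. agg_GX g n *\<^sub>v yh (Suc (t + n)))" using Xt(3)[of "Suc t"] by simp
  show "yh (Suc t) = agg_D g *\<^sub>v X (Suc t) + suminf_vec p (\<lambda>n. agg_Gp g n *\<^sub>v yh (Suc (t + n))) + agg_Hp g ew + exi"
   using Xt(4)[of "Suc t"] by simp
  show "X (Suc (Suc t)) = agg_A g *\<^sub>v X (Suc t) + suminf_vec (nX g) (\<lambda>n. agg_GX g n *\<^sub>v yh (Suc (t + n))) + agg_HX g ew + agg_C g *\<^sub>v yh (Suc t) + stack g ew"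
   using Xt(5)[of "Suc t"] by simp
 qed
 then have "yh (Suc k) = a k *\<^sub>v nextX x + b k" by (intro hat_affine) (auto intro: carrier_vecI)
 then show "vv (nextX x) k = vv x (Suc k)" by (simp add: yv vv_def)
qed

text \<open>Together with the next lemma: the game under any estimator-based strategy is the aggregate recursion.\<close>
lemma agg_output:
 assumes v: "!!i. i \<le> N ==> dim_vec (v i) = nx g i" and f: "dim_vec f = nX g" and e: "dim_vec e = p"
  and u: "!!i. i \<in> {1..N} ==> u i = cF g i *\<^sub>v v i + GG i f"
 shows "mD g *\<^sub>v v 0 + sum_vec p (\<lambda>i. mE1 g i *\<^sub>v u i + mE2 g i *\<^sub>v v i) {1..N} + e
  = agg_D g *\<^sub>v stack g v + (lim_Gp g a *\<^sub>v f + lim_Hp g ew b) + e"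
proof -
 have "sum_vec p (\<lambda>i. mE1 g i *\<^sub>v u i + mE2 g i *\<^sub>v v i) {1..N} =
  sum_vec p (\<lambda>j. (mE1 g j *\<^sub>v (cF g j *\<^sub>v v j) + mE2 g j *\<^sub>v v j) + mE1 g j *\<^sub>v GG j f) {1..N}"
 proof (rule sum_vec_cong)
  fix j assume j: "j \<in> {1..N}"
  then show "mE1 g j *\<^sub>v u j + mE2 g j *\<^sub>v v j = (mE1 g j *\<^sub>v (cF g j *\<^sub>v v j) + mE2 g j *\<^sub>v v j) + mE1 g j *\<^sub>v GG j f"
   using v[of j] by (simp add: u gdims_i GG_dim mv_simps) (intro eq_vecI, auto simp: gdims_i)
 qed
 also have "\<dots> = sum_vec p (\<lambda>j. mE1 g j *\<^sub>v (cF g j *\<^sub>v v j) + mE2 g j *\<^sub>v v j) {1..N} + sum_vec p (\<lambda>j. mE1 g j *\<^sub>v GG j f) {1..N}"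
  using v by (intro sum_vec_add[symmetric]) (auto simp: gdims_i)
 finally have 1: "sum_vec p (\<lambda>i. mE1 g i *\<^sub>v u i + mE2 g i *\<^sub>v v i) {1..N} = \<dots>" .
 have aD: "agg_D g *\<^sub>v stack g v = mD g *\<^sub>v v 0 + sum_vec p (\<lambda>j. mE1 g j *\<^sub>v (cF g j *\<^sub>v v j) + mE2 g j *\<^sub>v v j) {1..N}"
  using v by (rule agg_D_stack)
 show ?thesis unfolding aD 1 lim_Gp_eq(2)[OF f] using e by (intro eq_vecI) auto
qed

lemma agg_state:
 assumes v: "!!i. i \<le> N ==> dim_vec (v i) = nx g i" and f: "dim_vec f = nX g" and y: "dim_vec y = p"
  and w: "!!i. i \<le> N ==> dim_vec (w i) = nx g i"
  and u: "!!i. i \<in> {1..N} ==> u i = cF g i *\<^sub>v v i + GG i f"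
 shows "stack g (\<lambda>i. if i = 0 then mA g 0 *\<^sub>v v 0 + sum_vec (nx g 0) (\<lambda>j. mB1 g j *\<^sub>v u j + mB2 g j *\<^sub>v v j) {1..N} + w 0
   else mA g i *\<^sub>v v i + mB g i *\<^sub>v u i + mC g i *\<^sub>v y + w i)
  = agg_A g *\<^sub>v stack g v + (lim_GX g a *\<^sub>v f + lim_HX g ew b) + agg_C g *\<^sub>v y + stack g w"
proof -
 have s: "sum_vec (nx g 0) (\<lambda>i. mB1 g i *\<^sub>v u i + mB2 g i *\<^sub>v v i) {1..N} =
  sum_vec (nx g 0) (\<lambda>j. mB1 g j *\<^sub>v (cF g j *\<^sub>v v j) + mB2 g j *\<^sub>v v j) {1..N} + sum_vec (nx g 0) (\<lambda>j. mB1 g j *\<^sub>v GG j f) {1..N}"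
 proof -
  have "sum_vec (nx g 0) (\<lambda>i. mB1 g i *\<^sub>v u i + mB2 g i *\<^sub>v v i) {1..N} =
   sum_vec (nx g 0) (\<lambda>j. (mB1 g j *\<^sub>v (cF g j *\<^sub>v v j) + mB2 g j *\<^sub>v v j) + mB1 g j *\<^sub>v GG j f) {1..N}"
  proof (rule sum_vec_cong)
   fix j assume j: "j \<in> {1..N}"
   then show "mB1 g j *\<^sub>v u j + mB2 g j *\<^sub>v v j = (mB1 g j *\<^sub>v (cF g j *\<^sub>v v j) + mB2 g j *\<^sub>v v j) + mB1 g j *\<^sub>v GG j f"
    using v[of j] by (simp add: u gdims_i GG_dim mv_simps) (intro eq_vecI, auto simp: gdims_i)
  qed
  also have "\<dots> = sum_vec (nx g 0) (\<lambda>j. mB1 g j *\<^sub>v (cF g j *\<^sub>v v j) + mB2 g j *\<^sub>v v j) {1..N} + sum_vec (nx g 0) (\<lambda>j. mB1 g j *\<^sub>v GG j f) {1..N}"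
   using v by (intro sum_vec_add[symmetric]) (auto simp: gdims_i)
  finally show ?thesis .
 qed
 have st: "stack g v1 + stack g v2 + stack g v3 + stack g v4 = stack g (\<lambda>i. v1 i + v2 i + v3 i + v4 i)"
  if "!!i. i \<le> N ==> dim_vec (v1 i) = nx g i \<and> dim_vec (v2 i) = nx g i \<and> dim_vec (v3 i) = nx g i \<and> dim_vec (v4 i) = nx g i"
  for v1 v2 v3 v4 using that by (simp add: stack_add)
 have aA: "agg_A g *\<^sub>v stack g v = stack g (\<lambda>i. if i = 0
  then mA g 0 *\<^sub>v v 0 + sum_vec (nx g 0) (\<lambda>j. mB1 g j *\<^sub>v (cF g j *\<^sub>v v j) + mB2 g j *\<^sub>v v j) {1..N}
  else cAF g i *\<^sub>v v i)" using v by (rule agg_A_stack)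
 show ?thesis
  unfolding aA lim_GX_eq(2)[OF f] agg_C_mv[OF y]
 proof (subst st, goal_cases)
  case (1 i)
  then show ?case using v[OF 1] w[OF 1] gdims_i[of i] by auto
 next
  case 2
  show ?case
  proof (rule stack_cong, goal_cases)
   case (1 i)
   show ?case
   proof (cases "i = 0")
    case True
    then show ?thesis using v[of 0] w[of 0] by (simp add: s[unfolded One_nat_def]) (intro eq_vecI, auto)
   next
    case False
    then have i: "i \<in> {1..N}" using 1 by auto
    have "cAF g i *\<^sub>v v i = mA g i *\<^sub>v v i + mB g i *\<^sub>v (cF g i *\<^sub>v v i)"
     using v[OF 1] by (intro dm.cAF_mv[OF dm[OF i]])
    then show ?thesis using False v[OF 1] w[OF 1] y GG_dim[OF i, of f]
     by (simp add: u[OF i] gdims_i[OF i] mv_simps) (intro eq_vecI, auto simp: gdims_i[OF i])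
   qed
  qed
 qed
qed

end

section \<open>Random vectors\<close>

lemma space_borel_vec [simp]: "space (borel_vec n) = carrier_vec n"
 by (simp add: borel_vec_def)

text \<open>Random vectors are handled componentwise, because the Borel space is pulled back from a product of
 lines.\<close>
lemma measurable_borel_vec_iff:
 "f \<in> M \<rightarrow>\<^sub>M borel_vec n \<longleftrightarrow> (\<forall>om\<in>space M. f om \<in> carrier_vec n) \<and> (\<forall>k<n. (\<lambda>om. f om $ k) \<in> borel_measurable M)"
proof safe
 let ?h = "\<lambda>v :: rvec. \<lambda>k\<in>{..<n}. v $ k"
 have h: "?h \<in> borel_vec n \<rightarrow>\<^sub>M (\<Pi>\<^sub>M k\<in>{..<n}. borel)"
  unfolding borel_vec_def by (intro measurable_vimage_algebra1) (auto simp: space_PiM)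
 {
  assume f: "f \<in> M \<rightarrow>\<^sub>M borel_vec n"
  show "om \<in> space M ==> f om \<in> carrier_vec n" for om using measurable_space[OF f] by simp
  fix k assume k: "k < n"
  have "(\<lambda>om. ?h (f om) k) \<in> borel_measurable M"
   using k by (intro measurable_compose[OF measurable_compose[OF f h] measurable_component_singleton]) auto
  then show "(\<lambda>om. f om $ k) \<in> borel_measurable M" using k by simp
 }
 assume c: "\<forall>om\<in>space M. f om \<in> carrier_vec n" and m: "\<forall>k<n. (\<lambda>om. f om $ k) \<in> borel_measurable M"
 show "f \<in> M \<rightarrow>\<^sub>M borel_vec n"
  unfolding borel_vec_def
 proof (rule measurable_vimage_algebra2)
  show "f \<in> space M \<rightarrow> carrier_vec n" using c by auto
  show "(\<lambda>x. \<lambda>k\<in>{..<n}. f x $ k) \<in> M \<rightarrow>\<^sub>M (\<Pi>\<^sub>M k\<in>{..<n}. borel)"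
   using m by (intro measurable_restrict) auto
 qed
qed

lemma borel_vecI: "(!!om. om \<in> space M ==> f om \<in> carrier_vec n) ==> (!!k. k < n ==> (\<lambda>om. f om $ k) \<in> borel_measurable M) ==> f \<in> M \<rightarrow>\<^sub>M borel_vec n"
 by (simp add: measurable_borel_vec_iff)
lemma borel_vecD: assumes "f \<in> M \<rightarrow>\<^sub>M borel_vec n"
 shows "om \<in> space M ==> f om \<in> carrier_vec n" "om \<in> space M ==> dim_vec (f om) = n" "k < n ==> (\<lambda>om. f om $ k) \<in> borel_measurable M"
 using assms by (auto simp: measurable_borel_vec_iff)

lemma mv_index: "dim_vec x = c ==> dim_col A = c ==> k < dim_row A ==> (A *\<^sub>v x) $ k = (\<Sum>j<c. A $$ (k,j) * x $ j)"
 for x :: rvec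
 by (auto simp: scalar_prod_def lessThan_atLeast0 intro!: sum.cong)

lemma borel_vec_mv: assumes f: "f \<in> M \<rightarrow>\<^sub>M borel_vec c" and A: "dim_row A = r" "dim_col A = c"
 shows "(\<lambda>om. A *\<^sub>v f om) \<in> M \<rightarrow>\<^sub>M borel_vec r"
proof (rule borel_vecI)
 fix k assume k: "k < r"
 have "(\<lambda>om. (A *\<^sub>v f om) $ k) \<in> borel_measurable M \<longleftrightarrow> (\<lambda>om. \<Sum>j<c. A $$ (k,j) * f om $ j) \<in> borel_measurable M"
  using borel_vecD(2)[OF f] k A by (intro measurable_cong mv_index) auto
 then show "(\<lambda>om. (A *\<^sub>v f om) $ k) \<in> borel_measurable M"
  using borel_vecD(3)[OF f] by (auto intro!: borel_measurable_sum borel_measurable_times)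
qed (use A in \<open>auto intro: carrier_vecI\<close>)

lemma borel_vec_add: assumes f: "f \<in> M \<rightarrow>\<^sub>M borel_vec n" and h: "h \<in> M \<rightarrow>\<^sub>M borel_vec n"
 shows "(\<lambda>om. f om + h om) \<in> M \<rightarrow>\<^sub>M borel_vec n"
proof (rule borel_vecI)
 fix k assume k: "k < n"
 have "(\<lambda>om. (f om + h om) $ k) \<in> borel_measurable M \<longleftrightarrow> (\<lambda>om. f om $ k + h om $ k) \<in> borel_measurable M"
  using borel_vecD(2)[OF h] k by (intro measurable_cong) auto
 then show "(\<lambda>om. (f om + h om) $ k) \<in> borel_measurable M"
  using borel_vecD(3)[OF f k] borel_vecD(3)[OF h k] by auto
qed (use borel_vecD(1)[OF f] borel_vecD(1)[OF h] in auto)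

lemma borel_vec_diff: assumes f: "f \<in> M \<rightarrow>\<^sub>M borel_vec n" and h: "h \<in> M \<rightarrow>\<^sub>M borel_vec n"
 shows "(\<lambda>om. f om - h om) \<in> M \<rightarrow>\<^sub>M borel_vec n"
proof (rule borel_vecI)
 fix k assume k: "k < n"
 have "(\<lambda>om. (f om - h om) $ k) \<in> borel_measurable M \<longleftrightarrow> (\<lambda>om. f om $ k - h om $ k) \<in> borel_measurable M"
  using borel_vecD(2)[OF h] k by (intro measurable_cong) auto
 then show "(\<lambda>om. (f om - h om) $ k) \<in> borel_measurable M"
  using borel_vecD(3)[OF f k] borel_vecD(3)[OF h k] by auto
qed (use borel_vecD(1)[OF f] borel_vecD(1)[OF h] in auto)

lemma borel_vec_const: "dim_vec c = n ==> (\<lambda>om. c) \<in> M \<rightarrow>\<^sub>M borel_vec n"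
 by (rule borel_vecI) (auto intro: carrier_vecI)

lemma borel_vec_sum_vec: assumes "!!j. j \<in> I ==> f j \<in> M \<rightarrow>\<^sub>M borel_vec n"
 shows "(\<lambda>om. sum_vec n (\<lambda>j. f j om) I) \<in> M \<rightarrow>\<^sub>M borel_vec n"
 using borel_vecD(3)[OF assms] by (intro borel_vecI) (auto intro: carrier_vecI simp: sum_vec_def)

lemma borel_vec_sp: assumes f: "f \<in> M \<rightarrow>\<^sub>M borel_vec n" and h: "h \<in> M \<rightarrow>\<^sub>M borel_vec n"
 shows "(\<lambda>om. f om \<bullet> h om) \<in> borel_measurable M"
proof -
 have "(\<lambda>om. f om \<bullet> h om) \<in> borel_measurable M \<longleftrightarrow> (\<lambda>om. \<Sum>k<n. f om $ k * h om $ k) \<in> borel_measurable M"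
  using borel_vecD(2)[OF h] by (intro measurable_cong) (auto simp: scalar_prod_def lessThan_atLeast0)
 then show ?thesis using borel_vecD(3)[OF f] borel_vecD(3)[OF h] by (auto intro!: borel_measurable_sum borel_measurable_times)
qed

lemmas borel_vec_intros = borel_vec_mv borel_vec_add borel_vec_diff borel_vec_const borel_vec_sum_vec

section \<open>Square-integrable variables\<close>

definition L2 :: "'a measure => ('a => real) => bool" where
 "L2 M f \<longleftrightarrow> f \<in> borel_measurable M \<and> integrable M (\<lambda>om. (f om)\<^sup>2)"

lemma L2_measurable: "L2 M f ==> f \<in> borel_measurable M" by (simp add: L2_def)

lemma L2_mult: assumes "L2 M f" "L2 M h" shows "integrable M (\<lambda>om. f om * h om)"
proof (rule Bochner_Integration.integrable_bound)
 show "integrable M (\<lambda>om. (f om)\<^sup>2 + (h om)\<^sup>2)" using assms by (auto simp: L2_def)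
 have "\<bar>f om * h om\<bar> \<le> (f om)\<^sup>2 + (h om)\<^sup>2" for om
  using sum_squares_bound[of "\<bar>f om\<bar>" "\<bar>h om\<bar>"] mult_nonneg_nonneg[of "\<bar>f om\<bar>" "\<bar>h om\<bar>"]
  unfolding abs_mult power2_abs by linarith
 then show "AE om in M. norm (f om * h om) \<le> norm ((f om)\<^sup>2 + (h om)\<^sup>2)" by (auto intro: order_trans)
qed (use assms in \<open>auto simp: L2_def\<close>)

lemma L2_add: assumes "L2 M f" "L2 M h" shows "L2 M (\<lambda>om. f om + h om)"
 using assms L2_mult[OF assms] by (auto simp: L2_def power2_sum mult.assoc)
lemma L2_cmult: "L2 M f ==> L2 M (\<lambda>om. c * f om)" by (auto simp: L2_def power_mult_distrib)
lemma L2_diff: assumes "L2 M f" "L2 M h" shows "L2 M (\<lambda>om. f om - h om)"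
 using L2_add[OF assms(1) L2_cmult[OF assms(2), of "-1"]] by simp
lemma L2_zero: "L2 M (\<lambda>om. 0)" by (auto simp: L2_def)
lemma L2_sum: "(!!j. j \<in> I ==> L2 M (f j)) ==> L2 M (\<lambda>om. \<Sum>j\<in>I. f j om)"
 by (induction I rule: infinite_finite_induct) (auto intro: L2_add L2_zero)
lemma L2_const: "finite_measure M ==> L2 M (\<lambda>om. c)" by (simp add: L2_def finite_measure.integrable_const)
lemma L2_integrable: "finite_measure M ==> L2 M f ==> integrable M f"
 using L2_mult[of M f "\<lambda>_. 1"] L2_const[of M 1] by simp
lemma L2_cong: "(!!om. om \<in> space M ==> f om = h om) ==> L2 M f \<longleftrightarrow> L2 M h"
 unfolding L2_def by (intro conj_cong measurable_cong Bochner_Integration.integrable_cong) auto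

section \<open>Jointly Gaussian families\<close>

text \<open>The mean and the variance recover the parameters, also in the degenerate case; hence the law of a
 Gaussian variable is determined by its first two moments.\<close>
lemma gaussian_moments:
 assumes M: "prob_space M" and X: "X \<in> borel_measurable M" and s: "0 \<le> \<sigma>"
  and d: "distr M borel X = (if \<sigma> = 0 then return borel \<mu> else density lborel (normal_density \<mu> \<sigma>))"
 shows "integrable M (\<lambda>om. (X om)\<^sup>2)" "(\<integral>om. X om \<partial>M) = \<mu>" "(\<integral>om. (X om - \<mu>)\<^sup>2 \<partial>M) = \<sigma>\<^sup>2"
proof -
 interpret prob_space M by (rule M)
 let ?D = "distr M borel X"
 have "integrable ?D (\<lambda>x. x\<^sup>2) \<and> (\<integral>x. x \<partial>?D) = \<mu> \<and> (\<integral>x. (x - \<mu>)\<^sup>2 \<partial>?D) = \<sigma>\<^sup>2"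
 proof (cases "\<sigma> = 0")
  case True
  then have e: "?D = return borel \<mu>" using d by simp
  have "AE x in ?D. x = \<mu>" unfolding e by (simp add: AE_return)
  then have "integrable ?D (\<lambda>x. x\<^sup>2) \<longleftrightarrow> integrable ?D (\<lambda>x. \<mu>\<^sup>2)"
   by (intro integrable_cong_AE) auto
  moreover have "prob_space ?D" using X by (rule prob_space_distr)
  moreover have "(\<integral>x. x \<partial>?D) = \<mu>" "(\<integral>x. (x - \<mu>)\<^sup>2 \<partial>?D) = \<sigma>\<^sup>2"
   unfolding e using True by (simp_all add: integral_return)
  ultimately show ?thesis
   by (simp add: finite_measure.integrable_const prob_space.finite_measure)
 next
  case False
  then have s: "0 < \<sigma>" using s by simp
  have D: "?D = density lborel (normal_density \<mu> \<sigma>)" using d False by simp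
  have i2: "integrable lborel (\<lambda>x. normal_density \<mu> \<sigma> x * (x - \<mu>)\<^sup>2)" using integrable_normal_moment[OF s, of \<mu> 2] .
  have i1: "integrable lborel (\<lambda>x. normal_density \<mu> \<sigma> x * (x - \<mu>))" using integrable_normal_moment[OF s, of \<mu> 1] by simp
  have i0: "integrable lborel (\<lambda>x. normal_density \<mu> \<sigma> x)" using integrable_normal_moment[OF s, of \<mu> 0] by simp
  have "integrable lborel (\<lambda>x. normal_density \<mu> \<sigma> x * x\<^sup>2)"
  proof -
   have "integrable lborel (\<lambda>x. normal_density \<mu> \<sigma> x * (x - \<mu>)\<^sup>2 + 2 * \<mu> * (normal_density \<mu> \<sigma> x * (x - \<mu>)) + \<mu>\<^sup>2 * normal_density \<mu> \<sigma> x)"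
    using i0 i1 i2 by (intro Bochner_Integration.integrable_add integrable_mult_right) auto
   then show ?thesis by (simp add: power2_eq_square algebra_simps)
  qed
  moreover have "(\<integral>x. normal_density \<mu> \<sigma> x * x \<partial>lborel) = \<mu>" using integral_normal_moment_nz_1[OF s] .
  moreover have "(\<integral>x. normal_density \<mu> \<sigma> x * (x - \<mu>)\<^sup>2 \<partial>lborel) = \<sigma>\<^sup>2"
   using has_bochner_integral_integral_eq[OF normal_moment_even[OF s, of \<mu> 1]] s by (simp add: fact_numeral)
  ultimately show ?thesis unfolding D by (simp add: integrable_real_density integral_real_density)
 qed
 then show "integrable M (\<lambda>om. (X om)\<^sup>2)" "(\<integral>om. X om \<partial>M) = \<mu>" "(\<integral>om. (X om - \<mu>)\<^sup>2 \<partial>M) = \<sigma>\<^sup>2"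
  using X by (auto simp: integrable_distr_eq integral_distr)
qed

lemma gaussian_L2: "prob_space M ==> gaussian_rv M X ==> L2 M X"
 unfolding gaussian_rv_def L2_def using gaussian_moments(1) by blast

lemma gaussian_same_law:
 assumes M: "prob_space M" and X: "gaussian_rv M X" and Y: "gaussian_rv M Y"
  and m: "(\<integral>om. X om \<partial>M) = (\<integral>om. Y om \<partial>M)"
  and v: "(\<integral>om. (X om - (\<integral>om. X om \<partial>M))\<^sup>2 \<partial>M) = (\<integral>om. (Y om - (\<integral>om. Y om \<partial>M))\<^sup>2 \<partial>M)"
 shows "distr M borel X = distr M borel Y"
proof -
 obtain \<mu> \<sigma> where 1: "X \<in> borel_measurable M" "0 \<le> \<sigma>" "distr M borel X = (if \<sigma> = 0 then return borel \<mu> else density lborel (normal_density \<mu> \<sigma>))"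
  using X by (auto simp: gaussian_rv_def)
 obtain \<mu>' \<sigma>' where 2: "Y \<in> borel_measurable M" "0 \<le> \<sigma>'" "distr M borel Y = (if \<sigma>' = 0 then return borel \<mu>' else density lborel (normal_density \<mu>' \<sigma>'))"
  using Y by (auto simp: gaussian_rv_def)
 have "\<mu> = \<mu>'" "\<sigma>\<^sup>2 = \<sigma>'\<^sup>2" using m v gaussian_moments(2,3)[OF M 1] gaussian_moments(2,3)[OF M 2] by auto
 with 1 2 show ?thesis by (simp add: power2_eq_iff_nonneg)
qed

lemma gaussian_shift:
 assumes M: "prob_space M" and X: "gaussian_rv M X" shows "gaussian_rv M (\<lambda>om. X om + c)"
proof -
 interpret prob_space M by (rule M)
 obtain \<mu> \<sigma> where 1: "X \<in> borel_measurable M" "0 \<le> \<sigma>" "distr M borel X = (if \<sigma> = 0 then return borel \<mu> else density lborel (normal_density \<mu> \<sigma>))"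
  using X by (auto simp: gaussian_rv_def)
 have "distr M borel (\<lambda>om. X om + c) = distr (distr M borel X) borel (\<lambda>x. x + c)"
  using 1(1) by (subst distr_distr) (auto simp: o_def)
 also have "\<dots> = (if \<sigma> = 0 then return borel (\<mu> + c) else density lborel (normal_density (\<mu> + c) \<sigma>))"
 proof (cases "\<sigma> = 0")
  case True then show ?thesis using 1(3) by (simp add: distr_return)
 next
  case False
  then have s: "0 < \<sigma>" using 1 by simp
  have "distributed (density lborel (normal_density \<mu> \<sigma>)) lborel (\<lambda>x. x) (normal_density \<mu> \<sigma>)"
   by (auto simp: distributed_def distr_id2)
  from prob_space.normal_density_affine[OF prob_space_normal_density[OF s] this s, of 1 c]
  have "distr (density lborel (normal_density \<mu> \<sigma>)) lborel (\<lambda>x. c + x) = density lborel (normal_density (c + \<mu>) \<sigma>)"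
   by (simp add: distributed_def)
  moreover have "distr (density lborel (normal_density \<mu> \<sigma>)) lborel (\<lambda>x. c + x) = distr (density lborel (normal_density \<mu> \<sigma>)) borel (\<lambda>x. c + x)"
   by (intro distr_cong) auto
  ultimately show ?thesis using False 1(3) by (simp add: add.commute)
 qed
 finally show ?thesis unfolding gaussian_rv_def using 1 by (intro conjI exI[of _ "\<mu> + c"] exI[of _ \<sigma>]) auto
qed

definition aff :: "'i set => ('i => 'a => real) => ('a => real) => bool" where
 "aff I V f \<longleftrightarrow> (\<exists>J c c0. finite J \<and> J \<subseteq> I \<and> f = (\<lambda>om. (\<Sum>j\<in>J. c j * V j om) + c0))"

lemma aff_const: "aff I V (\<lambda>om. c)"
 unfolding aff_def by (intro exI[of _ "{}"] exI[of _ c]) auto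
lemma aff_var: "i \<in> I ==> aff I V (V i)"
 unfolding aff_def by (intro exI[of _ "{i}"] exI[of _ "\<lambda>_. 1"] exI[of _ 0]) auto
lemma aff_cmult: "aff I V f ==> aff I V (\<lambda>om. x * f om)"
proof -
 assume "aff I V f"
 then obtain J c c0 where *: "finite J" "J \<subseteq> I" "f = (\<lambda>om. (\<Sum>j\<in>J. c j * V j om) + c0)" by (auto simp: aff_def)
 then have "(\<lambda>om. x * f om) = (\<lambda>om. (\<Sum>j\<in>J. (x * c j) * V j om) + x * c0)" by (simp add: sum_distrib_left algebra_simps)
 then show ?thesis unfolding aff_def using *(1,2)
  by (intro exI[of _ J] exI[of _ "\<lambda>j. x * c j"] exI[of _ "x * c0"] conjI)
qed
lemma aff_add: assumes "aff I V f" "aff I V h" shows "aff I V (\<lambda>om. f om + h om)"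
proof -
 obtain J c c0 where *: "finite J" "J \<subseteq> I" "f = (\<lambda>om. (\<Sum>j\<in>J. c j * V j om) + c0)" using assms by (auto simp: aff_def)
 obtain J' c' c0' where **: "finite J'" "J' \<subseteq> I" "h = (\<lambda>om. (\<Sum>j\<in>J'. c' j * V j om) + c0')" using assms by (auto simp: aff_def)
 let ?d = "\<lambda>j. (if j \<in> J then c j else 0) + (if j \<in> J' then c' j else 0)"
 have e: "(\<Sum>j\<in>A. c j * V j om) = (\<Sum>j\<in>A \<union> B. (if j \<in> A then c j else 0) * V j om)" if "finite A" "finite B" for A B c om
  using that by (intro sum.mono_neutral_cong_left) auto
 have "f om + h om = (\<Sum>j\<in>J \<union> J'. ?d j * V j om) + (c0 + c0')" for om
  unfolding *(3) **(3) e[OF *(1) **(1)] e[OF **(1) *(1), unfolded Un_commute[of J' J]] by (simp add: algebra_simps sum.distrib)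
 then show ?thesis unfolding aff_def using * ** by (intro exI[of _ "J \<union> J'"] exI[of _ ?d] exI[of _ "c0 + c0'"]) auto
qed
lemma aff_diff: "aff I V f ==> aff I V h ==> aff I V (\<lambda>om. f om - h om)"
 using aff_add[of I V f "\<lambda>om. (-1) * h om"] aff_cmult[of I V h "-1"] by simp
lemma aff_sum: "(!!j. j \<in> J ==> aff I V (f j)) ==> aff I V (\<lambda>om. \<Sum>j\<in>J. f j om)"
 by (induction J rule: infinite_finite_induct) (auto intro: aff_add aff_const)

lemma aff_gaussian: "prob_space M ==> jointly_gaussian M I V ==> aff I V f ==> gaussian_rv M f"
 unfolding aff_def jointly_gaussian_def using gaussian_shift by blast

section \<open>Uncorrelated jointly Gaussian variables\<close>

lemma integral_Re_Im:
 fixes f h :: "'a => real" assumes "integrable M f" "integrable M h"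
 shows "(\<integral>om. complex_of_real (f om) + \<i> * complex_of_real (h om) \<partial>M) = complex_of_real (\<integral>om. f om \<partial>M) + \<i> * complex_of_real (\<integral>om. h om \<partial>M)"
 using assms by (subst Bochner_Integration.integral_add) auto

text \<open>The functions \<open>\<bar>Z\<bar> + Z\<close> and \<open>\<bar>Z\<bar> - Z\<close>, normalized,
 are densities of two probability measures under which \<open>nu\<close> has the same characteristic function,
 hence the same law; subtract.\<close>
lemma weighted_law_eq:
 fixes Z nu :: "'a => real"
 assumes M: "prob_space M" and Z: "integrable M Z" and nu [measurable]: "nu \<in> borel_measurable M"
  and 0: "!!\<theta> \<phi>. (\<integral>om. Z om * sin (\<theta> * nu om + \<phi>) \<partial>M) = 0" and B [measurable]: "B \<in> sets borel"
 shows "(\<integral>om. Z om * indicator B (nu om) \<partial>M) = 0"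
proof -
 interpret prob_space M by (rule M)
 have [measurable]: "Z \<in> borel_measurable M" using Z by auto
 have EZ: "(\<integral>om. Z om \<partial>M) = 0" using 0[of 0 "pi/2"] by simp
 define m where "m = (\<integral>om. \<bar>Z om\<bar> \<partial>M) / 2"
 show ?thesis
 proof (cases "m = 0")
  case True
  then have "AE om in M. Z om = 0"
   using integral_nonneg_eq_0_iff_AE[of M "\<lambda>om. \<bar>Z om\<bar>"] Z by (simp add: m_def)
  then have "(\<integral>om. Z om * indicator B (nu om) \<partial>M) = (\<integral>om. 0 \<partial>M)" by (intro integral_cong_AE) auto
  then show ?thesis by simp
 next
  case False
  then have m: "0 < m" by (simp add: m_def less_le)
  define P where "P s = (\<lambda>om. (\<bar>Z om\<bar> + s * Z om) / (2 * m))" for s :: real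
  have Pm [measurable]: "P s \<in> borel_measurable M" for s by (simp add: P_def)
  have Pi: "integrable M (P s)" for s using Z by (auto simp: P_def)
  have Pn: "0 \<le> P s om" if "s = 1 \<or> s = -1" for s om using that m by (auto simp: P_def)
  have P1: "(\<integral>om. P s om \<partial>M) = 1" for s
   using Z m EZ by (simp add: P_def m_def)
  have ps: "prob_space (density M (\<lambda>om. ennreal (P s om)))" if "s = 1 \<or> s = -1" for s
  proof (rule prob_spaceI)
   have "emeasure (density M (\<lambda>om. ennreal (P s om))) (space M) = (\<integral>\<^sup>+om. ennreal (P s om) \<partial>M)"
    by (subst emeasure_density) (auto intro!: nn_integral_cong)
   also have "\<dots> = 1" using Pi Pn[OF that] by (subst nn_integral_eq_integral) (auto simp: P1)
   finally show "emeasure (density M (\<lambda>om. ennreal (P s om))) (space (density M (\<lambda>om. ennreal (P s om)))) = 1" by simp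
  qed
  define D where "D s = distr (density M (\<lambda>om. ennreal (P s om))) borel nu" for s
  have rd: "real_distribution (D s)" if "s = 1 \<or> s = -1" for s
   unfolding D_def using prob_space.real_distribution_distr[OF ps[OF that]] by simp
  have ch: "char (D s) t = (\<integral>om. P s om *\<^sub>R iexp (t * nu om) \<partial>M)" if "s = 1 \<or> s = -1" for s t
   unfolding char_def D_def using Pn[OF that] by (subst integral_distr) (auto simp: integral_density)
  have "char (D 1) t = char (D (-1)) t" for t
  proof -
   have iz: "integrable M (\<lambda>om. Z om * sin (t * nu om + \<phi>))" for \<phi>
    by (rule Bochner_Integration.integrable_bound[OF Z]) (auto simp: abs_mult mult_left_le)
   have ip: "integrable M (\<lambda>om. P s om *\<^sub>R iexp (t * nu om))" for s
    by (rule Bochner_Integration.integrable_bound[OF Pi[of s]]) auto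
   have "char (D 1) t - char (D (-1)) t = (\<integral>om. P 1 om *\<^sub>R iexp (t * nu om) - P (-1) om *\<^sub>R iexp (t * nu om) \<partial>M)"
    using ip by (simp add: ch)
   also have "\<dots> = (\<integral>om. complex_of_real (Z om * sin (t * nu om + pi/2) / m) + \<i> * complex_of_real (Z om * sin (t * nu om + 0) / m) \<partial>M)"
   proof (intro Bochner_Integration.integral_cong refl)
    fix om
    have "P 1 om - P (-1) om = Z om / m" using m by (simp add: P_def field_simps)
    then have fin: "P 1 om *\<^sub>R iexp (t * nu om) - P (-1) om *\<^sub>R iexp (t * nu om) = (Z om / m) *\<^sub>R iexp (t * nu om)"
     by (simp flip: scaleR_diff_left)
    have ie: "iexp (t * nu om) = complex_of_real (cos (t * nu om)) + \<i> * complex_of_real (sin (t * nu om))"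
     by (simp add: complex_eq_iff Re_exp Im_exp)
    show "P 1 om *\<^sub>R iexp (t * nu om) - P (-1) om *\<^sub>R iexp (t * nu om) =
     complex_of_real (Z om * sin (t * nu om + pi/2) / m) + \<i> * complex_of_real (Z om * sin (t * nu om + 0) / m)"
     unfolding fin unfolding ie by (simp add: sin_add scaleR_conv_of_real algebra_simps)
   qed
   also have "\<dots> = complex_of_real (\<integral>om. Z om * sin (t * nu om + pi/2) / m \<partial>M) + \<i> * complex_of_real (\<integral>om. Z om * sin (t * nu om + 0) / m \<partial>M)"
    by (rule integral_Re_Im) (intro integrable_divide iz)+
   also have "\<dots> = 0" by (simp only: integral_divide_zero 0) simp
   finally show ?thesis by simp
  qed
  then have eq: "D 1 = D (-1)" using rd by (intro Levy_uniqueness) auto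
  have me: "measure (D s) B = (\<integral>om. P s om * indicator B (nu om) \<partial>M)" if "s = 1 \<or> s = -1" for s
  proof -
   interpret D: real_distribution "D s" by (rule rd[OF that])
   have "measure (D s) B = (\<integral>x. indicator B x \<partial>D s)" using B by simp
   also have "\<dots> = (\<integral>om. P s om * indicator B (nu om) \<partial>M)"
    unfolding D_def using Pn[OF that] by (subst integral_distr) (auto simp: integral_real_density)
   finally show ?thesis .
  qed
  have ib: "integrable M (\<lambda>om. P s om * indicator B (nu om))" for s
   by (rule Bochner_Integration.integrable_bound[OF Pi[of s]]) (auto simp: indicator_def)
  have "0 = (\<integral>om. P 1 om * indicator B (nu om) \<partial>M) - (\<integral>om. P (-1) om * indicator B (nu om) \<partial>M)"
   using me[of 1] me[of "-1"] eq by simp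
  also have "\<dots> = (\<integral>om. (1 / m) * (Z om * indicator B (nu om)) \<partial>M)"
   unfolding Bochner_Integration.integral_diff[OF ib ib, symmetric]
   using m by (intro Bochner_Integration.integral_cong refl) (auto simp: P_def indicator_def field_simps)
  finally show ?thesis using m by simp
 qed
qed

text \<open>Induction over the coordinates: the indicator of one coordinate is absorbed into the weight, which
 reduces the joint statement to the one-dimensional one.\<close>
lemma weighted_joint_law_eq:
 fixes Z :: "'a => real" and nu :: "'j => 'a => real"
 assumes M: "prob_space M" and J: "finite J" and nu: "!!j. j \<in> J ==> nu j \<in> borel_measurable M"
  and Z: "integrable M Z"
  and 0: "!!\<theta> \<phi>. (\<integral>om. Z om * sin ((\<Sum>j\<in>J. \<theta> j * nu j om) + \<phi>) \<partial>M) = 0"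
  and B: "!!j. j \<in> J ==> B j \<in> sets borel"
 shows "(\<integral>om. Z om * (\<Prod>j\<in>J. indicator (B j) (nu j om)) \<partial>M) = 0"
 using J nu Z 0 B
proof (induction J arbitrary: Z rule: finite_induct)
 case empty
 show ?case using empty(3)[of _ "pi/2"] by simp
next
 case (insert i J)
 interpret prob_space M by (rule M)
 have [measurable]: "nu j \<in> borel_measurable M" if "j \<in> insert i J" for j using insert.prems(1) that .
 have [measurable]: "nu i \<in> borel_measurable M" by (rule insert.prems) simp
 have [measurable]: "Z \<in> borel_measurable M" using insert.prems(2) by auto
 have [measurable]: "B i \<in> sets borel" by (rule insert.prems) simp
 have Sm [measurable]: "(\<lambda>om. \<Sum>j\<in>J. \<theta> j * nu j om) \<in> borel_measurable M" for \<theta>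
  using insert.prems(1) by (intro borel_measurable_sum borel_measurable_times) auto
 have zi: "integrable M (\<lambda>om. Z om * f om)" if "f \<in> borel_measurable M" "!!om. \<bar>f om\<bar> \<le> 1" for f
  using that by (intro Bochner_Integration.integrable_bound[OF insert.prems(2)]) (auto simp: abs_mult mult_left_le)
 have full: "(\<integral>om. Z om * sin ((\<Sum>j\<in>J. \<theta> j * nu j om) + \<tau> * nu i om + \<phi>) \<partial>M) = 0" for \<theta> \<tau> \<phi>
 proof -
  have "(\<Sum>j\<in>insert i J. (\<theta>(i := \<tau>)) j * nu j om) = (\<Sum>j\<in>J. \<theta> j * nu j om) + \<tau> * nu i om" for om
   using insert(1,2) by (simp add: sum.insert) (intro sum.cong, auto)
  then show ?thesis using insert.prems(3)[of "\<theta>(i := \<tau>)" \<phi>] by simp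
 qed
 have one: "(\<integral>om. (Z om * sin ((\<Sum>j\<in>J. \<theta> j * nu j om) + \<phi>)) * indicator (B i) (nu i om) \<partial>M) = 0" for \<theta> \<phi>
 proof (rule weighted_law_eq[OF M])
  let ?U = "\<lambda>om. (\<Sum>j\<in>J. \<theta> j * nu j om) + \<phi>"
  show "integrable M (\<lambda>om. Z om * sin (?U om))" by (rule zi) auto
  fix \<tau> \<psi>
  have "Z om * sin (?U om) * sin (\<tau> * nu i om + \<psi>) =
   (1/2) * (Z om * sin ((\<Sum>j\<in>J. \<theta> j * nu j om) + (- \<tau>) * nu i om + (\<phi> - \<psi> + pi/2)))
   - (1/2) * (Z om * sin ((\<Sum>j\<in>J. \<theta> j * nu j om) + \<tau> * nu i om + (\<phi> + \<psi> + pi/2)))" for om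
  proof -
   have sc: "sin (x + pi/2) = cos x" for x :: real by (simp add: sin_add)
   have "sin ((\<Sum>j\<in>J. \<theta> j * nu j om) + (- \<tau>) * nu i om + (\<phi> - \<psi> + pi/2)) = cos (?U om - (\<tau> * nu i om + \<psi>))"
    using sc[of "?U om - (\<tau> * nu i om + \<psi>)"] by (simp add: algebra_simps)
   moreover have "sin ((\<Sum>j\<in>J. \<theta> j * nu j om) + \<tau> * nu i om + (\<phi> + \<psi> + pi/2)) = cos (?U om + (\<tau> * nu i om + \<psi>))"
    using sc[of "?U om + (\<tau> * nu i om + \<psi>)"] by (simp add: algebra_simps)
   ultimately show ?thesis by (simp only: mult.assoc sin_times_sin) (simp add: field_simps)
  qed
  then have "(\<integral>om. Z om * sin (?U om) * sin (\<tau> * nu i om + \<psi>) \<partial>M) =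
   (1/2) * (\<integral>om. Z om * sin ((\<Sum>j\<in>J. \<theta> j * nu j om) + (- \<tau>) * nu i om + (\<phi> - \<psi> + pi/2)) \<partial>M)
   - (1/2) * (\<integral>om. Z om * sin ((\<Sum>j\<in>J. \<theta> j * nu j om) + \<tau> * nu i om + (\<phi> + \<psi> + pi/2)) \<partial>M)"
   by (simp only:) (subst Bochner_Integration.integral_diff, auto intro!: zi integrable_mult_right simp del: mult_minus_left)
  then show "(\<integral>om. Z om * sin (?U om) * sin (\<tau> * nu i om + \<psi>) \<partial>M) = 0" by (simp only: full)
 qed auto
 have "(\<integral>om. (Z om * indicator (B i) (nu i om)) * (\<Prod>j\<in>J. indicator (B j) (nu j om)) \<partial>M) = 0"
 proof (rule insert.IH)
  show "integrable M (\<lambda>om. Z om * indicator (B i) (nu i om))" by (rule zi) (auto simp: indicator_def)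
  show "(\<integral>om. (Z om * indicator (B i) (nu i om)) * sin ((\<Sum>j\<in>J. \<theta> j * nu j om) + \<phi>) \<partial>M) = 0" for \<theta> \<phi>
   using one[of \<theta> \<phi>] by (simp add: mult_ac)
 qed (use insert.prems in auto)
 then show ?case using insert(1,2) by (simp add: mult.assoc)
qed

text \<open>Boxes are an intersection-stable generator of the joint sigma algebra.\<close>
lemma weighted_joint_sets:
 fixes Z :: "'a => real" and nu :: "'j => 'a => real"
 assumes M: "prob_space M" and J: "finite J" and nu: "!!j. j \<in> J ==> nu j \<in> borel_measurable M"
  and Z: "integrable M Z"
  and 0: "!!\<theta> \<phi>. (\<integral>om. Z om * sin ((\<Sum>j\<in>J. \<theta> j * nu j om) + \<phi>) \<partial>M) = 0"
  and E: "E \<in> sets (\<Pi>\<^sub>M j\<in>J. borel)"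
 shows "(\<integral>om. Z om * indicator E (\<lambda>j\<in>J. nu j om) \<partial>M) = 0"
proof -
 interpret prob_space M by (rule M)
 let ?P = "\<Pi>\<^sub>M j\<in>J. (borel :: real measure)"
 let ?T = "\<lambda>om. \<lambda>j\<in>J. nu j om"
 have T [measurable]: "?T \<in> M \<rightarrow>\<^sub>M ?P" using nu by (intro measurable_restrict) auto
 have [measurable]: "Z \<in> borel_measurable M" using Z by auto
 define P where "P s = (\<lambda>om. (\<bar>Z om\<bar> + s * Z om) / 2)" for s :: real
 have Pm [measurable]: "P s \<in> borel_measurable M" for s by (simp add: P_def)
 have Pi: "integrable M (P s)" for s using Z by (auto simp: P_def)
 have Pn: "0 \<le> P s om" if "s = 1 \<or> s = -1" for s om using that by (auto simp: P_def)
 have Pd: "P 1 om - P (-1) om = Z om" for om by (simp add: P_def field_simps)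
 define D where "D s = distr (density M (\<lambda>om. ennreal (P s om))) ?P ?T" for s
 have ip: "integrable M (\<lambda>om. P s om * indicator E (?T om))" if E: "E \<in> sets ?P" for s E
  using measurable_sets[OF T E] E
  by (intro Bochner_Integration.integrable_bound[OF Pi[of s]]) (auto simp: indicator_def)
 have eD: "emeasure (D s) E = ennreal (\<integral>om. P s om * indicator E (?T om) \<partial>M)" if s: "s = 1 \<or> s = -1" and E: "E \<in> sets ?P" for s E
 proof -
  have "emeasure (D s) E = emeasure (density M (\<lambda>om. ennreal (P s om))) (?T -` E \<inter> space M)"
   unfolding D_def using E by (subst emeasure_distr) auto
  also have "\<dots> = (\<integral>\<^sup>+om. ennreal (P s om) * indicator (?T -` E \<inter> space M) om \<partial>M)"
   using measurable_sets[OF T E] by (intro emeasure_density) auto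
  also have "\<dots> = (\<integral>\<^sup>+om. ennreal (P s om * indicator E (?T om)) \<partial>M)"
   by (intro nn_integral_cong) (auto simp: indicator_def)
  also have "\<dots> = ennreal (\<integral>om. P s om * indicator E (?T om) \<partial>M)"
   using ip[OF E] Pn[OF s] by (intro nn_integral_eq_integral) (auto simp: indicator_def)
  finally show ?thesis .
 qed
 have "D 1 = D (-1)"
 proof (rule measure_eqI_PiM_finite[OF J, where A = "\<lambda>_. space ?P"])
  show "sets (D 1) = sets ?P" "sets (D (-1)) = sets ?P" by (auto simp: D_def)
  show "range (\<lambda>_::nat. space ?P) \<subseteq> prod_algebra J (\<lambda>_. borel)"
   using J by (auto simp: space_PiM intro!: prod_algebraI_finite)
  show "(\<Union>i::nat. space ?P) = space ?P" by simp
  show "emeasure (D 1) (space ?P) \<noteq> \<infinity>" by (simp add: eD)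
  fix B :: "'j => real set" assume B: "!!j. j \<in> J ==> B j \<in> sets borel"
  have Bs: "Pi\<^sub>E J B \<in> sets ?P" using J B by (intro sets_PiM_I_finite) auto
  have "indicator (Pi\<^sub>E J B) (?T om) = (\<Prod>j\<in>J. indicator (B j) (nu j om) :: real)" for om
  proof (cases "\<forall>j\<in>J. nu j om \<in> B j")
   case False
   then have "(\<Prod>j\<in>J. indicator (B j) (nu j om) :: real) = 0" using J False by (intro prod_zero) (auto simp: indicator_def)
   then show ?thesis using False by (auto simp: indicator_def PiE_iff)
  qed (auto simp: indicator_def)
  then have "(\<integral>om. Z om * indicator (Pi\<^sub>E J B) (?T om) \<partial>M) = 0"
   using weighted_joint_law_eq[OF M J nu Z 0 B] by simp
  then have "(\<integral>om. P 1 om * indicator (Pi\<^sub>E J B) (?T om) - P (-1) om * indicator (Pi\<^sub>E J B) (?T om) \<partial>M) = 0"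
   by (simp add: Pd flip: left_diff_distrib)
  then show "emeasure (D 1) (Pi\<^sub>E J B) = emeasure (D (-1)) (Pi\<^sub>E J B)"
   using ip[OF Bs] by (simp add: eD[OF _ Bs])
 qed
 then have "ennreal (\<integral>om. P 1 om * indicator E (?T om) \<partial>M) = ennreal (\<integral>om. P (-1) om * indicator E (?T om) \<partial>M)"
  using eD[of 1, OF _ E] eD[of "-1", OF _ E] by simp
 then have "(\<integral>om. P 1 om * indicator E (?T om) \<partial>M) = (\<integral>om. P (-1) om * indicator E (?T om) \<partial>M)"
  using Pn by (subst (asm) ennreal_inj) (auto intro!: integral_nonneg_AE)
 then have "(\<integral>om. P 1 om * indicator E (?T om) - P (-1) om * indicator E (?T om) \<partial>M) = 0"
  using ip[OF E] by simp
 then show ?thesis by (simp add: Pd flip: left_diff_distrib)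
qed

text \<open>As \<open>Z\<close> is centred and uncorrelated with every combination \<open>nu\<close>, the
 variables \<open>nu + s Z\<close> and \<open>nu - s Z\<close> have the same Gaussian law. The difference of
 their trigonometric moments, divided by \<open>s\<close>, tends to a trigonometric moment weighted by
 \<open>Z\<close>, which is therefore 0.\<close>
theorem gaussian_orth:
 fixes Z :: "'a => real" and nu :: "'j => 'a => real"
 assumes M: "prob_space M" and V: "jointly_gaussian M I V" and J: "finite J"
  and nu: "!!j. j \<in> J ==> aff I V (nu j)" and Z: "aff I V Z"
  and EZ: "(\<integral>om. Z om \<partial>M) = 0" and orth: "!!j. j \<in> J ==> (\<integral>om. Z om * nu j om \<partial>M) = 0"
  and E: "E \<in> sets (\<Pi>\<^sub>M j\<in>J. borel)"
 shows "(\<integral>om. Z om * indicator E (\<lambda>j\<in>J. nu j om) \<partial>M) = 0"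
proof (rule weighted_joint_sets[OF M J _ _ _ E])
 interpret prob_space M by (rule M)
 have L: "L2 M f" if "aff I V f" for f using gaussian_L2[OF M aff_gaussian[OF M V that]] .
 have ig: "integrable M f" if "aff I V f" for f using L2_integrable[OF finite_measure_axioms L[OF that]] .
 show "integrable M Z" using ig[OF Z] .
 show "nu j \<in> borel_measurable M" if "j \<in> J" for j using ig[OF nu[OF that]] by auto
 fix \<theta> \<phi>
 define U where "U = (\<lambda>om. (\<Sum>j\<in>J. \<theta> j * nu j om) + \<phi>)"
 have U: "aff I V U" unfolding U_def by (intro aff_add aff_sum aff_cmult aff_const nu)
 have [measurable]: "U \<in> borel_measurable M" "Z \<in> borel_measurable M" using ig[OF U] ig[OF Z] by auto
 have ZU: "(\<integral>om. Z om * U om \<partial>M) = 0"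
 proof -
  have "Z om * U om = (\<Sum>j\<in>J. \<theta> j * (Z om * nu j om)) + \<phi> * Z om" for om
   by (simp add: U_def algebra_simps sum_distrib_left)
  moreover have "integrable M (\<lambda>om. Z om * nu j om)" if "j \<in> J" for j using L2_mult[OF L[OF Z] L[OF nu[OF that]]] .
  ultimately show ?thesis using ig[OF Z] orth EZ by (simp add: Bochner_Integration.integral_sum)
 qed
 have s0: "(\<integral>om. sin (U om) * sin (s * Z om) \<partial>M) = 0" for s
 proof -
  let ?X = "\<lambda>t om. U om + t * Z om"
  have aX: "aff I V (?X t)" for t by (intro aff_add aff_cmult U Z)
  have mX: "(\<integral>om. ?X t om \<partial>M) = (\<integral>om. U om \<partial>M)" for t using ig[OF U] ig[OF Z] EZ by simp
  have "(\<integral>om. (?X t om - (\<integral>om. ?X t om \<partial>M))\<^sup>2 \<partial>M) = (\<integral>om. (U om - (\<integral>om. U om \<partial>M))\<^sup>2 \<partial>M) + t\<^sup>2 * (\<integral>om. (Z om)\<^sup>2 \<partial>M)" for t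
  proof -
   define c where "c = (\<integral>om. U om \<partial>M)"
   have "(?X t om - c)\<^sup>2 = (U om - c)\<^sup>2 + t\<^sup>2 * (Z om)\<^sup>2 + 2 * t * (Z om * U om) - 2 * t * c * Z om" for om
    by (simp add: power2_eq_square algebra_simps)
   moreover have "integrable M (\<lambda>om. (U om - c)\<^sup>2)" using L[OF aff_diff[OF U aff_const]] by (auto simp: L2_def)
   moreover have "integrable M (\<lambda>om. (Z om)\<^sup>2)" using L[OF Z] by (auto simp: L2_def)
   moreover have "integrable M (\<lambda>om. Z om * U om)" using L2_mult[OF L[OF Z] L[OF U]] .
   ultimately show ?thesis unfolding mX c_def[symmetric] using ig[OF Z] ZU EZ by simp
  qed
  then have "distr M borel (?X s) = distr M borel (?X (-s))"
   by (intro gaussian_same_law[OF M aff_gaussian[OF M V aX] aff_gaussian[OF M V aX]]) (simp_all only: mX power2_minus)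
  then have "(\<integral>x. cos x \<partial>distr M borel (?X s)) = (\<integral>x. cos x \<partial>distr M borel (?X (-s)))" by simp
  then have "(\<integral>om. cos (U om + s * Z om) \<partial>M) = (\<integral>om. cos (U om - s * Z om) \<partial>M)"
   by (subst (asm) (1 2) integral_distr) auto
  moreover have ic: "integrable M (\<lambda>om. cos (U om + s * Z om))" "integrable M (\<lambda>om. cos (U om - s * Z om))"
   by (auto intro!: integrable_const_bound[of _ 1])
  ultimately have "(\<integral>om. (cos (U om - s * Z om) - cos (U om + s * Z om)) / 2 \<partial>M) = 0" by simp
  then show ?thesis by (simp add: sin_times_sin)
 qed
 have lim: "(\<lambda>k. sin (U om) * (sin (inverse (real (Suc k)) * Z om) / inverse (real (Suc k)))) \<longlonglongrightarrow> Z om * sin (U om)" for om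
 proof -
  have "((\<lambda>s. sin (s * Z om)) has_real_derivative Z om) (at 0)"
   by (auto intro!: derivative_eq_intros)
  then have "((\<lambda>s. sin (s * Z om) / s) \<longlongrightarrow> Z om) (at 0)" by (simp add: DERIV_def)
  moreover have "filterlim (\<lambda>k. inverse (real (Suc k))) (at 0) sequentially"
   using LIMSEQ_inverse_real_of_nat by (simp add: filterlim_at)
  ultimately have "(\<lambda>k. sin (inverse (real (Suc k)) * Z om) / inverse (real (Suc k))) \<longlonglongrightarrow> Z om"
   by (rule filterlim_compose)
  from tendsto_mult[OF tendsto_const this, of "sin (U om)"] show ?thesis by (simp add: mult.commute)
 qed
 have "(\<lambda>k. \<integral>om. sin (U om) * (sin (inverse (real (Suc k)) * Z om) / inverse (real (Suc k))) \<partial>M) \<longlonglongrightarrow> (\<integral>om. Z om * sin (U om) \<partial>M)"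
 proof (rule integral_dominated_convergence)
  show "integrable M (\<lambda>om. \<bar>Z om\<bar>)" using ig[OF Z] by simp
  show "AE om in M. (\<lambda>k. sin (U om) * (sin (inverse (real (Suc k)) * Z om) / inverse (real (Suc k)))) \<longlonglongrightarrow> Z om * sin (U om)"
   using lim by simp
  show "AE om in M. norm (sin (U om) * (sin (inverse (real (Suc k)) * Z om) / inverse (real (Suc k)))) \<le> \<bar>Z om\<bar>" for k
  proof (rule AE_I2)
   fix om
   have "\<bar>sin (inverse (real (Suc k)) * Z om)\<bar> \<le> inverse (real (Suc k)) * \<bar>Z om\<bar>"
    using abs_sin_x_le_abs_x[of "inverse (real (Suc k)) * Z om"] by (simp add: abs_mult)
   then have "\<bar>sin (inverse (real (Suc k)) * Z om) / inverse (real (Suc k))\<bar> \<le> \<bar>Z om\<bar>"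
    by (subst abs_divide, subst pos_divide_le_eq) (auto simp: mult.commute)
   then have "\<bar>sin (U om)\<bar> * \<bar>sin (inverse (real (Suc k)) * Z om) / inverse (real (Suc k))\<bar> \<le> 1 * \<bar>Z om\<bar>"
    by (intro mult_mono) auto
   then show "norm (sin (U om) * (sin (inverse (real (Suc k)) * Z om) / inverse (real (Suc k)))) \<le> \<bar>Z om\<bar>"
    by (simp only: real_norm_def abs_mult mult_1_left)
  qed
 qed auto
 moreover have "(\<integral>om. sin (U om) * (sin (inverse (real (Suc k)) * Z om) / inverse (real (Suc k))) \<partial>M) = 0" for k
  using s0[of "inverse (real (Suc k))"] by (simp only: times_divide_eq_right integral_divide_zero)
 ultimately have "(\<integral>om. Z om * sin (U om) \<partial>M) = 0" by (simp add: LIMSEQ_const_iff)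
 then show "(\<integral>om. Z om * sin ((\<Sum>j\<in>J. \<theta> j * nu j om) + \<phi>) \<partial>M) = 0" by (simp add: U_def)
qed

section \<open>The filter driven by the primitive variables\<close>

text \<open>The recursion \<open>kX\<close>, \<open>kf\<close>, \<open>ky\<close> describes state, estimate and
 output as functions of the primitive variables, without any probability space, so that it can be evaluated on
 two of them.\<close>
locale kfilter = hat +
 fixes eX :: rvec and Sg V :: rmat
 assumes eX: "dim_vec eX = nX g" and Sg: "Sg \<in> carrier_mat (nX g) (nX g)" and V: "V \<in> carrier_mat (ny g) (ny g)"
  and innov: "invertible_mat (agg_D g * Sg * tr (agg_D g) + V)"
begin

abbreviation "d \<equiv> nX g"
definition "Lam = agg_D g * Sg * tr (agg_D g) + V"
definition "Lk = agg_A g * Sg * tr (agg_D g) * inv_mat Lam"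
abbreviation "filt \<equiv> lti_filter g ew exi a b eX Sg V"

lemma sdims [simp]: "dim_row Sg = d" "dim_col Sg = d" "dim_row V = p" "dim_col V = p" "dim_vec eX = d" "dim_vec exi = p"
 using eX Sg V exi by auto

lemma Lam: "Lam \<in> carrier_mat p p" "inv_mat Lam \<in> carrier_mat p p" "inv_mat Lam * Lam = 1\<^sub>m p"
proof -
 show c: "Lam \<in> carrier_mat p p" by (auto simp: Lam_def intro: carrier_matI)
 obtain B where B: "inverts_mat B Lam" "inverts_mat Lam B" using innov by (auto simp: invertible_mat_def Lam_def)
 have Bc: "dim_col B = p" using arg_cong[OF B(2)[unfolded inverts_mat_def], of dim_col] c by simp
 have "v = 0\<^sub>v p" if v: "v \<in> carrier_vec p" "Lam *\<^sub>v v = 0\<^sub>v p" for v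
 proof -
  have r: "dim_row B = p" using arg_cong[OF B(1)[unfolded inverts_mat_def], of dim_col] c by simp
  have "v = (B * Lam) *\<^sub>v v" using B(1) v r by (simp add: inverts_mat_def one_mv)
  also have "\<dots> = B *\<^sub>v (Lam *\<^sub>v v)" using c v Bc by (subst mult_mv) auto
  also have "\<dots> = 0\<^sub>v p" using v r Bc by (intro eq_vecI) (auto simp: scalar_prod_def)
  finally show ?thesis .
 qed
 from inj_inverse[OF c this] show "inv_mat Lam \<in> carrier_mat p p" "inv_mat Lam * Lam = 1\<^sub>m p" by auto
qed

lemma Lam_dims [simp]: "dim_row Lam = p" "dim_col Lam = p" "dim_row (inv_mat Lam) = p" "dim_col (inv_mat Lam) = p"
 "dim_row Lk = d" "dim_col Lk = p"
 using Lam by (auto simp: Lk_def)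

lemma Lk_Lam: "Lk * Lam = agg_A g * Sg * tr (agg_D g)"
proof -
 have "Lk * Lam = (agg_A g * Sg * tr (agg_D g)) * (inv_mat Lam * Lam)" unfolding Lk_def by (rule mat_assoc) auto
 then show ?thesis using Lam(3) by simp
qed

lemma filt_dim [simp]: "dim_vec (filt t y) = d"
 by (cases t) (simp_all add: Let_def Lam_def[symmetric])

lemma filt_Suc: assumes y: "dim_vec (y t) = p"
 shows "filt (Suc t) y = nextX (filt t y) + (agg_C g + Lk) *\<^sub>v (y t - pred (filt t y))"
proof -
 let ?f = "filt t y"
 have p: "pred ?f = agg_D g *\<^sub>v ?f + (lim_Gp g a *\<^sub>v ?f + lim_Hp g ew b) + exi" by (rule hat_step) simp
 have "y t - (agg_D g + lim_Gp g a) *\<^sub>v ?f - lim_Hp g ew b - exi = y t - pred ?f"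
  unfolding p using y by (simp add: mv_simps) (intro eq_vecI, auto)
 then have "filt (Suc t) y = agg_A g *\<^sub>v ?f + lim_GX g a *\<^sub>v ?f + lim_HX g ew b + agg_C g *\<^sub>v y t + stack g ew + Lk *\<^sub>v (y t - pred ?f)"
  by (simp add: Let_def Lam_def[symmetric] Lk_def[symmetric])
 then show ?thesis unfolding nextX_def using y by (simp add: mv_simps) (intro eq_vecI, auto)
qed

lemma filt_cong: "(!!k. k < t ==> y k = y' k) ==> filt t y = filt t y'"
 by (induction t) (auto simp: Let_def)

lemma filt_restrict: "filt t (restrict y {..<t}) = filt t y" "t \<le> s ==> filt t (restrict y {..<s}) = filt t y"
 by (auto intro!: filt_cong)

primrec kst :: "rvec => (nat => rvec) => (nat => rvec) => nat => rvec \<times> rvec" where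
 "kst x0 u w 0 = (x0, eX)"
| "kst x0 u w (Suc t) = (let (X, f) = kst x0 u w t; y = agg_D g *\<^sub>v X + (lim_Gp g a *\<^sub>v f + lim_Hp g ew b) + u t in
  (agg_A g *\<^sub>v X + (lim_GX g a *\<^sub>v f + lim_HX g ew b) + agg_C g *\<^sub>v y + w t,
   nextX f + (agg_C g + Lk) *\<^sub>v (y - pred f)))"

definition "kX x0 u w t = fst (kst x0 u w t)"
definition "kf x0 u w t = snd (kst x0 u w t)"
definition "ky x0 u w t = agg_D g *\<^sub>v kX x0 u w t + (lim_Gp g a *\<^sub>v kf x0 u w t + lim_Hp g ew b) + u t"

lemma k_simps: "kX x0 u w 0 = x0" "kf x0 u w 0 = eX"
 "kX x0 u w (Suc t) = agg_A g *\<^sub>v kX x0 u w t + (lim_GX g a *\<^sub>v kf x0 u w t + lim_HX g ew b) + agg_C g *\<^sub>v ky x0 u w t + w t"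
 "kf x0 u w (Suc t) = nextX (kf x0 u w t) + (agg_C g + Lk) *\<^sub>v (ky x0 u w t - pred (kf x0 u w t))"
 by (auto simp: kX_def kf_def ky_def Let_def case_prod_unfold)

context
 fixes x0 :: rvec and u w :: "nat => rvec" assumes x0: "dim_vec x0 = d" and u: "!!t. dim_vec (u t) = p" and w: "!!t. dim_vec (w t) = d"
begin

lemma k_dims: "dim_vec (kX x0 u w t) = d" "dim_vec (ky x0 u w t) = p" "dim_vec (kf x0 u w t) = d"
proof -
 show "dim_vec (kX x0 u w t) = d" by (cases t) (simp_all add: k_simps x0 w)
 show y: "dim_vec (ky x0 u w t) = p" for t by (simp add: ky_def u)
 show "dim_vec (kf x0 u w t) = d" by (cases t) (simp_all add: k_simps y)
qed

lemma kf_filt: "kf x0 u w t = filt t (ky x0 u w)"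
 by (induction t) (simp_all add: k_simps filt_Suc k_dims del: lti_filter.simps(2))

end

lemma error_rec:
 fixes x0 :: rvec and u w :: "nat => rvec"
 assumes x0: "dim_vec x0 = d" and u: "!!t. dim_vec (u t) = p" and w: "!!t. dim_vec (w t) = d"
 defines "e \<equiv> \<lambda>t. kX x0 u w t - kf x0 u w t" and "n \<equiv> \<lambda>t. ky x0 u w t - pred (kf x0 u w t)"
 shows "e 0 = x0 - eX" "n t = agg_D g *\<^sub>v e t + (u t - exi)" "e (Suc t) = agg_A g *\<^sub>v e t - Lk *\<^sub>v n t + (w t - stack g ew)"
proof -
 note kd = k_dims[of x0 u w, OF x0 u w]
 have p: "pred (kf x0 u w t) = agg_D g *\<^sub>v kf x0 u w t + (lim_Gp g a *\<^sub>v kf x0 u w t + lim_Hp g ew b) + exi" for t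
  by (rule hat_step) (simp add: kd)
 show "e 0 = x0 - eX" by (simp add: e_def k_simps)
 show "n t = agg_D g *\<^sub>v e t + (u t - exi)"
  unfolding n_def e_def p ky_def using kd[of t] u[of t] by (simp add: mv_simps) (intro eq_vecI, auto)
 have nd: "dim_vec (n t) = p" by (simp add: n_def)
 have "(agg_C g + Lk) *\<^sub>v n t = agg_C g *\<^sub>v ky x0 u w t - agg_C g *\<^sub>v pred (kf x0 u w t) + Lk *\<^sub>v n t"
  using nd kd[of t] by (simp add: add_mv) (simp add: n_def mv_diff)
 then have "kf x0 u w (Suc t) = nextX (kf x0 u w t) + (agg_C g *\<^sub>v ky x0 u w t - agg_C g *\<^sub>v pred (kf x0 u w t) + Lk *\<^sub>v n t)"
  by (simp add: k_simps n_def)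
 then show "e (Suc t) = agg_A g *\<^sub>v e t - Lk *\<^sub>v n t + (w t - stack g ew)"
  unfolding e_def k_simps nextX_def using kd[of t] w[of t] nd by (simp add: mv_diff) (intro eq_vecI, auto)
qed

end

section \<open>Second moments of vectors\<close>

text \<open>The matrix of mixed second moments; for centred vectors this is the cross covariance.\<close>
definition cmat :: "'a measure => nat => nat => ('a => rvec) => ('a => rvec) => rmat" where
 "cmat M r c U Z = mat r c (\<lambda>(k,l). \<integral>om. U om $ k * Z om $ l \<partial>M)"

definition L2v :: "'a measure => nat => ('a => rvec) => bool" where
 "L2v M n U \<longleftrightarrow> (\<forall>om\<in>space M. dim_vec (U om) = n) \<and> (\<forall>k<n. L2 M (\<lambda>om. U om $ k))"

lemma cmat_dim [simp]: "dim_row (cmat M r c U Z) = r" "dim_col (cmat M r c U Z) = c" by (auto simp: cmat_def)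
lemma cov_mat_dim [simp]: "dim_row (cov_mat M n X) = n" "dim_col (cov_mat M n X) = n" by (auto simp: cov_mat_def)
lemma cmat_tr: "tr (cmat M r c U Z) = cmat M c r Z U" by (intro eq_matI) (auto simp: cmat_def mult.commute)

lemma L2v_mult: "L2v M r U ==> L2v M c Z ==> k < r ==> l < c ==> integrable M (\<lambda>om. U om $ k * Z om $ l)"
 unfolding L2v_def by (intro L2_mult) auto

lemma L2v_mv: assumes U: "L2v M n U" and A: "dim_col A = n" "dim_row A = r" shows "L2v M r (\<lambda>om. A *\<^sub>v U om)"
 unfolding L2v_def
proof (intro conjI allI impI)
 fix k assume k: "k < r"
 have "L2 M (\<lambda>om. (A *\<^sub>v U om) $ k) \<longleftrightarrow> L2 M (\<lambda>om. \<Sum>j<n. A $$ (k,j) * U om $ j)"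
  using U A k by (intro L2_cong mv_index) (auto simp: L2v_def)
 then show "L2 M (\<lambda>om. (A *\<^sub>v U om) $ k)" using U by (auto simp: L2v_def intro!: L2_sum L2_cmult)
qed (use A in auto)

lemma L2v_add: assumes U: "L2v M n U" and Z: "L2v M n Z" shows "L2v M n (\<lambda>om. U om + Z om)"
 unfolding L2v_def
proof (intro conjI allI impI)
 fix k assume k: "k < n"
 have "L2 M (\<lambda>om. (U om + Z om) $ k) \<longleftrightarrow> L2 M (\<lambda>om. U om $ k + Z om $ k)"
  using Z k by (intro L2_cong) (auto simp: L2v_def)
 then show "L2 M (\<lambda>om. (U om + Z om) $ k)" using U Z k by (auto simp: L2v_def intro!: L2_add)
qed (use U Z in \<open>auto simp: L2v_def\<close>)

lemma L2v_diff: assumes U: "L2v M n U" and Z: "L2v M n Z" shows "L2v M n (\<lambda>om. U om - Z om)"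
 unfolding L2v_def
proof (intro conjI allI impI)
 fix k assume k: "k < n"
 have "L2 M (\<lambda>om. (U om - Z om) $ k) \<longleftrightarrow> L2 M (\<lambda>om. U om $ k - Z om $ k)"
  using Z k by (intro L2_cong) (auto simp: L2v_def)
 then show "L2 M (\<lambda>om. (U om - Z om) $ k)" using U Z k by (auto simp: L2v_def intro!: L2_diff)
qed (use U Z in \<open>auto simp: L2v_def\<close>)

lemma L2v_const: "finite_measure M ==> dim_vec c = n ==> L2v M n (\<lambda>om. c)"
 by (auto simp: L2v_def intro: L2_const)

lemma cmat_mv_left: assumes U: "L2v M n U" and Z: "L2v M c Z" and A: "dim_col A = n" "dim_row A = r"
 shows "cmat M r c (\<lambda>om. A *\<^sub>v U om) Z = A * cmat M n c U Z"
proof (rule eq_matI)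
 fix k l assume "k < dim_row (A * cmat M n c U Z)" "l < dim_col (A * cmat M n c U Z)"
 then have kl: "k < r" "l < c" using A by auto
 have mvi: "(A *\<^sub>v U om) $ k = (\<Sum>j<n. A $$ (k,j) * U om $ j)" if "om \<in> space M" for om
  using U A kl that by (intro mv_index) (auto simp: L2v_def)
 have "(\<integral>om. (A *\<^sub>v U om) $ k * Z om $ l \<partial>M) = (\<integral>om. (\<Sum>j<n. A $$ (k,j) * (U om $ j * Z om $ l)) \<partial>M)"
  by (intro Bochner_Integration.integral_cong refl) (simp add: mvi sum_distrib_right mult.assoc del: index_mult_mat_vec)
 also have "\<dots> = (\<Sum>j<n. A $$ (k,j) * (\<integral>om. U om $ j * Z om $ l \<partial>M))"
  using L2v_mult[OF U Z] kl by (subst Bochner_Integration.integral_sum) auto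
 finally show "cmat M r c (\<lambda>om. A *\<^sub>v U om) Z $$ (k,l) = (A * cmat M n c U Z) $$ (k,l)"
  using kl A by (auto simp: cmat_def scalar_prod_def lessThan_atLeast0)
qed (use A in auto)

lemma cmat_add_left: assumes U: "L2v M r U" "L2v M r U'" and Z: "L2v M c Z"
 shows "cmat M r c (\<lambda>om. U om + U' om) Z = cmat M r c U Z + cmat M r c U' Z"
proof (rule eq_matI)
 fix k l assume "k < dim_row (cmat M r c U Z + cmat M r c U' Z)" "l < dim_col (cmat M r c U Z + cmat M r c U' Z)"
 then have kl: "k < r" "l < c" by auto
 have "(\<integral>om. (U om + U' om) $ k * Z om $ l \<partial>M) = (\<integral>om. U om $ k * Z om $ l + U' om $ k * Z om $ l \<partial>M)"
  using U kl by (intro Bochner_Integration.integral_cong refl) (auto simp: L2v_def algebra_simps)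
 then show "cmat M r c (\<lambda>om. U om + U' om) Z $$ (k,l) = (cmat M r c U Z + cmat M r c U' Z) $$ (k,l)"
  using kl L2v_mult[OF U(1) Z kl] L2v_mult[OF U(2) Z kl] by (simp add: cmat_def)
qed auto

lemma cmat_diff_left: assumes U: "L2v M r U" "L2v M r U'" and Z: "L2v M c Z"
 shows "cmat M r c (\<lambda>om. U om - U' om) Z = cmat M r c U Z - cmat M r c U' Z"
proof (rule eq_matI)
 fix k l assume "k < dim_row (cmat M r c U Z - cmat M r c U' Z)" "l < dim_col (cmat M r c U Z - cmat M r c U' Z)"
 then have kl: "k < r" "l < c" by auto
 have "(\<integral>om. (U om - U' om) $ k * Z om $ l \<partial>M) = (\<integral>om. U om $ k * Z om $ l - U' om $ k * Z om $ l \<partial>M)"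
  using U kl by (intro Bochner_Integration.integral_cong refl) (auto simp: L2v_def algebra_simps)
 then show "cmat M r c (\<lambda>om. U om - U' om) Z $$ (k,l) = (cmat M r c U Z - cmat M r c U' Z) $$ (k,l)"
  using kl L2v_mult[OF U(1) Z kl] L2v_mult[OF U(2) Z kl] by (simp add: cmat_def)
qed auto

lemma cmat_cong: "(!!om. om \<in> space M ==> U om = U' om) ==> (!!om. om \<in> space M ==> Z om = Z' om) ==> cmat M r c U Z = cmat M r c U' Z'"
 unfolding cmat_def by (intro eq_matI) (auto intro!: Bochner_Integration.integral_cong)

section \<open>Orthogonality of the innovations\<close>

text \<open>Centred random vectors whose entries are affine in the primitive family. Equality is only required
 on the space, because stacking is unspecified elsewhere.\<close>
definition affv :: "'a measure => 'i set => ('i => 'a => real) => nat => ('a => rvec) => bool" where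
 "affv M I F n U \<longleftrightarrow> (\<forall>om\<in>space M. dim_vec (U om) = n) \<and>
  (\<forall>k<n. \<exists>f. aff I F f \<and> (\<forall>om\<in>space M. U om $ k = f om) \<and> (\<integral>om. f om \<partial>M) = 0)"

locale kal = kfilter +
 fixes M :: "'a measure" and X0 :: "'a => rvec" and W xi :: "nat => 'a => rvec"
 assumes prob: "prob_space M"
  and indep: "prob_space.indep_vars M (\<lambda>q. borel_vec (prim_dim g q)) (prim_var X0 W xi) UNIV"
  and ident: "!!t. distr M (borel_vec (nX g)) (W t) = distr M (borel_vec (nX g)) (W 0)"
   "!!t. distr M (borel_vec (ny g)) (xi t) = distr M (borel_vec (ny g)) (xi 0)"
  and gauss: "jointly_gaussian M {(q, k). k < prim_dim g q} (\<lambda>(q, k) om. prim_var X0 W xi q om $ k)"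
  and eX_def: "eX = mean_vec M (nX g) X0"
  and ew_mean: "stack g ew = mean_vec M (nX g) (W 0)"
  and exi_def: "exi = mean_vec M (ny g) (xi 0)"
  and V_def: "V = cov_mat M (ny g) (xi 0)"
  and cov0: "cov_mat M (nX g) X0 = Sg"
  and stationary: "Sg = agg_A g * (Sg - Sg * tr (agg_D g) *
   inv_mat (agg_D g * Sg * tr (agg_D g) + V) * agg_D g * Sg) * tr (agg_A g)
   + cov_mat M (nX g) (W 0)"
begin

sublocale prob_space M by (rule prob)

abbreviation "PI \<equiv> {(q, k). k < prim_dim g q}"
abbreviation "PV \<equiv> (\<lambda>(q, k) om. prim_var X0 W xi q om $ k)"

lemma prim_meas: "prim_var X0 W xi q \<in> M \<rightarrow>\<^sub>M borel_vec (prim_dim g q)"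
 using indep unfolding indep_vars_def by auto

lemma meas: "X0 \<in> M \<rightarrow>\<^sub>M borel_vec d" "W t \<in> M \<rightarrow>\<^sub>M borel_vec d" "xi t \<in> M \<rightarrow>\<^sub>M borel_vec p"
 using prim_meas[of Init] prim_meas[of "Dist t"] prim_meas[of "Obs t"] by auto

lemma sp_dims: assumes "om \<in> space M" shows "dim_vec (X0 om) = d" "dim_vec (W t om) = d" "dim_vec (xi t om) = p"
 using borel_vecD(2)[OF meas(1) assms] borel_vecD(2)[OF meas(2) assms] borel_vecD(2)[OF meas(3) assms] by auto

lemma affv_L2v: assumes "affv M PI PV n U" shows "L2v M n U"
 unfolding L2v_def
proof (intro conjI allI impI ballI)
 show "dim_vec (U om) = n" if "om \<in> space M" for om using assms that by (auto simp: affv_def)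
 fix k assume k: "k < n"
 then obtain f where f: "aff PI PV f" "!!om. om \<in> space M ==> U om $ k = f om" using assms unfolding affv_def by blast
 show "L2 M (\<lambda>om. U om $ k)" using gaussian_L2[OF prob aff_gaussian[OF prob gauss f(1)]] L2_cong[of M "\<lambda>om. U om $ k" f] f(2) by blast
qed

lemma aff_integrable: "aff PI PV f ==> integrable M f"
 using L2_integrable[OF finite_measure_axioms gaussian_L2[OF prob aff_gaussian[OF prob gauss]]] .

lemma affv_cong: "(!!om. om \<in> space M ==> U om = U' om) ==> affv M PI PV r U' ==> affv M PI PV r U"
 unfolding affv_def by simp

lemma affv_add: assumes U: "affv M PI PV n U" and Z: "affv M PI PV n Z" shows "affv M PI PV n (\<lambda>om. U om + Z om)"
 unfolding affv_def
proof (intro conjI allI impI ballI)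
 show "dim_vec (U om + Z om) = n" if "om \<in> space M" for om using Z that by (auto simp: affv_def)
 fix k assume k: "k < n"
 obtain f where f: "aff PI PV f" "!!om. om \<in> space M ==> U om $ k = f om" "(\<integral>om. f om \<partial>M) = 0" using U k unfolding affv_def by blast
 obtain h where h: "aff PI PV h" "!!om. om \<in> space M ==> Z om $ k = h om" "(\<integral>om. h om \<partial>M) = 0" using Z k unfolding affv_def by blast
 have dz: "!!om. om \<in> space M ==> dim_vec (Z om) = n" using Z by (auto simp: affv_def)
 show "\<exists>f. aff PI PV f \<and> (\<forall>om\<in>space M. (U om + Z om) $ k = f om) \<and> (\<integral>om. f om \<partial>M) = 0"
  using f h k dz aff_integrable[OF f(1)] aff_integrable[OF h(1)] aff_add[OF f(1) h(1)]
  by (intro exI[of _ "\<lambda>om. f om + h om"]) auto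
qed

lemma affv_mv: assumes U: "affv M PI PV n U" and A: "dim_col A = n" "dim_row A = r" shows "affv M PI PV r (\<lambda>om. A *\<^sub>v U om)"
 unfolding affv_def
proof (intro conjI allI impI ballI)
 show "dim_vec (A *\<^sub>v U om) = r" for om using A by simp
 fix k assume k: "k < r"
 have "\<forall>j<n. \<exists>f. aff PI PV f \<and> (\<forall>om\<in>space M. U om $ j = f om) \<and> (\<integral>om. f om \<partial>M) = 0" using U unfolding affv_def by blast
 then obtain f where f: "!!j. j < n ==> aff PI PV (f j)" "!!j om. j < n ==> om \<in> space M ==> U om $ j = f j om" "!!j. j < n ==> (\<integral>om. f j om \<partial>M) = 0"
  by metis
 have dU: "!!om. om \<in> space M ==> dim_vec (U om) = n" using U by (auto simp: affv_def)
 have "(\<integral>om. (\<Sum>j<n. A $$ (k,j) * f j om) \<partial>M) = 0"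
  using aff_integrable[OF f(1)] f(3) by (subst Bochner_Integration.integral_sum) auto
 moreover have "aff PI PV (\<lambda>om. \<Sum>j<n. A $$ (k,j) * f j om)" using f(1) by (intro aff_sum aff_cmult) auto
 moreover have "(A *\<^sub>v U om) $ k = (\<Sum>j<n. A $$ (k,j) * f j om)" if "om \<in> space M" for om
  using that k A dU[OF that] f(2) by (simp add: mv_index[of _ n] del: index_mult_mat_vec)
 ultimately show "\<exists>f. aff PI PV f \<and> (\<forall>om\<in>space M. (A *\<^sub>v U om) $ k = f om) \<and> (\<integral>om. f om \<partial>M) = 0" by blast
qed

lemma affv_diff: assumes U: "affv M PI PV n U" and Z: "affv M PI PV n Z" shows "affv M PI PV n (\<lambda>om. U om - Z om)"
proof -
 have "affv M PI PV n (\<lambda>om. U om + (- 1\<^sub>m n) *\<^sub>v Z om)" using U Z by (intro affv_add affv_mv) auto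
 moreover have "U om - Z om = U om + (- 1\<^sub>m n) *\<^sub>v Z om" if "om \<in> space M" for om
  using that Z by (auto simp: affv_def uminus_mv one_mv intro!: eq_vecI)
 ultimately show ?thesis by (rule affv_cong[rotated])
qed

definition "e t om = kX (X0 om) (\<lambda>t. xi t om) (\<lambda>t. W t om) t - kf (X0 om) (\<lambda>t. xi t om) (\<lambda>t. W t om) t"
definition "n t om = ky (X0 om) (\<lambda>t. xi t om) (\<lambda>t. W t om) t - pred (kf (X0 om) (\<lambda>t. xi t om) (\<lambda>t. W t om) t)"
definition "xc t om = xi t om - exi"
definition "wc t om = W t om - stack g ew"

lemma rec: assumes "om \<in> space M"
 shows "e 0 om = X0 om - eX" "n t om = agg_D g *\<^sub>v e t om + xc t om" "e (Suc t) om = agg_A g *\<^sub>v e t om - Lk *\<^sub>v n t om + wc t om"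
 unfolding e_def n_def xc_def wc_def using sp_dims[OF assms] by (auto intro!: error_rec)

lemma distr_mean_cov:
 assumes m: "U \<in> M \<rightarrow>\<^sub>M borel_vec r" "U' \<in> M \<rightarrow>\<^sub>M borel_vec r" and d: "distr M (borel_vec r) U = distr M (borel_vec r) U'"
 shows "mean_vec M r U = mean_vec M r U'" "cov_mat M r U = cov_mat M r U'"
proof -
 have c: "(\<lambda>v. v $ k) \<in> borel_measurable (borel_vec r)" if "k < r" for k
  using borel_vecD(3)[OF measurable_ident that] by simp
 have i: "(\<integral>om. f (U om) \<partial>M) = (\<integral>om. f (U' om) \<partial>M)" if "f \<in> borel_measurable (borel_vec r)" for f :: "rvec => real"
  using integral_distr[OF m(1) that] integral_distr[OF m(2) that] d by simp
 show me: "mean_vec M r U = mean_vec M r U'" unfolding mean_vec_def using i[OF c] by (intro vec_cong) auto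
 show "cov_mat M r U = cov_mat M r U'" unfolding cov_mat_def me
  using c by (intro eq_matI) (auto intro!: i borel_measurable_times borel_measurable_diff)
qed

lemma W_mean_cov: "mean_vec M d (W t) = stack g ew" "cov_mat M d (W t) = cov_mat M d (W 0)"
 using distr_mean_cov[OF meas(2) meas(2) ident(1)] ew_mean by auto
lemma xi_mean_cov: "mean_vec M p (xi t) = exi" "cov_mat M p (xi t) = V"
 using distr_mean_cov[OF meas(3) meas(3) ident(2)] exi_def V_def by auto

lemma prim_centered:
 assumes m: "mean_vec M (prim_dim g q) (prim_var X0 W xi q) = c"
 shows "affv M PI PV (prim_dim g q) (\<lambda>om. prim_var X0 W xi q om - c)"
  "cmat M (prim_dim g q) (prim_dim g q) (\<lambda>om. prim_var X0 W xi q om - c) (\<lambda>om. prim_var X0 W xi q om - c) = cov_mat M (prim_dim g q) (prim_var X0 W xi q)"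
proof -
 have cd: "dim_vec c = prim_dim g q" using m by (auto simp: mean_vec_def)
 have ck: "c $ k = (\<integral>om. prim_var X0 W xi q om $ k \<partial>M)" if "k < prim_dim g q" for k
  using that by (simp add: m[symmetric] mean_vec_def)
 show "affv M PI PV (prim_dim g q) (\<lambda>om. prim_var X0 W xi q om - c)"
  unfolding affv_def
 proof (intro conjI allI impI ballI)
  show "dim_vec (prim_var X0 W xi q om - c) = prim_dim g q" for om using cd by simp
  fix k assume k: "k < prim_dim g q"
  have a: "aff PI PV (\<lambda>om. prim_var X0 W xi q om $ k)" using aff_var[of "(q,k)" PI PV] k by simp
  show "\<exists>f. aff PI PV f \<and> (\<forall>om\<in>space M. (prim_var X0 W xi q om - c) $ k = f om) \<and> (\<integral>om. f om \<partial>M) = 0"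
   using aff_diff[OF a aff_const] k cd aff_integrable[OF a] ck[OF k] prob_space
   by (intro exI[of _ "\<lambda>om. prim_var X0 W xi q om $ k - c $ k"]) auto
 qed
 show "cmat M (prim_dim g q) (prim_dim g q) (\<lambda>om. prim_var X0 W xi q om - c) (\<lambda>om. prim_var X0 W xi q om - c) = cov_mat M (prim_dim g q) (prim_var X0 W xi q)"
  unfolding cov_mat_def cmat_def m using cd by (intro eq_matI) auto
qed

lemma prim_uncorr:
 assumes q: "q \<noteq> q'" and m: "mean_vec M (prim_dim g q) (prim_var X0 W xi q) = c" "mean_vec M (prim_dim g q') (prim_var X0 W xi q') = c'"
 shows "cmat M (prim_dim g q) (prim_dim g q') (\<lambda>om. prim_var X0 W xi q om - c) (\<lambda>om. prim_var X0 W xi q' om - c') = 0\<^sub>m (prim_dim g q) (prim_dim g q')"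
proof (rule eq_matI)
 fix k l assume "k < dim_row (0\<^sub>m (prim_dim g q) (prim_dim g q') :: rmat)" "l < dim_col (0\<^sub>m (prim_dim g q) (prim_dim g q') :: rmat)"
 then have kl: "k < prim_dim g q" "l < prim_dim g q'" by auto
 have cd: "dim_vec c = prim_dim g q" "dim_vec c' = prim_dim g q'" using m by (auto simp: mean_vec_def)
 let ?U = "\<lambda>om. prim_var X0 W xi q om $ k - c $ k" and ?Z = "\<lambda>om. prim_var X0 W xi q' om $ l - c' $ l"
 have iv: "indep_var (PiM {q} (\<lambda>q. borel_vec (prim_dim g q))) (\<lambda>om. restrict (\<lambda>q. prim_var X0 W xi q om) {q})
   (PiM {q'} (\<lambda>q. borel_vec (prim_dim g q))) (\<lambda>om. restrict (\<lambda>q. prim_var X0 W xi q om) {q'})"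
  by (rule indep_var_restrict[OF indep]) (use q in auto)
 have c: "(\<lambda>v. v q $ k - x) \<in> borel_measurable (PiM {q} (\<lambda>q. borel_vec (prim_dim g q)))" if "k < prim_dim g q" for k q x
  using borel_vecD(3)[OF measurable_component_singleton[of q "{q}" "\<lambda>q. borel_vec (prim_dim g q)"] that] by simp
 have "indep_var borel ((\<lambda>v. v q $ k - c $ k) \<circ> (\<lambda>om. restrict (\<lambda>q. prim_var X0 W xi q om) {q}))
   borel ((\<lambda>v. v q' $ l - c' $ l) \<circ> (\<lambda>om. restrict (\<lambda>q. prim_var X0 W xi q om) {q'}))"
  using kl by (intro indep_var_compose[OF iv] c)
 then have iv2: "indep_var borel ?U borel ?Z" by (simp add: o_def)
 have a: "aff PI PV (\<lambda>om. prim_var X0 W xi q om $ k - c $ k)" using aff_diff[OF aff_var[of "(q,k)" PI PV] aff_const] kl by simp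
 have a': "aff PI PV (\<lambda>om. prim_var X0 W xi q' om $ l - c' $ l)" using aff_diff[OF aff_var[of "(q',l)" PI PV] aff_const] kl by simp
 have i: "integrable M (\<lambda>om. prim_var X0 W xi q om $ k)" using aff_integrable[OF aff_var[of "(q,k)" PI PV]] kl by simp
 have z: "(\<integral>om. ?U om \<partial>M) = 0" using i m(1) kl prob_space by (simp add: m(1)[symmetric] mean_vec_def)
 have "(\<integral>om. ?U om * ?Z om \<partial>M) = (\<integral>om. ?U om \<partial>M) * (\<integral>om. ?Z om \<partial>M)"
  by (rule indep_var_lebesgue_integral[OF iv2 aff_integrable[OF a] aff_integrable[OF a']])
 then show "cmat M (prim_dim g q) (prim_dim g q') (\<lambda>om. prim_var X0 W xi q om - c) (\<lambda>om. prim_var X0 W xi q' om - c') $$ (k,l) = 0\<^sub>m (prim_dim g q) (prim_dim g q') $$ (k,l)"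
  using kl cd z by (simp add: cmat_def)
qed auto

abbreviation "CM r c \<equiv> cmat M r c"

lemma aff_noise: "affv M PI PV p (xc t)" "affv M PI PV d (wc t)" "affv M PI PV d (\<lambda>om. X0 om - eX)"
 using prim_centered(1)[of "Obs t"] prim_centered(1)[of "Dist t"] prim_centered(1)[of Init] xi_mean_cov W_mean_cov eX_def
 by (auto simp: xc_def[abs_def] wc_def[abs_def])

lemma cov_noise: "CM p p (xc t) (xc t) = V" "CM d d (wc t) (wc t) = cov_mat M d (W 0)" "CM d d (\<lambda>om. X0 om - eX) (\<lambda>om. X0 om - eX) = Sg"
 "t \<noteq> s ==> CM p p (xc t) (xc s) = 0\<^sub>m p p" "t \<noteq> s ==> CM d d (wc t) (wc s) = 0\<^sub>m d d" "CM d p (wc t) (xc s) = 0\<^sub>m d p"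
 "CM d p (\<lambda>om. X0 om - eX) (xc s) = 0\<^sub>m d p" "CM d d (\<lambda>om. X0 om - eX) (wc s) = 0\<^sub>m d d" "CM p d (xc t) (wc s) = 0\<^sub>m p d"
 using prim_centered(2)[of "Obs t"] prim_centered(2)[of "Dist t"] prim_centered(2)[of Init] xi_mean_cov W_mean_cov eX_def cov0
  prim_uncorr[of "Obs t" "Obs s"] prim_uncorr[of "Dist t" "Dist s"] prim_uncorr[of "Dist t" "Obs s"]
  prim_uncorr[of Init "Obs s"] prim_uncorr[of Init "Dist s"] prim_uncorr[of "Obs t" "Dist s"]
 by (auto simp: xc_def[abs_def] wc_def[abs_def])

lemma aff_en: "affv M PI PV d (e t)" "affv M PI PV p (n t)"
proof -
 show e: "affv M PI PV d (e t)" for t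
 proof (induction t)
  case 0 show ?case using aff_noise(3) by (rule affv_cong[rotated]) (rule rec(1))
 next
  case (Suc t)
  have "affv M PI PV p (\<lambda>om. agg_D g *\<^sub>v e t om + xc t om)" using Suc by (intro affv_add affv_mv aff_noise) auto
  then have "affv M PI PV p (n t)" by (rule affv_cong[rotated]) (rule rec(2))
  then have "affv M PI PV d (\<lambda>om. agg_A g *\<^sub>v e t om - Lk *\<^sub>v n t om + wc t om)" using Suc by (intro affv_add affv_diff affv_mv aff_noise) auto
  then show ?case by (rule affv_cong[rotated]) (rule rec(3))
 qed
 have "affv M PI PV p (\<lambda>om. agg_D g *\<^sub>v e t om + xc t om)" using e by (intro affv_add affv_mv aff_noise) auto
 then show "affv M PI PV p (n t)" by (rule affv_cong[rotated]) (rule rec(2))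
qed

lemmas L2_en = affv_L2v[OF aff_en(1)] affv_L2v[OF aff_en(2)] affv_L2v[OF aff_noise(1)] affv_L2v[OF aff_noise(2)]

lemma CM_n: assumes Z: "L2v M c Z" shows "CM p c (n t) Z = agg_D g * CM d c (e t) Z + CM p c (xc t) Z"
proof -
 have "CM p c (n t) Z = CM p c (\<lambda>om. agg_D g *\<^sub>v e t om + xc t om) Z" by (rule cmat_cong[OF rec(2) refl])
 also have "\<dots> = CM p c (\<lambda>om. agg_D g *\<^sub>v e t om) Z + CM p c (xc t) Z" by (intro cmat_add_left L2v_mv[OF L2_en(1)] L2_en Z) auto
 also have "CM p c (\<lambda>om. agg_D g *\<^sub>v e t om) Z = agg_D g * CM d c (e t) Z" by (rule cmat_mv_left[OF L2_en(1) Z]) auto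
 finally show ?thesis .
qed

lemma CM_e: assumes Z: "L2v M c Z" shows "CM d c (e (Suc t)) Z = agg_A g * CM d c (e t) Z - Lk * CM p c (n t) Z + CM d c (wc t) Z"
proof -
 have "CM d c (e (Suc t)) Z = CM d c (\<lambda>om. (agg_A g *\<^sub>v e t om - Lk *\<^sub>v n t om) + wc t om) Z" by (rule cmat_cong[OF rec(3) refl])
 also have "\<dots> = CM d c (\<lambda>om. agg_A g *\<^sub>v e t om - Lk *\<^sub>v n t om) Z + CM d c (wc t) Z"
  by (intro cmat_add_left L2v_diff L2v_mv[OF L2_en(1)] L2v_mv[OF L2_en(2)] L2_en Z) auto
 also have "CM d c (\<lambda>om. agg_A g *\<^sub>v e t om - Lk *\<^sub>v n t om) Z = CM d c (\<lambda>om. agg_A g *\<^sub>v e t om) Z - CM d c (\<lambda>om. Lk *\<^sub>v n t om) Z"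
  by (intro cmat_diff_left L2v_mv[OF L2_en(1)] L2v_mv[OF L2_en(2)] Z) auto
 also have "CM d c (\<lambda>om. agg_A g *\<^sub>v e t om) Z = agg_A g * CM d c (e t) Z" by (rule cmat_mv_left[OF L2_en(1) Z]) auto
 also have "CM d c (\<lambda>om. Lk *\<^sub>v n t om) Z = Lk * CM p c (n t) Z" by (rule cmat_mv_left[OF L2_en(2) Z]) auto
 finally show ?thesis .
qed

lemma zero_mats: "dim_col A = r ==> dim_row A = q ==> A * 0\<^sub>m r c = (0\<^sub>m q c :: rmat)"
 "dim_row A = r ==> dim_col A = c ==> A + 0\<^sub>m r c = A" "dim_row A = r ==> dim_col A = c ==> A - 0\<^sub>m r c = A"
 "dim_row A = r ==> dim_col A = c ==> 0\<^sub>m r c + A = A"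
 by (auto intro!: eq_matI simp: scalar_prod_def)

lemma future: "t \<le> s ==> CM d p (e t) (xc s) = 0\<^sub>m d p \<and> CM d d (e t) (wc s) = 0\<^sub>m d d"
proof (induction t)
 case 0
 have "CM d p (e 0) (xc s) = CM d p (\<lambda>om. X0 om - eX) (xc s)" "CM d d (e 0) (wc s) = CM d d (\<lambda>om. X0 om - eX) (wc s)"
  by (rule cmat_cong[OF rec(1) refl]; assumption)+
 then show ?case using cov_noise by simp
next
 case (Suc t)
 then have IH: "CM d p (e t) (xc s) = 0\<^sub>m d p" "CM d d (e t) (wc s) = 0\<^sub>m d d" and ts: "t \<noteq> s" by auto
 have "CM p p (n t) (xc s) = 0\<^sub>m p p" "CM p d (n t) (wc s) = 0\<^sub>m p d"
  using ts by (simp_all add: CM_n[OF L2_en(3)] CM_n[OF L2_en(4)] IH cov_noise zero_mats)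
 then show ?case using ts by (simp add: CM_e[OF L2_en(3)] CM_e[OF L2_en(4)] IH cov_noise zero_mats) 
qed

lemma future_n: "t < s ==> CM p p (n t) (xc s) = 0\<^sub>m p p" "t \<le> s ==> CM p d (n t) (wc s) = 0\<^sub>m p d"
 using future[of t s] by (simp_all add: CM_n[OF L2_en(3)] CM_n[OF L2_en(4)] cov_noise zero_mats)

lemma CM_sym: "CM r c U Z = tr (CM c r Z U)" by (rule cmat_tr[symmetric])

text \<open>One step of the covariance recursion: with error covariance \<open>Sg\<close> the gain
 \<open>Lk\<close> is exactly the regression coefficient, so the next error is uncorrelated with the
 innovation.\<close>
lemma en_cov:
 assumes S: "CM d d (e t) (e t) = Sg"
 shows "CM p d (n t) (e t) = agg_D g * Sg" "CM p p (n t) (n t) = Lam" "CM d p (e (Suc t)) (n t) = 0\<^sub>m d p"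
proof -
 have "CM p d (xc t) (e t) = 0\<^sub>m p d" using future[of t t] by (subst CM_sym) simp
 then show ne: "CM p d (n t) (e t) = agg_D g * Sg" by (simp add: CM_n[OF L2_en(1)] S zero_mats)
 have Ss: "tr Sg = Sg" using cmat_tr[of M d d "e t" "e t"] S by simp
 have en: "CM d p (e t) (n t) = Sg * tr (agg_D g)" by (subst CM_sym) (simp add: ne tr_mult Ss)
 have "CM p p (n t) (xc t) = V" using future[of t t] by (simp add: CM_n[OF L2_en(3)] cov_noise zero_mats)
 moreover have Vs: "tr V = V" using cmat_tr[of M p p "xc t" "xc t"] by (simp add: cov_noise)
 ultimately have "CM p p (xc t) (n t) = V" by (subst CM_sym) simp
 then show nn: "CM p p (n t) (n t) = Lam" by (simp add: CM_n[OF L2_en(2)] en Lam_def mat_assoc)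
 have "CM d p (wc t) (n t) = 0\<^sub>m d p" using future_n(2)[of t t] by (subst CM_sym) simp
 then have "CM d p (e (Suc t)) (n t) = agg_A g * (Sg * tr (agg_D g)) - Lk * Lam" by (simp add: CM_e[OF L2_en(2)] en nn zero_mats)
 then show "CM d p (e (Suc t)) (n t) = 0\<^sub>m d p" by (simp add: Lk_Lam mat_assoc) (intro eq_matI, auto)
qed

text \<open>The Riccati equation for \<open>Sg\<close> is the fixed-point equation of the error covariance, and
 the initial covariance starts there.\<close>
lemma Sg_cov: "CM d d (e t) (e t) = Sg"
proof (induction t)
 case 0
 have "CM d d (e 0) (e 0) = CM d d (\<lambda>om. X0 om - eX) (\<lambda>om. X0 om - eX)" by (rule cmat_cong[OF rec(1) rec(1)])
 then show ?case by (simp add: cov_noise)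
next
 case (Suc t)
 note c = en_cov[OF Suc]
 let ?A = "agg_A g" and ?D = "agg_D g"
 have "CM d d (wc t) (e t) = 0\<^sub>m d d" using future[of t t] by (subst CM_sym) simp
 then have "CM d d (e (Suc t)) (e t) = ?A * Sg - Lk * (?D * Sg)"
  by (simp add: CM_e[OF L2_en(1)] Suc c(1) zero_mats)
 then have 1: "CM d d (e t) (e (Suc t)) = tr (?A * Sg - Lk * (?D * Sg))" by (subst CM_sym) simp
 have 2: "CM p d (n t) (e (Suc t)) = 0\<^sub>m p d" by (subst CM_sym) (simp add: c(3))
 have "CM d d (e (Suc t)) (wc t) = cov_mat M d (W 0)"
  using future[of t t] future_n(2)[of t t] by (simp add: CM_e[OF L2_en(4)] cov_noise zero_mats)
 moreover have Ws: "tr (cov_mat M d (W 0)) = cov_mat M d (W 0)" using cmat_tr[of M d d "wc t" "wc t"] by (simp add: cov_noise)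
 ultimately have 3: "CM d d (wc t) (e (Suc t)) = cov_mat M d (W 0)" by (subst CM_sym) simp
 have dW: "dim_row (cov_mat M d (W 0)) = d" "dim_col (cov_mat M d (W 0)) = d" by (auto simp: cov_mat_def)
 have "CM d d (e (Suc t)) (e (Suc t)) = ?A * tr (?A * Sg - Lk * (?D * Sg)) + cov_mat M d (W 0)"
  using dW by (simp add: CM_e[OF L2_en(1)] 1 2 3 zero_mats)
 also have "?A * tr (?A * Sg - Lk * (?D * Sg)) = (?A * Sg - Lk * (?D * Sg)) * tr ?A"
 proof -
  have "CM d d (e (Suc t)) (e (Suc t)) = tr (CM d d (e (Suc t)) (e (Suc t)))" by (rule CM_sym)
  then have "?A * tr (?A * Sg - Lk * (?D * Sg)) + cov_mat M d (W 0) = (?A * Sg - Lk * (?D * Sg)) * tr ?A + cov_mat M d (W 0)"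
   unfolding \<open>CM d d (e (Suc t)) (e (Suc t)) = ?A * tr (?A * Sg - Lk * (?D * Sg)) + cov_mat M d (W 0)\<close>
   using dW by (simp add: tr_add tr_mult Ws)
  then have "(?A * tr (?A * Sg - Lk * (?D * Sg)) + cov_mat M d (W 0)) - cov_mat M d (W 0) = ((?A * Sg - Lk * (?D * Sg)) * tr ?A + cov_mat M d (W 0)) - cov_mat M d (W 0)" by simp
  moreover have "X + Y - Y = X" if "dim_row X = d" "dim_col X = d" "dim_row Y = d" "dim_col Y = d" for X Y :: rmat
   using that by (intro eq_matI) auto
  ultimately show ?thesis using dW by simp
 qed
 also have "?A * Sg - Lk * (?D * Sg) = ?A * (Sg - Sg * tr ?D * inv_mat Lam * ?D * Sg)"
 proof -
  have "?A * (Sg - Sg * tr ?D * inv_mat Lam * ?D * Sg) = ?A * Sg - ?A * (Sg * tr ?D * inv_mat Lam * ?D * Sg)"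
   by (rule mult_minus_distrib_mat[of _ d d _ d]) (auto intro: carrier_matI)
  then show ?thesis by (simp add: Lk_def mat_assoc)
 qed
 also have "?A * (Sg - Sg * tr ?D * inv_mat Lam * ?D * Sg) * tr ?A + cov_mat M d (W 0) = Sg"
  using stationary by (simp add: Lam_def)
 finally show ?case .
qed

text \<open>The error inherits being uncorrelated with older innovations through the linear recursion.\<close>
lemma past: "k < t ==> CM d p (e t) (n k) = 0\<^sub>m d p"
proof (induction t)
 case (Suc t)
 show ?case
 proof (cases "k = t")
  case True then show ?thesis using en_cov(3)[OF Sg_cov] by simp
 next
  case False
  then have kt: "k < t" using Suc by simp
  have "CM d p (wc t) (n k) = 0\<^sub>m d p" "CM p p (xc t) (n k) = 0\<^sub>m p p"
   using future_n(2)[of k t] future_n(1)[of k t] kt by (subst CM_sym, simp)+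
  then show ?thesis using Suc.IH[OF kt] by (simp add: CM_e[OF L2_en(2)] CM_n[OF L2_en(2)] zero_mats) 
 qed
qed simp

lemma past_n: "k < t ==> CM p p (n t) (n k) = 0\<^sub>m p p"
proof -
 assume kt: "k < t"
 have "CM p p (xc t) (n k) = 0\<^sub>m p p" using future_n(1)[OF kt] by (subst CM_sym, simp)
 then show ?thesis using past[OF kt] by (simp add: CM_n[OF L2_en(2)] zero_mats)
qed

end

section \<open>Orthogonality to the past of the observations\<close>

lemma int0_cong: "(!!om. om \<in> space M ==> f om = h om) ==> (\<integral>om. h om \<partial>M) = 0 ==> (\<integral>om. f om \<partial>M) = (0 :: real)"
 by (simp cong: Bochner_Integration.integral_cong)

lemma past_algebra_props:
 fixes Y :: "nat => 'a => rvec"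
 assumes Y: "!!k. Y k \<in> M \<rightarrow>\<^sub>M borel_vec q"
 shows "subalgebra M (past_algebra M q Y t)"
  "(\<lambda>om. \<lambda>k\<in>{..<t}. Y k om) \<in> past_algebra M q Y t \<rightarrow>\<^sub>M (\<Pi>\<^sub>M k\<in>{..<t}. borel_vec q)"
  "(\<lambda>om. \<lambda>k\<in>{..<t}. Y k om) \<in> M \<rightarrow>\<^sub>M (\<Pi>\<^sub>M k\<in>{..<t}. borel_vec q)"
  "A \<in> sets (past_algebra M q Y t) \<longleftrightarrow> (\<exists>B\<in>sets (\<Pi>\<^sub>M k\<in>{..<t}. borel_vec q). A = (\<lambda>om. \<lambda>k\<in>{..<t}. Y k om) -` B \<inter> space M)"
proof -
 let ?T = "\<lambda>om. \<lambda>k\<in>{..<t}. Y k om"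
 show T: "?T \<in> M \<rightarrow>\<^sub>M (\<Pi>\<^sub>M k\<in>{..<t}. borel_vec q)" using Y by (intro measurable_restrict) auto
 then have sp: "?T \<in> space M \<rightarrow> space (\<Pi>\<^sub>M k\<in>{..<t}. borel_vec q)" by (auto dest: measurable_space)
 show s: "A \<in> sets (past_algebra M q Y t) \<longleftrightarrow> (\<exists>B\<in>sets (\<Pi>\<^sub>M k\<in>{..<t}. borel_vec q). A = ?T -` B \<inter> space M)" for A
  unfolding past_algebra_def using sets_vimage_algebra2[OF sp] by auto
 show "subalgebra M (past_algebra M q Y t)"
  unfolding subalgebra_def using s measurable_sets[OF T] by (auto simp: past_algebra_def)
 show "?T \<in> past_algebra M q Y t \<rightarrow>\<^sub>M (\<Pi>\<^sub>M k\<in>{..<t}. borel_vec q)"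
  unfolding past_algebra_def using sp by (rule measurable_vimage_algebra1)
qed

text \<open>Vanishing against all indicators of past events means vanishing conditional expectation, which
 extends to square-integrable multipliers.\<close>
lemma orth_past_L2:
 fixes Y :: "nat => 'a => rvec"
 assumes M: "prob_space M" and Y: "!!k. Y k \<in> M \<rightarrow>\<^sub>M borel_vec q" and D: "L2 M D"
  and 0: "!!B. B \<in> sets (\<Pi>\<^sub>M k\<in>{..<t}. borel_vec q) ==> (\<integral>om. D om * indicator B (\<lambda>k\<in>{..<t}. Y k om) \<partial>M) = 0"
  and v: "v \<in> borel_measurable (\<Pi>\<^sub>M k\<in>{..<t}. borel_vec q)" and vL: "L2 M (\<lambda>om. v (\<lambda>k\<in>{..<t}. Y k om))"
 shows "(\<integral>om. D om * v (\<lambda>k\<in>{..<t}. Y k om) \<partial>M) = 0"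
proof -
 interpret prob_space M by (rule M)
 let ?F = "past_algebra M q Y t" and ?T = "\<lambda>om. \<lambda>k\<in>{..<t}. Y k om"
 note pa = past_algebra_props[where Y = Y and M = M and q = q and t = t, OF Y]
 interpret finite_measure_subalgebra M ?F by unfold_locales (rule pa(1))
 have Di: "integrable M D" by (rule L2_integrable[OF finite_measure_axioms D])
 have "AE om in M. real_cond_exp M ?F D om = 0"
 proof (rule real_cond_exp_charact)
  fix A assume "A \<in> sets ?F"
  then obtain B where B: "B \<in> sets (\<Pi>\<^sub>M k\<in>{..<t}. borel_vec q)" "A = ?T -` B \<inter> space M" using pa(4) by auto
  have "(\<integral>om\<in>A. D om \<partial>M) = (\<integral>om. D om * indicator B (?T om) \<partial>M)"
   unfolding set_lebesgue_integral_def B(2) by (intro Bochner_Integration.integral_cong) (auto simp: indicator_def)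
  then show "(\<integral>om\<in>A. D om \<partial>M) = (\<integral>om\<in>A. 0 \<partial>M)" using 0[OF B(1)] by (simp add: set_lebesgue_integral_def)
 qed (use Di in auto)
 moreover have "(\<integral>om. v (?T om) * real_cond_exp M ?F D om \<partial>M) = (\<integral>om. v (?T om) * D om \<partial>M)"
 proof (rule real_cond_exp_intg(2))
  show "integrable M (\<lambda>om. v (?T om) * D om)" by (rule L2_mult[OF vL D])
  show "(\<lambda>om. v (?T om)) \<in> borel_measurable ?F" by (rule measurable_compose[OF pa(2) v])
 qed (use Di in auto)
 moreover have "(\<integral>om. v (?T om) * real_cond_exp M ?F D om \<partial>M) = (\<integral>om. 0 \<partial>M)"
  using calculation(1) measurable_compose[OF pa(3) v] by (intro integral_cong_AE) auto
 ultimately show ?thesis by (simp add: mult.commute)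
qed

context hat
begin
lemma borel_pred: "f \<in> NN \<rightarrow>\<^sub>M borel_vec (nX g) ==> (\<lambda>om. pred (f om)) \<in> NN \<rightarrow>\<^sub>M borel_vec p"
 "f \<in> NN \<rightarrow>\<^sub>M borel_vec (nX g) ==> (\<lambda>om. vv (f om) k) \<in> NN \<rightarrow>\<^sub>M borel_vec p"
 unfolding pred_def vv_def by (intro borel_vec_intros; simp)+
lemma borel_nextX: "f \<in> NN \<rightarrow>\<^sub>M borel_vec (nX g) ==> (\<lambda>om. nextX (f om)) \<in> NN \<rightarrow>\<^sub>M borel_vec (nX g)"
 unfolding nextX_def by (intro borel_vec_intros borel_pred[THEN borel_vec_mv]; simp)
end

context hat
begin
lemma borel_update:
 assumes f: "f \<in> NN \<rightarrow>\<^sub>M borel_vec (nX g)" and y: "y \<in> NN \<rightarrow>\<^sub>M borel_vec p" and K: "dim_row K = nX g" "dim_col K = p"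
 shows "(\<lambda>om. nextX (f om) + K *\<^sub>v (y om - pred (f om))) \<in> NN \<rightarrow>\<^sub>M borel_vec (nX g)"
 by (rule borel_vec_add[OF borel_nextX[OF f] borel_vec_mv[OF borel_vec_diff[OF y borel_pred(1)[OF f]] K]])
end

context kfilter
begin

lemma filt_measurable: "filt t \<in> (\<Pi>\<^sub>M k\<in>{..<t}. borel_vec p) \<rightarrow>\<^sub>M borel_vec d"
proof -
 have "s \<le> t ==> filt s \<in> (\<Pi>\<^sub>M k\<in>{..<t}. borel_vec p) \<rightarrow>\<^sub>M borel_vec d" for s
 proof (induction s)
  case 0 show ?case by (simp add: borel_vec_const)
 next
  case (Suc s)
  let ?P = "\<Pi>\<^sub>M k\<in>{..<t}. borel_vec p"
  have c: "(\<lambda>y. y s) \<in> ?P \<rightarrow>\<^sub>M borel_vec p" using Suc.prems by (intro measurable_component_singleton) auto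
  have "filt (Suc s) y = nextX (filt s y) + (agg_C g + Lk) *\<^sub>v (y s - pred (filt s y))" if "y \<in> space ?P" for y
   using borel_vecD(2)[OF c that] by (rule filt_Suc)
  moreover have "(\<lambda>y. nextX (filt s y) + (agg_C g + Lk) *\<^sub>v (y s - pred (filt s y))) \<in> ?P \<rightarrow>\<^sub>M borel_vec d"
   using Suc c by (intro borel_update) auto
  ultimately show ?case by (subst measurable_cong)
 qed
 then show ?thesis by blast
qed

abbreviation "PL \<equiv> borel_vec d \<Otimes>\<^sub>M (\<Pi>\<^sub>M t\<in>UNIV. borel_vec p) \<Otimes>\<^sub>M (\<Pi>\<^sub>M t\<in>UNIV. borel_vec d)"

lemma PL_comp: "(\<lambda>(x,u,w). x) \<in> PL \<rightarrow>\<^sub>M borel_vec d" "(\<lambda>(x,u,w). u t) \<in> PL \<rightarrow>\<^sub>M borel_vec p" "(\<lambda>(x,u,w). w t) \<in> PL \<rightarrow>\<^sub>M borel_vec d"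
proof -
 show "(\<lambda>(x,u,w). x) \<in> PL \<rightarrow>\<^sub>M borel_vec d" by simp
 have "(\<lambda>z. fst (snd z) t) \<in> PL \<rightarrow>\<^sub>M borel_vec p"
  by (rule measurable_compose[OF measurable_compose[OF measurable_snd measurable_fst] measurable_component_singleton]) simp
 then show "(\<lambda>(x,u,w). u t) \<in> PL \<rightarrow>\<^sub>M borel_vec p" by (simp add: case_prod_unfold)
 have "(\<lambda>z. snd (snd z) t) \<in> PL \<rightarrow>\<^sub>M borel_vec d"
  by (rule measurable_compose[OF measurable_compose[OF measurable_snd measurable_snd] measurable_component_singleton]) simp
 then show "(\<lambda>(x,u,w). w t) \<in> PL \<rightarrow>\<^sub>M borel_vec d" by (simp add: case_prod_unfold)
qed

lemma k_measurable: "(\<lambda>(x,u,w). kX x u w t) \<in> PL \<rightarrow>\<^sub>M borel_vec d" "(\<lambda>(x,u,w). kf x u w t) \<in> PL \<rightarrow>\<^sub>M borel_vec d"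
 "(\<lambda>(x,u,w). ky x u w t) \<in> PL \<rightarrow>\<^sub>M borel_vec p"
proof -
 note c = PL_comp[unfolded case_prod_unfold]
 have y: "(\<lambda>z. ky (fst z) (fst (snd z)) (snd (snd z)) t) \<in> PL \<rightarrow>\<^sub>M borel_vec p"
  if "(\<lambda>z. kX (fst z) (fst (snd z)) (snd (snd z)) t) \<in> PL \<rightarrow>\<^sub>M borel_vec d" "(\<lambda>z. kf (fst z) (fst (snd z)) (snd (snd z)) t) \<in> PL \<rightarrow>\<^sub>M borel_vec d" for t
  unfolding ky_def using that by (intro borel_vec_intros c) auto
 have "(\<lambda>z. kX (fst z) (fst (snd z)) (snd (snd z)) t) \<in> PL \<rightarrow>\<^sub>M borel_vec d \<and> (\<lambda>z. kf (fst z) (fst (snd z)) (snd (snd z)) t) \<in> PL \<rightarrow>\<^sub>M borel_vec d"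
 proof (induction t)
  case 0 show ?case using c(1) by (simp add: k_simps borel_vec_const)
 next
  case (Suc t)
  then have "(\<lambda>z. kX (fst z) (fst (snd z)) (snd (snd z)) t) \<in> PL \<rightarrow>\<^sub>M borel_vec d" "(\<lambda>z. kf (fst z) (fst (snd z)) (snd (snd z)) t) \<in> PL \<rightarrow>\<^sub>M borel_vec d" by auto
  note h = this and h3 = y[OF this]
  show ?case unfolding k_simps
  proof
   show "(\<lambda>z. nextX (kf (fst z) (fst (snd z)) (snd (snd z)) t) + (agg_C g + Lk) *\<^sub>v
     (ky (fst z) (fst (snd z)) (snd (snd z)) t - pred (kf (fst z) (fst (snd z)) (snd (snd z)) t))) \<in> PL \<rightarrow>\<^sub>M borel_vec d"
    using h(2) h3 by (rule borel_update) auto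
  qed (rule borel_vec_add[OF borel_vec_add[OF borel_vec_add[OF borel_vec_mv[OF h(1)] borel_vec_add[OF borel_vec_mv[OF h(2)] borel_vec_const]] borel_vec_mv[OF h3]] c(3)]; simp)
 qed
 with y show "(\<lambda>(x,u,w). kX x u w t) \<in> PL \<rightarrow>\<^sub>M borel_vec d" "(\<lambda>(x,u,w). kf x u w t) \<in> PL \<rightarrow>\<^sub>M borel_vec d"
 "(\<lambda>(x,u,w). ky x u w t) \<in> PL \<rightarrow>\<^sub>M borel_vec p" by (auto simp: case_prod_unfold)
qed

end

context kal
begin

definition "prims om = (X0 om, (\<lambda>t. xi t om), (\<lambda>t. W t om))"
definition "Xs t om = kX (X0 om) (\<lambda>t. xi t om) (\<lambda>t. W t om) t"
definition "Fe t om = kf (X0 om) (\<lambda>t. xi t om) (\<lambda>t. W t om) t"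
definition "Y t om = ky (X0 om) (\<lambda>t. xi t om) (\<lambda>t. W t om) t"

lemma prims_measurable: "prims \<in> M \<rightarrow>\<^sub>M PL"
 unfolding prims_def by (intro measurable_Pair measurable_PiM_single' meas) (auto simp: space_PiM PiE_def dest: measurable_space[OF meas(2)] measurable_space[OF meas(3)])

lemma Y_measurable: "Y t \<in> M \<rightarrow>\<^sub>M borel_vec p" "Fe t \<in> M \<rightarrow>\<^sub>M borel_vec d" "Xs t \<in> M \<rightarrow>\<^sub>M borel_vec d"
 using measurable_compose[OF prims_measurable k_measurable(1)] measurable_compose[OF prims_measurable k_measurable(2)]
  measurable_compose[OF prims_measurable k_measurable(3)]
 by (simp_all add: Y_def[abs_def] Fe_def[abs_def] Xs_def[abs_def] prims_def)

lemma Ydims: "om \<in> space M ==> dim_vec (Y t om) = p" "om \<in> space M ==> dim_vec (Fe t om) = d" "om \<in> space M ==> dim_vec (Xs t om) = d"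
 using borel_vecD(2)[OF Y_measurable(1)] borel_vecD(2)[OF Y_measurable(2)] borel_vecD(2)[OF Y_measurable(3)] by auto

lemma n_dim [simp]: "dim_vec (n t om) = p" by (simp add: n_def)

lemma Y_eq: "om \<in> space M ==> Y t om = pred (Fe t om) + n t om"
 unfolding n_def Y_def[symmetric] Fe_def[symmetric] using Ydims(1)[of om t] by (intro eq_vecI) auto
lemma Fe_rec: "Fe 0 om = eX" "Fe (Suc t) om = nextX (Fe t om) + (agg_C g + Lk) *\<^sub>v n t om"
 by (simp_all add: Fe_def n_def k_simps)
lemma Fe_filt: "om \<in> space M ==> Fe t om = filt t (\<lambda>k. Y k om)"
 unfolding Fe_def Y_def[abs_def] using sp_dims by (intro kf_filt) auto
lemma Xs_eq: "om \<in> space M ==> Xs t om = Fe t om + e t om"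
 unfolding e_def Xs_def[symmetric] Fe_def[symmetric] using Ydims[of om t] by (intro eq_vecI) auto

lemma chain_measurable:
 assumes NN: "space NN = space M" and n: "!!k. k < t ==> n k \<in> NN \<rightarrow>\<^sub>M borel_vec p"
 shows "k \<le> t ==> Fe k \<in> NN \<rightarrow>\<^sub>M borel_vec d" "k < t ==> Y k \<in> NN \<rightarrow>\<^sub>M borel_vec p"
proof -
 show F: "k \<le> t ==> Fe k \<in> NN \<rightarrow>\<^sub>M borel_vec d" for k
 proof (induction k)
  case 0 show ?case unfolding Fe_rec[abs_def] by (simp add: borel_vec_const)
 next
  case (Suc k)
  then show ?case using n[of k] unfolding Fe_rec[abs_def] by (intro borel_vec_intros borel_nextX) auto
 qed
 assume k: "k < t"
 have "(\<lambda>om. pred (Fe k om) + n k om) \<in> NN \<rightarrow>\<^sub>M borel_vec p"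
  using k by (intro borel_vec_add borel_pred(1) F n) auto
 then show "Y k \<in> NN \<rightarrow>\<^sub>M borel_vec p" using Y_eq NN by (subst measurable_cong) auto
qed

lemma L2_pred: "L2v M d U ==> L2v M p (\<lambda>om. vv (U om) k)" "L2v M d U ==> L2v M p (\<lambda>om. pred (U om))"
 unfolding pred_def vv_def by (intro L2v_add L2v_const finite_measure_axioms; (rule L2v_mv)?; simp)+

lemma L2_nextX: "L2v M d U ==> L2v M d (\<lambda>om. nextX (U om))"
 unfolding nextX_def by (intro L2v_add L2v_const finite_measure_axioms L2v_mv[of M d U] L2v_mv[OF L2_pred(2)]) auto

lemma L2v_cong: "(!!om. om \<in> space M ==> U om = U' om) ==> L2v M r U' ==> L2v M r U"
 unfolding L2v_def using L2_cong[of M "\<lambda>om. U om $ _" "\<lambda>om. U' om $ _"] by simp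

lemma L2_Fe: "L2v M d (Fe t)"
proof (induction t)
 case 0 show ?case unfolding Fe_rec[abs_def] by (intro L2v_const finite_measure_axioms) simp
next
 case (Suc t) then show ?case unfolding Fe_rec[abs_def] by (intro L2v_add L2_nextX L2v_mv[OF L2_en(2)]) auto
qed

lemma L2_Y: "L2v M p (Y t)"
 by (rule L2v_cong[OF Y_eq]) (auto intro!: L2v_add L2_pred L2_Fe L2_en)

lemma L2_Xs: "L2v M d (Xs t)"
 by (rule L2v_cong[OF Xs_eq]) (auto intro!: L2v_add L2_Fe L2_en)

text \<open>For Gaussian families, uncorrelated with the past innovations means orthogonal to their sigma
 algebra, and the observations are functions of the innovations.\<close>
lemma orth_event:
 assumes U: "affv M PI PV r U" and orth: "!!j. j < t ==> CM r p U (n j) = 0\<^sub>m r p" and k: "k < r"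
  and B: "B \<in> sets (\<Pi>\<^sub>M k\<in>{..<t}. borel_vec p)"
 shows "(\<integral>om. U om $ k * indicator B (\<lambda>k\<in>{..<t}. Y k om) \<partial>M) = 0"
proof -
 have "\<forall>j. \<forall>l<p. \<exists>f. aff PI PV f \<and> (\<forall>om\<in>space M. n j om $ l = f om) \<and> (\<integral>om. f om \<partial>M) = 0"
  using aff_en(2) unfolding affv_def by blast
 then obtain G where G: "!!j l. l < p ==> aff PI PV (G j l)" "!!j l om. l < p ==> om \<in> space M ==> n j om $ l = G j l om"
  by metis
 obtain f where f: "aff PI PV f" "!!om. om \<in> space M ==> U om $ k = f om" "(\<integral>om. f om \<partial>M) = 0" using U k unfolding affv_def by blast
 let ?J = "{..<t} \<times> {..<p}"
 define nu where "nu = (\<lambda>(j,l). G j l)"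
 let ?T = "\<lambda>om. \<lambda>j\<in>?J. nu j om"
 let ?P = "\<Pi>\<^sub>M j\<in>?J. (borel :: real measure)"
 have nu: "aff PI PV (nu j)" if "j \<in> ?J" for j using G(1) that by (auto simp: nu_def)
 define NN where "NN = vimage_algebra (space M) ?T ?P"
 have sp: "?T \<in> space M \<rightarrow> space ?P" by (auto simp: space_PiM)
 have sN: "space NN = space M" by (simp add: NN_def)
 have "n j \<in> NN \<rightarrow>\<^sub>M borel_vec p" if j: "j < t" for j
 proof (rule borel_vecI)
  show "n j om \<in> carrier_vec p" for om by (intro carrier_vecI) simp
  fix l assume l: "l < p"
  have "(\<lambda>om. ?T om (j,l)) \<in> borel_measurable NN"
   unfolding NN_def using j l by (intro measurable_compose[OF measurable_vimage_algebra1[OF sp] measurable_component_singleton]) auto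
  then show "(\<lambda>om. n j om $ l) \<in> borel_measurable NN"
   using j l G(2) sN by (subst measurable_cong[of NN _ "\<lambda>om. ?T om (j,l)"]) (auto simp: nu_def)
 qed
 then have YN: "(\<lambda>om. \<lambda>k\<in>{..<t}. Y k om) \<in> NN \<rightarrow>\<^sub>M (\<Pi>\<^sub>M k\<in>{..<t}. borel_vec p)"
  using chain_measurable(2)[OF sN, of t] by (intro measurable_restrict) auto
 have "(\<lambda>om. \<lambda>k\<in>{..<t}. Y k om) -` B \<inter> space M \<in> sets NN" using measurable_sets[OF YN B] sN by simp
 then obtain E where E: "E \<in> sets ?P" "(\<lambda>om. \<lambda>k\<in>{..<t}. Y k om) -` B \<inter> space M = ?T -` E \<inter> space M"
  unfolding NN_def sets_vimage_algebra2[OF sp] by blast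
 have "(\<integral>om. U om $ k * indicator B (\<lambda>k\<in>{..<t}. Y k om) \<partial>M) = (\<integral>om. f om * indicator E (?T om) \<partial>M)"
 proof (rule Bochner_Integration.integral_cong[OF refl])
  fix om assume om: "om \<in> space M"
  then have "(\<lambda>k\<in>{..<t}. Y k om) \<in> B \<longleftrightarrow> ?T om \<in> E" using E(2) by blast
  then show "U om $ k * indicator B (\<lambda>k\<in>{..<t}. Y k om) = f om * indicator E (?T om)" using f(2)[OF om] by (simp add: indicator_def)
 qed
 also have "\<dots> = 0"
 proof (rule gaussian_orth[OF prob gauss _ nu f(1) f(3) _ E(1)])
  fix j assume "j \<in> ?J"
  then obtain i l where j: "j = (i,l)" "i < t" "l < p" by auto
  have "(\<integral>om. U om $ k * n i om $ l \<partial>M) = CM r p U (n i) $$ (k,l)" using k j by (simp add: cmat_def)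
  also have "\<dots> = 0" using orth[OF j(2)] k j by simp
  finally show "(\<integral>om. f om * nu j om \<partial>M) = 0"
   by (rule int0_cong[rotated]) (use f(2) G(2) j in \<open>simp add: nu_def\<close>)
 qed auto
 finally show ?thesis .
qed

lemma e_orth: "B \<in> sets (\<Pi>\<^sub>M k\<in>{..<t}. borel_vec p) ==> k < d ==> (\<integral>om. e t om $ k * indicator B (\<lambda>k\<in>{..<t}. Y k om) \<partial>M) = 0"
 by (rule orth_event[OF aff_en(1)]) (auto intro: past)
lemma n_orth: "B \<in> sets (\<Pi>\<^sub>M k\<in>{..<t}. borel_vec p) ==> k < p ==> (\<integral>om. n t om $ k * indicator B (\<lambda>k\<in>{..<t}. Y k om) \<partial>M) = 0"
 by (rule orth_event[OF aff_en(2)]) (auto intro: past_n)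

lemma L2_indicator_mult: assumes "L2 M D" and B: "B \<in> sets (\<Pi>\<^sub>M k\<in>{..<t}. borel_vec p)"
 shows "integrable M (\<lambda>om. D om * indicator B (\<lambda>k\<in>{..<t}. Y k om))"
proof -
 have "(\<lambda>om. indicator B (\<lambda>k\<in>{..<t}. Y k om) :: real) \<in> borel_measurable M"
  using measurable_compose[OF past_algebra_props(3)[of Y M p t, OF Y_measurable(1)] borel_measurable_indicator[OF B]] .
 then show ?thesis
  using L2_integrable[OF finite_measure_axioms assms(1)]
  by (intro Bochner_Integration.integrable_bound[OF L2_integrable[OF finite_measure_axioms assms(1)]]) (auto simp: indicator_def)
qed

text \<open>Induction on the horizon: \<open>hat_step\<close> moves the prediction one step ahead, at the price
 of an innovation, which is orthogonal to the past.\<close>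
lemma predict_orth:
 assumes "B \<in> sets (\<Pi>\<^sub>M k\<in>{..<t}. borel_vec p)" "k < p"
 shows "(\<integral>om. (Y (t + m) om - vv (Fe t om) m) $ k * indicator B (\<lambda>k\<in>{..<t}. Y k om) \<partial>M) = 0"
 using assms
proof (induction m arbitrary: t B)
 case 0
 have "(Y (t + 0) om - vv (Fe t om) 0) $ k = n t om $ k" if "om \<in> space M" for om
  using Y_eq[OF that] 0 by (simp add: pred_def)
 then show ?case using n_orth[OF 0] by (intro int0_cong[OF _ n_orth[OF 0]]) (simp only:)
next
 case (Suc m)
 let ?R = "\<lambda>z. restrict z {..<t}"
 let ?B = "?R -` B \<inter> space (\<Pi>\<^sub>M k\<in>{..<Suc t}. borel_vec p)"
 let ?K = "a m * (agg_C g + Lk)"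
 have "?R \<in> (\<Pi>\<^sub>M k\<in>{..<Suc t}. borel_vec p) \<rightarrow>\<^sub>M (\<Pi>\<^sub>M k\<in>{..<t}. borel_vec p)"
  by (rule measurable_restrict_subset) auto
 then have B': "?B \<in> sets (\<Pi>\<^sub>M k\<in>{..<Suc t}. borel_vec p)" using Suc.prems(1) by (rule measurable_sets)
 have "om \<in> space M ==> (\<lambda>k\<in>{..<Suc t}. Y k om) \<in> space (\<Pi>\<^sub>M k\<in>{..<Suc t}. borel_vec p)" for om
  using Ydims(1) by (auto simp: space_PiM intro!: carrier_vecI)
 then have iB: "om \<in> space M ==> indicator ?B (\<lambda>k\<in>{..<Suc t}. Y k om) = (indicator B (\<lambda>k\<in>{..<t}. Y k om) :: real)" for om
  by (simp add: indicator_def restrict_def fun_eq_iff cong: if_cong)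
 have 1: "(\<integral>om. (Y (Suc t + m) om - vv (Fe (Suc t) om) m) $ k * indicator B (\<lambda>k\<in>{..<t}. Y k om) \<partial>M) = 0"
  by (rule int0_cong[OF _ Suc.IH[OF B' Suc.prems(2)]]) (simp only: iB)
 have Ka: "affv M PI PV p (\<lambda>om. ?K *\<^sub>v n t om)" by (rule affv_mv[OF aff_en(2)]) auto
 have "CM p p (\<lambda>om. ?K *\<^sub>v n t om) (n j) = 0\<^sub>m p p" if "j < t" for j
  using past_n[OF that] by (subst cmat_mv_left[OF L2_en(2) L2_en(2)]) (auto simp: zero_mats)
 from orth_event[OF Ka this Suc.prems(2,1)]
 have 2: "(\<integral>om. (?K *\<^sub>v n t om) $ k * indicator B (\<lambda>k\<in>{..<t}. Y k om) \<partial>M) = 0" .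
 have eq: "(Y (t + Suc m) om - vv (Fe t om) (Suc m)) $ k = (Y (Suc t + m) om - vv (Fe (Suc t) om) m) $ k + (?K *\<^sub>v n t om) $ k"
  if "om \<in> space M" for om
 proof -
  have "vv (Fe (Suc t) om) m = vv (nextX (Fe t om)) m + ?K *\<^sub>v n t om"
   unfolding Fe_rec vv_def by (simp add: mv_simps) (intro eq_vecI, auto)
  also have "vv (nextX (Fe t om)) m = vv (Fe t om) (Suc m)" using Ydims(2)[OF that] by (rule hat_step(2))
  finally show ?thesis using Suc.prems(2) Ydims(1)[OF that] by simp
 qed
 have "L2v M p (\<lambda>om. Y (Suc t + m) om - vv (Fe (Suc t) om) m)" by (intro L2v_diff L2_Y L2_pred L2_Fe)
 then have L1: "L2 M (\<lambda>om. (Y (Suc t + m) om - vv (Fe (Suc t) om) m) $ k)" using Suc.prems(2) by (simp add: L2v_def)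
 have L2: "L2 M (\<lambda>om. (?K *\<^sub>v n t om) $ k)" using affv_L2v[OF Ka] Suc.prems(2) by (simp add: L2v_def)
 have "(\<integral>om. (Y (t + Suc m) om - vv (Fe t om) (Suc m)) $ k * indicator B (\<lambda>k\<in>{..<t}. Y k om) \<partial>M) =
  (\<integral>om. (Y (Suc t + m) om - vv (Fe (Suc t) om) m) $ k * indicator B (\<lambda>k\<in>{..<t}. Y k om)
   + (?K *\<^sub>v n t om) $ k * indicator B (\<lambda>k\<in>{..<t}. Y k om) \<partial>M)"
  by (intro Bochner_Integration.integral_cong refl) (simp only: eq distrib_right)
 also have "\<dots> = 0" using L2_indicator_mult[OF L1 Suc.prems(1)] L2_indicator_mult[OF L2 Suc.prems(1)]
  by (subst Bochner_Integration.integral_add) (simp_all only: 1 2 add_0_left)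
 finally show ?case .
qed

text \<open>The prediction is an orthogonal projection of the future observation, whence Pythagoras.\<close>
lemma predict_L2:
 assumes k: "k < p" shows "(\<integral>om. (vv (Fe t om) m $ k)\<^sup>2 \<partial>M) \<le> (\<integral>om. (Y (t + m) om $ k)\<^sup>2 \<partial>M)"
proof -
 let ?D = "\<lambda>om. (Y (t + m) om - vv (Fe t om) m) $ k" and ?v = "\<lambda>om. vv (Fe t om) m $ k"
 have LD: "L2 M ?D" using L2v_diff[OF L2_Y L2_pred(1)[OF L2_Fe]] k by (auto simp: L2v_def)
 have Lv: "L2 M ?v" using L2_pred(1)[OF L2_Fe] k by (auto simp: L2v_def)
 have fv: "om \<in> space M ==> vv (filt t (\<lambda>k\<in>{..<t}. Y k om)) m = vv (Fe t om) m" for om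
  using Fe_filt[of om t] filt_restrict(1)[of t "\<lambda>k. Y k om"] by simp
 have "(\<integral>om. ?D om * (\<lambda>y. vv (filt t y) m $ k) (\<lambda>k\<in>{..<t}. Y k om) \<partial>M) = 0"
 proof (rule orth_past_L2[OF prob Y_measurable(1) LD])
  show "(\<integral>om. ?D om * indicator B (\<lambda>k\<in>{..<t}. Y k om) \<partial>M) = 0" if "B \<in> sets (\<Pi>\<^sub>M k\<in>{..<t}. borel_vec p)" for B
   using predict_orth[OF that k] .
  show "(\<lambda>y. vv (filt t y) m $ k) \<in> borel_measurable (\<Pi>\<^sub>M k\<in>{..<t}. borel_vec p)"
   using borel_vecD(3)[OF borel_pred(2)[OF filt_measurable] k] .
  show "L2 M (\<lambda>om. vv (filt t (\<lambda>k\<in>{..<t}. Y k om)) m $ k)"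
   using Lv by (subst L2_cong[of M _ ?v]) (auto simp: fv)
 qed
 then have 0: "(\<integral>om. ?D om * ?v om \<partial>M) = 0" by (rule int0_cong[rotated]) (simp only: fv)
 have "(Y (t + m) om $ k)\<^sup>2 = (?v om)\<^sup>2 + (?D om)\<^sup>2 + 2 * (?D om * ?v om)" if "om \<in> space M" for om
  using k by (simp add: power2_eq_square algebra_simps)
 then have "(\<integral>om. (Y (t + m) om $ k)\<^sup>2 \<partial>M) = (\<integral>om. (?v om)\<^sup>2 + (?D om)\<^sup>2 + 2 * (?D om * ?v om) \<partial>M)"
  by (rule Bochner_Integration.integral_cong[OF refl])
 also have "\<dots> = (\<integral>om. (?v om)\<^sup>2 \<partial>M) + (\<integral>om. (?D om)\<^sup>2 \<partial>M) + 2 * (\<integral>om. ?D om * ?v om \<partial>M)"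
 proof -
  have "integrable M (\<lambda>om. (?v om)\<^sup>2)" "integrable M (\<lambda>om. (?D om)\<^sup>2)" "integrable M (\<lambda>om. ?D om * ?v om)"
   using LD Lv L2_mult[OF LD Lv] by (auto simp: L2_def)
  then show ?thesis by (simp del: index_minus_vec)
 qed
 finally show ?thesis using 0 by (simp del: index_minus_vec)
qed

end

section \<open>The auxiliary process\<close>

lemma borel_vec_eq_sets:
 assumes f: "f \<in> NN \<rightarrow>\<^sub>M borel_vec q" and h: "h \<in> NN \<rightarrow>\<^sub>M borel_vec q"
 shows "{z \<in> space NN. f z = h z} \<in> sets NN"
proof -
 have "{z \<in> space NN. f z = h z} = {z \<in> space NN. \<forall>k\<in>{..<q}. f z $ k = h z $ k}"
  using borel_vecD(2)[OF f] borel_vecD(2)[OF h] by (auto intro!: eq_vecI)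
 also have "\<dots> \<in> sets NN"
 proof (rule sets.sets_Collect_finite_All)
  fix k assume "k \<in> {..<q}"
  then have [measurable]: "(\<lambda>z. f z $ k) \<in> borel_measurable NN" "(\<lambda>z. h z $ k) \<in> borel_measurable NN"
   using borel_vecD(3)[OF f] borel_vecD(3)[OF h] by auto
  show "{z \<in> space NN. f z $ k = h z $ k} \<in> sets NN" by measurable
 qed simp
 finally show ?thesis .
qed

context kfilter
begin
abbreviation "KX t z \<equiv> kX (fst z) (fst (snd z)) (snd (snd z)) t"
abbreviation "KF t z \<equiv> kf (fst z) (fst (snd z)) (snd (snd z)) t"
abbreviation "KY t z \<equiv> ky (fst z) (fst (snd z)) (snd (snd z)) t"

lemma K_measurable: "KX t \<in> PL \<rightarrow>\<^sub>M borel_vec d" "KF t \<in> PL \<rightarrow>\<^sub>M borel_vec d" "KY t \<in> PL \<rightarrow>\<^sub>M borel_vec p"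
 using k_measurable by (simp_all add: case_prod_unfold)

lemma KF_filt: assumes "z \<in> space PL" shows "KF t z = filt t (\<lambda>k. KY k z)"
 using borel_vecD(2)[OF PL_comp(1) assms] borel_vecD(2)[OF PL_comp(2) assms] borel_vecD(2)[OF PL_comp(3) assms]
 by (intro kf_filt) (auto simp: case_prod_unfold)
end

context kal
begin

lemma PL_prims: "KX t (prims om) = Xs t om" "KF t (prims om) = Fe t om" "KY t (prims om) = Y t om"
 by (simp_all add: prims_def Xs_def Fe_def Y_def)

text \<open>The auxiliary process is, almost surely, the recursion driven by the filter; hence any version of
 the conditional expectations agrees with the filter along the observations.\<close>
lemma est_eq:
 fixes M' :: "'b measure"
 assumes M': "prob_space M'" and aux: "aux_process g ew a b M' Xb yb xib Wb"
  and law: "prim_law g M' (Xb 0) xib Wb = prim_law g M X0 xi W"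
  and est: "cond_exp_map g M' Xb yb h"
 shows "AE om in M. \<forall>t. h t (\<lambda>k\<in>{..<t}. Y k om) = Fe t om"
proof -
 interpret M': prob_space M' by (rule M')
 define pr where "pr om = (Xb 0 om, (\<lambda>t. xib t om), (\<lambda>t. Wb t om))" for om
 have am: "Xb t \<in> M' \<rightarrow>\<^sub>M borel_vec d" "yb t \<in> M' \<rightarrow>\<^sub>M borel_vec p" "xib t \<in> M' \<rightarrow>\<^sub>M borel_vec p" "Wb t \<in> M' \<rightarrow>\<^sub>M borel_vec d" for t
  using aux by (auto simp: aux_process_def)
 have prm: "pr \<in> M' \<rightarrow>\<^sub>M PL"
  unfolding pr_def by (intro measurable_Pair measurable_PiM_single' am) (auto simp: space_PiM PiE_def dest: measurable_space[OF am(4)] measurable_space[OF am(3)])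
 have L: "distr M' PL pr = distr M PL prims"
  using law unfolding prim_law_def pr_def[abs_def] prims_def[abs_def] .
 have tint: "(\<integral>om. F (pr om) \<partial>M') = (\<integral>om. F (prims om) \<partial>M)" and tintg: "integrable M' (\<lambda>om. F (pr om)) \<longleftrightarrow> integrable M (\<lambda>om. F (prims om))"
  if F: "F \<in> borel_measurable PL" for F :: "_ => real"
  using integral_distr[OF prm F] integral_distr[OF prims_measurable F] integrable_distr_eq[OF prm F] integrable_distr_eq[OF prims_measurable F] L by auto
 have tAE: "(AE om in M'. Q (pr om)) \<longleftrightarrow> (AE om in M. Q (prims om))" if "{z \<in> space PL. Q z} \<in> sets PL" for Q
  unfolding AE_distr_iff[OF prm that, symmetric] AE_distr_iff[OF prims_measurable that, symmetric] L ..
 let ?F = "\<lambda>t. past_algebra M' p yb t"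
 note pa = past_algebra_props[where Y = yb and M = M' and q = p, OF am(2)]
 have cond: "AE om in M'. cond_exp_vec M' (?F t) d (Xb t) om = KF t (pr om)"
  if H: "AE om in M'. Xb t om = KX t (pr om) \<and> (\<forall>k<t. yb k om = KY k (pr om))" for t
 proof -
  interpret S: finite_measure_subalgebra M' "?F t" by unfold_locales (rule pa(1))
  let ?T = "\<lambda>om. \<lambda>k\<in>{..<t}. yb k om"
  have Ff: "AE om in M'. filt t (?T om) = KF t (pr om) \<and> ?T om = (\<lambda>k\<in>{..<t}. KY k (pr om)) \<and> Xb t om = KX t (pr om)"
   using H AE_space
  proof eventually_elim
   case (elim om)
   then have T: "?T om = (\<lambda>k\<in>{..<t}. KY k (pr om))" by auto
   have "KF t (pr om) = filt t (\<lambda>k. KY k (pr om))" using measurable_space[OF prm] elim by (intro KF_filt) auto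
   then show ?case using elim T filt_restrict(1)[of t "\<lambda>k. KY k (pr om)"] by simp
  qed
  have comp: "AE om in M'. real_cond_exp M' (?F t) (\<lambda>om. Xb t om $ k) om = filt t (?T om) $ k" if k: "k < d" for k
  proof (rule S.real_cond_exp_charact)
   have m1: "(\<lambda>om. Xb t om $ k) \<in> borel_measurable M'" using borel_vecD(3)[OF am(1) k] .
   have fm: "(\<lambda>y. filt t y $ k) \<in> borel_measurable (\<Pi>\<^sub>M k\<in>{..<t}. borel_vec p)" using borel_vecD(3)[OF filt_measurable k] .
   show "(\<lambda>om. filt t (?T om) $ k) \<in> borel_measurable (?F t)" by (rule measurable_compose[OF pa(2) fm])
   have m2: "(\<lambda>om. filt t (?T om) $ k) \<in> borel_measurable M'" by (rule measurable_compose[OF pa(3) fm])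
   have kx: "(\<lambda>z. KX t z $ k) \<in> borel_measurable PL" "(\<lambda>z. KF t z $ k) \<in> borel_measurable PL"
    using borel_vecD(3)[OF K_measurable(1) k] borel_vecD(3)[OF K_measurable(2) k] by auto
   have "integrable M (\<lambda>om. KX t (prims om) $ k)" "integrable M (\<lambda>om. KF t (prims om) $ k)"
    unfolding PL_prims using L2_Xs[of t] L2_Fe[of t] k L2_integrable[OF finite_measure_axioms] by (auto simp: L2v_def)
   then have i: "integrable M' (\<lambda>om. KX t (pr om) $ k)" "integrable M' (\<lambda>om. KF t (pr om) $ k)"
    using tintg[OF kx(1)] tintg[OF kx(2)] by auto
   have m3: "(\<lambda>om. KX t (pr om) $ k) \<in> borel_measurable M'" "(\<lambda>om. KF t (pr om) $ k) \<in> borel_measurable M'" using i by auto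
   have ae1: "AE om in M'. Xb t om $ k = KX t (pr om) $ k" using Ff by eventually_elim auto
   have ae2: "AE om in M'. filt t (?T om) $ k = KF t (pr om) $ k" using Ff by eventually_elim auto
   show i1: "integrable M' (\<lambda>om. Xb t om $ k)" using integrable_cong_AE[OF m1 m3(1) ae1] i(1) by simp
   show i2: "integrable M' (\<lambda>om. filt t (?T om) $ k)" using integrable_cong_AE[OF m2 m3(2) ae2] i(2) by simp
   fix A assume A: "A \<in> sets (?F t)"
   then obtain B where B: "B \<in> sets (\<Pi>\<^sub>M k\<in>{..<t}. borel_vec p)" "A = ?T -` B \<inter> space M'" using pa(4) by auto
   have AM: "A \<in> sets M'" using A pa(1)[of t] by (auto simp: subalgebra_def)
   let ?Z = "\<lambda>z. (KX t z $ k - KF t z $ k) * indicator B (\<lambda>k\<in>{..<t}. KY k z)"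
   have TK: "(\<lambda>z. \<lambda>k\<in>{..<t}. KY k z) \<in> PL \<rightarrow>\<^sub>M (\<Pi>\<^sub>M k\<in>{..<t}. borel_vec p)" by (intro measurable_restrict K_measurable)
   have Zm: "?Z \<in> borel_measurable PL"
    using kx measurable_compose[OF TK borel_measurable_indicator[OF B(1)]] by (intro borel_measurable_times borel_measurable_diff)
   have "(\<integral>om\<in>A. Xb t om $ k \<partial>M') - (\<integral>om\<in>A. filt t (?T om) $ k \<partial>M') = (\<integral>om. (Xb t om $ k - filt t (?T om) $ k) * indicator A om \<partial>M')"
    unfolding set_lebesgue_integral_def
    using integrable_mult_indicator[OF AM i1] integrable_mult_indicator[OF AM i2]
    by (subst Bochner_Integration.integral_diff[symmetric]) (auto simp: algebra_simps)
   also have "\<dots> = (\<integral>om. ?Z (pr om) \<partial>M')"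
   proof (rule integral_cong_AE)
    show "(\<lambda>om. (Xb t om $ k - filt t (?T om) $ k) * indicator A om) \<in> borel_measurable M'" using m1 m2 AM by auto
    show "(\<lambda>om. ?Z (pr om)) \<in> borel_measurable M'" using measurable_compose[OF prm Zm] .
    show "AE om in M'. (Xb t om $ k - filt t (?T om) $ k) * indicator A om = ?Z (pr om)"
     using Ff AE_space
    proof eventually_elim
     case (elim om)
     then have "om \<in> A \<longleftrightarrow> (\<lambda>k\<in>{..<t}. KY k (pr om)) \<in> B" unfolding B(2) by auto
     then have iA: "indicator A om = (indicator B (\<lambda>k\<in>{..<t}. KY k (pr om)) :: real)" by (simp add: indicator_def)
     have e1: "filt t (?T om) = KF t (pr om)" and e3: "Xb t om = KX t (pr om)" using elim(1) by blast+
     show ?case by (simp only: iA e1 e3)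
    qed
   qed
   also have "\<dots> = (\<integral>om. ?Z (prims om) \<partial>M)" by (rule tint[OF Zm])
   also have "\<dots> = 0"
   proof (rule int0_cong[OF _ e_orth[OF B(1) k]])
    fix om assume "om \<in> space M"
    then show "?Z (prims om) = e t om $ k * indicator B (\<lambda>k\<in>{..<t}. Y k om)"
     using Ydims[of om t] k by (simp add: PL_prims e_def Xs_def[symmetric] Fe_def[symmetric])
   qed
   finally show "(\<integral>om\<in>A. Xb t om $ k \<partial>M') = (\<integral>om\<in>A. filt t (?T om) $ k \<partial>M')" by simp
  qed
  have "AE om in M'. \<forall>k. k < d --> real_cond_exp M' (?F t) (\<lambda>om. Xb t om $ k) om = filt t (?T om) $ k"
   unfolding AE_all_countable using comp by auto
  then show ?thesis using Ff
  proof eventually_elim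
   case (elim om)
   have "cond_exp_vec M' (?F t) d (Xb t) om = filt t (?T om)"
    using elim(1) by (intro eq_vecI) (auto simp: cond_exp_vec_def)
   then show ?case using conjunct1[OF elim(2)] by (rule trans)
  qed
 qed
 have dyn: "AE om in M'. yb t om = agg_D g *\<^sub>v Xb t om + lim_Gp g a *\<^sub>v cond_exp_vec M' (?F t) d (Xb t) om + lim_Hp g ew b + xib t om \<and>
    Xb (Suc t) om = agg_A g *\<^sub>v Xb t om + lim_GX g a *\<^sub>v cond_exp_vec M' (?F t) d (Xb t) om + lim_HX g ew b + agg_C g *\<^sub>v yb t om + Wb t om" for t
 proof -
  have "AE om in M'. \<forall>t. yb t om = agg_D g *\<^sub>v Xb t om + lim_Gp g a *\<^sub>v cond_exp_vec M' (?F t) d (Xb t) om + lim_Hp g ew b + xib t om \<and>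
    Xb (Suc t) om = agg_A g *\<^sub>v Xb t om + lim_GX g a *\<^sub>v cond_exp_vec M' (?F t) d (Xb t) om + lim_HX g ew b + agg_C g *\<^sub>v yb t om + Wb t om"
   using aux by (simp add: aux_process_def)
  then show ?thesis by (simp only: AE_all_countable)
 qed
 have main: "AE om in M'. Xb t om = KX t (pr om) \<and> (\<forall>k<t. yb k om = KY k (pr om))" for t
 proof (induction t)
  case 0 show ?case by (simp add: pr_def k_simps)
 next
  case (Suc t)
  show ?case using Suc cond[OF Suc] dyn[of t] AE_space
  proof eventually_elim
   case (elim om)
   have dx: "dim_vec (xib t om) = p" "dim_vec (Wb t om) = d" using borel_vecD(2)[OF am(3)] borel_vecD(2)[OF am(4)] elim(4) by auto
   have kd: "dim_vec (KX t (pr om)) = d" "dim_vec (KF t (pr om)) = d"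
    using borel_vecD(2)[OF K_measurable(1)] borel_vecD(2)[OF K_measurable(2)] measurable_space[OF prm elim(4)] by auto
   have y: "yb t om = KY t (pr om)"
    using elim(1-3) dx kd unfolding ky_def by (simp add: pr_def) (intro eq_vecI, auto)
   have "Xb (Suc t) om = KX (Suc t) (pr om)"
    using elim(1-3) dx kd y unfolding k_simps by (simp add: pr_def) (intro eq_vecI, auto)
   then show ?case using y elim(1) by (auto simp: less_Suc_eq)
  qed
 qed
 have hm: "h t \<in> (\<Pi>\<^sub>M k\<in>{..<t}. borel_vec p) \<rightarrow>\<^sub>M borel_vec d" for t using est by (auto simp: cond_exp_map_def)
 have "AE om in M. h t (\<lambda>k\<in>{..<t}. Y k om) = Fe t om" for t
 proof -
  let ?Q = "\<lambda>z. h t (\<lambda>k\<in>{..<t}. KY k z) = KF t z"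
  have e: "AE om in M'. h t (\<lambda>k\<in>{..<t}. yb k om) = cond_exp_vec M' (?F t) d (Xb t) om" using est by (auto simp: cond_exp_map_def)
  have "AE om in M'. ?Q (pr om)" using e main[of t] cond[OF main[of t]]
  proof eventually_elim
   case (elim om)
   then have "(\<lambda>k\<in>{..<t}. yb k om) = (\<lambda>k\<in>{..<t}. KY k (pr om))" by auto
   then show ?case using elim by simp
  qed
  moreover have "{z \<in> space PL. ?Q z} \<in> sets PL"
  proof (rule borel_vec_eq_sets[OF _ K_measurable(2)])
   have "(\<lambda>z. \<lambda>k\<in>{..<t}. KY k z) \<in> PL \<rightarrow>\<^sub>M (\<Pi>\<^sub>M k\<in>{..<t}. borel_vec p)" by (intro measurable_restrict K_measurable)
   then show "(\<lambda>z. h t (\<lambda>k\<in>{..<t}. KY k z)) \<in> PL \<rightarrow>\<^sub>M borel_vec d" by (rule measurable_compose[OF _ hm])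
  qed
  ultimately have "AE om in M. ?Q (prims om)" using tAE[of ?Q] by blast
  then show ?thesis by (simp only: PL_prims)
 qed
 then show ?thesis unfolding AE_all_countable by blast
qed

end

section \<open>The game under estimator strategies\<close>

locale full = kal +
 fixes x0 :: "nat => 'a => rvec" and w :: "nat => nat => 'a => rvec"
 assumes X0_stack: "X0 = (\<lambda>om. stack g (\<lambda>i. x0 i om))" and W_stack: "W = (\<lambda>t om. stack g (\<lambda>i. w i t om))"
  and rv: "!!i. i \<le> nDM g ==> x0 i \<in> M \<rightarrow>\<^sub>M borel_vec (nx g i)" "!!i t. i \<le> nDM g ==> w i t \<in> M \<rightarrow>\<^sub>M borel_vec (nx g i)"
begin

abbreviation "sfilt \<equiv> est_strategy g ew a b filt"
abbreviation "gx s om \<equiv> game_x g s (\<lambda>i. x0 i om) (\<lambda>i k. w i k om) (\<lambda>k. xi k om)"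
abbreviation "gu s om \<equiv> game_u g s (\<lambda>i. x0 i om) (\<lambda>i k. w i k om) (\<lambda>k. xi k om)"
abbreviation "gy s om \<equiv> game_y g s (\<lambda>i. x0 i om) (\<lambda>i k. w i k om) (\<lambda>k. xi k om)"

lemma est_apply: assumes "i \<in> {1..N}" "dim_vec (h t (restrict y {..<t})) = d"
 shows "est_strategy g ew a b h i t (info t x u y) = cF g i *\<^sub>v x t + GG i (h t (restrict y {..<t}))"
 using assms unfolding est_strategy_def info_def GG_def by (simp add: gdims_i lim_H_dim) (intro eq_vecI, auto simp: gdims_i lim_H_dim)

lemma stack_prims: "X0 om = stack g (\<lambda>i. x0 i om)" "W t om = stack g (\<lambda>i. w i t om)"
 using fun_cong[OF X0_stack, of om] fun_cong[OF fun_cong[OF W_stack, of t], of om] by auto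

text \<open>Under the filter strategy the stacked states of the game satisfy the recursion \<open>kX\<close>,
 driven by the same primitive variables.\<close>
lemma game_filt:
 assumes om: "om \<in> space M"
 shows "(\<forall>i\<le>N. dim_vec (gx sfilt om i t) = nx g i) \<and> stack g (\<lambda>i. gx sfilt om i t) = Xs t om \<and> (\<forall>k<t. gy sfilt om k = Y k om)"
proof (induction t)
 case 0
 have "Xs 0 om = X0 om" by (simp add: Xs_def k_simps)
 then show ?case using borel_vecD(2)[OF rv(1) om] by (simp add: game_equations(1) stack_prims(1)[of om])
next
 case (Suc t)
 let ?x = "\<lambda>i. gx sfilt om i t" and ?u = "\<lambda>i. gu sfilt om i t"
 have fe: "filt t (restrict (gy sfilt om) {..<t}) = Fe t om"
 proof -
  have "filt t (gy sfilt om) = filt t (\<lambda>k. Y k om)" using Suc by (intro filt_cong) auto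
  then show ?thesis by (simp add: filt_restrict Fe_filt[OF om])
 qed
 have u: "?u i = cF g i *\<^sub>v ?x i + GG i (Fe t om)" if i: "i \<in> {1..N}" for i
 proof -
  have "?u i = sfilt i t (info t (gx sfilt om i) (gu sfilt om i) (gy sfilt om))" by (rule game_equations(2))
  also have "\<dots> = cF g i *\<^sub>v ?x i + GG i (filt t (restrict (gy sfilt om) {..<t}))" by (rule est_apply[OF i filt_dim])
  finally show ?thesis unfolding fe .
 qed
 have xd: "!!i. i \<le> N ==> dim_vec (?x i) = nx g i" using Suc by auto
 have wd: "!!i. i \<le> N ==> dim_vec (w i t om) = nx g i" using borel_vecD(2)[OF rv(2) om] .
 have y: "gy sfilt om t = Y t om"
 proof -
  have "gy sfilt om t = agg_D g *\<^sub>v stack g ?x + (lim_Gp g a *\<^sub>v Fe t om + lim_Hp g ew b) + xi t om"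
   unfolding game_equations(3) using xd Ydims(2)[OF om] sp_dims(3)[OF om] u by (rule agg_output)
  then show ?thesis using Suc by (simp add: Y_def ky_def Xs_def Fe_def)
 qed
 have "stack g (\<lambda>i. gx sfilt om i (Suc t)) = stack g (\<lambda>i. if i = 0 then mA g 0 *\<^sub>v ?x 0 + sum_vec (nx g 0) (\<lambda>j. mB1 g j *\<^sub>v ?u j + mB2 g j *\<^sub>v ?x j) {1..N} + w 0 t om
   else mA g i *\<^sub>v ?x i + mB g i *\<^sub>v ?u i + mC g i *\<^sub>v Y t om + w i t om)"
  by (rule stack_cong) (auto simp: game_equations(4,5) y)
 also have "\<dots> = agg_A g *\<^sub>v stack g ?x + (lim_GX g a *\<^sub>v Fe t om + lim_HX g ew b) + agg_C g *\<^sub>v Y t om + stack g (\<lambda>i. w i t om)"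
  using xd Ydims(2)[OF om] Ydims(1)[OF om] wd u by (rule agg_state)
 also have "\<dots> = Xs (Suc t) om" using Suc by (simp add: Xs_def Fe_def Y_def k_simps stack_prims(2)[symmetric])
 finally have X: "stack g (\<lambda>i. gx sfilt om i (Suc t)) = Xs (Suc t) om" .
 have "dim_vec (gx sfilt om i (Suc t)) = nx g i" if "i \<le> N" for i
  using wd[OF that] by (cases "i = 0") (simp_all add: game_equations(4,5))
 then show ?case using X y Suc by (auto simp: less_Suc_eq)
qed

lemma env_filt: "om \<in> space M ==> env_process g x0 w xi sfilt t om = Y t om"
 using game_filt[of om "Suc t"] by (simp add: env_process_def)

text \<open>For an arbitrary measurable estimator, as both the given estimator and the filter are needed.\<close>
lemma game_measurable:
 assumes hm: "!!t. h t \<in> (\<Pi>\<^sub>M k\<in>{..<t}. borel_vec p) \<rightarrow>\<^sub>M borel_vec d"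
 defines "s \<equiv> est_strategy g ew a b h"
 shows "(\<forall>i\<le>N. (\<lambda>om. gx s om i t) \<in> M \<rightarrow>\<^sub>M borel_vec (nx g i)) \<and> (\<forall>k<t. (\<lambda>om. gy s om k) \<in> M \<rightarrow>\<^sub>M borel_vec p)"
proof (induction t)
 case 0 then show ?case using rv(1) by (simp add: game_equations(1))
next
 case (Suc t)
 have xm: "(\<lambda>om. gx s om i t) \<in> M \<rightarrow>\<^sub>M borel_vec (nx g i)" if "i \<le> N" for i using Suc that by auto
 have ym: "(\<lambda>om. \<lambda>k\<in>{..<t}. gy s om k) \<in> M \<rightarrow>\<^sub>M (\<Pi>\<^sub>M k\<in>{..<t}. borel_vec p)" using Suc by (intro measurable_restrict) auto
 have hym: "(\<lambda>om. h t (\<lambda>k\<in>{..<t}. gy s om k)) \<in> M \<rightarrow>\<^sub>M borel_vec d" by (rule measurable_compose[OF ym hm])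
 have um: "(\<lambda>om. gu s om i t) \<in> M \<rightarrow>\<^sub>M borel_vec (nu g i)" if i: "i \<in> {1..N}" for i
 proof -
  have "(\<lambda>om. cF g i *\<^sub>v gx s om i t + lim_G g a i *\<^sub>v h t (\<lambda>k\<in>{..<t}. gy s om k) + lim_H g ew b i) \<in> M \<rightarrow>\<^sub>M borel_vec (nu g i)"
   using i by (intro borel_vec_add borel_vec_mv[OF xm[of i]] borel_vec_mv[OF hym] borel_vec_const) (auto simp: gdims_i lim_H_dim)
  moreover have "gu s om i t = cF g i *\<^sub>v gx s om i t + lim_G g a i *\<^sub>v h t (\<lambda>k\<in>{..<t}. gy s om k) + lim_H g ew b i" for om
  proof -
   have "gu s om i t = s i t (info t (gx s om i) (gu s om i) (gy s om))" by (rule game_equations(2))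
   also have "\<dots> = cF g i *\<^sub>v gx s om i t + lim_G g a i *\<^sub>v h t (\<lambda>k\<in>{..<t}. gy s om k) + lim_H g ew b i"
    by (simp add: s_def est_strategy_def info_def)
   finally show ?thesis .
  qed
  ultimately show ?thesis by simp
 qed
 have yt: "(\<lambda>om. gy s om t) \<in> M \<rightarrow>\<^sub>M borel_vec p"
  unfolding game_equations(3)
  by (intro borel_vec_add borel_vec_mv[OF xm] borel_vec_mv[OF um] borel_vec_sum_vec meas) (auto simp: gdims_i)
 have "(\<lambda>om. gx s om i (Suc t)) \<in> M \<rightarrow>\<^sub>M borel_vec (nx g i)" if i: "i \<le> N" for i
 proof (cases "i = 0")
  case True
  then show ?thesis unfolding True game_equations(4)
   by (intro borel_vec_add borel_vec_mv[OF xm] borel_vec_mv[OF um] borel_vec_sum_vec rv) (auto simp: gdims_i)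
 next
  case False
  then have i1: "i \<in> {1..N}" using i by auto
  show ?thesis unfolding game_equations(5)[OF False[unfolded neq0_conv]]
   by (intro borel_vec_add borel_vec_mv[OF xm[OF i]] borel_vec_mv[OF um[OF i1]] borel_vec_mv[OF yt] rv i) (auto simp: gdims_i[OF i1])
 qed
 then show ?case using yt Suc by (auto simp: less_Suc_eq)
qed

lemma env_measurable:
 assumes hm: "!!t. h t \<in> (\<Pi>\<^sub>M k\<in>{..<t}. borel_vec p) \<rightarrow>\<^sub>M borel_vec d"
 shows "env_process g x0 w xi (est_strategy g ew a b h) t \<in> M \<rightarrow>\<^sub>M borel_vec p"
  "(\<lambda>om t. env_process g x0 w xi (est_strategy g ew a b h) t om) \<in> M \<rightarrow>\<^sub>M env_space g"
proof -
 show 1: "env_process g x0 w xi (est_strategy g ew a b h) t \<in> M \<rightarrow>\<^sub>M borel_vec p" for t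
  using game_measurable[OF hm, of "Suc t"] by (simp add: env_process_def[abs_def])
 show "(\<lambda>om t. env_process g x0 w xi (est_strategy g ew a b h) t om) \<in> M \<rightarrow>\<^sub>M env_space g"
  by (intro measurable_PiM_single' 1) (auto dest: measurable_space[OF 1])
qed

lemma est_in_strategies:
 assumes hm: "!!t. h t \<in> (\<Pi>\<^sub>M k\<in>{..<t}. borel_vec p) \<rightarrow>\<^sub>M borel_vec d" and i: "i \<in> {1..N}"
 shows "est_strategy g ew a b h i \<in> strategies g i"
 unfolding strategies_def
proof (intro CollectI allI)
 fix t :: nat
 let ?P = "(\<Pi>\<^sub>M k\<in>{..t}. borel_vec (nx g i)) \<Otimes>\<^sub>M (\<Pi>\<^sub>M k\<in>{..<t}. borel_vec (nu g i)) \<Otimes>\<^sub>M (\<Pi>\<^sub>M k\<in>{..<t}. borel_vec p)"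
 have 1: "(\<lambda>z. fst z t) \<in> ?P \<rightarrow>\<^sub>M borel_vec (nx g i)" by (rule measurable_compose[OF measurable_fst measurable_component_singleton[of t "{..t}"]]) auto
 have 2: "(\<lambda>z. h t (snd (snd z))) \<in> ?P \<rightarrow>\<^sub>M borel_vec d" by (rule measurable_compose[OF measurable_compose[OF measurable_snd measurable_snd] hm])
 have "(\<lambda>z. cF g i *\<^sub>v fst z t + lim_G g a i *\<^sub>v h t (snd (snd z)) + lim_H g ew b i) \<in> ?P \<rightarrow>\<^sub>M borel_vec (nu g i)"
  using i by (intro borel_vec_add borel_vec_mv[OF 1] borel_vec_mv[OF 2] borel_vec_const) (auto simp: gdims_i lim_H_dim)
 then show "est_strategy g ew a b h i t \<in> ?P \<rightarrow>\<^sub>M borel_vec (nu g i)" unfolding est_strategy_def by (simp add: case_prod_unfold)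
qed

end

lemma game_hist_cong:
 assumes "!!t. h t (restrict (game_y g (est_strategy g ew a b h') x0 w xi) {..<t}) = h' t (restrict (game_y g (est_strategy g ew a b h') x0 w xi) {..<t})"
 shows "game_hist g (est_strategy g ew a b h) x0 w xi t = game_hist g (est_strategy g ew a b h') x0 w xi t"
proof (induction t)
 case (Suc t)
 let ?s = "est_strategy g ew a b h" and ?s' = "est_strategy g ew a b h'"
 let ?H = "game_hist g ?s' x0 w xi t"
 have "restrict (snd (snd ?H)) {..<t} = restrict (game_y g ?s' x0 w xi) {..<t}"
  using game_hist_past(3)[of _ t g ?s' x0 w xi] by (auto simp: restrict_def)
 then have "h t (restrict (snd (snd ?H)) {..<t}) = h' t (restrict (snd (snd ?H)) {..<t})" using assms[of t] by simp
 then have "?s i t (info t (fst ?H i) (fst (snd ?H) i) (snd (snd ?H))) = ?s' i t (info t (fst ?H i) (fst (snd ?H) i) (snd (snd ?H)))" for i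
  by (simp add: est_strategy_def info_def)
 moreover define U where "U i = ?s' i t (info t (fst ?H i) (fst (snd ?H) i) (snd (snd ?H)))" for i
 ultimately have "?s i t (info t (fst ?H i) (fst (snd ?H) i) (snd (snd ?H))) = U i" for i by simp
 then show ?case by (simp only: game_hist.simps Let_def case_prod_unfold Suc U_def[symmetric])
qed simp

lemma subj_hist_cong:
 assumes "!!t. h t (restrict z {..<t}) = h' t (restrict z {..<t})"
 shows "subj_hist g i (est_strategy g ew a b h i) x0 w z t = subj_hist g i (est_strategy g ew a b h' i) x0 w z t"
proof (induction t)
 case (Suc t)
 let ?s = "est_strategy g ew a b h i" and ?s' = "est_strategy g ew a b h' i"
 define U where "U x u = ?s' t (info t x u z)" for x u
 have "?s t (info t x u z) = U x u" for x u using assms[of t] by (simp add: U_def est_strategy_def info_def)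
 then show ?case by (simp only: subj_hist.simps Let_def case_prod_unfold Suc U_def[symmetric])
qed simp

section \<open>Comparison of private trajectories\<close>

lemma sp_tr: assumes "dim_vec x = dim_col A" "dim_vec y = dim_row A" shows "x \<bullet> (tr A *\<^sub>v y) = (A *\<^sub>v x) \<bullet> (y :: rvec)"
proof -
 have "x \<bullet> (tr A *\<^sub>v y) = (tr A *\<^sub>v y) \<bullet> x" using assms by (intro sp_comm) simp
 also have "\<dots> = y \<bullet> (A *\<^sub>v x)" using assms by (intro transpose_sp) auto
 also have "\<dots> = (A *\<^sub>v x) \<bullet> y" using assms by (intro sp_comm) simp
 finally show ?thesis .
qed

lemma sp_young_weighted: assumes d: "dim_vec x = dim_vec y" and c: "0 < c"
 shows "2 * \<bar>x \<bullet> y\<bar> \<le> c * (x \<bullet> x) + (y \<bullet> y) / (c :: real)"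
proof -
 have "0 \<le> (c \<cdot>\<^sub>v x + y) \<bullet> (c \<cdot>\<^sub>v x + y)" "0 \<le> (c \<cdot>\<^sub>v x - y) \<bullet> (c \<cdot>\<^sub>v x - y)" by (rule sp_self_nonneg)+
 then have "0 \<le> c * (c * (x \<bullet> x)) + 2 * c * (x \<bullet> y) + y \<bullet> y" "0 \<le> c * (c * (x \<bullet> x)) - 2 * c * (x \<bullet> y) + y \<bullet> y"
  using d sp_comm[of x y] by (simp_all add: sp_simps algebra_simps)
 then have "c * (2 * \<bar>x \<bullet> y\<bar>) \<le> c * (c * (x \<bullet> x)) + y \<bullet> y" using c by (auto simp: abs_if)
 also have "\<dots> = c * (c * (x \<bullet> x) + (y \<bullet> y) / c)" using c by (simp add: field_simps)
 finally show ?thesis using c by simp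
qed

context dm
begin

lemma stage_cost_eq: "stage_cost g i x u z = x \<bullet> (mQ g i *\<^sub>v x) + u \<bullet> (mR g i *\<^sub>v u) + 2 * (z \<bullet> (mK g i *\<^sub>v u)) + 2 * (z \<bullet> (mL g i *\<^sub>v x))"
 unfolding stage_cost_def by (simp add: sp_add_right)

text \<open>The mixed terms are absorbed by half of \<open>Q\<close> and \<open>R\<close>, at the price of a
 multiple of \<open>\<bar>z\<bar>\<^sup>2\<close>. This is what makes expected costs well defined.\<close>
lemma stage_coercive:
 "\<exists>\<epsilon> \<kappa>. 0 < \<epsilon> \<and> 0 \<le> \<kappa> \<and> (\<forall>x u z. dim_vec x = n --> dim_vec u = m --> dim_vec z = p -->
  \<epsilon> * (x \<bullet> x + u \<bullet> u) \<le> stage_cost g i x u z + \<kappa> * (z \<bullet> z))"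
proof -
 obtain q where q: "q > 0" "!!v. v \<in> carrier_vec n ==> q * (v \<bullet> v) \<le> v \<bullet> (mQ g i *\<^sub>v v)" using pd_coercive[OF Q] by blast
 obtain r where r: "r > 0" "!!v. v \<in> carrier_vec m ==> r * (v \<bullet> v) \<le> v \<bullet> (mR g i *\<^sub>v v)" using pd_coercive[OF R] by blast
 define cx where "cx = 2 * (fro (mL g i) + 1) / q"
 define cu where "cu = 2 * (fro (mK g i) + 1) / r"
 have f0: "0 < fro (mL g i) + 1" "0 < fro (mK g i) + 1" using fro_nonneg[of "mL g i"] fro_nonneg[of "mK g i"] by auto
 have c: "0 < cx" "0 < cu" using f0 q r by (auto simp: cx_def cu_def)
 have half: "(A *\<^sub>v v) \<bullet> (A *\<^sub>v v) / (2 * (fro A + 1) / s) \<le> s / 2 * (v \<bullet> v)" if "dim_vec v = dim_col A" "0 < s" for A s and v :: rvec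
 proof -
  have f: "0 < fro A + 1" using fro_nonneg[of A] by linarith
  have "(A *\<^sub>v v) \<bullet> (A *\<^sub>v v) \<le> (fro A + 1) * (v \<bullet> v)"
   using fro_bound[OF that(1)] sp_self_nonneg[of v] by (simp add: algebra_simps)
  then have "(A *\<^sub>v v) \<bullet> (A *\<^sub>v v) * s \<le> (fro A + 1) * (v \<bullet> v) * s" using that by (intro mult_right_mono) auto
  then show ?thesis using f that by (simp add: field_simps)
 qed
 define \<epsilon> where "\<epsilon> = min q r / 2"
 have "\<epsilon> * (x \<bullet> x + u \<bullet> u) \<le> stage_cost g i x u z + (cx + cu) * (z \<bullet> z)"
  if d: "dim_vec x = n" "dim_vec u = m" "dim_vec z = p" for x u z
 proof -
  have 1: "2 * \<bar>z \<bullet> (mL g i *\<^sub>v x)\<bar> \<le> cx * (z \<bullet> z) + q / 2 * (x \<bullet> x)"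
  proof -
   have "2 * \<bar>z \<bullet> (mL g i *\<^sub>v x)\<bar> \<le> cx * (z \<bullet> z) + (mL g i *\<^sub>v x) \<bullet> (mL g i *\<^sub>v x) / cx"
    using sp_young_weighted[OF _ c(1), of z "mL g i *\<^sub>v x"] d by simp
   also have "(mL g i *\<^sub>v x) \<bullet> (mL g i *\<^sub>v x) / cx \<le> q / 2 * (x \<bullet> x)" unfolding cx_def by (rule half) (use d q in auto)
   finally show ?thesis by simp
  qed
  have 2: "2 * \<bar>z \<bullet> (mK g i *\<^sub>v u)\<bar> \<le> cu * (z \<bullet> z) + r / 2 * (u \<bullet> u)"
  proof -
   have "2 * \<bar>z \<bullet> (mK g i *\<^sub>v u)\<bar> \<le> cu * (z \<bullet> z) + (mK g i *\<^sub>v u) \<bullet> (mK g i *\<^sub>v u) / cu"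
    using sp_young_weighted[OF _ c(2), of z "mK g i *\<^sub>v u"] d by simp
   also have "(mK g i *\<^sub>v u) \<bullet> (mK g i *\<^sub>v u) / cu \<le> r / 2 * (u \<bullet> u)" unfolding cu_def by (rule half) (use d r in auto)
   finally show ?thesis by simp
  qed
  have 3: "q * (x \<bullet> x) \<le> x \<bullet> (mQ g i *\<^sub>v x)" "r * (u \<bullet> u) \<le> u \<bullet> (mR g i *\<^sub>v u)" using q(2) r(2) d by (auto intro: carrier_vecI)
  have "\<epsilon> * (x \<bullet> x) \<le> q / 2 * (x \<bullet> x)" "\<epsilon> * (u \<bullet> u) \<le> r / 2 * (u \<bullet> u)"
   by (intro mult_right_mono sp_self_nonneg; simp add: \<epsilon>_def)+
  with 1 2 3 show ?thesis unfolding stage_cost_eq by (simp add: algebra_simps abs_le_iff)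
 qed
 then show ?thesis using q r c by (intro exI[of _ \<epsilon>] exI[of _ "cx + cu"]) (auto simp: \<epsilon>_def)
qed

text \<open>Comparison of two private trajectories: up to a telescoping costate term and terms that are
 linear in the innovation and in the centred disturbance, the cost difference is a nonnegative
 quadratic form.\<close>
lemma stage_identity:
 fixes xs us z zh v w ewi gv r r1 dx du :: rvec and Pm :: rmat
 assumes d: "dim_vec xs = n" "dim_vec zh = p" "dim_vec v = p" "dim_vec w = n" "dim_vec ewi = n" "dim_vec gv = m"
   "dim_vec r1 = n" "dim_vec dx = n" "dim_vec du = m" "dim_row Pm = n" "dim_col Pm = p"
  and z: "z = zh + v" and us: "us = cF g i *\<^sub>v xs + gv"
  and gv: "Sm *\<^sub>v gv = (- 1) \<cdot>\<^sub>v (tr (mK g i) *\<^sub>v zh + \<beta> \<cdot>\<^sub>v (tr (mB g i) *\<^sub>v (cM g i *\<^sub>v (mC g i *\<^sub>v zh)))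
   + \<beta> \<cdot>\<^sub>v (tr (mB g i) *\<^sub>v (cM g i *\<^sub>v ewi + r1)))"
  and r: "r = Gam *\<^sub>v zh + Tm *\<^sub>v (cM g i *\<^sub>v ewi + r1)"
 defines "lam \<equiv> cM g i *\<^sub>v xs + r"
  and "lam' \<equiv> cM g i *\<^sub>v (mA g i *\<^sub>v xs + mB g i *\<^sub>v us + mC g i *\<^sub>v z + w) + (r1 + Pm *\<^sub>v v)"
  and "dx' \<equiv> mA g i *\<^sub>v dx + mB g i *\<^sub>v du"
 shows "stage_cost g i (xs + dx) (us + du) z - stage_cost g i xs us z =
  dx \<bullet> (mQ g i *\<^sub>v dx) + du \<bullet> (mR g i *\<^sub>v du) + 2 * (dx \<bullet> lam - \<beta> * (dx' \<bullet> lam')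
   + (mK g i *\<^sub>v du + mL g i *\<^sub>v dx) \<bullet> v + \<beta> * (dx' \<bullet> (cM g i *\<^sub>v (mC g i *\<^sub>v v) + Pm *\<^sub>v v))
   + \<beta> * (dx' \<bullet> (cM g i *\<^sub>v (w - ewi))))"
proof -
 let ?M = "cM g i" and ?A = "mA g i" and ?B = "mB g i" and ?C = "mC g i" and ?K = "mK g i" and ?L = "mL g i" and ?F = "cF g i"
 have usd: "dim_vec us = m" using d us by simp
 have zd: "dim_vec z = p" using z d by simp
 define y where "y = ?B *\<^sub>v du"
 define a where "a = ?A *\<^sub>v dx"
 have yd: "dim_vec y = n" "dim_vec a = n" by (auto simp: y_def a_def)
 have Mx: "!!s. s \<bullet> (?M *\<^sub>v (?A *\<^sub>v xs + ?B *\<^sub>v us + ?C *\<^sub>v z + w) + (r1 + Pm *\<^sub>v v)) =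
   s \<bullet> (?M *\<^sub>v (?A *\<^sub>v xs)) + s \<bullet> (?M *\<^sub>v (?B *\<^sub>v us)) + s \<bullet> (?M *\<^sub>v (?C *\<^sub>v zh)) + s \<bullet> (?M *\<^sub>v (?C *\<^sub>v v)) + s \<bullet> (?M *\<^sub>v w) + s \<bullet> r1 + s \<bullet> (Pm *\<^sub>v v)"
  using d usd by (simp add: z mv_add sp_add_right)
 have Sg: "s \<bullet> (Sm *\<^sub>v gv) = - ((?K *\<^sub>v s) \<bullet> zh) - \<beta> * ((?B *\<^sub>v s) \<bullet> (?M *\<^sub>v (?C *\<^sub>v zh))) - \<beta> * ((?B *\<^sub>v s) \<bullet> (?M *\<^sub>v ewi)) - \<beta> * ((?B *\<^sub>v s) \<bullet> r1)"
  if s: "dim_vec s = m" for s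
  unfolding gv using d s by (simp add: sp_simps sp_tr mv_add algebra_simps)
 have Kdu: "z \<bullet> (?K *\<^sub>v du) = (?K *\<^sub>v du) \<bullet> zh + (?K *\<^sub>v du) \<bullet> v"
  using d zd sp_comm[of z "?K *\<^sub>v du"] by (simp add: z sp_add_right)
 have Ldx: "z \<bullet> (?L *\<^sub>v dx) = (?L *\<^sub>v dx) \<bullet> zh + (?L *\<^sub>v dx) \<bullet> v"
  using d zd sp_comm[of z "?L *\<^sub>v dx"] by (simp add: z sp_add_right)
 have Rus: "du \<bullet> (mR g i *\<^sub>v us) = - \<beta> * (y \<bullet> (?M *\<^sub>v (?A *\<^sub>v xs))) - (?K *\<^sub>v du) \<bullet> zh - \<beta> * (y \<bullet> (?M *\<^sub>v (?C *\<^sub>v zh)))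
   - \<beta> * (y \<bullet> (?M *\<^sub>v ewi)) - \<beta> * (y \<bullet> r1) - \<beta> * (y \<bullet> (?M *\<^sub>v (?B *\<^sub>v us)))"
 proof -
  have "du \<bullet> (mR g i *\<^sub>v us) = du \<bullet> (Sm *\<^sub>v us) - \<beta> * (y \<bullet> (?M *\<^sub>v (?B *\<^sub>v us)))"
   using d usd by (simp add: Sm_mv sp_simps sp_tr y_def)
  moreover have "Sm *\<^sub>v us = Sm *\<^sub>v (?F *\<^sub>v xs) + Sm *\<^sub>v gv" using d by (simp add: us mv_add gm_dims)
  moreover have "du \<bullet> (Sm *\<^sub>v (?F *\<^sub>v xs)) = - \<beta> * (y \<bullet> (?M *\<^sub>v (?A *\<^sub>v xs)))" using d by (simp add: Sm_F sp_simps sp_tr y_def)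
  ultimately show ?thesis using Sg[OF d(9)] by (simp add: sp_add_right gm_dims y_def algebra_simps)
 qed
 have Qxs: "dx \<bullet> (mQ g i *\<^sub>v xs) = dx \<bullet> (?M *\<^sub>v xs) - \<beta> * (a \<bullet> (?M *\<^sub>v (?A *\<^sub>v xs))) - \<beta> * (a \<bullet> (?M *\<^sub>v (?B *\<^sub>v (?F *\<^sub>v xs))))"
  using d by (simp add: M_mv[OF d(1)] sp_simps sp_tr cAF_mv mv_add a_def algebra_simps)
 define f where "f = ?F *\<^sub>v dx"
 have fd: "dim_vec f = m" by (simp add: f_def)
 have FS: "\<beta> * (a \<bullet> (?M *\<^sub>v (?B *\<^sub>v gv))) = - (f \<bullet> (Sm *\<^sub>v gv))" using F_S[of dx gv] d by (simp add: a_def f_def)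
 have dxr: "dx \<bullet> r = (?L *\<^sub>v dx) \<bullet> zh + \<beta> * (a \<bullet> (?M *\<^sub>v (?C *\<^sub>v zh))) + \<beta> * (a \<bullet> (?M *\<^sub>v ewi)) + \<beta> * (a \<bullet> r1) + \<beta> * (a \<bullet> (?M *\<^sub>v (?B *\<^sub>v gv)))"
 proof -
  have "dx \<bullet> (Gam *\<^sub>v zh) = (?K *\<^sub>v f) \<bullet> zh + (?L *\<^sub>v dx) \<bullet> zh + \<beta> * ((cAF g i *\<^sub>v dx) \<bullet> (?M *\<^sub>v (?C *\<^sub>v zh)))"
   using d by (simp add: Gam_def mv_simps sp_simps sp_tr f_def)
  moreover have "dx \<bullet> (Tm *\<^sub>v (?M *\<^sub>v ewi + r1)) = \<beta> * ((cAF g i *\<^sub>v dx) \<bullet> (?M *\<^sub>v ewi)) + \<beta> * ((cAF g i *\<^sub>v dx) \<bullet> r1)"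
   using d by (simp add: Tm_def smult_mv sp_simps sp_tr algebra_simps)
  moreover have "cAF g i *\<^sub>v dx = a + ?B *\<^sub>v f" using d by (simp add: cAF_mv a_def f_def)
  ultimately show ?thesis unfolding r FS Sg[OF fd]
   using d yd fd by (simp add: sp_simps Tm_dims algebra_simps)
 qed
 have usM: "a \<bullet> (?M *\<^sub>v (?B *\<^sub>v us)) = a \<bullet> (?M *\<^sub>v (?B *\<^sub>v (?F *\<^sub>v xs))) + a \<bullet> (?M *\<^sub>v (?B *\<^sub>v gv))"
  using d by (simp add: us mv_add sp_add_right)
 have sq: "stage_cost g i (xs + dx) (us + du) z - stage_cost g i xs us z = dx \<bullet> (mQ g i *\<^sub>v dx) + du \<bullet> (mR g i *\<^sub>v du)
   + 2 * (dx \<bullet> (mQ g i *\<^sub>v xs) + du \<bullet> (mR g i *\<^sub>v us) + z \<bullet> (?K *\<^sub>v du) + z \<bullet> (?L *\<^sub>v dx))"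
 proof -
  have "xs \<bullet> (mQ g i *\<^sub>v dx) = dx \<bullet> (mQ g i *\<^sub>v xs)" using d by (rule_tac sym_sp[OF carriers(9,11)]) auto
  moreover have "us \<bullet> (mR g i *\<^sub>v du) = du \<bullet> (mR g i *\<^sub>v us)" using d usd by (rule_tac sym_sp[OF carriers(10,12)]) auto
  ultimately show ?thesis unfolding stage_cost_eq using d usd by (simp add: mv_add sp_simps algebra_simps)
 qed
 have dxl: "dx \<bullet> lam = dx \<bullet> (?M *\<^sub>v xs) + dx \<bullet> r" unfolding lam_def using d by (simp add: sp_add_right r Tm_dims)
 have lamd: "dim_vec lam' = n" using d by (simp add: lam'_def)
 have dl: "dx' \<bullet> lam' = a \<bullet> lam' + y \<bullet> lam'" unfolding dx'_def using d lamd by (simp add: sp_add_left a_def y_def)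
 have dm1: "dx' \<bullet> (?M *\<^sub>v (?C *\<^sub>v v) + Pm *\<^sub>v v) = a \<bullet> (?M *\<^sub>v (?C *\<^sub>v v)) + a \<bullet> (Pm *\<^sub>v v) + y \<bullet> (?M *\<^sub>v (?C *\<^sub>v v)) + y \<bullet> (Pm *\<^sub>v v)"
  unfolding dx'_def using d by (simp add: sp_simps a_def y_def)
 have dm2: "dx' \<bullet> (?M *\<^sub>v (w - ewi)) = a \<bullet> (?M *\<^sub>v w) - a \<bullet> (?M *\<^sub>v ewi) + y \<bullet> (?M *\<^sub>v w) - y \<bullet> (?M *\<^sub>v ewi)"
  unfolding dx'_def using d by (simp add: sp_simps mv_diff a_def y_def)
 have dkl: "(?K *\<^sub>v du + ?L *\<^sub>v dx) \<bullet> v = (?K *\<^sub>v du) \<bullet> v + (?L *\<^sub>v dx) \<bullet> v" using d by (simp add: sp_add_left)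
 show ?thesis
  unfolding sq dl dm1 dm2 dkl dxl unfolding lam'_def Mx Rus Qxs dxr Kdu Ldx usM
  by (simp add: algebra_simps)
qed

end

section \<open>Expected cost as an integral of nonnegative terms\<close>

text \<open>Subtracting an integrable function does not produce the case \<open>\<infinity> -
 \<infinity>\<close>, as the negative part stays integrable; so the expectation splits although the positive
 part may be infinite.\<close>
lemma ereal_expectation_shift:
 assumes M: "prob_space M" and L: "L \<in> borel_measurable M" and k: "integrable M k" "!!om. 0 \<le> k om"
  and f: "AE om in M. f om = enn2ereal (L om) - ereal (k om)"
 shows "ereal_expectation M f = enn2ereal (\<integral>\<^sup>+om. L om \<partial>M) - ereal (\<integral>om. k om \<partial>M)"
proof -
 have km [measurable]: "k \<in> borel_measurable M" using k by auto
 note L [measurable]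
 have ek: "ereal (k om) = enn2ereal (ennreal (k om))" for om using k(2) by (simp add: enn2ereal_ennreal)
 have pos: "e2ennreal (enn2ereal x - enn2ereal y) = x - y" for x y :: ennreal
  by (rule e2eenreal_enn2ereal_diff)
 have neg: "- (enn2ereal x - enn2ereal y) = enn2ereal y - enn2ereal x" if "y \<noteq> Orderings.top" for x y :: ennreal
  using that by (cases "enn2ereal x"; cases "enn2ereal y") auto
 have ip: "(\<integral>\<^sup>+om. e2ennreal (f om) \<partial>M) = (\<integral>\<^sup>+om. L om - ennreal (k om) \<partial>M)"
  by (rule nn_integral_cong_AE) (use f in \<open>eventually_elim, simp add: ek pos\<close>)
 have im: "(\<integral>\<^sup>+om. e2ennreal (- f om) \<partial>M) = (\<integral>\<^sup>+om. ennreal (k om) - L om \<partial>M)"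
  by (rule nn_integral_cong_AE) (use f in \<open>eventually_elim, simp add: ek pos neg\<close>)
 have ik: "(\<integral>\<^sup>+om. ennreal (k om) \<partial>M) = ennreal (\<integral>om. k om \<partial>M)" using k by (intro nn_integral_eq_integral) auto
 have "(\<integral>\<^sup>+om. L om - ennreal (k om) \<partial>M) + (\<integral>\<^sup>+om. ennreal (k om) \<partial>M) = (\<integral>\<^sup>+om. (L om - ennreal (k om)) + ennreal (k om) \<partial>M)"
  by (rule nn_integral_add[symmetric]) auto
 also have "\<dots> = (\<integral>\<^sup>+om. (ennreal (k om) - L om) + L om \<partial>M)"
 proof (rule nn_integral_cong)
  fix om
  show "(L om - ennreal (k om)) + ennreal (k om) = (ennreal (k om) - L om) + L om"
  proof (cases "L om")
   case (real r)
   then show ?thesis using k(2)[of om] by (cases "k om \<le> r") (simp_all add: ennreal_minus ennreal_plus[symmetric] ennreal_neg del: ennreal_plus)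
  qed (simp add: ennreal_top_minus)
 qed
 also have "\<dots> = (\<integral>\<^sup>+om. ennreal (k om) - L om \<partial>M) + (\<integral>\<^sup>+om. L om \<partial>M)" by (rule nn_integral_add) auto
 finally have eq: "(\<integral>\<^sup>+om. L om - ennreal (k om) \<partial>M) + ennreal (\<integral>om. k om \<partial>M) = (\<integral>\<^sup>+om. ennreal (k om) - L om \<partial>M) + (\<integral>\<^sup>+om. L om \<partial>M)" unfolding ik .
 have "(\<integral>\<^sup>+om. ennreal (k om) - L om \<partial>M) \<le> ennreal (\<integral>om. k om \<partial>M)" unfolding ik[symmetric] by (intro nn_integral_mono) (auto intro: diff_le_self_ennreal)
 then have fin: "(\<integral>\<^sup>+om. ennreal (k om) - L om \<partial>M) \<noteq> Orderings.top" by (metis ennreal_less_top leD top.not_eq_extremum)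
 have ik0: "0 \<le> (\<integral>om. k om \<partial>M)" using k by (intro integral_nonneg_AE) auto
 have arith: "enn2ereal P - enn2ereal Q = enn2ereal J - ereal c" if "P + ennreal c = Q + J" "Q \<noteq> Orderings.top" "0 \<le> c" for P Q J :: ennreal and c
 proof -
  have "enn2ereal P + ereal c = enn2ereal Q + enn2ereal J"
   using arg_cong[OF that(1), of enn2ereal] that(3) by (simp add: plus_ennreal.rep_eq enn2ereal_ennreal)
  moreover have "enn2ereal Q \<noteq> \<infinity>" using that(2) by simp
  moreover have "0 \<le> enn2ereal P" "0 \<le> enn2ereal Q" "0 \<le> enn2ereal J" by auto
  ultimately show ?thesis by (cases "enn2ereal P"; cases "enn2ereal Q"; cases "enn2ereal J") auto
 qed
 show ?thesis unfolding ereal_expectation_def ip im by (rule arith[OF eq fin ik0])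
qed

lemma limsup_nonneg_series:
 fixes s l k :: "nat => real"
 assumes s: "!!t. s t = l t - k t" and l: "!!t. 0 \<le> l t" and k: "summable k"
 shows "limsup (\<lambda>T. ereal (\<Sum>t<T. s t)) = enn2ereal (\<Sum>t. ennreal (l t)) - ereal (\<Sum>t. k t)"
proof (rule lim_imp_Limsup)
 have "(\<lambda>T. \<Sum>t<T. ennreal (l t)) \<longlonglongrightarrow> (\<Sum>t. ennreal (l t))" by (rule summable_LIMSEQ) auto
 then have "(\<lambda>T. enn2ereal (\<Sum>t<T. ennreal (l t))) \<longlonglongrightarrow> enn2ereal (\<Sum>t. ennreal (l t))"
  by (rule tendsto_enn2erealI)
 moreover have "enn2ereal (\<Sum>t<T. ennreal (l t)) = ereal (\<Sum>t<T. l t)" for T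
  using l by (simp add: enn2ereal_ennreal sum_nonneg)
 ultimately have 1: "(\<lambda>T. ereal (\<Sum>t<T. l t)) \<longlonglongrightarrow> enn2ereal (\<Sum>t. ennreal (l t))" by simp
 have 2: "(\<lambda>T. ereal (- (\<Sum>t<T. k t))) \<longlonglongrightarrow> ereal (- (\<Sum>t. k t))" using summable_LIMSEQ[OF k] by (auto intro: tendsto_intros)
 have "(\<lambda>T. ereal (\<Sum>t<T. l t) + ereal (- (\<Sum>t<T. k t))) \<longlonglongrightarrow> enn2ereal (\<Sum>t. ennreal (l t)) + ereal (- (\<Sum>t. k t))"
  by (rule tendsto_add_ereal_general[OF _ 1 2]) auto
 moreover have "ereal (\<Sum>t<T. l t) + ereal (- (\<Sum>t<T. k t)) = ereal (\<Sum>t<T. s t)" for T by (simp add: s sum_subtractf)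
 moreover have "x + ereal (- c) = x - ereal c" for x c by (cases x) auto
 ultimately show "(\<lambda>T. ereal (\<Sum>t<T. s t)) \<longlonglongrightarrow> enn2ereal (\<Sum>t. ennreal (l t)) - ereal (\<Sum>t. k t)" by simp
qed simp

text \<open>With a rate strictly above both \<open>r\<close> and \<open>q\<close>, a geometric bound propagates
 through the recursion.\<close>
lemma affine_decay:
 fixes b :: "nat => real"
 assumes b: "!!t. 0 \<le> b t" and step: "!!t. b (Suc t) \<le> r * b t + K * q ^ t" and r: "0 \<le> r" "r < 1" and q: "0 \<le> q" "q < 1" and K: "0 \<le> K"
 shows "b \<longlonglongrightarrow> 0"
proof -
 define s where "s = (1 + max r q) / 2"
 have s: "r < s" "q \<le> s" "s < 1" "0 \<le> s" using r q by (auto simp: s_def)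
 define C where "C = max (b 0) (K / (s - r))"
 have C: "b 0 \<le> C" "0 \<le> C" "K \<le> C * (s - r)" using s b[of 0] by (auto simp: C_def pos_divide_le_eq[symmetric])
 have "b t \<le> C * s ^ t" for t
 proof (induction t)
  case (Suc t)
  have "b (Suc t) \<le> r * (C * s ^ t) + K * s ^ t"
   using step[of t] Suc r K power_mono[OF s(2) q(1), of t] by (meson add_mono mult_left_mono order_trans)
  also have "\<dots> = (r * C + K) * s ^ t" by (simp add: algebra_simps)
  also have "\<dots> \<le> (C * s) * s ^ t" using C(3) s by (intro mult_right_mono) (auto simp: algebra_simps)
  finally show ?case by (simp add: mult_ac)
 qed (use C in simp)
 moreover have "(\<lambda>t. C * s ^ t) \<longlonglongrightarrow> C * 0" using s by (intro tendsto_intros LIMSEQ_realpow_zero) auto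
 ultimately show ?thesis using b by (intro tendsto_sandwich[of "\<lambda>_. 0" b sequentially "\<lambda>t. C * s ^ t"]) auto
qed

section \<open>Private paths as functions of the past\<close>

lemma subj_hist_causal:
 assumes "!!k. k < t ==> w k = w' k" "!!k. k < t ==> z k = z' k"
 shows "subj_hist g i \<sigma> x0 w z t = subj_hist g i \<sigma> x0 w' z' t"
 using assms
proof (induction t)
 case (Suc t)
 have 1: "subj_hist g i \<sigma> x0 w z t = subj_hist g i \<sigma> x0 w' z' t" using Suc by auto
 have 2: "info t x u z = info t x u z'" for x u using Suc.prems(2) by (auto simp: info_def restrict_def)
 have 3: "w t = w' t" "z t = z' t" using Suc.prems by auto
 show ?case by (simp only: subj_hist.simps Let_def case_prod_unfold 1 2 3)
qed simp

lemma subj_causal: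
 assumes "!!k. k < t ==> w k = w' k" "!!k. k < t ==> z k = z' k"
 shows "subj_x g i \<sigma> x0 w z t = subj_x g i \<sigma> x0 w' z' t" "subj_u g i \<sigma> x0 w z t = subj_u g i \<sigma> x0 w' z' t"
proof -
 have 1: "subj_hist g i \<sigma> x0 w z t = subj_hist g i \<sigma> x0 w' z' t" by (rule subj_hist_causal[OF assms])
 have 2: "info t x u z = info t x u z'" for x u using assms(2) by (auto simp: info_def restrict_def)
 show "subj_x g i \<sigma> x0 w z t = subj_x g i \<sigma> x0 w' z' t" by (simp add: subj_x_def 1)
 show "subj_u g i \<sigma> x0 w z t = subj_u g i \<sigma> x0 w' z' t"
  by (simp add: subj_u_def 1 2 Let_def case_prod_unfold)
qed

lemma (in dm) subj_measurable:
 fixes X :: "'c => rvec"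
 assumes \<sigma>: "\<sigma> \<in> strategies g i" and X: "X \<in> NN \<rightarrow>\<^sub>M borel_vec n"
  and Wp: "!!t. Wp t \<in> NN \<rightarrow>\<^sub>M borel_vec n" and Z: "!!t. Z t \<in> NN \<rightarrow>\<^sub>M borel_vec p"
 shows "(\<lambda>om. subj_x g i \<sigma> (X om) (\<lambda>k. Wp k om) (\<lambda>k. Z k om) t) \<in> NN \<rightarrow>\<^sub>M borel_vec n" (is "?X t")
  "(\<lambda>om. subj_u g i \<sigma> (X om) (\<lambda>k. Wp k om) (\<lambda>k. Z k om) t) \<in> NN \<rightarrow>\<^sub>M borel_vec m" (is "?U t")
proof -
 let ?x = "\<lambda>om. subj_x g i \<sigma> (X om) (\<lambda>k. Wp k om) (\<lambda>k. Z k om)" and ?u = "\<lambda>om. subj_u g i \<sigma> (X om) (\<lambda>k. Wp k om) (\<lambda>k. Z k om)"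
 have "(\<forall>k\<le>t. ?X k) \<and> (\<forall>k<t. ?U k)" for t
 proof (induction t)
  case 0 then show ?case using X by (simp add: subj_equations(1))
 next
  case (Suc t)
  have "(\<lambda>om. info t (?x om) (?u om) (\<lambda>k. Z k om)) \<in> NN \<rightarrow>\<^sub>M
    (\<Pi>\<^sub>M k\<in>{..t}. borel_vec n) \<Otimes>\<^sub>M (\<Pi>\<^sub>M k\<in>{..<t}. borel_vec m) \<Otimes>\<^sub>M (\<Pi>\<^sub>M k\<in>{..<t}. borel_vec p)"
   unfolding info_def using Suc Z by (intro measurable_Pair measurable_restrict) auto
  moreover have "\<sigma> t \<in> (\<Pi>\<^sub>M k\<in>{..t}. borel_vec n) \<Otimes>\<^sub>M (\<Pi>\<^sub>M k\<in>{..<t}. borel_vec m) \<Otimes>\<^sub>M (\<Pi>\<^sub>M k\<in>{..<t}. borel_vec p) \<rightarrow>\<^sub>M borel_vec m"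
   using \<sigma> unfolding strategies_def by blast
  ultimately have "(\<lambda>om. \<sigma> t (info t (?x om) (?u om) (\<lambda>k. Z k om))) \<in> NN \<rightarrow>\<^sub>M borel_vec m" by (rule measurable_compose)
  then have u: "?U t" unfolding subj_equations(2)[of g i \<sigma> "X _" "\<lambda>k. Wp k _" "\<lambda>k. Z k _" t] .
  have x: "?X t" using Suc by auto
  have "?X (Suc t)" unfolding subj_equations(3)
   by (intro borel_vec_add borel_vec_mv[OF x] borel_vec_mv[OF u] borel_vec_mv[OF Z] Wp) auto
  then show ?case using u Suc by (auto simp: le_Suc_eq less_Suc_eq)
 qed
 from this[of "Suc t"] show "?X t" "?U t" by auto
qed

section \<open>Square integrable vectors\<close>

lemma L2v_eq: "(!!om. om \<in> space NN ==> U om = U' om) ==> L2v NN r U' ==> L2v NN r U"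
 unfolding L2v_def using L2_cong[of NN "\<lambda>om. U om $ _" "\<lambda>om. U' om $ _"] by simp

lemma L2v_sp_self: assumes U: "L2v NN r U" shows "integrable NN (\<lambda>om. U om \<bullet> U om)"
 "(\<integral>om. U om \<bullet> U om \<partial>NN) = (\<Sum>k<r. \<integral>om. (U om $ k)\<^sup>2 \<partial>NN)"
proof -
 have e: "U om \<bullet> U om = (\<Sum>k<r. (U om $ k)\<^sup>2)" if "om \<in> space NN" for om using U that by (simp add: L2v_def sp_self)
 have i: "integrable NN (\<lambda>om. (U om $ k)\<^sup>2)" if "k < r" for k using U that by (simp add: L2v_def L2_def)
 show "integrable NN (\<lambda>om. U om \<bullet> U om)"
  by (subst Bochner_Integration.integrable_cong[OF refl e]) (auto intro!: Bochner_Integration.integrable_sum i)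
 show "(\<integral>om. U om \<bullet> U om \<partial>NN) = (\<Sum>k<r. \<integral>om. (U om $ k)\<^sup>2 \<partial>NN)"
  by (subst Bochner_Integration.integral_cong[OF refl e]) (auto intro!: Bochner_Integration.integral_sum i)
qed

lemma L2v_sp: assumes U: "L2v NN r U" and Z: "L2v NN r Z" shows "integrable NN (\<lambda>om. U om \<bullet> Z om)"
 "(\<integral>om. U om \<bullet> Z om \<partial>NN) = (\<Sum>k<r. \<integral>om. U om $ k * Z om $ k \<partial>NN)"
proof -
 have e: "U om \<bullet> Z om = (\<Sum>k<r. U om $ k * Z om $ k)" if "om \<in> space NN" for om
  using Z that by (simp add: L2v_def scalar_prod_def lessThan_atLeast0)
 have i: "integrable NN (\<lambda>om. U om $ k * Z om $ k)" if "k < r" for k using U Z that by (intro L2_mult) (auto simp: L2v_def)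
 show "integrable NN (\<lambda>om. U om \<bullet> Z om)"
  by (subst Bochner_Integration.integrable_cong[OF refl e]) (auto intro!: Bochner_Integration.integrable_sum i)
 show "(\<integral>om. U om \<bullet> Z om \<partial>NN) = (\<Sum>k<r. \<integral>om. U om $ k * Z om $ k \<partial>NN)"
  by (subst Bochner_Integration.integral_cong[OF refl e]) (auto intro!: Bochner_Integration.integral_sum i)
qed

lemma L2vI: assumes "U \<in> NN \<rightarrow>\<^sub>M borel_vec r" and f: "integrable NN f" and le: "!!om. om \<in> space NN ==> U om \<bullet> U om \<le> f om"
 shows "L2v NN r U"
 unfolding L2v_def L2_def
proof (intro conjI allI impI ballI)
 show "dim_vec (U om) = r" if "om \<in> space NN" for om using borel_vecD(2)[OF assms(1) that] .
 fix k assume k: "k < r"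
 show m: "(\<lambda>om. U om $ k) \<in> borel_measurable NN" by (rule borel_vecD(3)[OF assms(1) k])
 show "integrable NN (\<lambda>om. (U om $ k)\<^sup>2)"
 proof (rule Bochner_Integration.integrable_bound[OF f])
  show "(\<lambda>om. (U om $ k)\<^sup>2) \<in> borel_measurable NN" using m by measurable
  show "AE om in NN. norm ((U om $ k)\<^sup>2) \<le> norm (f om)"
  proof (rule AE_I2)
   fix om assume om: "om \<in> space NN"
   have "(U om $ k)\<^sup>2 \<le> U om \<bullet> U om" using borel_vecD(2)[OF assms(1) om] k by (intro comp_le_sp_self) simp
   also have "\<dots> \<le> f om" by (rule le[OF om])
   finally show "norm ((U om $ k)\<^sup>2) \<le> norm (f om)" by simp
  qed
 qed
qed

lemma L2v_bound_add:
 assumes U: "L2v NN r U" and Z: "L2v NN r Z"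
 shows "(\<integral>om. (U om + Z om) \<bullet> (U om + Z om) \<partial>NN) \<le> 2 * (\<integral>om. U om \<bullet> U om \<partial>NN) + 2 * (\<integral>om. Z om \<bullet> Z om \<partial>NN)"
proof -
 have "(\<integral>om. (U om + Z om) \<bullet> (U om + Z om) \<partial>NN) \<le> (\<integral>om. 2 * (U om \<bullet> U om) + 2 * (Z om \<bullet> Z om) \<partial>NN)"
  using U Z by (intro integral_mono L2v_sp_self(1)[OF L2v_add[OF U Z]] sp_self_sum_bound Bochner_Integration.integrable_add
    Bochner_Integration.integrable_mult_right L2v_sp_self(1)[OF U] L2v_sp_self(1)[OF Z]) (auto simp: L2v_def)
 then show ?thesis using L2v_sp_self(1)[OF U] L2v_sp_self(1)[OF Z] by simp
qed

lemma L2v_bound_mv: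
 assumes U: "L2v NN c U" and A: "dim_col A = c"
 shows "(\<integral>om. (A *\<^sub>v U om) \<bullet> (A *\<^sub>v U om) \<partial>NN) \<le> fro A * (\<integral>om. U om \<bullet> U om \<partial>NN)"
proof -
 have "(\<integral>om. (A *\<^sub>v U om) \<bullet> (A *\<^sub>v U om) \<partial>NN) \<le> (\<integral>om. fro A * (U om \<bullet> U om) \<partial>NN)"
  using U A by (intro integral_mono L2v_sp_self(1)[OF L2v_mv[OF U A refl]] fro_bound
    Bochner_Integration.integrable_mult_right L2v_sp_self(1)[OF U]) (auto simp: L2v_def)
 then show ?thesis by simp
qed

section \<open>Independent copies: subjective environment and private noise\<close>

text \<open>The product of two copies of \<open>M\<close>: the first coordinate drives the environment, the
 second one the private primitives. This realizes the independence in the subjective cost.\<close>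
locale verif = full + 
 fixes i :: nat
 assumes i: "i \<in> {1..nDM g}"
begin

sublocale dmi: dm g i by (rule dm[OF i])

abbreviation "ni \<equiv> nx g i"
abbreviation "mi \<equiv> nu g i"
abbreviation "PP \<equiv> M \<Otimes>\<^sub>M M"

sublocale P: pair_prob_space M M ..

lemma marg: "distr PP M fst = M" "distr PP M snd = M"
proof -
 show 1: "distr PP M fst = M" by (rule distr_pair_fst)
 have "distr PP M snd = distr (distr PP PP (\<lambda>(x, y). (y, x))) M snd" using P.distr_pair_swap by simp
 also have "\<dots> = distr PP M fst" by (subst distr_distr) (auto simp: o_def case_prod_unfold)
 finally show "distr PP M snd = M" using 1 by simp
qed

lemma marg_integral: assumes [measurable]: "f \<in> borel_measurable M"
 shows "(\<integral>om. f (fst om) \<partial>PP) = (\<integral>om. f om \<partial>M)" "(\<integral>om. f (snd om) \<partial>PP) = (\<integral>om. (f om :: real) \<partial>M)"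
 "integrable PP (\<lambda>om. f (fst om)) \<longleftrightarrow> integrable M f" "integrable PP (\<lambda>om. f (snd om)) \<longleftrightarrow> integrable M f"
 using integral_distr[of fst PP M f] integral_distr[of snd PP M f] integrable_distr_eq[of fst PP M f] integrable_distr_eq[of snd PP M f]
 by (simp_all add: marg)

lemma L2v_marg: assumes "L2v M r U" shows "L2v PP r (\<lambda>om. U (fst om))" "L2v PP r (\<lambda>om. U (snd om))"
proof -
 have U: "(\<lambda>om. U om $ k) \<in> borel_measurable M" "integrable M (\<lambda>om. (U om $ k)\<^sup>2)" if "k < r" for k using assms that by (auto simp: L2v_def L2_def)
 have q: "(\<lambda>om. (U om $ k)\<^sup>2) \<in> borel_measurable M" if "k < r" for k using U(1)[OF that] by measurable
 show "L2v PP r (\<lambda>om. U (fst om))" "L2v PP r (\<lambda>om. U (snd om))"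
  using assms measurable_compose[OF measurable_fst U(1)] measurable_compose[OF measurable_snd U(1)] marg_integral(3)[OF q] marg_integral(4)[OF q] U(2)
  by (auto simp: L2v_def L2_def space_pair_measure)
qed

lemma private_dims: "om \<in> space M ==> dim_vec (x0 i om) = ni" "om \<in> space M ==> dim_vec (w i t om) = ni"
 using borel_vecD(2)[OF rv(1)] borel_vecD(2)[OF rv(2)] i by auto

lemma private_meas: "x0 i \<in> M \<rightarrow>\<^sub>M borel_vec ni" "w i t \<in> M \<rightarrow>\<^sub>M borel_vec ni" using rv i by auto

lemma private_block: assumes om: "om \<in> space M" shows "x0 i om = block i (X0 om)" "w i t om = block i (W t om)"
 unfolding stack_prims using borel_vecD(2)[OF rv(1) om] borel_vecD(2)[OF rv(2) om] i by (simp_all add: block_stack)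

lemma block_pos: "k < ni ==> (\<Sum>j<i. nx g j) + k < d"
proof -
 assume k: "k < ni"
 have "(\<Sum>j<i. nx g j) + ni = (\<Sum>j\<le>i. nx g j)" by (simp add: lessThan_Suc_atMost[symmetric])
 also have "\<dots> \<le> d" unfolding nX_def using i by (intro sum_mono2) auto
 finally show ?thesis using k by simp
qed

lemma borel_block: assumes f: "f \<in> NN \<rightarrow>\<^sub>M borel_vec d" shows "(\<lambda>om. block i (f om)) \<in> NN \<rightarrow>\<^sub>M borel_vec ni"
 by (rule borel_vecI) (auto simp: block_def intro!: carrier_vecI borel_vecD(3)[OF f] block_pos)

lemma W_L2: "L2v M d (W t)" "L2v M d X0"
proof -
 have "L2v M d (\<lambda>om. wc t om + stack g ew)" by (intro L2v_add L2_en(4) L2v_const finite_measure_axioms) simp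
 then show "L2v M d (W t)" by (rule L2v_eq[rotated]) (auto simp: wc_def sp_dims intro!: eq_vecI)
 have "L2v M d (\<lambda>om. (X0 om - eX) + eX)" by (intro L2v_add affv_L2v aff_noise(3) L2v_const finite_measure_axioms) simp
 then show "L2v M d X0" by (rule L2v_eq[rotated]) (auto simp: sp_dims intro!: eq_vecI)
qed

lemma private_L2: "L2v M ni (w i t)" "L2v M ni (x0 i)"
proof -
 have "L2v M ni (\<lambda>om. block i (W t om))" "L2v M ni (\<lambda>om. block i (X0 om))"
  using W_L2 block_pos by (auto simp: L2v_def block_def)
 from L2v_eq[OF private_block(2) this(1)] L2v_eq[OF private_block(1) this(2)] show "L2v M ni (w i t)" "L2v M ni (x0 i)" by auto
qed

lemma private_mean: assumes k: "k < ni" shows "(\<integral>om. w i t om $ k \<partial>M) = ew i $ k"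
proof -
 have "ew i = block i (stack g ew)" using ew i by (simp add: block_stack)
 also have "\<dots> $ k = stack g ew $ ((\<Sum>j<i. nx g j) + k)" using k by (simp add: block_def)
 also have "\<dots> = (\<integral>om. W t om $ ((\<Sum>j<i. nx g j) + k) \<partial>M)"
  unfolding W_mean_cov(1)[of t, symmetric] mean_vec_def using block_pos[OF k] by simp
 also have "\<dots> = (\<integral>om. w i t om $ k \<partial>M)" using k by (intro Bochner_Integration.integral_cong) (auto simp: private_block block_def)
 finally show ?thesis ..
qed

text \<open>What the decision maker may have seen up to time \<open>t\<close>: the environment before \<open>t\<close>, and
 the initial state and disturbances before \<open>t\<close>.\<close>
abbreviation "HS t \<equiv> (\<Pi>\<^sub>M k\<in>{..<t}. borel_vec p) \<Otimes>\<^sub>M borel_vec ni \<Otimes>\<^sub>M (\<Pi>\<^sub>M k\<in>{..<t}. borel_vec ni)"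
definition "hst t om = ((\<lambda>k\<in>{..<t}. Y k (fst om)), x0 i (snd om), (\<lambda>k\<in>{..<t}. w i k (snd om)))" for t :: nat
definition adapted :: "nat => nat => ('a \<times> 'a => rvec) => bool" where
 "adapted t r U \<longleftrightarrow> (\<exists>v \<in> HS t \<rightarrow>\<^sub>M borel_vec r. \<forall>om\<in>space PP. U om = v (hst t om))"

lemma hst_measurable: "hst t \<in> PP \<rightarrow>\<^sub>M HS t"
 unfolding hst_def using private_meas Y_measurable(1)
 by (intro measurable_Pair measurable_restrict measurable_compose[OF measurable_fst] measurable_compose[OF measurable_snd]) auto

lemma adapted_measurable: assumes "adapted t r U" shows "U \<in> PP \<rightarrow>\<^sub>M borel_vec r"
proof -
 obtain v where v: "v \<in> HS t \<rightarrow>\<^sub>M borel_vec r" "!!om. om \<in> space PP ==> U om = v (hst t om)" using assms unfolding adapted_def by blast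
 have "(\<lambda>om. v (hst t om)) \<in> PP \<rightarrow>\<^sub>M borel_vec r" by (rule measurable_compose[OF hst_measurable v(1)])
 then show ?thesis by (subst measurable_cong[of PP U "\<lambda>om. v (hst t om)"]) (rule v(2))
qed

lemma adapted_mv: assumes "adapted t c U" "dim_row A = r" "dim_col A = c" shows "adapted t r (\<lambda>om. A *\<^sub>v U om)"
proof -
 obtain v where v: "v \<in> HS t \<rightarrow>\<^sub>M borel_vec c" "\<forall>om\<in>space PP. U om = v (hst t om)" using assms unfolding adapted_def by blast
 have "(\<lambda>h. A *\<^sub>v v h) \<in> HS t \<rightarrow>\<^sub>M borel_vec r" by (rule borel_vec_mv[OF v(1) assms(2,3)])
 then show ?thesis using v(2) unfolding adapted_def by (intro bexI[of _ "\<lambda>h. A *\<^sub>v v h"]) simp_all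
qed
lemma adapted_add: assumes "adapted t r U" "adapted t r Z" shows "adapted t r (\<lambda>om. U om + Z om)"
proof -
 obtain v v' where v: "v \<in> HS t \<rightarrow>\<^sub>M borel_vec r" "\<forall>om\<in>space PP. U om = v (hst t om)"
  "v' \<in> HS t \<rightarrow>\<^sub>M borel_vec r" "\<forall>om\<in>space PP. Z om = v' (hst t om)" using assms unfolding adapted_def by blast
 have "(\<lambda>h. v h + v' h) \<in> HS t \<rightarrow>\<^sub>M borel_vec r" by (rule borel_vec_add[OF v(1,3)])
 then show ?thesis using v(2,4) unfolding adapted_def by (intro bexI[of _ "\<lambda>h. v h + v' h"]) simp_all
qed
lemma adapted_diff: assumes "adapted t r U" "adapted t r Z" shows "adapted t r (\<lambda>om. U om - Z om)"
proof -
 obtain v v' where v: "v \<in> HS t \<rightarrow>\<^sub>M borel_vec r" "\<forall>om\<in>space PP. U om = v (hst t om)"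
  "v' \<in> HS t \<rightarrow>\<^sub>M borel_vec r" "\<forall>om\<in>space PP. Z om = v' (hst t om)" using assms unfolding adapted_def by blast
 have "(\<lambda>h. v h - v' h) \<in> HS t \<rightarrow>\<^sub>M borel_vec r" by (rule borel_vec_diff[OF v(1,3)])
 then show ?thesis using v(2,4) unfolding adapted_def by (intro bexI[of _ "\<lambda>h. v h - v' h"]) simp_all
qed

abbreviation "px \<sigma> t om \<equiv> subj_x g i \<sigma> (x0 i (snd om)) (\<lambda>k. w i k (snd om)) (\<lambda>k. Y k (fst om)) t"
abbreviation "pu \<sigma> t om \<equiv> subj_u g i \<sigma> (x0 i (snd om)) (\<lambda>k. w i k (snd om)) (\<lambda>k. Y k (fst om)) t"

lemma adapted_path: assumes \<sigma>: "\<sigma> \<in> strategies g i" shows "adapted t ni (px \<sigma> t)" "adapted t mi (pu \<sigma> t)"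
proof -
 let ?X = "\<lambda>h. fst (snd h)"
 let ?Z = "\<lambda>k h. if k < t then fst h k else 0\<^sub>v p" and ?W = "\<lambda>k h. if k < t then snd (snd h) k else 0\<^sub>v ni"
 have X: "?X \<in> HS t \<rightarrow>\<^sub>M borel_vec ni" by measurable
 have Z: "?Z k \<in> HS t \<rightarrow>\<^sub>M borel_vec p" for k
 proof (cases "k < t")
  case True
  have "(\<lambda>h. fst h k) \<in> HS t \<rightarrow>\<^sub>M borel_vec p" by (rule measurable_compose[OF measurable_fst measurable_component_singleton]) (use True in auto)
  then show ?thesis using True by simp
 qed (auto intro!: borel_vec_const)
 have W: "?W k \<in> HS t \<rightarrow>\<^sub>M borel_vec ni" for k
 proof (cases "k < t")
  case True
  have "(\<lambda>h. snd (snd h) k) \<in> HS t \<rightarrow>\<^sub>M borel_vec ni"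
   by (rule measurable_compose[OF measurable_compose[OF measurable_snd measurable_snd] measurable_component_singleton]) (use True in auto)
  then show ?thesis using True by simp
 qed (auto intro!: borel_vec_const)
 note m = dmi.subj_measurable[where X = ?X and Wp = ?W and Z = ?Z and NN = "HS t" and t = t, OF \<sigma> X W Z]
 show "adapted t ni (px \<sigma> t)" unfolding adapted_def
 proof (rule bexI[OF _ m(1)], rule ballI)
  fix om
  show "px \<sigma> t om = subj_x g i \<sigma> (?X (hst t om)) (\<lambda>k. ?W k (hst t om)) (\<lambda>k. ?Z k (hst t om)) t"
   unfolding hst_def fst_conv snd_conv by (rule subj_causal(1)) simp_all
 qed
 show "adapted t mi (pu \<sigma> t)" unfolding adapted_def
 proof (rule bexI[OF _ m(2)], rule ballI)
  fix om
  show "pu \<sigma> t om = subj_u g i \<sigma> (?X (hst t om)) (\<lambda>k. ?W k (hst t om)) (\<lambda>k. ?Z k (hst t om)) t"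
   unfolding hst_def fst_conv snd_conv by (rule subj_causal(2)) simp_all
 qed
qed

text \<open>For fixed private noise the multiplier is a function of the past observations, so the innovation
 integrates to 0 against it; then integrate over the private noise.\<close>
lemma innovation_orth:
 assumes a: "adapted t r U" and L: "L2v PP r U" and k: "k < r" and l: "l < p"
 shows "(\<integral>om. U om $ k * n t (fst om) $ l \<partial>PP) = 0"
proof -
 obtain v where v: "v \<in> HS t \<rightarrow>\<^sub>M borel_vec r" and Uv: "!!om. om \<in> space PP ==> U om = v (hst t om)" using a unfolding adapted_def by blast
 have LU: "L2 PP (\<lambda>om. U om $ k)" using L k by (simp add: L2v_def)
 have Ln: "L2 PP (\<lambda>om. n t (fst om) $ l)" using L2v_marg(1)[OF L2_en(2)] l by (simp add: L2v_def)
 have int: "integrable PP (case_prod (\<lambda>x y. U (x, y) $ k * n t x $ l))" using L2_mult[OF LU Ln] by (simp add: case_prod_unfold)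
 have int2: "integrable PP (case_prod (\<lambda>x y. (U (x, y) $ k)\<^sup>2))" using LU by (simp add: case_prod_unfold L2_def)
 have "AE y in M. (\<integral>x. U (x, y) $ k * n t x $ l \<partial>M) = 0"
  using P.AE_integrable_snd[OF int2] AE_space
 proof eventually_elim
  case (elim y)
  let ?v = "\<lambda>\<rho>. v (\<rho>, x0 i y, \<lambda>k\<in>{..<t}. w i k y) $ k"
  have "(\<lambda>\<rho>. (\<rho>, x0 i y, \<lambda>k\<in>{..<t}. w i k y)) \<in> (\<Pi>\<^sub>M k\<in>{..<t}. borel_vec p) \<rightarrow>\<^sub>M HS t"
   using elim private_dims by (intro measurable_Pair measurable_ident_sets measurable_const)
    (auto simp: space_PiM space_pair_measure intro!: carrier_vecI)
  from borel_vecD(3)[OF measurable_compose[OF this v] k] have vm: "?v \<in> borel_measurable (\<Pi>\<^sub>M k\<in>{..<t}. borel_vec p)" .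
  have e: "U (x, y) $ k = ?v (\<lambda>k\<in>{..<t}. Y k x)" if "x \<in> space M" for x
   using Uv[of "(x, y)"] elim that by (simp add: hst_def space_pair_measure)
  have mY: "(\<lambda>x. \<lambda>k\<in>{..<t}. Y k x) \<in> M \<rightarrow>\<^sub>M (\<Pi>\<^sub>M k\<in>{..<t}. borel_vec p)" using Y_measurable(1) by (intro measurable_restrict) auto
  have "L2 M (\<lambda>x. ?v (\<lambda>k\<in>{..<t}. Y k x))"
   unfolding L2_def using measurable_compose[OF mY vm] elim(1) Bochner_Integration.integrable_cong[OF refl, of M "\<lambda>x. (U (x, y) $ k)\<^sup>2" "\<lambda>x. (?v (\<lambda>k\<in>{..<t}. Y k x))\<^sup>2"]
   by (simp add: e)
  then have "(\<integral>x. n t x $ l * ?v (\<lambda>k\<in>{..<t}. Y k x) \<partial>M) = 0"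
   using L2_en(2)[of t] l by (intro orth_past_L2[OF prob Y_measurable(1) _ _ vm] n_orth) (auto simp: L2v_def)
  moreover have "(\<integral>x. U (x, y) $ k * n t x $ l \<partial>M) = (\<integral>x. n t x $ l * ?v (\<lambda>k\<in>{..<t}. Y k x) \<partial>M)"
   by (intro Bochner_Integration.integral_cong) (auto simp: e)
  ultimately show ?case by simp
 qed
 then have "(\<integral>y. (\<integral>x. U (x, y) $ k * n t x $ l \<partial>M) \<partial>M) = 0" by (rule integral_eq_zero_AE)
 then show ?thesis unfolding P.integral_snd[OF int] by (simp add: case_prod_unfold)
qed

text \<open>For fixed environment the multiplier depends on the initial state and earlier disturbances, which
 are independent of the current centred disturbance.\<close>
lemma noise_orth:
 assumes a: "adapted t r U" and L: "L2v PP r U" and k: "k < r" and l: "l < ni"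
 shows "(\<integral>om. U om $ k * (w i t (snd om) - ew i) $ l \<partial>PP) = 0"
proof -
 obtain v where v: "v \<in> HS t \<rightarrow>\<^sub>M borel_vec r" and Uv: "!!om. om \<in> space PP ==> U om = v (hst t om)" using a unfolding adapted_def by blast
 have ewd: "dim_vec (ew i) = ni" using ew i by simp
 have Lw: "L2v M ni (\<lambda>om. w i t om - ew i)" using ewd by (intro L2v_diff private_L2 L2v_const finite_measure_axioms)
 have LU: "L2 PP (\<lambda>om. U om $ k)" using L k by (simp add: L2v_def)
 have Ln: "L2 PP (\<lambda>om. (w i t (snd om) - ew i) $ l)" using L2v_marg(2)[OF Lw] l by (simp add: L2v_def)
 have int: "integrable PP (\<lambda>om. U om $ k * (w i t (snd om) - ew i) $ l)" by (rule L2_mult[OF LU Ln])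
 have int2: "integrable PP (\<lambda>om. (U om $ k)\<^sup>2)" using LU by (simp add: L2_def)
 have w0: "(\<integral>y. (w i t y - ew i) $ l \<partial>M) = 0"
 proof -
  have iw: "integrable M (\<lambda>y. w i t y $ l)" using private_L2(1)[of t] l finite_measure_axioms by (auto simp: L2v_def intro: L2_integrable)
  have "(\<integral>y. (w i t y - ew i) $ l \<partial>M) = (\<integral>y. w i t y $ l - ew i $ l \<partial>M)" using l ewd by (intro Bochner_Integration.integral_cong) auto
  then show ?thesis using iw private_mean[OF l, of t] by (simp add: prob_space)
 qed
 let ?A = "insert Init (Dist ` {..<t})" and ?B = "{Dist t}" and ?pd = "\<lambda>q. borel_vec (prim_dim g q)"
 let ?pv = "prim_var X0 W xi"
 have ind: "indep_var (PiM ?A ?pd) (\<lambda>om. restrict (\<lambda>q. ?pv q om) ?A) (PiM ?B ?pd) (\<lambda>om. restrict (\<lambda>q. ?pv q om) ?B)"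
  by (rule indep_var_restrict[OF indep]) auto
 have "AE x in M. (\<integral>y. U (x, y) $ k * (w i t y - ew i) $ l \<partial>M) = 0"
  using P.AE_integrable_fst'[OF int2] AE_space
 proof eventually_elim
  case (elim x)
  let ?F = "\<lambda>f. v ((\<lambda>k\<in>{..<t}. Y k x), block i (f Init), (\<lambda>k\<in>{..<t}. block i (f (Dist k)))) $ k"
  let ?G = "\<lambda>f. (block i (f (Dist t)) - ew i) $ l"
  have comp: "(\<lambda>f. f q) \<in> PiM J ?pd \<rightarrow>\<^sub>M borel_vec d" if "q \<in> J" "prim_dim g q = d" for q J
   using measurable_component_singleton[of q J ?pd] that by simp
  have "(\<lambda>f. ((\<lambda>k\<in>{..<t}. Y k x), block i (f Init), (\<lambda>k\<in>{..<t}. block i (f (Dist k))))) \<in> PiM ?A ?pd \<rightarrow>\<^sub>M HS t"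
   using elim Ydims(1) by (intro measurable_Pair measurable_restrict borel_block comp measurable_const)
    (auto simp: space_PiM intro!: carrier_vecI)
  from borel_vecD(3)[OF measurable_compose[OF this v] k] have Fm: "?F \<in> borel_measurable (PiM ?A ?pd)" .
  have "(\<lambda>f. block i (f (Dist t)) - ew i) \<in> PiM ?B ?pd \<rightarrow>\<^sub>M borel_vec ni"
   using ewd by (intro borel_vec_diff borel_block comp borel_vec_const) auto
  from borel_vecD(3)[OF this l] have Gm: "?G \<in> borel_measurable (PiM ?B ?pd)" .
  have eU: "U (x, y) $ k = (?F \<circ> (\<lambda>om. restrict (\<lambda>q. ?pv q om) ?A)) y" if y: "y \<in> space M" for y
  proof -
   have "(\<lambda>k\<in>{..<t}. block i (restrict (\<lambda>q. ?pv q y) ?A (Dist k))) = (\<lambda>k\<in>{..<t}. w i k y)"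
    by (rule restrict_ext) (simp add: private_block[OF y])
   moreover have "block i (restrict (\<lambda>q. ?pv q y) ?A Init) = x0 i y" by (simp add: private_block[OF y])
   moreover have "U (x, y) = v ((\<lambda>k\<in>{..<t}. Y k x), x0 i y, (\<lambda>k\<in>{..<t}. w i k y))"
    using Uv[of "(x, y)"] elim(2) y by (simp add: hst_def space_pair_measure)
   ultimately show ?thesis by (simp only: o_apply)
  qed
  have eW: "(w i t y - ew i) $ l = (?G \<circ> (\<lambda>om. restrict (\<lambda>q. ?pv q om) ?B)) y" if "y \<in> space M" for y
   using that by (simp add: private_block)
  have ind2: "indep_var borel (?F \<circ> (\<lambda>om. restrict (\<lambda>q. ?pv q om) ?A)) borel (?G \<circ> (\<lambda>om. restrict (\<lambda>q. ?pv q om) ?B))"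
   by (rule indep_var_compose[OF ind Fm Gm])
  have mU: "(\<lambda>y. U (x, y) $ k) \<in> borel_measurable M"
   using measurable_compose[OF measurable_Pair1' L2_measurable[OF LU]] elim(2) by simp
  have iU: "integrable M (\<lambda>y. U (x, y) $ k)" using elim(1) mU by (intro L2_integrable[OF finite_measure_axioms]) (simp add: L2_def)
  have iW: "integrable M (\<lambda>y. (w i t y - ew i) $ l)" using Lw l finite_measure_axioms by (auto simp: L2v_def intro: L2_integrable)
  define F' where "F' = (?F \<circ> (\<lambda>om. restrict (\<lambda>q. ?pv q om) ?A))"
  define G' where "G' = (?G \<circ> (\<lambda>om. restrict (\<lambda>q. ?pv q om) ?B))"
  have eU': "U (x, y) $ k = F' y" and eW': "(w i t y - ew i) $ l = G' y" if "y \<in> space M" for y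
   unfolding F'_def G'_def using that by (rule eU, rule eW)
  have i': "integrable M F'" "integrable M G'"
   using iU iW Bochner_Integration.integrable_cong[of M M _ F', OF refl eU'] Bochner_Integration.integrable_cong[of M M _ G', OF refl eW'] by blast+
  have "(\<integral>y. U (x, y) $ k * (w i t y - ew i) $ l \<partial>M) = (\<integral>y. F' y * G' y \<partial>M)"
   by (rule Bochner_Integration.integral_cong) (simp_all only: eU' eW')
  also have "\<dots> = (\<integral>y. F' y \<partial>M) * (\<integral>y. G' y \<partial>M)"
   by (rule indep_var_lebesgue_integral[OF ind2[folded F'_def G'_def] i'])
  also have "(\<integral>y. G' y \<partial>M) = 0"
   using w0 Bochner_Integration.integral_cong[of M M _ G', OF refl eW'] by simp
  finally show ?case by simp
 qed
 then have "(\<integral>x. (\<integral>y. U (x, y) $ k * (w i t y - ew i) $ l \<partial>M) \<partial>M) = 0" by (rule integral_eq_zero_AE)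
 then show ?thesis using P.integral_fst'[OF int] by simp
qed

lemma orth_sp:
 assumes a: "adapted t r U" and L: "L2v PP r U"
 shows "dim_row A = r ==> dim_col A = p ==> (\<integral>om. U om \<bullet> (A *\<^sub>v n t (fst om)) \<partial>PP) = 0"
  "dim_row A = r ==> dim_col A = ni ==> (\<integral>om. U om \<bullet> (A *\<^sub>v (w i t (snd om) - ew i)) \<partial>PP) = 0"
proof -
 have ewd: "dim_vec (ew i) = ni" using ew i by simp
 have gen: "(\<integral>om. U om \<bullet> (A *\<^sub>v Z om) \<partial>PP) = 0" if A: "dim_row A = r" "dim_col A = c" and Z: "L2v PP c Z"
  and 0: "!!k l. k < r ==> l < c ==> (\<integral>om. U om $ k * Z om $ l \<partial>PP) = 0" for A c Z
 proof -
  have "(\<integral>om. U om $ k * (A *\<^sub>v Z om) $ k \<partial>PP) = 0" if k: "k < r" for k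
  proof -
   have "(\<integral>om. U om $ k * (A *\<^sub>v Z om) $ k \<partial>PP) = (\<integral>om. (\<Sum>l<c. A $$ (k,l) * (U om $ k * Z om $ l)) \<partial>PP)"
    using k A Z by (intro Bochner_Integration.integral_cong) (auto simp: L2v_def mv_index sum_distrib_left mult_ac simp del: index_mult_mat_vec)
   also have "\<dots> = (\<Sum>l<c. \<integral>om. A $$ (k,l) * (U om $ k * Z om $ l) \<partial>PP)"
    using k L Z by (intro Bochner_Integration.integral_sum Bochner_Integration.integrable_mult_right L2_mult) (auto simp: L2v_def)
   also have "\<dots> = 0" using 0[OF k] by simp
   finally show ?thesis .
  qed
  then show ?thesis unfolding L2v_sp(2)[OF L L2v_mv[OF Z A(2,1)]] by simp
 qed
 show "(\<integral>om. U om \<bullet> (A *\<^sub>v n t (fst om)) \<partial>PP) = 0" if "dim_row A = r" "dim_col A = p"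
  by (rule gen[OF that L2v_marg(1)[OF L2_en(2)] innovation_orth[OF a L]])
 show "(\<integral>om. U om \<bullet> (A *\<^sub>v (w i t (snd om) - ew i)) \<partial>PP) = 0" if "dim_row A = r" "dim_col A = ni"
  using ewd by (intro gen[OF that _ noise_orth[OF a L]] L2v_marg(2)[OF L2v_diff[OF private_L2(1) L2v_const[OF finite_measure_axioms]]])
qed

end

section \<open>Mean square bounds along the candidate strategy\<close>

text \<open>Cauchy-Schwarz with the geometric weights bounds the partial sums in mean square, and Fatou passes
 to the limit. The bound depends on \<open>B\<close> only, not on the sequence, and is thus uniform in time.\<close>
lemma geo_moment:
 fixes NN :: "'c measure"
 assumes U: "geo r c U" and B: "0 \<le> B"
 shows "\<exists>K\<ge>0. \<forall>v :: nat => 'c => rvec. (\<forall>k. L2v NN c (v k)) --> (\<forall>k l. l < c --> (\<integral>om. (v k om $ l)\<^sup>2 \<partial>NN) \<le> B)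
  --> (\<forall>om\<in>space NN. bdd_vec c (\<lambda>k. v k om))
  --> L2v NN r (\<lambda>om. suminf_vec r (\<lambda>k. U k *\<^sub>v v k om)) \<and> (\<integral>om. suminf_vec r (\<lambda>k. U k *\<^sub>v v k om) \<bullet> suminf_vec r (\<lambda>k. U k *\<^sub>v v k om) \<partial>NN) \<le> K"
proof -
 obtain C \<rho> where C: "0 \<le> C" "0 \<le> \<rho>" "\<rho> < 1" "!!k i j. i < r ==> j < c ==> \<bar>U k $$ (i,j)\<bar> \<le> C * \<rho> ^ k"
  "!!k. U k \<in> carrier_mat r c" using geoD[OF U] by blast
 define q where "q kl = C * \<rho> ^ fst kl" for kl :: "nat \<times> nat"
 define Q where "Q = c * (C / (1 - \<rho>))"
 have q0: "0 \<le> q kl" for kl using C by (simp add: q_def)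
 have Q0: "0 \<le> Q" using C by (simp add: Q_def)
 have qQ: "(\<Sum>kl\<in>{..<T}\<times>{..<c}. q kl) \<le> Q" for T
 proof -
  have "(\<Sum>k<T. \<rho> ^ k) \<le> (\<Sum>k. \<rho> ^ k)" using C by (intro sum_le_suminf summable_geometric) auto
  also have "\<dots> = 1 / (1 - \<rho>)" using C by (simp add: suminf_geometric)
  finally have "(\<Sum>k<T. C * \<rho> ^ k) \<le> C / (1 - \<rho>)" using C by (simp add: sum_distrib_left[symmetric] mult_left_mono[of _ "1 / (1 - \<rho>)", simplified])
  then have "c * (\<Sum>k<T. C * \<rho> ^ k) \<le> Q" unfolding Q_def by (intro mult_left_mono) auto
  then show ?thesis by (simp add: q_def sum.cartesian_product' sum_distrib_left)
 qed
 show ?thesis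
 proof (intro exI[of _ "r * (Q * (Q * B))"] conjI[of "0 \<le> r * (Q * (Q * B))"] allI impI)
  show "0 \<le> real r * (Q * (Q * B))" using Q0 B by simp
  fix v :: "nat => 'c => rvec"
  assume L': "\<forall>k. L2v NN c (v k)" and bd': "\<forall>k l. l < c --> (\<integral>om. (v k om $ l)\<^sup>2 \<partial>NN) \<le> B"
   and bv': "\<forall>om\<in>space NN. bdd_vec c (\<lambda>k. v k om)"
  note L = L'[rule_format] and bd = bd'[rule_format] and bv = bv'[rule_format]
  let ?S = "\<lambda>om. suminf_vec r (\<lambda>k. U k *\<^sub>v v k om)"
  have Li: "integrable NN (\<lambda>om. (v k om $ l)\<^sup>2)" "(\<lambda>om. v k om $ l) \<in> borel_measurable NN" if "l < c" for k l
   using L[of k] that by (auto simp: L2v_def L2_def)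
  have comp: "L2 NN (\<lambda>om. ?S om $ j) \<and> (\<integral>om. (?S om $ j)\<^sup>2 \<partial>NN) \<le> Q * (Q * B)" if j: "j < r" for j
  proof -
   define s where "s T om = (\<Sum>k<T. (U k *\<^sub>v v k om) $ j)" for T om
   have m: "s T \<in> borel_measurable NN" for T
    unfolding s_def
   proof (intro borel_measurable_sum)
    fix k
    have "v k \<in> NN \<rightarrow>\<^sub>M borel_vec c" using L[of k] Li(2) by (intro borel_vecI) (auto simp: L2v_def intro: carrier_vecI)
    from borel_vecD(3)[OF borel_vec_mv[OF this, of "U k" r] j] show "(\<lambda>om. (U k *\<^sub>v v k om) $ j) \<in> borel_measurable NN" using C(5)[of k] by auto
   qed
   have lim: "(\<lambda>T. s T om) \<longlonglongrightarrow> ?S om $ j" if om: "om \<in> space NN" for om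
   proof -
    have "summable (\<lambda>k. (U k *\<^sub>v v k om) $ j)" using geo_summable[OF U bv[OF om]] j by (simp add: summable_vec_def)
    from summable_LIMSEQ[OF this] show ?thesis using j by (simp add: s_def suminf_vec_def)
   qed
   have mS: "(\<lambda>om. ?S om $ j) \<in> borel_measurable NN" by (rule borel_measurable_LIMSEQ_real[OF lim m])
   let ?I = "\<lambda>T. {..<T}\<times>{..<c}"
   have sq: "(s T om)\<^sup>2 \<le> Q * (\<Sum>kl\<in>?I T. q kl * (v (fst kl) om $ snd kl)\<^sup>2)" if om: "om \<in> space NN" for T om
   proof -
    have vd: "dim_vec (v k om) = c" for k using L[of k] om by (simp add: L2v_def)
    have "\<bar>s T om\<bar> \<le> (\<Sum>k<T. \<bar>(U k *\<^sub>v v k om) $ j\<bar>)" unfolding s_def by (rule sum_abs)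
    also have "\<dots> \<le> (\<Sum>k<T. \<Sum>l<c. q (k,l) * \<bar>v k om $ l\<bar>)"
    proof (rule sum_mono)
     fix k
     have "\<bar>(U k *\<^sub>v v k om) $ j\<bar> = \<bar>\<Sum>l<c. U k $$ (j,l) * v k om $ l\<bar>" using C(5)[of k] j vd by (subst mv_index) auto
     also have "\<dots> \<le> (\<Sum>l<c. \<bar>U k $$ (j,l) * v k om $ l\<bar>)" by (rule sum_abs)
     also have "\<dots> \<le> (\<Sum>l<c. q (k,l) * \<bar>v k om $ l\<bar>)"
      using C(4)[OF j] by (intro sum_mono) (auto simp: abs_mult q_def intro: mult_right_mono)
     finally show "\<bar>(U k *\<^sub>v v k om) $ j\<bar> \<le> (\<Sum>l<c. q (k,l) * \<bar>v k om $ l\<bar>)" .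
    qed
    also have "\<dots> = (\<Sum>kl\<in>?I T. sqrt (q kl) * (sqrt (q kl) * \<bar>v (fst kl) om $ snd kl\<bar>))"
     using q0 by (simp add: sum.cartesian_product case_prod_unfold mult.assoc[symmetric])
    finally have "\<bar>s T om\<bar> \<le> (\<Sum>kl\<in>?I T. sqrt (q kl) * (sqrt (q kl) * \<bar>v (fst kl) om $ snd kl\<bar>))" .
    from power_mono[OF this abs_ge_zero, of 2]
    have "(s T om)\<^sup>2 \<le> (\<Sum>kl\<in>?I T. sqrt (q kl) * (sqrt (q kl) * \<bar>v (fst kl) om $ snd kl\<bar>))\<^sup>2"
     by (simp only: power2_abs)
    also have "\<dots> \<le> (\<Sum>kl\<in>?I T. (sqrt (q kl))\<^sup>2) * (\<Sum>kl\<in>?I T. (sqrt (q kl) * \<bar>v (fst kl) om $ snd kl\<bar>)\<^sup>2)"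
     by (rule Cauchy_Schwarz_ineq_sum)
    also have "\<dots> = (\<Sum>kl\<in>?I T. q kl) * (\<Sum>kl\<in>?I T. q kl * (v (fst kl) om $ snd kl)\<^sup>2)"
     using q0 by (simp add: power_mult_distrib)
    also have "\<dots> \<le> Q * (\<Sum>kl\<in>?I T. q kl * (v (fst kl) om $ snd kl)\<^sup>2)"
     using qQ q0 by (intro mult_right_mono sum_nonneg) auto
    finally show ?thesis .
   qed
   have ib: "integrable NN (\<lambda>om. Q * (\<Sum>kl\<in>?I T. q kl * (v (fst kl) om $ snd kl)\<^sup>2))" for T
    using Li(1) by (intro Bochner_Integration.integrable_mult_right Bochner_Integration.integrable_sum) auto
   have fin: "(\<integral>\<^sup>+om. ennreal ((s T om)\<^sup>2) \<partial>NN) \<le> ennreal (Q * (Q * B))" for T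
   proof -
    have "(\<integral>\<^sup>+om. ennreal ((s T om)\<^sup>2) \<partial>NN) \<le> (\<integral>\<^sup>+om. ennreal (Q * (\<Sum>kl\<in>?I T. q kl * (v (fst kl) om $ snd kl)\<^sup>2)) \<partial>NN)"
     by (intro nn_integral_mono ennreal_leI sq)
    also have "\<dots> = ennreal (\<integral>om. Q * (\<Sum>kl\<in>?I T. q kl * (v (fst kl) om $ snd kl)\<^sup>2) \<partial>NN)"
     using Q0 q0 by (intro nn_integral_eq_integral ib AE_I2 mult_nonneg_nonneg sum_nonneg) auto
    also have "(\<integral>om. Q * (\<Sum>kl\<in>?I T. q kl * (v (fst kl) om $ snd kl)\<^sup>2) \<partial>NN) = Q * (\<Sum>kl\<in>?I T. q kl * (\<integral>om. (v (fst kl) om $ snd kl)\<^sup>2 \<partial>NN))"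
     using Li(1) by (simp, subst Bochner_Integration.integral_sum) auto
    also have "\<dots> \<le> Q * (\<Sum>kl\<in>?I T. q kl * B)"
     using Q0 q0 bd by (intro mult_left_mono sum_mono) auto
    also have "\<dots> = Q * ((\<Sum>kl\<in>?I T. q kl) * B)" by (simp add: sum_distrib_right)
    also have "\<dots> \<le> Q * (Q * B)" using Q0 qQ B by (intro mult_left_mono mult_right_mono) auto
    finally show ?thesis by (simp add: ennreal_leI)
   qed
   have "(\<integral>\<^sup>+om. ennreal ((?S om $ j)\<^sup>2) \<partial>NN) = (\<integral>\<^sup>+om. liminf (\<lambda>T. ennreal ((s T om)\<^sup>2)) \<partial>NN)"
    using lim by (intro nn_integral_cong lim_imp_Liminf[symmetric] tendsto_ennrealI tendsto_power) auto
   also have "\<dots> \<le> liminf (\<lambda>T. \<integral>\<^sup>+om. ennreal ((s T om)\<^sup>2) \<partial>NN)" using m by (intro nn_integral_liminf) measurable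
   also have "\<dots> \<le> ennreal (Q * (Q * B))" using fin by (intro Liminf_le) auto
   finally have le: "(\<integral>\<^sup>+om. ennreal ((?S om $ j)\<^sup>2) \<partial>NN) \<le> ennreal (Q * (Q * B))" .
   have int: "integrable NN (\<lambda>om. (?S om $ j)\<^sup>2)"
    using le mS by (intro integrableI_bounded) (auto simp: ennreal_less_top le_less_trans)
   have "ennreal (\<integral>om. (?S om $ j)\<^sup>2 \<partial>NN) \<le> ennreal (Q * (Q * B))"
    using le nn_integral_eq_integral[OF int] by simp
   then have "(\<integral>om. (?S om $ j)\<^sup>2 \<partial>NN) \<le> Q * (Q * B)" using Q0 B by (subst (asm) ennreal_le_iff) auto
   with mS int show ?thesis by (simp add: L2_def)
  qed
  then have LS: "L2v NN r ?S" by (simp add: L2v_def)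
  have "(\<integral>om. ?S om \<bullet> ?S om \<partial>NN) \<le> (\<Sum>j<r. Q * (Q * B))"
   unfolding L2v_sp_self(2)[OF LS] using comp by (intro sum_mono) auto
  then show "L2v NN r ?S \<and> (\<integral>om. ?S om \<bullet> ?S om \<partial>NN) \<le> r * (Q * (Q * B))" using LS by simp
 qed
qed

lemma psd_young:
 assumes P: "pos_semidef n P" and d: "dim_vec x = n" "dim_vec y = n" and c: "0 < c"
 shows "2 * (x \<bullet> (P *\<^sub>v y)) \<le> c * (x \<bullet> (P *\<^sub>v x)) + (y \<bullet> (P *\<^sub>v y)) / c"
proof -
 have Pd: "dim_row P = n" "dim_col P = n" "tr P = P" using P by (auto simp: pos_semidef_def)
 have "0 \<le> (c \<cdot>\<^sub>v x - y) \<bullet> (P *\<^sub>v (c \<cdot>\<^sub>v x - y))" using P d by (intro psd_nonneg) auto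
 also have "\<dots> = c * (c * (x \<bullet> (P *\<^sub>v x))) - 2 * c * (x \<bullet> (P *\<^sub>v y)) + y \<bullet> (P *\<^sub>v y)"
 proof -
  have "y \<bullet> (P *\<^sub>v x) = x \<bullet> (P *\<^sub>v y)" using sp_tr[of y P x] sp_comm[of "P *\<^sub>v y" x] Pd d by simp
  then show ?thesis using d Pd by (simp add: mv_simps sp_simps algebra_simps)
 qed
 finally have "c * (2 * (x \<bullet> (P *\<^sub>v y))) \<le> c * (c * (x \<bullet> (P *\<^sub>v x)) + (y \<bullet> (P *\<^sub>v y)) / c)"
  using c by (simp add: distrib_left)
 then show ?thesis using c by simp
qed

lemma two_term_chain:
 "u \<le> 2 * v + 2 * z ==> v \<le> 2 * x + 2 * y ==> x \<le> x' ==> y \<le> y' ==> z \<le> z' ==> u \<le> 2 * (2 * x' + 2 * y') + 2 * z'"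
 for u :: real by (simp add: algebra_simps)

locale verif_bd = verif +
 fixes B :: real
 assumes Ybd: "!!t k. k < ny g ==> (\<integral>om. (Y t om $ k)\<^sup>2 \<partial>M) \<le> B"
begin

lemma B_bounds: obtains B' where "0 \<le> B'" "!!t k. k < p ==> (\<integral>om. (Y t om $ k)\<^sup>2 \<partial>M) \<le> B'"
 "!!t k l. k < p ==> (\<integral>om. (vv (Fe t om) l $ k)\<^sup>2 \<partial>M) \<le> B'"
proof (rule that[of "max 0 B"])
 show "(\<integral>om. (Y t om $ k)\<^sup>2 \<partial>M) \<le> max 0 B" if "k < p" for t k using Ybd[OF that, of t] by simp
 then show "(\<integral>om. (vv (Fe t om) l $ k)\<^sup>2 \<partial>M) \<le> max 0 B" if "k < p" for t k l using predict_L2[OF that, of t l] that by (meson order_trans)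
qed simp

definition "Ur k = (dmi.Tm ^\<^sub>m k) * dmi.Gam" for k :: nat
lemma Ur: "geo ni p Ur" unfolding Ur_def using dmi.Tm_dims by (intro geo_right[OF dmi.Tm_geo]) auto

abbreviation "ro x \<equiv> dmi.rr ew (vv x)"
definition "Pm = suminf_mat ni d (\<lambda>k. Ur k * a k)"
lemma Pm_dim [simp]: "dim_row Pm = ni" "dim_col Pm = d" by (simp_all add: Pm_def suminf_mat_def)

lemma ro_dim [simp]: "dim_vec (dmi.rr ew v) = ni" by (simp add: dmi.rr_def dmi.qv_def)

lemma ro_affine: assumes x: "dim_vec x = d" and y: "dim_vec y = d" shows "ro (x + y) = ro x + Pm *\<^sub>v y"
proof -
 have s: "suminf_vec ni (\<lambda>k. Ur k *\<^sub>v vv x k) = Pm *\<^sub>v x + suminf_vec ni (\<lambda>k. Ur k *\<^sub>v b k)" if "dim_vec x = d" for x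
  unfolding Pm_def using Ur that by (intro suminf_vv geo_summable[OF Ur]) (auto simp: geo_def)
 have e: "ro x = Pm *\<^sub>v x + suminf_vec ni (\<lambda>k. Ur k *\<^sub>v b k) + (dmi.qv ew - cM g i *\<^sub>v ew i)" if "dim_vec x = d" for x
  unfolding dmi.rr_def Ur_def[symmetric] s[OF that] ..
 show ?thesis unfolding e[OF x] using x y
  by (subst e) (auto simp: mv_add dmi.qv_def intro!: eq_vecI)
qed

text \<open>The offset is affine in the estimate, and the estimate moves by \<open>nextX\<close> and an
 innovation; by \<open>hat_step\<close> the first part is the shifted anticipation.\<close>
lemma ro_next: "ro (Fe (Suc t) om) = dmi.rr ew (\<lambda>k. vv (Fe t om) (Suc k)) + (Pm * (agg_C g + Lk)) *\<^sub>v n t om" if "om \<in> space M"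
proof -
 have d: "dim_vec (Fe t om) = d" using that by (rule Ydims(2))
 have "vv (nextX (Fe t om)) = (\<lambda>k. vv (Fe t om) (Suc k))" using hat_step(2)[OF d] by auto
 moreover have "ro (nextX (Fe t om) + (agg_C g + Lk) *\<^sub>v n t om) = ro (nextX (Fe t om)) + Pm *\<^sub>v ((agg_C g + Lk) *\<^sub>v n t om)"
  by (rule ro_affine) simp_all
 moreover have "(Pm * (agg_C g + Lk)) *\<^sub>v n t om = Pm *\<^sub>v ((agg_C g + Lk) *\<^sub>v n t om)" by (rule mult_mv) simp_all
 ultimately show ?thesis by (simp only: Fe_rec(2))
qed

text \<open>The estimate itself may grow, but the anticipated environments are bounded in mean square by the
 environment (\<open>predict_L2\<close>), and the offsets depend on it through them only.\<close>
lemma moments: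
 obtains K where "0 \<le> K" "!!t. L2v M ni (\<lambda>om. ro (Fe t om))" "!!t. (\<integral>om. ro (Fe t om) \<bullet> ro (Fe t om) \<partial>M) \<le> K"
  "!!t. L2v M mi (\<lambda>om. GG i (Fe t om))" "!!t. (\<integral>om. GG i (Fe t om) \<bullet> GG i (Fe t om) \<partial>M) \<le> K"
proof -
 obtain B' where B: "0 \<le> B'" "!!t k l. k < p ==> (\<integral>om. (vv (Fe t om) l $ k)\<^sup>2 \<partial>M) \<le> B'" by (rule B_bounds) (rule that)
 have gen: "\<exists>K\<ge>0. \<forall>t. L2v M r (\<lambda>om. suminf_vec r (\<lambda>k. U k *\<^sub>v vv (Fe t om) k) + c0) \<and>
   (\<integral>om. (suminf_vec r (\<lambda>k. U k *\<^sub>v vv (Fe t om) k) + c0) \<bullet> (suminf_vec r (\<lambda>k. U k *\<^sub>v vv (Fe t om) k) + c0) \<partial>M) \<le> K"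
  if U: "geo r p U" and c: "dim_vec c0 = r" for r U and c0 :: rvec
 proof -
  obtain K where K: "0 \<le> K" "\<forall>v :: nat => 'a => rvec. (\<forall>k. L2v M p (v k)) --> (\<forall>k l. l < p --> (\<integral>om. (v k om $ l)\<^sup>2 \<partial>M) \<le> B')
    --> (\<forall>om\<in>space M. bdd_vec p (\<lambda>k. v k om))
    --> L2v M r (\<lambda>om. suminf_vec r (\<lambda>k. U k *\<^sub>v v k om)) \<and> (\<integral>om. suminf_vec r (\<lambda>k. U k *\<^sub>v v k om) \<bullet> suminf_vec r (\<lambda>k. U k *\<^sub>v v k om) \<partial>M) \<le> K"
   using geo_moment[OF U B(1), where NN = M] by (elim exE conjE) (rule that)
  show ?thesis
  proof (intro exI[of _ "2 * K + 2 * (c0 \<bullet> c0)"] conjI allI)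
   show "0 \<le> 2 * K + 2 * (c0 \<bullet> c0)" using K(1) sp_self_nonneg[of c0] by simp
   fix t
   have 1: "L2v M r (\<lambda>om. suminf_vec r (\<lambda>k. U k *\<^sub>v vv (Fe t om) k)) \<and>
     (\<integral>om. suminf_vec r (\<lambda>k. U k *\<^sub>v vv (Fe t om) k) \<bullet> suminf_vec r (\<lambda>k. U k *\<^sub>v vv (Fe t om) k) \<partial>M) \<le> K"
    by (rule K(2)[rule_format]) (use L2_pred(1)[OF L2_Fe] B(2) vv_bdd Ydims(2) in auto)
   have 2: "L2v M r (\<lambda>om. c0)" using c by (intro L2v_const finite_measure_axioms)
   show "L2v M r (\<lambda>om. suminf_vec r (\<lambda>k. U k *\<^sub>v vv (Fe t om) k) + c0)" using 1 2 by (intro L2v_add) auto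
   have "(\<integral>om. (suminf_vec r (\<lambda>k. U k *\<^sub>v vv (Fe t om) k) + c0) \<bullet> (suminf_vec r (\<lambda>k. U k *\<^sub>v vv (Fe t om) k) + c0) \<partial>M) \<le>
     2 * (\<integral>om. suminf_vec r (\<lambda>k. U k *\<^sub>v vv (Fe t om) k) \<bullet> suminf_vec r (\<lambda>k. U k *\<^sub>v vv (Fe t om) k) \<partial>M) + 2 * (\<integral>om. c0 \<bullet> c0 \<partial>M)"
    using 1 2 by (intro L2v_bound_add) auto
   then show "(\<integral>om. (suminf_vec r (\<lambda>k. U k *\<^sub>v vv (Fe t om) k) + c0) \<bullet> (suminf_vec r (\<lambda>k. U k *\<^sub>v vv (Fe t om) k) + c0) \<partial>M) \<le> 2 * K + 2 * (c0 \<bullet> c0)"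
    using 1 by (simp add: prob_space)
  qed
 qed
 have rd: "dim_vec (dmi.qv ew - cM g i *\<^sub>v ew i) = ni" by simp
 obtain K1 where K1: "0 \<le> K1" "\<forall>t. L2v M ni (\<lambda>om. ro (Fe t om)) \<and> (\<integral>om. ro (Fe t om) \<bullet> ro (Fe t om) \<partial>M) \<le> K1"
  using gen[OF Ur rd] unfolding dmi.rr_def Ur_def by blast
 obtain K2 where K2: "0 \<le> K2" "\<forall>t. L2v M mi (\<lambda>om. dmi.gg ew (vv (Fe t om))) \<and> (\<integral>om. dmi.gg ew (vv (Fe t om)) \<bullet> dmi.gg ew (vv (Fe t om)) \<partial>M) \<le> K2"
  using gen[OF dmi.cG_geo gdims_i(21)[OF i]] unfolding dmi.gg_def by blast
 have e: "GG i (Fe t om) = dmi.gg ew (vv (Fe t om))" if "om \<in> space M" for t om by (rule GG_gg(2)[OF i Ydims(2)[OF that]])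
 have G1: "L2v M mi (\<lambda>om. GG i (Fe t om))" for t by (rule L2v_eq[OF e]) (use K2 in auto)
 have G2: "(\<integral>om. GG i (Fe t om) \<bullet> GG i (Fe t om) \<partial>M) \<le> K2" for t
 proof -
  have "(\<integral>om. GG i (Fe t om) \<bullet> GG i (Fe t om) \<partial>M) = (\<integral>om. dmi.gg ew (vv (Fe t om)) \<bullet> dmi.gg ew (vv (Fe t om)) \<partial>M)"
   by (rule Bochner_Integration.integral_cong) (simp_all add: e)
  then show ?thesis using K2(2) by simp
 qed
 show thesis
 proof (rule that[of "max K1 K2"])
  show "(\<integral>om. ro (Fe t om) \<bullet> ro (Fe t om) \<partial>M) \<le> max K1 K2" for t using K1(2) by (simp add: le_max_iff_disj)
  show "(\<integral>om. GG i (Fe t om) \<bullet> GG i (Fe t om) \<partial>M) \<le> max K1 K2" for t using G2[of t] by simp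
 qed (use K1 K2 G1 in auto)
qed

abbreviation "xs \<equiv> px (sfilt i)"
abbreviation "us \<equiv> pu (sfilt i)"

lemma us_eq: assumes om: "om \<in> space PP" shows "us t om = cF g i *\<^sub>v xs t om + GG i (Fe t (fst om))"
proof -
 have w: "fst om \<in> space M" using om by (auto simp: space_pair_measure)
 have "us t om = sfilt i t (info t (\<lambda>t. xs t om) (\<lambda>t. us t om) (\<lambda>k. Y k (fst om)))" by (rule subj_equations(2))
 also have "\<dots> = cF g i *\<^sub>v xs t om + GG i (filt t (restrict (\<lambda>k. Y k (fst om)) {..<t}))" by (rule est_apply[OF i filt_dim])
 finally show ?thesis by (simp add: filt_restrict Fe_filt[OF w])
qed

lemma sfilt_strategy: "sfilt i \<in> strategies g i" by (rule est_in_strategies[OF filt_measurable i])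

definition "drive t om = mB g i *\<^sub>v GG i (Fe t (fst om)) + mC g i *\<^sub>v Y t (fst om) + w i t (snd om)"

lemma PP_D: "om \<in> space PP ==> fst om \<in> space M" "om \<in> space PP ==> snd om \<in> space M"
 by (auto simp: space_pair_measure)

lemma path_dims: assumes "\<sigma> \<in> strategies g i" "om \<in> space PP" shows "dim_vec (px \<sigma> t om) = ni" "dim_vec (pu \<sigma> t om) = mi"
 using borel_vecD(2)[OF adapted_measurable[OF adapted_path(1)[OF assms(1)]] assms(2)]
  borel_vecD(2)[OF adapted_measurable[OF adapted_path(2)[OF assms(1)]] assms(2)] by auto

lemma xs_rec: assumes om: "om \<in> space PP" shows "xs (Suc t) om = cAF g i *\<^sub>v xs t om + drive t om"
 unfolding subj_equations(3) us_eq[OF om] drive_def using path_dims[OF sfilt_strategy om] GG_dim[OF i] private_dims(2)[OF PP_D(2)[OF om]]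
 by (simp add: dmi.cAF_mv mv_add) (auto intro!: eq_vecI)

text \<open>The disturbances are identically distributed and the other inputs are bounded in mean square, so
 one constant serves all times.\<close>
lemma drive_moment: obtains K where "0 \<le> K" "!!t. L2v PP ni (drive t)" "!!t. (\<integral>om. drive t om \<bullet> drive t om \<partial>PP) \<le> K"
proof -
 obtain KG where KG: "0 \<le> KG" "!!t. L2v M mi (\<lambda>om. GG i (Fe t om))" "!!t. (\<integral>om. GG i (Fe t om) \<bullet> GG i (Fe t om) \<partial>M) \<le> KG"
  by (rule moments) (rule that)
 obtain B' where B: "0 \<le> B'" "!!t k. k < p ==> (\<integral>om. (Y t om $ k)\<^sup>2 \<partial>M) \<le> B'" by (rule B_bounds) (rule that)
 define Kw where "Kw = (\<integral>om. W 0 om \<bullet> W 0 om \<partial>M)"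
 have Y2: "(\<integral>om. Y t om \<bullet> Y t om \<partial>M) \<le> p * B'" for t
 proof -
  have "(\<integral>om. Y t om \<bullet> Y t om \<partial>M) \<le> (\<Sum>k<p. B')" unfolding L2v_sp_self(2)[OF L2_Y] using B(2) by (intro sum_mono) auto
  then show ?thesis by simp
 qed
 have W2: "(\<integral>om. w i t om \<bullet> w i t om \<partial>M) \<le> Kw" for t
 proof -
  have m: "(\<lambda>v. v \<bullet> v) \<in> borel_measurable (borel_vec d)" by (rule borel_vec_sp[where n = d]) simp_all
  have "(\<integral>om. w i t om \<bullet> w i t om \<partial>M) \<le> (\<integral>om. W t om \<bullet> W t om \<partial>M)"
  proof (intro integral_mono L2v_sp_self(1)[OF private_L2(1)] L2v_sp_self(1)[OF W_L2(1)])
   fix om assume om: "om \<in> space M"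
   have "w i t om \<bullet> w i t om = (\<Sum>k<ni. (W t om $ ((\<Sum>j<i. nx g j) + k))\<^sup>2)"
    using om by (simp add: sp_self private_block block_def)
   also have "\<dots> = (\<Sum>k\<in>(\<lambda>k. (\<Sum>j<i. nx g j) + k) ` {..<ni}. (W t om $ k)\<^sup>2)" by (simp add: sum.reindex)
   also have "\<dots> \<le> W t om \<bullet> W t om" unfolding sp_self using block_pos sp_dims(2)[OF om] by (intro sum_mono2) auto
   finally show "w i t om \<bullet> w i t om \<le> W t om \<bullet> W t om" .
  qed
  also have "\<dots> = (\<integral>v. v \<bullet> v \<partial>distr M (borel_vec d) (W t))" by (rule integral_distr[symmetric, OF meas(2) m])
  also have "\<dots> = Kw" unfolding ident(1)[of t] Kw_def by (rule integral_distr[OF meas(2) m])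
  finally show ?thesis .
 qed
 have mG: "L2v M ni (\<lambda>om. mB g i *\<^sub>v GG i (Fe t om))" and mY: "L2v M ni (\<lambda>om. mC g i *\<^sub>v Y t om)" for t
  using KG(2) L2_Y by (auto intro!: L2v_mv)
 note LG = L2v_marg(1)[OF mG] and LY = L2v_marg(1)[OF mY] and Lw = L2v_marg(2)[OF private_L2(1)]
 have LGY: "L2v PP ni (\<lambda>om. mB g i *\<^sub>v GG i (Fe t (fst om)) + mC g i *\<^sub>v Y t (fst om))" for t
  using LG LY by (rule L2v_add)
 define K where "K = 2 * (2 * (fro (mB g i) * KG) + 2 * (fro (mC g i) * (p * B'))) + 2 * Kw"
 have Kw0: "0 \<le> Kw" unfolding Kw_def by (intro integral_nonneg_AE AE_I2 sp_self_nonneg)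
 show thesis
 proof (rule that[of K])
  show "0 \<le> K" unfolding K_def using KG B Kw0 fro_nonneg by (intro add_nonneg_nonneg mult_nonneg_nonneg) auto
  show L: "L2v PP ni (drive t)" for t unfolding drive_def[abs_def] using LGY Lw by (rule L2v_add)
  fix t
  have e1: "(\<integral>om. (mB g i *\<^sub>v GG i (Fe t (fst om))) \<bullet> (mB g i *\<^sub>v GG i (Fe t (fst om))) \<partial>PP) \<le> fro (mB g i) * KG"
  proof -
   have "(\<integral>om. (mB g i *\<^sub>v GG i (Fe t (fst om))) \<bullet> (mB g i *\<^sub>v GG i (Fe t (fst om))) \<partial>PP) = (\<integral>om. (mB g i *\<^sub>v GG i (Fe t om)) \<bullet> (mB g i *\<^sub>v GG i (Fe t om)) \<partial>M)"
    using L2v_sp_self(1)[OF mG] by (intro marg_integral(1)[of "\<lambda>om. (mB g i *\<^sub>v GG i (Fe t om)) \<bullet> (mB g i *\<^sub>v GG i (Fe t om))"]) auto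
   also have "\<dots> \<le> fro (mB g i) * (\<integral>om. GG i (Fe t om) \<bullet> GG i (Fe t om) \<partial>M)" by (rule L2v_bound_mv[OF KG(2)]) simp
   also have "\<dots> \<le> fro (mB g i) * KG" by (intro mult_left_mono KG fro_nonneg)
   finally show ?thesis .
  qed
  have e2: "(\<integral>om. (mC g i *\<^sub>v Y t (fst om)) \<bullet> (mC g i *\<^sub>v Y t (fst om)) \<partial>PP) \<le> fro (mC g i) * (p * B')"
  proof -
   have "(\<integral>om. (mC g i *\<^sub>v Y t (fst om)) \<bullet> (mC g i *\<^sub>v Y t (fst om)) \<partial>PP) = (\<integral>om. (mC g i *\<^sub>v Y t om) \<bullet> (mC g i *\<^sub>v Y t om) \<partial>M)"
    using L2v_sp_self(1)[OF mY] by (intro marg_integral(1)[of "\<lambda>om. (mC g i *\<^sub>v Y t om) \<bullet> (mC g i *\<^sub>v Y t om)"]) auto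
   also have "\<dots> \<le> fro (mC g i) * (\<integral>om. Y t om \<bullet> Y t om \<partial>M)" by (rule L2v_bound_mv[OF L2_Y]) simp
   also have "\<dots> \<le> fro (mC g i) * (p * B')" by (intro mult_left_mono Y2 fro_nonneg)
   finally show ?thesis .
  qed
  have e3: "(\<integral>om. w i t (snd om) \<bullet> w i t (snd om) \<partial>PP) \<le> Kw"
   using W2[of t] marg_integral(2)[of "\<lambda>om. w i t om \<bullet> w i t om"] L2v_sp_self(1)[OF private_L2(1)] by auto
  have "(\<integral>om. drive t om \<bullet> drive t om \<partial>PP) \<le>
    2 * (\<integral>om. (mB g i *\<^sub>v GG i (Fe t (fst om)) + mC g i *\<^sub>v Y t (fst om)) \<bullet> (mB g i *\<^sub>v GG i (Fe t (fst om)) + mC g i *\<^sub>v Y t (fst om)) \<partial>PP)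
    + 2 * (\<integral>om. w i t (snd om) \<bullet> w i t (snd om) \<partial>PP)"
   unfolding drive_def by (rule L2v_bound_add[OF LGY Lw])
  then show "(\<integral>om. drive t om \<bullet> drive t om \<partial>PP) \<le> K" unfolding K_def using L2v_bound_add[OF LG LY, of t t] e1 e2 e3 by (rule two_term_chain)
 qed
qed

lemma xs_L2: "L2v PP ni (xs t)" "L2v PP mi (us t)"
proof -
 show x: "L2v PP ni (xs t)" for t
 proof (induction t)
  case 0 show ?case unfolding subj_equations(1) by (rule L2v_marg(2)[OF private_L2(2)])
 next
  case (Suc t)
  obtain K where "!!t. L2v PP ni (drive t)" by (rule drive_moment) (rule that)
  then have "L2v PP ni (\<lambda>om. cAF g i *\<^sub>v xs t om + drive t om)" using Suc by (intro L2v_add L2v_mv[OF Suc]) auto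
  then show ?case by (rule L2v_eq[rotated]) (rule xs_rec)
 qed
 obtain K where "!!t. L2v M mi (\<lambda>om. GG i (Fe t om))" by (rule moments) (rule that)
 then have "L2v PP mi (\<lambda>om. cF g i *\<^sub>v xs t om + GG i (Fe t (fst om)))" by (intro L2v_add L2v_mv[OF x] L2v_marg(1)) auto
 then show "L2v PP mi (us t)" by (rule L2v_eq[rotated]) (rule us_eq)
qed

text \<open>Discounted second moments contract along the closed loop; the driving term contributes a multiple
 of \<open>\<beta>\<^sup>t\<close>. The parameter \<open>\<eta>\<close> trades a slightly worse rate for the
 mixed term.\<close>
lemma xs_decay: "(\<lambda>t. disc g i ^ t * (\<integral>om. xs t om \<bullet> xs t om \<partial>PP)) \<longlonglongrightarrow> 0"
proof -
 let ?\<beta> = "disc g i" and ?M = "cM g i"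
 have b: "0 \<le> ?\<beta>" "?\<beta> < 1" using game i by (auto simp: lq_game_data_def)
 obtain \<rho> where \<rho>: "0 \<le> \<rho>" "\<rho> < 1" "!!x. dim_vec x = ni ==> ?\<beta> * ((cAF g i *\<^sub>v x) \<bullet> (?M *\<^sub>v (cAF g i *\<^sub>v x))) \<le> \<rho> * (x \<bullet> (?M *\<^sub>v x))"
  using dmi.closed_contraction[OF dmi.cM] unfolding dmi.cAF_eq by blast
 obtain q where q: "q > 0" "!!x. dim_vec x = ni ==> q * (x \<bullet> x) \<le> x \<bullet> (?M *\<^sub>v x)" using dmi.fix_coercive[OF dmi.cM] by blast
 obtain K where K: "0 \<le> K" "!!t. L2v PP ni (drive t)" "!!t. (\<integral>om. drive t om \<bullet> drive t om \<partial>PP) \<le> K" by (rule drive_moment) (rule that)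
 define \<eta> where "\<eta> = (1 - \<rho>) / 2"
 have \<eta>: "0 < \<eta>" using \<rho> by (simp add: \<eta>_def)
 have "0 < (1 - \<rho>) * (2 - \<rho>)" using \<rho> by simp
 then have r1: "(1 + \<eta>) * \<rho> < 1" by (simp add: \<eta>_def field_simps)
 define b where "b t = ?\<beta> ^ t * (\<integral>om. xs t om \<bullet> (?M *\<^sub>v xs t om) \<partial>PP)" for t
 define K' where "K' = (1 + 1 / \<eta>) * (sqrt (fro ?M) * K)"
 have int: "integrable PP (\<lambda>om. U om \<bullet> (?M *\<^sub>v U om))" if "L2v PP ni U" for U by (rule L2v_sp(1)[OF that L2v_mv[OF that]]) simp_all
 have nn: "0 \<le> x \<bullet> (?M *\<^sub>v x)" if "dim_vec x = ni" for x using psd_nonneg[OF dmi.cM(1) that] .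
 have xd: "om \<in> space PP ==> dim_vec (xs t om) = ni" for t om using path_dims[OF sfilt_strategy] by blast
 have dd: "om \<in> space PP ==> dim_vec (drive t om) = ni" for t om using K(2)[of t] by (simp add: L2v_def)
 have bn: "0 \<le> b t" for t unfolding b_def using b(1) xd nn by (intro mult_nonneg_nonneg integral_nonneg_AE AE_I2) auto
 have step: "b (Suc t) \<le> ((1 + \<eta>) * \<rho>) * b t + K' * ?\<beta> ^ t" for t
 proof -
  let ?y = "\<lambda>om. cAF g i *\<^sub>v xs t om"
  have Ly: "L2v PP ni ?y" by (rule L2v_mv[OF xs_L2(1)]) simp_all
  have pt: "?\<beta> * (xs (Suc t) om \<bullet> (?M *\<^sub>v xs (Suc t) om)) \<le> (1 + \<eta>) * (\<rho> * (xs t om \<bullet> (?M *\<^sub>v xs t om))) + (1 + 1 / \<eta>) * (sqrt (fro ?M) * (drive t om \<bullet> drive t om))"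
   if om: "om \<in> space PP" for om
  proof -
   define y z where "y = ?y om" and "z = drive t om"
   have d: "dim_vec y = ni" "dim_vec z = ni" using dd[OF om] by (auto simp: y_def z_def)
   have sym: "z \<bullet> (?M *\<^sub>v y) = y \<bullet> (?M *\<^sub>v z)"
    using sp_tr[of z ?M y] sp_comm[of "?M *\<^sub>v z" y] d dmi.gm_dims(1-3) by simp
   have "(y + z) \<bullet> (?M *\<^sub>v (y + z)) = y \<bullet> (?M *\<^sub>v y) + 2 * (y \<bullet> (?M *\<^sub>v z)) + z \<bullet> (?M *\<^sub>v z)"
    using d sym by (simp add: mv_add sp_simps)
   also have "\<dots> \<le> (1 + \<eta>) * (y \<bullet> (?M *\<^sub>v y)) + (1 + 1 / \<eta>) * (z \<bullet> (?M *\<^sub>v z))"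
    using psd_young[OF dmi.cM(1) d \<eta>] by (simp add: algebra_simps)
   finally have 1: "?\<beta> * ((y + z) \<bullet> (?M *\<^sub>v (y + z))) \<le> ?\<beta> * ((1 + \<eta>) * (y \<bullet> (?M *\<^sub>v y)) + (1 + 1 / \<eta>) * (z \<bullet> (?M *\<^sub>v z)))"
    using b by (intro mult_left_mono) auto
   have 2: "(1 + \<eta>) * (?\<beta> * (y \<bullet> (?M *\<^sub>v y))) \<le> (1 + \<eta>) * (\<rho> * (xs t om \<bullet> (?M *\<^sub>v xs t om)))"
    unfolding y_def using \<rho>(3)[OF xd[OF om]] \<eta> by (intro mult_left_mono) auto
   have fb: "z \<bullet> (?M *\<^sub>v z) \<le> sqrt (fro ?M) * (z \<bullet> z)" using form_bound[of z ?M] d by (simp add: abs_le_iff)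
   have "?\<beta> * (z \<bullet> (?M *\<^sub>v z)) \<le> z \<bullet> (?M *\<^sub>v z)" using b nn[OF d(2)] by (simp add: mult_left_le_one_le)
   then have 3: "(1 + 1 / \<eta>) * (?\<beta> * (z \<bullet> (?M *\<^sub>v z))) \<le> (1 + 1 / \<eta>) * (sqrt (fro ?M) * (z \<bullet> z))"
    using fb \<eta> by (intro mult_left_mono) auto
   have "?\<beta> * ((y + z) \<bullet> (?M *\<^sub>v (y + z))) \<le> (1 + \<eta>) * (?\<beta> * (y \<bullet> (?M *\<^sub>v y))) + (1 + 1 / \<eta>) * (?\<beta> * (z \<bullet> (?M *\<^sub>v z)))"
    using 1 by (simp add: algebra_simps)
   then show ?thesis unfolding xs_rec[OF om] using 2 3 by (simp add: y_def z_def)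
  qed
  have "(\<integral>om. ?\<beta> * (xs (Suc t) om \<bullet> (?M *\<^sub>v xs (Suc t) om)) \<partial>PP) \<le>
    (\<integral>om. (1 + \<eta>) * (\<rho> * (xs t om \<bullet> (?M *\<^sub>v xs t om))) + (1 + 1 / \<eta>) * (sqrt (fro ?M) * (drive t om \<bullet> drive t om)) \<partial>PP)"
   by (intro integral_mono pt Bochner_Integration.integrable_add Bochner_Integration.integrable_mult_right int xs_L2 L2v_sp_self(1)[OF K(2)])
  also have "\<dots> = (1 + \<eta>) * (\<rho> * (\<integral>om. xs t om \<bullet> (?M *\<^sub>v xs t om) \<partial>PP)) + (1 + 1 / \<eta>) * (sqrt (fro ?M) * (\<integral>om. drive t om \<bullet> drive t om \<partial>PP))"
   using int[OF xs_L2(1)] L2v_sp_self(1)[OF K(2)] by simp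
  also have "\<dots> \<le> (1 + \<eta>) * (\<rho> * (\<integral>om. xs t om \<bullet> (?M *\<^sub>v xs t om) \<partial>PP)) + K'"
   unfolding K'_def using K(3)[of t] \<eta> fro_nonneg[of ?M] by (intro add_left_mono mult_left_mono) auto
  finally have "?\<beta> * (\<integral>om. xs (Suc t) om \<bullet> (?M *\<^sub>v xs (Suc t) om) \<partial>PP) \<le> (1 + \<eta>) * \<rho> * (\<integral>om. xs t om \<bullet> (?M *\<^sub>v xs t om) \<partial>PP) + K'" by simp
  then have "?\<beta> ^ t * (?\<beta> * (\<integral>om. xs (Suc t) om \<bullet> (?M *\<^sub>v xs (Suc t) om) \<partial>PP)) \<le> ?\<beta> ^ t * ((1 + \<eta>) * \<rho> * (\<integral>om. xs t om \<bullet> (?M *\<^sub>v xs t om) \<partial>PP) + K')"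
   using b by (intro mult_left_mono) auto
  then show ?thesis unfolding b_def by (simp add: algebra_simps)
 qed
 have b0: "b \<longlonglongrightarrow> 0"
  using K(1) \<eta> \<rho> b fro_nonneg[of ?M] by (intro affine_decay[OF bn step _ r1]) (auto simp: K'_def)
 have le: "?\<beta> ^ t * (\<integral>om. xs t om \<bullet> xs t om \<partial>PP) \<le> b t / q" for t
 proof -
  have "(\<integral>om. q * (xs t om \<bullet> xs t om) \<partial>PP) \<le> (\<integral>om. xs t om \<bullet> (?M *\<^sub>v xs t om) \<partial>PP)"
   using q(2) xd by (intro integral_mono int xs_L2 Bochner_Integration.integrable_mult_right L2v_sp_self(1)[OF xs_L2(1)]) auto
  then have "?\<beta> ^ t * (q * (\<integral>om. xs t om \<bullet> xs t om \<partial>PP)) \<le> b t" unfolding b_def using b by (intro mult_left_mono) auto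
  then show ?thesis using q by (simp add: field_simps)
 qed
 have "(\<lambda>t. b t / q) \<longlonglongrightarrow> 0 / q" by (intro tendsto_intros b0) (use q in auto)
 then have lim: "(\<lambda>t. b t / q) \<longlonglongrightarrow> 0" by simp
 show ?thesis
 proof (rule tendsto_sandwich[OF _ _ tendsto_const lim])
  show "\<forall>\<^sub>F t in sequentially. 0 \<le> ?\<beta> ^ t * (\<integral>om. xs t om \<bullet> xs t om \<partial>PP)"
   using b sp_self_nonneg by (intro always_eventually allI mult_nonneg_nonneg integral_nonneg_AE AE_I2) auto
  show "\<forall>\<^sub>F t in sequentially. ?\<beta> ^ t * (\<integral>om. xs t om \<bullet> xs t om \<partial>PP) \<le> b t / q" using le by simp
 qed
qed

end

section \<open>Optimality of the candidate strategy\<close>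

text \<open>A finite-horizon comparison with a vanishing boundary term survives the limit, since the partial
 sums of \<open>f\<close> increase.\<close>
lemma telescoping_comparison:
 fixes e f D h :: "nat => real"
 assumes e: "!!t. 0 \<le> e t" "summable e" and f: "!!t. 0 \<le> f t" and step: "!!t. 2 * (D t - D (Suc t)) \<le> e t - f t"
  and D0: "D 0 = 0" and D: "!!T. 2 * D T \<le> h T" and h: "h \<longlonglongrightarrow> 0"
 shows "(\<Sum>t. ennreal (f t)) \<le> (\<Sum>t. ennreal (e t))"
proof -
 have part: "(\<Sum>t<T. f t) \<le> suminf e + h T" for T
 proof -
  have "(\<Sum>t<T. e t - f t) \<ge> 2 * (D 0 - D T)"
  proof (induction T)
   case (Suc T) then show ?case using step[of T] by simp
  qed simp
  then have "(\<Sum>t<T. f t) \<le> (\<Sum>t<T. e t) + h T" using D0 D[of T] by (simp add: sum_subtractf)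
  moreover have "(\<Sum>t<T. e t) \<le> suminf e" using e by (intro sum_le_suminf) auto
  ultimately show ?thesis by simp
 qed
 have "(\<lambda>T. suminf e + h T) \<longlonglongrightarrow> suminf e + 0" by (intro tendsto_intros h)
 then have lim: "(\<lambda>T. suminf e + h T) \<longlonglongrightarrow> suminf e" by simp
 have le: "(\<Sum>t<T. f t) \<le> suminf e" for T
 proof (rule LIMSEQ_le_const[OF lim], intro exI[of _ T] allI impI)
  fix n assume "T \<le> n"
  then have "(\<Sum>t<T. f t) \<le> (\<Sum>t<n. f t)" using f by (intro sum_mono2) auto
  then show "(\<Sum>t<T. f t) \<le> suminf e + h n" using part[of n] by simp
 qed
 have "(\<Sum>t. ennreal (f t)) \<le> ennreal (suminf e)"
 proof (rule suminf_le_const[OF summableI])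
  fix n show "(\<Sum>t<n. ennreal (f t)) \<le> ennreal (suminf e)" using le[of n] f by (simp add: sum_ennreal ennreal_leI)
 qed
 also have "\<dots> = (\<Sum>t. ennreal (e t))" using e by (intro suminf_ennreal2[symmetric])
 finally show ?thesis .
qed

lemma sp_diff_bound: "dim_vec x = dim_vec y ==> (x - y) \<bullet> (x - y) \<le> 2 * (x \<bullet> x) + 2 * (y \<bullet> (y :: rvec))"
 using sp_self_nonneg[of "x + y"] sp_comm[of x y] by (simp add: sp_simps)

lemma sp_le_half: "dim_vec x = dim_vec y ==> 2 * (x \<bullet> y) \<le> x \<bullet> x + y \<bullet> (y :: rvec)"
 using sp_young_weighted[of x y 1] by simp

lemma (in dm) stage_measurable:
 assumes "x \<in> NN \<rightarrow>\<^sub>M borel_vec n" "u \<in> NN \<rightarrow>\<^sub>M borel_vec m" "z \<in> NN \<rightarrow>\<^sub>M borel_vec p"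
 shows "(\<lambda>om. stage_cost g i (x om) (u om) (z om)) \<in> borel_measurable NN"
 unfolding stage_cost_eq
 by (intro borel_measurable_add borel_measurable_times borel_measurable_const borel_vec_sp[OF assms(1)] borel_vec_sp[OF assms(2)] borel_vec_sp[OF assms(3)]
   borel_vec_mv[OF assms(1)] borel_vec_mv[OF assms(2)]) simp_all

context verif_bd
begin

definition "st \<sigma> t om = stage_cost g i (px \<sigma> t om) (pu \<sigma> t om) (Y t (fst om))"
definition "dx \<sigma> t om = px \<sigma> t om - xs t om"
definition "lam t om = cM g i *\<^sub>v xs t om + ro (Fe t (fst om))"

lemma lam_L2: "L2v PP ni (lam t)"
proof -
 obtain K where "!!t. L2v M ni (\<lambda>om. ro (Fe t om))" by (rule moments) (rule that)
 then show ?thesis unfolding lam_def[abs_def] by (intro L2v_add L2v_mv[OF xs_L2(1)] L2v_marg(1)) auto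
qed

lemma st_integrable: assumes x: "L2v PP ni (px \<sigma> t)" and u: "L2v PP mi (pu \<sigma> t)" shows "integrable PP (st \<sigma> t)"
proof -
 have z: "L2v PP p (\<lambda>om. Y t (fst om))" by (rule L2v_marg(1)[OF L2_Y])
 show ?thesis unfolding st_def[abs_def] dmi.stage_cost_eq
  by (intro Bochner_Integration.integrable_add Bochner_Integration.integrable_mult_right
    L2v_sp(1)[OF x L2v_mv[OF x]] L2v_sp(1)[OF u L2v_mv[OF u]] L2v_sp(1)[OF z L2v_mv[OF u]] L2v_sp(1)[OF z L2v_mv[OF x]]) simp_all
qed

lemma dx_rec: assumes \<sigma>: "\<sigma> \<in> strategies g i" and om: "om \<in> space PP"
 shows "dx \<sigma> (Suc t) om = mA g i *\<^sub>v dx \<sigma> t om + mB g i *\<^sub>v (pu \<sigma> t om - us t om)"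
 unfolding dx_def subj_equations(3) using path_dims[OF \<sigma> om] path_dims[OF sfilt_strategy om] private_dims(2)[OF PP_D(2)[OF om]]
 by (simp add: mv_diff) (auto intro!: eq_vecI)

lemma stage_difference:
 assumes \<sigma>: "\<sigma> \<in> strategies g i" and om: "om \<in> space PP"
 shows "st \<sigma> t om - st (sfilt i) t om = dx \<sigma> t om \<bullet> (mQ g i *\<^sub>v dx \<sigma> t om) + (pu \<sigma> t om - us t om) \<bullet> (mR g i *\<^sub>v (pu \<sigma> t om - us t om))
  + 2 * (dx \<sigma> t om \<bullet> lam t om - disc g i * (dx \<sigma> (Suc t) om \<bullet> lam (Suc t) om)
   + (mK g i *\<^sub>v (pu \<sigma> t om - us t om) + mL g i *\<^sub>v dx \<sigma> t om) \<bullet> (1\<^sub>m p *\<^sub>v n t (fst om))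
   + disc g i * (dx \<sigma> (Suc t) om \<bullet> ((cM g i * mC g i + Pm * (agg_C g + Lk)) *\<^sub>v n t (fst om)))
   + disc g i * (dx \<sigma> (Suc t) om \<bullet> (cM g i *\<^sub>v (w i t (snd om) - ew i))))"
proof -
 have f: "fst om \<in> space M" "snd om \<in> space M" using PP_D[OF om] by auto
 have Fd: "dim_vec (Fe t (fst om)) = d" by (rule Ydims(2)[OF f(1)])
 have bv: "bdd_vec p (vv (Fe t (fst om)))" by (rule vv_bdd[OF Fd])
 have ewd: "dim_vec (ew i) = ni" using ew i by simp
 let ?v = "n t (fst om)" and ?zh = "pred (Fe t (fst om))" and ?dx = "dx \<sigma> t om" and ?du = "pu \<sigma> t om - us t om"
 let ?r1 = "dmi.rr ew (\<lambda>k. vv (Fe t (fst om)) (Suc k))"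
 have gv: "dmi.Sm *\<^sub>v GG i (Fe t (fst om)) = (- 1) \<cdot>\<^sub>v (tr (mK g i) *\<^sub>v ?zh + disc g i \<cdot>\<^sub>v (tr (mB g i) *\<^sub>v (cM g i *\<^sub>v (mC g i *\<^sub>v ?zh)))
   + disc g i \<cdot>\<^sub>v (tr (mB g i) *\<^sub>v (cM g i *\<^sub>v ew i + ?r1)))"
  unfolding GG_gg(2)[OF i Fd] pred_def by (rule dmi.gg_eq[where ew = ew and v = "vv (Fe t (fst om))", OF ewd bv])
 have r: "ro (Fe t (fst om)) = dmi.Gam *\<^sub>v ?zh + dmi.Tm *\<^sub>v (cM g i *\<^sub>v ew i + ?r1)"
  unfolding pred_def by (rule dmi.rr_step[where ew = ew and v = "vv (Fe t (fst om))", OF ewd bv])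
 have dims: "dim_vec (xs t om) = ni" "dim_vec ?zh = p" "dim_vec ?v = p" "dim_vec (w i t (snd om)) = ni" "dim_vec (ew i) = ni"
  "dim_vec (GG i (Fe t (fst om))) = mi" "dim_vec ?r1 = ni" "dim_vec ?dx = ni" "dim_vec ?du = mi" "dim_row (Pm * (agg_C g + Lk)) = ni" "dim_col (Pm * (agg_C g + Lk)) = p"
  using path_dims[OF \<sigma> om] path_dims[OF sfilt_strategy om] private_dims(2)[OF f(2)] ewd GG_dim[OF i] by (auto simp: dx_def)
 note id = dmi.stage_identity[OF dims Y_eq[OF f(1)] us_eq[OF om] gv r]
 have x: "xs t om + ?dx = px \<sigma> t om" "us t om + ?du = pu \<sigma> t om"
  using path_dims[OF \<sigma> om] path_dims[OF sfilt_strategy om] by (auto simp: dx_def intro!: eq_vecI)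
 have l: "cM g i *\<^sub>v (mA g i *\<^sub>v xs t om + mB g i *\<^sub>v us t om + mC g i *\<^sub>v Y t (fst om) + w i t (snd om)) + (?r1 + (Pm * (agg_C g + Lk)) *\<^sub>v ?v) = lam (Suc t) om"
  unfolding lam_def ro_next[OF f(1)] subj_equations(3) ..
 have one: "1\<^sub>m p *\<^sub>v ?v = ?v" by (rule one_mv) simp
 have comb: "(cM g i * mC g i + Pm * (agg_C g + Lk)) *\<^sub>v ?v = cM g i *\<^sub>v (mC g i *\<^sub>v ?v) + (Pm * (agg_C g + Lk)) *\<^sub>v ?v"
 proof -
  have "(cM g i * mC g i + Pm * (agg_C g + Lk)) *\<^sub>v ?v = (cM g i * mC g i) *\<^sub>v ?v + (Pm * (agg_C g + Lk)) *\<^sub>v ?v"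
   by (rule add_mv) simp_all
  moreover have "(cM g i * mC g i) *\<^sub>v ?v = cM g i *\<^sub>v (mC g i *\<^sub>v ?v)" by (rule mult_mv) simp_all
  ultimately show ?thesis by simp
 qed
 show ?thesis using id unfolding x l dx_rec[OF \<sigma> om, symmetric] one comb st_def lam_def[of t] .
qed

text \<open>Taking expectations removes the terms linear in the innovation and in the disturbance, since
 deviations are adapted; the quadratic form is dropped.\<close>
lemma step_inequality:
 assumes \<sigma>: "\<sigma> \<in> strategies g i" and x: "L2v PP ni (px \<sigma> t)" and u: "L2v PP mi (pu \<sigma> t)"
 shows "2 * ((\<integral>om. dx \<sigma> t om \<bullet> lam t om \<partial>PP) - disc g i * (\<integral>om. dx \<sigma> (Suc t) om \<bullet> lam (Suc t) om \<partial>PP))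
  \<le> (\<integral>om. st \<sigma> t om \<partial>PP) - (\<integral>om. st (sfilt i) t om \<partial>PP)"
proof -
 let ?du = "\<lambda>om. pu \<sigma> t om - us t om"
 have ewd: "dim_vec (ew i) = ni" using ew i by simp
 have Ldx: "L2v PP ni (dx \<sigma> t)" unfolding dx_def[abs_def] by (intro L2v_diff x xs_L2)
 have Ldu: "L2v PP mi ?du" by (intro L2v_diff u xs_L2)
 have "L2v PP ni (\<lambda>om. mA g i *\<^sub>v dx \<sigma> t om + mB g i *\<^sub>v ?du om)" by (intro L2v_add L2v_mv[OF Ldx] L2v_mv[OF Ldu]) simp_all
 then have Ldx': "L2v PP ni (dx \<sigma> (Suc t))" by (rule L2v_eq[rotated]) (rule dx_rec[OF \<sigma>])
 have adx: "adapted t ni (dx \<sigma> t)" unfolding dx_def[abs_def] by (intro adapted_diff adapted_path \<sigma> sfilt_strategy)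
 have adu: "adapted t mi ?du" by (intro adapted_diff adapted_path \<sigma> sfilt_strategy)
 have "adapted t ni (\<lambda>om. mA g i *\<^sub>v dx \<sigma> t om + mB g i *\<^sub>v ?du om)" by (intro adapted_add adapted_mv[OF adx] adapted_mv[OF adu]) simp_all
 then have adx': "adapted t ni (dx \<sigma> (Suc t))" unfolding adapted_def using dx_rec[OF \<sigma>] by simp
 let ?U = "\<lambda>om. mK g i *\<^sub>v ?du om + mL g i *\<^sub>v dx \<sigma> t om"
 have LU: "L2v PP p ?U" by (intro L2v_add L2v_mv[OF Ldu] L2v_mv[OF Ldx]) simp_all
 have aU: "adapted t p ?U" by (intro adapted_add adapted_mv[OF adu] adapted_mv[OF adx]) simp_all
 let ?G = "cM g i * mC g i + Pm * (agg_C g + Lk)"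
 define T1 where "T1 om = ?U om \<bullet> (1\<^sub>m p *\<^sub>v n t (fst om))" for om
 define T2 where "T2 om = dx \<sigma> (Suc t) om \<bullet> (?G *\<^sub>v n t (fst om))" for om
 define T3 where "T3 om = dx \<sigma> (Suc t) om \<bullet> (cM g i *\<^sub>v (w i t (snd om) - ew i))" for om
 define a0 where "a0 om = dx \<sigma> t om \<bullet> lam t om" for om
 define a1 where "a1 om = dx \<sigma> (Suc t) om \<bullet> lam (Suc t) om" for om
 define q where "q om = dx \<sigma> t om \<bullet> (mQ g i *\<^sub>v dx \<sigma> t om) + ?du om \<bullet> (mR g i *\<^sub>v ?du om)" for om
 have Ln: "L2v PP p (\<lambda>om. n t (fst om))" by (rule L2v_marg(1)[OF L2_en(2)])
 have Lw: "L2v PP ni (\<lambda>om. w i t (snd om) - ew i)"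
  by (rule L2v_marg(2)[OF L2v_diff[OF private_L2(1) L2v_const[OF finite_measure_axioms ewd]]])
 have z: "(\<integral>om. T1 om \<partial>PP) = 0" "(\<integral>om. T2 om \<partial>PP) = 0" "(\<integral>om. T3 om \<partial>PP) = 0"
  unfolding T1_def T2_def T3_def by (rule orth_sp(1)[OF aU LU] orth_sp(1)[OF adx' Ldx'] orth_sp(2)[OF adx' Ldx'], simp, simp)+
 have it: "integrable PP T1" "integrable PP T2" "integrable PP T3"
  unfolding T1_def[abs_def] T2_def[abs_def] T3_def[abs_def]
  by (rule L2v_sp(1)[OF LU L2v_mv[OF Ln]] L2v_sp(1)[OF Ldx' L2v_mv[OF Ln]] L2v_sp(1)[OF Ldx' L2v_mv[OF Lw]], simp, simp)+
 have ia: "integrable PP a0" "integrable PP a1" unfolding a0_def[abs_def] a1_def[abs_def]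
  by (rule L2v_sp(1)[OF Ldx lam_L2] L2v_sp(1)[OF Ldx' lam_L2])+
 have le: "2 * (a0 om - disc g i * a1 om + T1 om + disc g i * T2 om + disc g i * T3 om) \<le> st \<sigma> t om - st (sfilt i) t om" if om: "om \<in> space PP" for om
 proof -
  have dd: "dim_vec (dx \<sigma> t om) = ni" "dim_vec (?du om) = mi" using Ldx Ldu om by (auto simp: L2v_def)
  have "0 \<le> q om" unfolding q_def
   using psd_nonneg[OF pd_psd[OF dmi.Q] dd(1)] psd_nonneg[OF pd_psd[OF dmi.R] dd(2)] by simp
  moreover have "st \<sigma> t om - st (sfilt i) t om = q om + 2 * (a0 om - disc g i * a1 om + T1 om + disc g i * T2 om + disc g i * T3 om)"
   unfolding stage_difference[OF \<sigma> om] q_def a0_def a1_def T1_def T2_def T3_def ..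
  ultimately show ?thesis by simp
 qed
 have ist: "integrable PP (st \<sigma> t)" "integrable PP (st (sfilt i) t)" by (rule st_integrable[OF x u], rule st_integrable[OF xs_L2])
 have "(\<integral>om. 2 * (a0 om - disc g i * a1 om + T1 om + disc g i * T2 om + disc g i * T3 om) \<partial>PP) \<le> (\<integral>om. st \<sigma> t om - st (sfilt i) t om \<partial>PP)"
  using it ia ist by (intro integral_mono le Bochner_Integration.integrable_add Bochner_Integration.integrable_diff Bochner_Integration.integrable_mult_right)
 also have "\<dots> = (\<integral>om. st \<sigma> t om \<partial>PP) - (\<integral>om. st (sfilt i) t om \<partial>PP)" using ist by simp
 also have "(\<integral>om. 2 * (a0 om - disc g i * a1 om + T1 om + disc g i * T2 om + disc g i * T3 om) \<partial>PP) = 2 * ((\<integral>om. a0 om \<partial>PP) - disc g i * (\<integral>om. a1 om \<partial>PP))"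
  using it ia z by simp
 finally show ?thesis unfolding a0_def a1_def .
qed

lemma lam_decay: "(\<lambda>t. disc g i ^ t * (\<integral>om. lam t om \<bullet> lam t om \<partial>PP)) \<longlonglongrightarrow> 0"
proof -
 have b: "0 \<le> disc g i" "disc g i < 1" using game i by (auto simp: lq_game_data_def)
 obtain K where K: "!!t. L2v M ni (\<lambda>om. ro (Fe t om))" "!!t. (\<integral>om. ro (Fe t om) \<bullet> ro (Fe t om) \<partial>M) \<le> K" by (rule moments) (rule that)
 let ?X = "\<lambda>t. \<integral>om. xs t om \<bullet> xs t om \<partial>PP"
 have le: "(\<integral>om. lam t om \<bullet> lam t om \<partial>PP) \<le> 2 * (fro (cM g i) * ?X t) + 2 * K" for t
 proof -
  have "(\<integral>om. lam t om \<bullet> lam t om \<partial>PP) \<le> 2 * (\<integral>om. (cM g i *\<^sub>v xs t om) \<bullet> (cM g i *\<^sub>v xs t om) \<partial>PP) + 2 * (\<integral>om. ro (Fe t (fst om)) \<bullet> ro (Fe t (fst om)) \<partial>PP)"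
   unfolding lam_def by (rule L2v_bound_add[OF L2v_mv[OF xs_L2(1)] L2v_marg(1)[OF K(1)]]) simp_all
  also have "\<dots> \<le> 2 * (fro (cM g i) * ?X t) + 2 * K"
  proof (intro add_mono mult_left_mono)
   show "(\<integral>om. (cM g i *\<^sub>v xs t om) \<bullet> (cM g i *\<^sub>v xs t om) \<partial>PP) \<le> fro (cM g i) * ?X t" by (rule L2v_bound_mv[OF xs_L2(1)]) simp
   have "(\<integral>om. ro (Fe t (fst om)) \<bullet> ro (Fe t (fst om)) \<partial>PP) = (\<integral>om. ro (Fe t om) \<bullet> ro (Fe t om) \<partial>M)"
    using L2v_sp_self(1)[OF K(1)] by (intro marg_integral(1)[of "\<lambda>om. ro (Fe t om) \<bullet> ro (Fe t om)"]) auto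
   then show "(\<integral>om. ro (Fe t (fst om)) \<bullet> ro (Fe t (fst om)) \<partial>PP) \<le> K" using K(2)[of t] by simp
  qed simp_all
  finally show ?thesis .
 qed
 have "(\<lambda>t. 2 * fro (cM g i) * (disc g i ^ t * ?X t) + 2 * K * disc g i ^ t) \<longlonglongrightarrow> 2 * fro (cM g i) * 0 + 2 * K * 0"
  using b by (intro tendsto_intros xs_decay LIMSEQ_realpow_zero) auto
 then have lim: "(\<lambda>t. 2 * fro (cM g i) * (disc g i ^ t * ?X t) + 2 * K * disc g i ^ t) \<longlonglongrightarrow> 0" by simp
 show ?thesis
 proof (rule tendsto_sandwich[OF _ _ tendsto_const lim])
  show "\<forall>\<^sub>F t in sequentially. 0 \<le> disc g i ^ t * (\<integral>om. lam t om \<bullet> lam t om \<partial>PP)"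
   using b sp_self_nonneg by (intro always_eventually allI mult_nonneg_nonneg integral_nonneg_AE AE_I2) auto
  show "\<forall>\<^sub>F t in sequentially. disc g i ^ t * (\<integral>om. lam t om \<bullet> lam t om \<partial>PP) \<le> 2 * fro (cM g i) * (disc g i ^ t * ?X t) + 2 * K * disc g i ^ t"
  proof (intro always_eventually allI)
   fix t
   have "disc g i ^ t * (\<integral>om. lam t om \<bullet> lam t om \<partial>PP) \<le> disc g i ^ t * (2 * (fro (cM g i) * ?X t) + 2 * K)" using b le by (intro mult_left_mono) auto
   then show "disc g i ^ t * (\<integral>om. lam t om \<bullet> lam t om \<partial>PP) \<le> 2 * fro (cM g i) * (disc g i ^ t * ?X t) + 2 * K * disc g i ^ t" by (simp add: algebra_simps)
  qed
 qed
qed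

text \<open>If the other strategy has infinite cost there is nothing to show. Otherwise coercivity makes its
 path square integrable at every time with \<open>\<beta>\<^sup>t \<noteq> 0\<close>, and the boundary term is
 bounded by discounted second moments that tend to 0. When \<open>\<beta> = 0\<close> all later times have
 weight 0 and only the first one is compared.\<close>
lemma comparison:
 assumes \<sigma>: "\<sigma> \<in> strategies g i" and eps: "0 < \<epsilon>" and kap: "0 \<le> \<kappa>"
  and coer: "!!x u z. dim_vec x = ni ==> dim_vec u = mi ==> dim_vec z = p ==> \<epsilon> * (x \<bullet> x + u \<bullet> u) \<le> stage_cost g i x u z + \<kappa> * (z \<bullet> z)"
 defines "l \<equiv> \<lambda>\<sigma> t om. st \<sigma> t om + \<kappa> * (Y t (fst om) \<bullet> Y t (fst om))"
 shows "(\<Sum>t. \<integral>\<^sup>+om. ennreal (disc g i ^ t * l (sfilt i) t om) \<partial>PP) \<le> (\<Sum>t. \<integral>\<^sup>+om. ennreal (disc g i ^ t * l \<sigma> t om) \<partial>PP)"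
proof (cases "(\<Sum>t. \<integral>\<^sup>+om. ennreal (disc g i ^ t * l \<sigma> t om) \<partial>PP) = \<infinity>")
 case False
 let ?b = "disc g i"
 have b: "0 \<le> ?b" "?b < 1" using game i by (auto simp: lq_game_data_def)
 define L where "L t = (\<integral>\<^sup>+om. ennreal (?b ^ t * l \<sigma> t om) \<partial>PP)" for t
 have Lfin: "L t \<noteq> \<infinity>" for t
 proof -
  have "L t \<le> (\<Sum>t. L t)" using sum_le_suminf[OF summableI, of "{t}" L] by simp
  then show ?thesis using False by (auto simp: L_def[symmetric] top_unique)
 qed
 have Yd: "om \<in> space PP ==> dim_vec (Y t (fst om)) = p" for t om using Ydims(1)[OF PP_D(1)] .
 have lc: "\<epsilon> * (px \<tau> t om \<bullet> px \<tau> t om + pu \<tau> t om \<bullet> pu \<tau> t om) \<le> l \<tau> t om" if "\<tau> \<in> strategies g i" "om \<in> space PP" for \<tau> t om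
  unfolding l_def st_def by (rule coer[OF path_dims[OF that] Yd[OF that(2)]])
 have l0: "0 \<le> l \<tau> t om" if "\<tau> \<in> strategies g i" "om \<in> space PP" for \<tau> t om
  using lc[OF that, of t] eps sp_self_nonneg[of "px \<tau> t om"] sp_self_nonneg[of "pu \<tau> t om"] by (meson add_nonneg_nonneg mult_nonneg_nonneg order_trans less_imp_le)
 have mx: "px \<tau> t \<in> PP \<rightarrow>\<^sub>M borel_vec ni" "pu \<tau> t \<in> PP \<rightarrow>\<^sub>M borel_vec mi" if "\<tau> \<in> strategies g i" for \<tau> t
  by (rule adapted_measurable[OF adapted_path(1)[OF that]], rule adapted_measurable[OF adapted_path(2)[OF that]])
 have mY: "(\<lambda>om. Y t (fst om)) \<in> PP \<rightarrow>\<^sub>M borel_vec p" for t by (rule measurable_compose[OF measurable_fst Y_measurable(1)])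
 have ml: "l \<sigma> t \<in> borel_measurable PP" for t
  unfolding l_def st_def
  by (intro borel_measurable_add borel_measurable_times borel_measurable_const dmi.stage_measurable mx \<sigma> mY borel_vec_sp[OF mY mY])
 have il: "integrable PP (l \<sigma> t)" if t: "?b ^ t \<noteq> 0" for t
 proof (rule integrableI_nonneg[OF ml])
  show "AE om in PP. 0 \<le> l \<sigma> t om" using l0[OF \<sigma>] by (intro AE_I2) auto
  have "L t = (\<integral>\<^sup>+om. ennreal (?b ^ t) * ennreal (l \<sigma> t om) \<partial>PP)"
   unfolding L_def using b l0[OF \<sigma>] by (intro nn_integral_cong ennreal_mult) auto
  also have "\<dots> = ennreal (?b ^ t) * (\<integral>\<^sup>+om. ennreal (l \<sigma> t om) \<partial>PP)" using ml by (intro nn_integral_cmult) auto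
  finally have eq: "L t = ennreal (?b ^ t) * (\<integral>\<^sup>+om. ennreal (l \<sigma> t om) \<partial>PP)" .
  have "0 < ?b ^ t" using t zero_le_power[OF b(1), of t] by linarith
  then have c: "ennreal (?b ^ t) \<noteq> 0" by (simp only: ennreal_eq_0_iff not_le not_False_eq_True)
  have "(\<integral>\<^sup>+om. ennreal (l \<sigma> t om) \<partial>PP) \<noteq> \<infinity>"
  proof
   assume "(\<integral>\<^sup>+om. ennreal (l \<sigma> t om) \<partial>PP) = \<infinity>"
   then have "L t = \<infinity>" unfolding eq using c by (simp add: ennreal_mult_top)
   then show False using Lfin by blast
  qed
  then show "(\<integral>\<^sup>+om. ennreal (l \<sigma> t om) \<partial>PP) < \<infinity>" by (simp add: less_top)
 qed
 have Lx: "L2v PP ni (px \<sigma> t)" "L2v PP mi (pu \<sigma> t)" if t: "?b ^ t \<noteq> 0" for t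
 proof -
  have i': "integrable PP (\<lambda>om. l \<sigma> t om / \<epsilon>)" using il[OF t] by simp
  have "px \<sigma> t om \<bullet> px \<sigma> t om \<le> l \<sigma> t om / \<epsilon>" "pu \<sigma> t om \<bullet> pu \<sigma> t om \<le> l \<sigma> t om / \<epsilon>" if "om \<in> space PP" for om
  proof -
   have "px \<sigma> t om \<bullet> px \<sigma> t om + pu \<sigma> t om \<bullet> pu \<sigma> t om \<le> l \<sigma> t om / \<epsilon>"
    using lc[OF \<sigma> that, of t] eps by (simp add: pos_le_divide_eq mult.commute)
   then show "px \<sigma> t om \<bullet> px \<sigma> t om \<le> l \<sigma> t om / \<epsilon>" "pu \<sigma> t om \<bullet> pu \<sigma> t om \<le> l \<sigma> t om / \<epsilon>"
    using sp_self_nonneg[of "px \<sigma> t om"] sp_self_nonneg[of "pu \<sigma> t om"] by simp_all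
  qed
  then show "L2v PP ni (px \<sigma> t)" "L2v PP mi (pu \<sigma> t)" using L2vI[OF mx(1)[OF \<sigma>] i'] L2vI[OF mx(2)[OF \<sigma>] i'] by blast+
 qed
 have iY: "integrable PP (\<lambda>om. Y t (fst om) \<bullet> Y t (fst om))" for t by (rule L2v_sp_self(1)[OF L2v_marg(1)[OF L2_Y]])
 have ils: "integrable PP (l (sfilt i) t)" for t
  unfolding l_def by (intro Bochner_Integration.integrable_add Bochner_Integration.integrable_mult_right iY st_integrable xs_L2)
 define e f where "e t = ?b ^ t * (\<integral>om. l \<sigma> t om \<partial>PP)" and "f t = ?b ^ t * (\<integral>om. l (sfilt i) t om \<partial>PP)" for t
 define D where "D t = ?b ^ t * (\<integral>om. dx \<sigma> t om \<bullet> lam t om \<partial>PP)" for t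
 have e0: "0 \<le> e t" and f0: "0 \<le> f t" for t
  unfolding e_def f_def using b l0[OF \<sigma>] l0[OF sfilt_strategy] by (auto intro!: mult_nonneg_nonneg integral_nonneg_AE AE_I2)
 have eL: "(\<integral>\<^sup>+om. ennreal (?b ^ t * l \<sigma> t om) \<partial>PP) = ennreal (e t)" for t
 proof (cases "?b ^ t = 0")
  case False
  have "(\<integral>\<^sup>+om. ennreal (?b ^ t * l \<sigma> t om) \<partial>PP) = ennreal (\<integral>om. ?b ^ t * l \<sigma> t om \<partial>PP)"
   using b l0[OF \<sigma>] il[OF False] by (intro nn_integral_eq_integral AE_I2) auto
  then show ?thesis by (simp add: e_def)
 qed (simp add: e_def del: power_eq_0_iff)
 have fL: "(\<integral>\<^sup>+om. ennreal (?b ^ t * l (sfilt i) t om) \<partial>PP) = ennreal (f t)" for t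
 proof -
  have "(\<integral>\<^sup>+om. ennreal (?b ^ t * l (sfilt i) t om) \<partial>PP) = ennreal (\<integral>om. ?b ^ t * l (sfilt i) t om \<partial>PP)"
   using b l0[OF sfilt_strategy] ils by (intro nn_integral_eq_integral AE_I2) auto
  then show ?thesis by (simp add: f_def)
 qed
 have es: "summable e" using False e0 by (intro summable_suminf_not_top) (auto simp: eL)
 have step: "2 * (D t - D (Suc t)) \<le> e t - f t" for t
 proof (cases "?b ^ t = 0")
  case False
  have "(\<integral>om. l \<sigma> t om \<partial>PP) - (\<integral>om. l (sfilt i) t om \<partial>PP) = (\<integral>om. st \<sigma> t om \<partial>PP) - (\<integral>om. st (sfilt i) t om \<partial>PP)"
   unfolding l_def using st_integrable[OF Lx[OF False]] st_integrable[OF xs_L2] iY by simp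
  then have "2 * ((\<integral>om. dx \<sigma> t om \<bullet> lam t om \<partial>PP) - ?b * (\<integral>om. dx \<sigma> (Suc t) om \<bullet> lam (Suc t) om \<partial>PP)) \<le> (\<integral>om. l \<sigma> t om \<partial>PP) - (\<integral>om. l (sfilt i) t om \<partial>PP)"
   using step_inequality[OF \<sigma> Lx[OF False]] by simp
  then have "?b ^ t * (2 * ((\<integral>om. dx \<sigma> t om \<bullet> lam t om \<partial>PP) - ?b * (\<integral>om. dx \<sigma> (Suc t) om \<bullet> lam (Suc t) om \<partial>PP))) \<le> ?b ^ t * ((\<integral>om. l \<sigma> t om \<partial>PP) - (\<integral>om. l (sfilt i) t om \<partial>PP))"
   using b by (intro mult_left_mono) auto
  then show ?thesis by (simp add: D_def e_def f_def algebra_simps)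
 qed (simp add: D_def e_def f_def del: power_eq_0_iff)
 have D0: "D 0 = 0"
 proof -
  have "(\<integral>om. dx \<sigma> 0 om \<bullet> lam 0 om \<partial>PP) = (\<integral>om. 0 \<partial>PP)"
  proof (rule Bochner_Integration.integral_cong[OF refl])
   fix om assume om: "om \<in> space PP"
   have "dim_vec (lam 0 om) = ni" using lam_L2[of 0] om by (simp add: L2v_def)
   then show "dx \<sigma> 0 om \<bullet> lam 0 om = 0"
    using private_dims(1)[OF PP_D(2)[OF om]] by (simp add: dx_def subj_equations(1) scalar_prod_def)
  qed
  then show ?thesis by (simp add: D_def)
 qed
 define X where "X t = ?b ^ t * (\<integral>om. xs t om \<bullet> xs t om \<partial>PP)" for t
 define Z where "Z t = ?b ^ t * (\<integral>om. lam t om \<bullet> lam t om \<partial>PP)" for t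
 define h where "h t = 2 * (e t / \<epsilon>) + 2 * X t + Z t" for t
 have X0: "0 \<le> X t" "0 \<le> Z t" for t unfolding X_def Z_def using b sp_self_nonneg by (auto intro!: mult_nonneg_nonneg integral_nonneg_AE AE_I2)
 have Dh: "2 * D t \<le> h t" for t
 proof (cases "?b ^ t = 0")
  case True then show ?thesis using e0[of t] X0[of t] eps by (simp add: D_def h_def del: power_eq_0_iff)
 next
  case False
  note L = Lx[OF False]
  have Ldx: "L2v PP ni (dx \<sigma> t)" unfolding dx_def[abs_def] by (intro L2v_diff L xs_L2)
  have pt: "2 * (dx \<sigma> t om \<bullet> lam t om) \<le> (2 * (l \<sigma> t om / \<epsilon>) + 2 * (xs t om \<bullet> xs t om)) + lam t om \<bullet> lam t om" if om: "om \<in> space PP" for om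
  proof -
   have dd: "dim_vec (dx \<sigma> t om) = ni" "dim_vec (lam t om) = ni" using Ldx lam_L2[of t] om by (auto simp: L2v_def)
   have "2 * (dx \<sigma> t om \<bullet> lam t om) \<le> dx \<sigma> t om \<bullet> dx \<sigma> t om + lam t om \<bullet> lam t om" using dd by (intro sp_le_half) simp
   moreover have "dx \<sigma> t om \<bullet> dx \<sigma> t om \<le> 2 * (px \<sigma> t om \<bullet> px \<sigma> t om) + 2 * (xs t om \<bullet> xs t om)"
    unfolding dx_def using path_dims(1)[OF \<sigma> om] path_dims(1)[OF sfilt_strategy om] by (intro sp_diff_bound) simp
   moreover have "px \<sigma> t om \<bullet> px \<sigma> t om \<le> l \<sigma> t om / \<epsilon>"
   proof -
    have "px \<sigma> t om \<bullet> px \<sigma> t om + pu \<sigma> t om \<bullet> pu \<sigma> t om \<le> l \<sigma> t om / \<epsilon>"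
     using lc[OF \<sigma> om, of t] eps by (simp add: pos_le_divide_eq mult.commute)
    then show ?thesis using sp_self_nonneg[of "pu \<sigma> t om"] by simp
   qed
   ultimately show ?thesis by simp
  qed
  have "(\<integral>om. 2 * (dx \<sigma> t om \<bullet> lam t om) \<partial>PP) \<le> (\<integral>om. (2 * (l \<sigma> t om / \<epsilon>) + 2 * (xs t om \<bullet> xs t om)) + lam t om \<bullet> lam t om \<partial>PP)"
   using il[OF False] by (intro integral_mono pt Bochner_Integration.integrable_add Bochner_Integration.integrable_mult_right
     L2v_sp(1)[OF Ldx lam_L2] L2v_sp_self(1)[OF xs_L2(1)] L2v_sp_self(1)[OF lam_L2]) auto
  also have "\<dots> = 2 * ((\<integral>om. l \<sigma> t om \<partial>PP) / \<epsilon>) + 2 * (\<integral>om. xs t om \<bullet> xs t om \<partial>PP) + (\<integral>om. lam t om \<bullet> lam t om \<partial>PP)"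
   using il[OF False] L2v_sp_self(1)[OF xs_L2(1)] L2v_sp_self(1)[OF lam_L2] by simp
  finally have "?b ^ t * (2 * (\<integral>om. dx \<sigma> t om \<bullet> lam t om \<partial>PP)) \<le> ?b ^ t * (2 * ((\<integral>om. l \<sigma> t om \<partial>PP) / \<epsilon>) + 2 * (\<integral>om. xs t om \<bullet> xs t om \<partial>PP) + (\<integral>om. lam t om \<bullet> lam t om \<partial>PP))"
   using b by (intro mult_left_mono) auto
  then show ?thesis by (simp add: D_def h_def e_def X_def Z_def algebra_simps)
 qed
 have "h \<longlonglongrightarrow> 2 * (0 / \<epsilon>) + 2 * 0 + 0" unfolding h_def[abs_def] X_def Z_def
  using eps by (intro tendsto_intros xs_decay lam_decay summable_LIMSEQ_zero[OF es]) auto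
 then have h: "h \<longlonglongrightarrow> 0" by simp
 show ?thesis unfolding eL fL by (rule telescoping_comparison[OF e0 es f0 step D0 Dh h])
qed simp

end

section \<open>Subjective costs as integrals of nonnegative terms\<close>

lemma path_cost_shift:
 assumes l: "!!t. 0 \<le> disc g i ^ t * (stage_cost g i (subj_x g i \<sigma> x w z t) (subj_u g i \<sigma> x w z t) (z t) + \<kappa> * (z t \<bullet> z t))"
  and b: "0 \<le> disc g i" and kap: "0 \<le> \<kappa>" and fin: "(\<Sum>t. ennreal (disc g i ^ t * (\<kappa> * (z t \<bullet> z t)))) \<noteq> \<infinity>"
 shows "path_cost g i \<sigma> x w z =
  enn2ereal (\<Sum>t. ennreal (disc g i ^ t * (stage_cost g i (subj_x g i \<sigma> x w z t) (subj_u g i \<sigma> x w z t) (z t) + \<kappa> * (z t \<bullet> z t))))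
  - ereal (enn2real (\<Sum>t. ennreal (disc g i ^ t * (\<kappa> * (z t \<bullet> z t)))))"
proof -
 have k0: "0 \<le> disc g i ^ t * (\<kappa> * (z t \<bullet> z t))" for t using b kap sp_self_nonneg[of "z t"] by (intro mult_nonneg_nonneg) auto
 have ks: "summable (\<lambda>t. disc g i ^ t * (\<kappa> * (z t \<bullet> z t)))" using k0 fin by (intro summable_suminf_not_top) auto
 have kv: "(\<Sum>t. ennreal (disc g i ^ t * (\<kappa> * (z t \<bullet> z t)))) = ennreal (\<Sum>t. disc g i ^ t * (\<kappa> * (z t \<bullet> z t)))"
  by (rule suminf_ennreal2[OF k0 ks])
 have "0 \<le> (\<Sum>t. disc g i ^ t * (\<kappa> * (z t \<bullet> z t)))" by (rule suminf_nonneg[OF ks k0])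
 then have e: "enn2real (\<Sum>t. ennreal (disc g i ^ t * (\<kappa> * (z t \<bullet> z t)))) = (\<Sum>t. disc g i ^ t * (\<kappa> * (z t \<bullet> z t)))"
  unfolding kv by simp
 show ?thesis unfolding path_cost_def e by (rule limsup_nonneg_series[OF _ l ks]) (simp add: algebra_simps)
qed

context verif_bd
begin

abbreviation "Zf \<equiv> env_law g M x0 w xi sfilt"

lemma env_meas: "(\<lambda>om t. env_process g x0 w xi sfilt t om) \<in> M \<rightarrow>\<^sub>M env_space g"
 by (rule env_measurable(2)[OF filt_measurable])

lemma Zf_prob: "prob_space Zf" unfolding env_law_def by (rule prob_space_distr[OF env_meas])

lemma Zf_nn_integral: assumes "F \<in> borel_measurable (env_space g)"
 shows "(\<integral>\<^sup>+z. F z \<partial>Zf) = (\<integral>\<^sup>+om. F (\<lambda>t. Y t om) \<partial>M)"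
proof -
 have "(\<integral>\<^sup>+z. F z \<partial>Zf) = (\<integral>\<^sup>+om. F (\<lambda>t. env_process g x0 w xi sfilt t om) \<partial>M)"
  unfolding env_law_def by (rule nn_integral_distr[OF env_meas]) (use assms in simp)
 also have "\<dots> = (\<integral>\<^sup>+om. F (\<lambda>t. Y t om) \<partial>M)" by (rule nn_integral_cong) (simp add: env_filt)
 finally show ?thesis .
qed

text \<open>The strategy-independent shift of the cost, and the shifted cost of a path.\<close>
definition "pen \<kappa> z = (\<Sum>t. ennreal (disc g i ^ t * (\<kappa> * (z t \<bullet> z t))))" for z :: "nat => rvec"
definition "tot \<kappa> \<sigma> z om = (\<Sum>t. ennreal (disc g i ^ t * (stage_cost g i (subj_x g i \<sigma> (x0 i om) (\<lambda>k. w i k om) z t)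
 (subj_u g i \<sigma> (x0 i om) (\<lambda>k. w i k om) z t) (z t) + \<kappa> * (z t \<bullet> z t))))"

lemma env_coord: "(\<lambda>z. z t) \<in> env_space g \<rightarrow>\<^sub>M borel_vec p" by (rule measurable_component_singleton) simp

lemma pen_measurable: "pen \<kappa> \<in> borel_measurable (env_space g)"
 unfolding pen_def
 by (intro borel_measurable_suminf_order measurable_compose[OF _ measurable_ennreal] borel_measurable_times borel_measurable_const borel_vec_sp[OF env_coord env_coord])

lemma tot_measurable: assumes \<sigma>: "\<sigma> \<in> strategies g i"
 and Z: "!!t. (\<lambda>q. Z q t) \<in> NN \<rightarrow>\<^sub>M borel_vec p" and f: "f \<in> NN \<rightarrow>\<^sub>M M"
 shows "(\<lambda>q. tot \<kappa> \<sigma> (Z q) (f q)) \<in> borel_measurable NN"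
proof -
 have X: "(\<lambda>q. x0 i (f q)) \<in> NN \<rightarrow>\<^sub>M borel_vec ni" "!!k. (\<lambda>q. w i k (f q)) \<in> NN \<rightarrow>\<^sub>M borel_vec ni"
  using measurable_compose[OF f private_meas(1)] measurable_compose[OF f private_meas(2)] by auto
 note m = dmi.subj_measurable[where X = "\<lambda>q. x0 i (f q)" and Wp = "\<lambda>k q. w i k (f q)" and Z = "\<lambda>k q. Z q k", OF \<sigma> X Z]
 show ?thesis unfolding tot_def
  by (intro borel_measurable_suminf_order measurable_compose[OF _ measurable_ennreal] borel_measurable_times borel_measurable_add borel_measurable_const
    dmi.stage_measurable m Z borel_vec_sp[OF Z Z])
qed

lemma pen_moment: assumes kap: "0 \<le> \<kappa>" shows "(\<integral>\<^sup>+z. pen \<kappa> z \<partial>Zf) \<noteq> \<infinity>"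
proof -
 let ?b = "disc g i"
 have b: "0 \<le> ?b" "?b < 1" using game i by (auto simp: lq_game_data_def)
 obtain B' where B: "0 \<le> B'" "!!t k. k < p ==> (\<integral>om. (Y t om $ k)\<^sup>2 \<partial>M) \<le> B'" by (rule B_bounds) (rule that)
 have t: "(\<integral>\<^sup>+om. ennreal (?b ^ t * (\<kappa> * (Y t om \<bullet> Y t om))) \<partial>M) \<le> ennreal (?b ^ t * (\<kappa> * (p * B')))" for t
 proof -
  have "(\<integral>\<^sup>+om. ennreal (?b ^ t * (\<kappa> * (Y t om \<bullet> Y t om))) \<partial>M) = ennreal (\<integral>om. ?b ^ t * (\<kappa> * (Y t om \<bullet> Y t om)) \<partial>M)"
   using b kap sp_self_nonneg L2v_sp_self(1)[OF L2_Y]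
   by (intro nn_integral_eq_integral Bochner_Integration.integrable_mult_right AE_I2 mult_nonneg_nonneg) auto
  also have "(\<integral>om. ?b ^ t * (\<kappa> * (Y t om \<bullet> Y t om)) \<partial>M) = ?b ^ t * (\<kappa> * (\<integral>om. Y t om \<bullet> Y t om \<partial>M))" by simp
  also have "(\<integral>om. Y t om \<bullet> Y t om \<partial>M) \<le> p * B'"
  proof -
   have "(\<integral>om. Y t om \<bullet> Y t om \<partial>M) \<le> (\<Sum>k<p. B')" unfolding L2v_sp_self(2)[OF L2_Y] using B(2) by (intro sum_mono) auto
   then show ?thesis by simp
  qed
  finally show ?thesis using b kap by (simp add: ennreal_leI mult_left_mono)
 qed
 have "(\<integral>\<^sup>+z. pen \<kappa> z \<partial>Zf) = (\<integral>\<^sup>+om. pen \<kappa> (\<lambda>t. Y t om) \<partial>M)" by (rule Zf_nn_integral[OF pen_measurable])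
 also have "\<dots> = (\<Sum>t. \<integral>\<^sup>+om. ennreal (?b ^ t * (\<kappa> * (Y t om \<bullet> Y t om))) \<partial>M)"
  unfolding pen_def
  by (intro nn_integral_suminf measurable_compose[OF _ measurable_ennreal] borel_measurable_times borel_measurable_const borel_vec_sp[OF Y_measurable(1) Y_measurable(1)])
 also have "\<dots> \<le> (\<Sum>t. ennreal (?b ^ t * (\<kappa> * (p * B'))))" by (intro suminf_le t summableI)
 also have "\<dots> = ennreal (\<Sum>t. ?b ^ t * (\<kappa> * (p * B')))"
  using b B kap by (intro suminf_ennreal2 summable_mult2 summable_geometric mult_nonneg_nonneg) auto
 finally show ?thesis by (auto simp: top_unique)
qed

text \<open>Two applications of \<open>ereal_expectation_shift\<close>, over the private noise and over the
 environment, and Tonelli.\<close>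
lemma expected_cost:
 assumes \<sigma>: "\<sigma> \<in> strategies g i" and eps: "0 < \<epsilon>" and kap: "0 \<le> \<kappa>"
  and coer: "!!x u z. dim_vec x = ni ==> dim_vec u = mi ==> dim_vec z = p ==> \<epsilon> * (x \<bullet> x + u \<bullet> u) \<le> stage_cost g i x u z + \<kappa> * (z \<bullet> z)"
 shows "ereal_expectation Zf (subj_cost g M x0 w i \<sigma>) =
  enn2ereal (\<Sum>t. \<integral>\<^sup>+om. ennreal (disc g i ^ t * (st \<sigma> t om + \<kappa> * (Y t (fst om) \<bullet> Y t (fst om)))) \<partial>PP)
  - ereal (\<integral>z. enn2real (pen \<kappa> z) \<partial>Zf)"
proof -
 have b: "0 \<le> disc g i" using game i by (auto simp: lq_game_data_def)
 have Zs: "space Zf = space (env_space g)" "sets Zf = sets (env_space g)" by (simp_all add: env_law_def)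
 have Zm: "borel_measurable Zf = borel_measurable (env_space g)" by (rule measurable_cong_sets[OF Zs(2) refl])
 have L0: "tot \<kappa> \<sigma> z \<in> borel_measurable M" if z: "z \<in> space (env_space g)" for z
  using z by (intro tot_measurable[OF \<sigma>] measurable_const measurable_ident_sets) (auto simp: space_PiM)
 have inner: "subj_cost g M x0 w i \<sigma> z = enn2ereal (\<integral>\<^sup>+om. tot \<kappa> \<sigma> z om \<partial>M) - ereal (enn2real (pen \<kappa> z))"
  if z: "z \<in> space (env_space g)" and fin: "pen \<kappa> z \<noteq> \<infinity>" for z
 proof -
  have zc: "z t \<in> space (borel_vec p)" for t using z by (auto simp: space_PiM)
  have zd: "dim_vec (z t) = p" for t using zc[of t] by (simp add: carrier_vecD)
  have "path_cost g i \<sigma> (x0 i om) (\<lambda>k. w i k om) z = enn2ereal (tot \<kappa> \<sigma> z om) - ereal (enn2real (pen \<kappa> z))" if om: "om \<in> space M" for om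
   unfolding tot_def pen_def
  proof (rule path_cost_shift[OF _ b kap fin[unfolded pen_def]])
   fix t
   let ?x = "subj_x g i \<sigma> (x0 i om) (\<lambda>k. w i k om) z t" and ?u = "subj_u g i \<sigma> (x0 i om) (\<lambda>k. w i k om) z t"
   note m = dmi.subj_measurable[where X = "x0 i" and Wp = "w i" and Z = "\<lambda>k _. z k" and NN = M, OF \<sigma> private_meas measurable_const[OF zc]]
   have "dim_vec ?x = ni" "dim_vec ?u = mi" using borel_vecD(2)[OF m(1) om] borel_vecD(2)[OF m(2) om] by auto
   from coer[OF this zd[of t]] have "0 \<le> stage_cost g i ?x ?u (z t) + \<kappa> * (z t \<bullet> z t)"
    using eps sp_self_nonneg[of ?x] sp_self_nonneg[of ?u] by (meson add_nonneg_nonneg mult_nonneg_nonneg order_trans less_imp_le)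
   then show "0 \<le> disc g i ^ t * (stage_cost g i ?x ?u (z t) + \<kappa> * (z t \<bullet> z t))" using b by (intro mult_nonneg_nonneg) auto
  qed
  then have "ereal_expectation M (\<lambda>om. path_cost g i \<sigma> (x0 i om) (\<lambda>k. w i k om) z) =
    enn2ereal (\<integral>\<^sup>+om. tot \<kappa> \<sigma> z om \<partial>M) - ereal (\<integral>om. enn2real (pen \<kappa> z) \<partial>M)"
   by (intro ereal_expectation_shift[OF prob L0[OF z]]) auto
  then show ?thesis unfolding subj_cost_def by (simp add: prob_space)
 qed
 have penm: "pen \<kappa> \<in> borel_measurable Zf" unfolding Zm by (rule pen_measurable)
 have AEf: "AE z in Zf. pen \<kappa> z \<noteq> \<infinity>" by (rule nn_integral_PInf_AE[OF penm pen_moment[OF kap]])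
 have ipen: "integrable Zf (\<lambda>z. enn2real (pen \<kappa> z))"
 proof (rule integrableI_nonneg)
  show "(\<lambda>z. enn2real (pen \<kappa> z)) \<in> borel_measurable Zf" using penm by measurable
  have "(\<integral>\<^sup>+z. ennreal (enn2real (pen \<kappa> z)) \<partial>Zf) \<le> (\<integral>\<^sup>+z. pen \<kappa> z \<partial>Zf)" by (intro nn_integral_mono) (simp add: ennreal_enn2real_if)
  also have "\<dots> < \<infinity>" using pen_moment[OF kap] by (simp add: less_top)
  finally show "(\<integral>\<^sup>+z. ennreal (enn2real (pen \<kappa> z)) \<partial>Zf) < \<infinity>" .
 qed simp
 have mfst: "(\<lambda>q. fst q t) \<in> env_space g \<Otimes>\<^sub>M M \<rightarrow>\<^sub>M borel_vec p" for t by (rule measurable_compose[OF measurable_fst env_coord])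
 have Lm: "(\<lambda>z. \<integral>\<^sup>+om. tot \<kappa> \<sigma> z om \<partial>M) \<in> borel_measurable (env_space g)"
  using borel_measurable_nn_integral_fst[OF tot_measurable[OF \<sigma> mfst measurable_snd, of \<kappa>]] by simp
 have "ereal_expectation Zf (subj_cost g M x0 w i \<sigma>) = enn2ereal (\<integral>\<^sup>+z. (\<integral>\<^sup>+om. tot \<kappa> \<sigma> z om \<partial>M) \<partial>Zf) - ereal (\<integral>z. enn2real (pen \<kappa> z) \<partial>Zf)"
 proof (rule ereal_expectation_shift[OF Zf_prob _ ipen])
  show "(\<lambda>z. \<integral>\<^sup>+om. tot \<kappa> \<sigma> z om \<partial>M) \<in> borel_measurable Zf" unfolding Zm by (rule Lm)
  show "AE z in Zf. subj_cost g M x0 w i \<sigma> z = enn2ereal (\<integral>\<^sup>+om. tot \<kappa> \<sigma> z om \<partial>M) - ereal (enn2real (pen \<kappa> z))"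
   using AEf AE_space by eventually_elim (rule inner, simp_all add: Zs)
 qed simp
 also have "(\<integral>\<^sup>+z. (\<integral>\<^sup>+om. tot \<kappa> \<sigma> z om \<partial>M) \<partial>Zf) = (\<integral>\<^sup>+om1. (\<integral>\<^sup>+om2. tot \<kappa> \<sigma> (\<lambda>t. Y t om1) om2 \<partial>M) \<partial>M)" by (rule Zf_nn_integral[OF Lm])
 also have "\<dots> = (\<integral>\<^sup>+om. tot \<kappa> \<sigma> (\<lambda>t. Y t (fst om)) (snd om) \<partial>PP)"
  using nn_integral_fst[OF tot_measurable[where Z = "\<lambda>om t. Y t (fst om)" and f = snd and NN = PP and \<kappa> = \<kappa>, OF \<sigma> measurable_compose[OF measurable_fst Y_measurable(1)] measurable_snd]]
  by simp
 also have "\<dots> = (\<Sum>t. \<integral>\<^sup>+om. ennreal (disc g i ^ t * (st \<sigma> t om + \<kappa> * (Y t (fst om) \<bullet> Y t (fst om)))) \<partial>PP)"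
  unfolding tot_def st_def
 proof (rule nn_integral_suminf)
  fix t
  have mY: "(\<lambda>om. Y t (fst om)) \<in> PP \<rightarrow>\<^sub>M borel_vec p" by (rule measurable_compose[OF measurable_fst Y_measurable(1)])
  show "(\<lambda>om. ennreal (disc g i ^ t * (stage_cost g i (px \<sigma> t om) (pu \<sigma> t om) (Y t (fst om)) + \<kappa> * (Y t (fst om) \<bullet> Y t (fst om))))) \<in> borel_measurable PP"
   by (intro measurable_compose[OF _ measurable_ennreal] borel_measurable_times borel_measurable_add borel_measurable_const dmi.stage_measurable
     adapted_measurable[OF adapted_path(1)[OF \<sigma>]] adapted_measurable[OF adapted_path(2)[OF \<sigma>]] mY borel_vec_sp[OF mY mY])
 qed
 finally show ?thesis .
qed

lemma candidate_optimal: assumes \<sigma>: "\<sigma> \<in> strategies g i"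
 shows "ereal_expectation Zf (subj_cost g M x0 w i (sfilt i)) \<le> ereal_expectation Zf (subj_cost g M x0 w i \<sigma>)"
proof -
 obtain \<epsilon> \<kappa> where c: "0 < \<epsilon>" "0 \<le> \<kappa>" "!!x u z. dim_vec x = ni ==> dim_vec u = mi ==> dim_vec z = p ==>
   \<epsilon> * (x \<bullet> x + u \<bullet> u) \<le> stage_cost g i x u z + \<kappa> * (z \<bullet> z)" using dmi.stage_coercive by blast
 have e: "ereal_expectation Zf (subj_cost g M x0 w i \<tau>) =
  enn2ereal (\<Sum>t. \<integral>\<^sup>+om. ennreal (disc g i ^ t * (st \<tau> t om + \<kappa> * (Y t (fst om) \<bullet> Y t (fst om)))) \<partial>PP)
  - ereal (\<integral>z. enn2real (pen \<kappa> z) \<partial>Zf)" if "\<tau> \<in> strategies g i" for \<tau>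
  using that c(1,2) by (rule expected_cost) (rule c(3))
 have "(\<Sum>t. \<integral>\<^sup>+om. ennreal (disc g i ^ t * (st (sfilt i) t om + \<kappa> * (Y t (fst om) \<bullet> Y t (fst om)))) \<partial>PP)
   \<le> (\<Sum>t. \<integral>\<^sup>+om. ennreal (disc g i ^ t * (st \<sigma> t om + \<kappa> * (Y t (fst om) \<bullet> Y t (fst om)))) \<partial>PP)"
  using \<sigma> c(1,2) by (rule comparison) (rule c(3))
 then show ?thesis unfolding e[OF \<sigma>] e[OF sfilt_strategy] by (intro ereal_minus_mono) (simp_all add: less_eq_ennreal.rep_eq)
qed

end

context full
begin

lemma filter_sebeu:
 assumes B: "!!t k. k < ny g ==> (\<integral>om. (Y t om $ k)\<^sup>2 \<partial>M) \<le> B"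
 shows "sebeu g M x0 w xi sfilt"
proof -
 have v: "verif_bd g ew exi a b eX Sg V M X0 W xi x0 w i B" if "i \<in> {1..N}" for i
  using that B by unfold_locales auto
 have "prob_space (env_law g M x0 w xi sfilt)" unfolding env_law_def by (rule prob_space_distr[OF env_measurable(2)[OF filt_measurable]])
 then have Z: "env_law g M x0 w xi sfilt \<in> space (prob_algebra (env_space g))" by (simp add: space_prob_algebra env_law_def)
 show ?thesis unfolding sebeu_def
  using Z est_in_strategies[OF filt_measurable] verif_bd.candidate_optimal[OF v]
  by (intro conjI exI[of _ "\<lambda>_. env_law g M x0 w xi sfilt"]) auto
qed

text \<open>Plays coincide path by path wherever the estimators agree along the generated observations. The
 agreement holds almost surely under the common law, so strategies and beliefs may be exchanged.\<close>
lemma estimator_transfer: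
 assumes hm: "!!t. h t \<in> (\<Pi>\<^sub>M k\<in>{..<t}. borel_vec p) \<rightarrow>\<^sub>M borel_vec d"
  and h: "AE om in M. \<forall>t. h t (\<lambda>k\<in>{..<t}. Y k om) = Fe t om"
 defines "s \<equiv> est_strategy g ew a b h"
 shows "AE om in M. \<forall>t. env_process g x0 w xi s t om = Y t om"
  and "env_law g M x0 w xi s = env_law g M x0 w xi sfilt"
  and "AE z in env_law g M x0 w xi sfilt. \<forall>t. h t (restrict z {..<t}) = filt t z"
  and "sebeu g M x0 w xi sfilt ==> sebeu g M x0 w xi s"
proof -
 let ?Z = "env_law g M x0 w xi sfilt"
 have em: "(\<lambda>om t. env_process g x0 w xi sfilt t om) \<in> M \<rightarrow>\<^sub>M env_space g" by (rule env_measurable(2)[OF filt_measurable])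
 have e: "AE om in M. \<forall>t. env_process g x0 w xi s t om = env_process g x0 w xi sfilt t om"
  using h AE_space
 proof eventually_elim
  case (elim om)
  have y: "game_y g sfilt (\<lambda>i. x0 i om) (\<lambda>i k. w i k om) (\<lambda>k. xi k om) = (\<lambda>k. Y k om)"
   using env_filt[OF elim(2)] by (auto simp: env_process_def)
  have "game_hist g s (\<lambda>i. x0 i om) (\<lambda>i k. w i k om) (\<lambda>k. xi k om) t = game_hist g sfilt (\<lambda>i. x0 i om) (\<lambda>i k. w i k om) (\<lambda>k. xi k om) t" for t
   unfolding s_def using elim by (intro game_hist_cong) (simp add: y filt_restrict Fe_filt)
  then have "game_y g s (\<lambda>i. x0 i om) (\<lambda>i k. w i k om) (\<lambda>k. xi k om) t = game_y g sfilt (\<lambda>i. x0 i om) (\<lambda>i k. w i k om) (\<lambda>k. xi k om) t" for t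
   by (simp only: game_y_def)
  then show ?case by (simp add: env_process_def)
 qed
 show "AE om in M. \<forall>t. env_process g x0 w xi s t om = Y t om"
  using e AE_space by eventually_elim (simp add: env_filt)
 show law: "env_law g M x0 w xi s = ?Z" unfolding env_law_def
 proof (rule distr_cong_AE[OF refl refl _ _ em])
  show "AE om in M. (\<lambda>t. env_process g x0 w xi s t om) = (\<lambda>t. env_process g x0 w xi sfilt t om)" using e by eventually_elim auto
  show "(\<lambda>om t. env_process g x0 w xi s t om) \<in> M \<rightarrow>\<^sub>M env_space g" unfolding s_def by (rule env_measurable(2)[OF hm])
 qed
 have "AE z in ?Z. \<forall>t. h t (restrict z {..<t}) = filt t (restrict z {..<t})"
  unfolding env_law_def
 proof (subst AE_distr_iff[OF em])
  have r: "(\<lambda>z. restrict z {..<t}) \<in> env_space g \<rightarrow>\<^sub>M (\<Pi>\<^sub>M k\<in>{..<t}. borel_vec p)" for t by (rule measurable_restrict_subset) simp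
  show "{z \<in> space (env_space g). \<forall>t. h t (restrict z {..<t}) = filt t (restrict z {..<t})} \<in> sets (env_space g)"
   by (intro sets.sets_Collect_countable_All borel_vec_eq_sets[OF measurable_compose[OF r hm] measurable_compose[OF r filt_measurable]])
  show "AE om in M. \<forall>t. h t (restrict (\<lambda>t. env_process g x0 w xi sfilt t om) {..<t}) = filt t (restrict (\<lambda>t. env_process g x0 w xi sfilt t om) {..<t})"
   using h AE_space by eventually_elim (simp add: env_filt filt_restrict Fe_filt)
 qed
 then show hf: "AE z in ?Z. \<forall>t. h t (restrict z {..<t}) = filt t z" by (simp add: filt_restrict)
 show "sebeu g M x0 w xi s" if S: "sebeu g M x0 w xi sfilt"
 proof -
  have cost: "ereal_expectation ?Z (subj_cost g M x0 w i (s i)) = ereal_expectation ?Z (subj_cost g M x0 w i (sfilt i))" for i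
  proof -
   have "AE z in ?Z. subj_cost g M x0 w i (s i) z = subj_cost g M x0 w i (sfilt i) z"
    using hf
   proof eventually_elim
    case (elim z)
    have H: "subj_hist g i (s i) x' w' z t = subj_hist g i (sfilt i) x' w' z t" for x' w' t
     unfolding s_def using elim by (intro subj_hist_cong) (simp add: filt_restrict)
    have "subj_x g i (s i) x' w' z t = subj_x g i (sfilt i) x' w' z t" "subj_u g i (s i) x' w' z t = subj_u g i (sfilt i) x' w' z t" for x' w' t
     by (simp_all only: subj_x_def subj_u_def H)
    then show ?case by (simp add: subj_cost_def path_cost_def)
   qed
   then have "(\<integral>\<^sup>+z. e2ennreal (subj_cost g M x0 w i (s i) z) \<partial>?Z) = (\<integral>\<^sup>+z. e2ennreal (subj_cost g M x0 w i (sfilt i) z) \<partial>?Z)"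
    "(\<integral>\<^sup>+z. e2ennreal (- subj_cost g M x0 w i (s i) z) \<partial>?Z) = (\<integral>\<^sup>+z. e2ennreal (- subj_cost g M x0 w i (sfilt i) z) \<partial>?Z)"
    by (auto intro!: nn_integral_cong_AE)
   then show ?thesis by (simp add: ereal_expectation_def)
  qed
  have opt: "\<forall>i\<in>{1..N}. \<forall>\<sigma>\<in>strategies g i. ereal_expectation ?Z (subj_cost g M x0 w i (sfilt i)) \<le> ereal_expectation ?Z (subj_cost g M x0 w i \<sigma>)"
   and Z: "\<forall>i\<in>{1..N}. ?Z \<in> space (prob_algebra (env_space g))"
   using S unfolding sebeu_def by auto
  have opt': "\<forall>i\<in>{1..N}. \<forall>\<sigma>\<in>strategies g i. ereal_expectation ?Z (subj_cost g M x0 w i (s i)) \<le> ereal_expectation ?Z (subj_cost g M x0 w i \<sigma>)"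
   using opt by (simp only: cost)
  have "\<forall>i\<in>{1..N}. s i \<in> strategies g i" unfolding s_def using est_in_strategies[OF hm] by blast
  then show ?thesis unfolding sebeu_def law using opt' Z by (intro conjI exI[of _ "\<lambda>_. ?Z"]) simp_all
 qed
qed

end

theorem corollary3p3p1:
  fixes g :: lq_game
    and M :: "'a measure" and x0 :: "nat \<Rightarrow> 'a \<Rightarrow> rvec"
    and w :: "nat \<Rightarrow> nat \<Rightarrow> 'a \<Rightarrow> rvec" and xi :: "nat \<Rightarrow> 'a \<Rightarrow> rvec"
    and a :: "nat \<Rightarrow> rmat" and b :: "nat \<Rightarrow> rvec"
    and M' :: "'b measure" and Xb yb xib Wb :: "nat \<Rightarrow> 'b \<Rightarrow> rvec"
    and h :: "nat \<Rightarrow> (nat \<Rightarrow> rvec) \<Rightarrow> rvec" and \<Sigma> :: rmat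
    and X0 :: "'a \<Rightarrow> rvec" and W :: "nat \<Rightarrow> 'a \<Rightarrow> rvec"
    and ew :: "nat \<Rightarrow> rvec" and exi :: rvec and V :: rmat
    and s :: "nat \<Rightarrow> strategy" and filt :: "nat \<Rightarrow> (nat \<Rightarrow> rvec) \<Rightarrow> rvec"
  assumes X0: "X0 = (\<lambda>\<omega>. stack g (\<lambda>i. x0 i \<omega>))"
    and W: "W = (\<lambda>t \<omega>. stack g (\<lambda>i. w i t \<omega>))"
    and ew: "ew = (\<lambda>i. mean_vec M (nx g i) (w i 0))"
    and exi: "exi = mean_vec M (ny g) (xi 0)"
    and V: "V = cov_mat M (ny g) (xi 0)"
    and s: "s = est_strategy g ew a b h"
    and filt: "filt = lti_filter g ew exi a b (mean_vec M (nX g) X0) \<Sigma> V"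
    and game: "lq_game_data g"
    and prob: "prob_space M"
    and rv: "\<And>i. i \<le> nDM g \<Longrightarrow> x0 i \<in> M \<rightarrow>\<^sub>M borel_vec (nx g i)"
      "\<And>i t. i \<le> nDM g \<Longrightarrow> w i t \<in> M \<rightarrow>\<^sub>M borel_vec (nx g i)"
      "\<And>t. xi t \<in> M \<rightarrow>\<^sub>M borel_vec (ny g)"
    and stab: "stable_mat (mA g 0)" "\<And>i. i \<in> {1..nDM g} \<Longrightarrow> stabilizable (mA g i) (mB g i)"
    and indep: "prob_space.indep_vars M (\<lambda>p. borel_vec (prim_dim g p)) (prim_var X0 W xi) UNIV"
    and moments: "\<And>p. finite_second_moment M (prim_dim g p) (prim_var X0 W xi p)"
    and ident: "\<And>t. distr M (borel_vec (nX g)) (W t) = distr M (borel_vec (nX g)) (W 0)"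
      "\<And>t. distr M (borel_vec (ny g)) (xi t) = distr M (borel_vec (ny g)) (xi 0)"
    and hat_unique: "\<And>Xh0. Xh0 \<in> carrier_vec (nX g) \<Longrightarrow> \<exists>!yh. hat_solution g ew exi Xh0 yh"
    and hat_carrier: "\<And>t. a t \<in> carrier_mat (ny g) (nX g)" "\<And>t. b t \<in> carrier_vec (ny g)"
    and hat_affine: "\<And>Xh0 yh t. Xh0 \<in> carrier_vec (nX g) \<Longrightarrow> hat_solution g ew exi Xh0 yh
      \<Longrightarrow> yh t = a t *\<^sub>v Xh0 + b t"
    and hat_bounded: "\<exists>c. \<forall>t. \<forall>k<ny g. \<bar>b t $ k\<bar> \<le> c \<and> (\<forall>l<nX g. \<bar>a t $$ (k, l)\<bar> \<le> c)"
    and aux_prob: "prob_space M'"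
    and aux: "aux_process g ew a b M' Xb yb xib Wb"
    and aux_law: "prim_law g M' (Xb 0) xib Wb = prim_law g M X0 xi W"
    and est: "cond_exp_map g M' Xb yb h"
    and gauss: "jointly_gaussian M {(p, k). k < prim_dim g p} (\<lambda>(p, k) \<omega>. prim_var X0 W xi p \<omega> $ k)"
    and innov: "invertible_mat (agg_D g * \<Sigma> * tr (agg_D g) + V)"
    and cov0: "cov_mat M (nX g) X0 = \<Sigma>"
    and stationary: "\<Sigma> = agg_A g * (\<Sigma> - \<Sigma> * tr (agg_D g) *
      inv_mat (agg_D g * \<Sigma> * tr (agg_D g) + V) * agg_D g * \<Sigma>) * tr (agg_A g)
      + cov_mat M (nX g) (W 0)"
    and bounded: "(SUP t. \<integral>\<^sup>+\<omega>. ennreal (env_process g x0 w xi s t \<omega> \<bullet> env_process g x0 w xi s t \<omega>) \<partial>M) < \<infinity>"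
  shows "sebeu g M x0 w xi s \<and>
    (AE Y in env_law g M x0 w xi s. \<forall>i\<in>{1..nDM g}. \<forall>t x u.
       s i t (info t x u Y) = cF g i *\<^sub>v x t + lim_G g a i *\<^sub>v filt t Y + lim_H g ew b i) \<and>
    sebeu g M x0 w xi (est_strategy g ew a b filt)"
proof -
 interpret PM: prob_space M by (rule prob)
 interpret G: game g using game stab(2) by unfold_locales auto
 have stX: "X0 = (\<lambda>om. stack g (\<lambda>i. x0 i om))" and stW: "W = (\<lambda>t om. stack g (\<lambda>i. w i t om))" by (rule X0, rule W)
 have ewd: "!!i. dim_vec (ew i) = nx g i" by (simp add: ew mean_vec_def)
 have ewm: "stack g ew = mean_vec M (nX g) (W 0)"
 proof (rule eq_vecI)
  show "dim_vec (stack g ew) = dim_vec (mean_vec M (nX g) (W 0))" using G.stack_dim[of ew] ewd by (simp add: mean_vec_def)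
  fix l assume "l < dim_vec (mean_vec M (nX g) (W 0))"
  then have l: "l < nX g" by (simp add: mean_vec_def)
  obtain i k where ik: "i \<le> nDM g" "k < nx g i" "!!v. (!!i. i \<le> nDM g ==> dim_vec (v i) = nx g i) ==> stack g v $ l = v i $ k"
   using G.stack_index[OF l] by blast
  have "(\<integral>om. W 0 om $ l \<partial>M) = (\<integral>om. w i 0 om $ k \<partial>M)"
  proof (rule Bochner_Integration.integral_cong[OF refl])
   fix om assume om: "om \<in> space M"
   show "W 0 om $ l = w i 0 om $ k" unfolding stW by (rule ik(3)) (rule borel_vecD(2)[OF rv(2) om])
  qed
  moreover have "stack g ew $ l = ew i $ k" by (rule ik(3)) (rule ewd)
  ultimately show "stack g ew $ l = mean_vec M (nX g) (W 0) $ l" using l ik(2) by (simp add: ew mean_vec_def)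
 qed
 define eX where "eX = mean_vec M (nX g) X0"
 have Sc: "\<Sigma> \<in> carrier_mat (nX g) (nX g)" unfolding cov0[symmetric] by (simp add: cov_mat_def)
 have Vc: "V \<in> carrier_mat (ny g) (ny g)" unfolding V by (simp add: cov_mat_def)
 interpret F: full g ew exi a b eX \<Sigma> V M X0 W xi x0 w
 proof (unfold_locales)
  show "dim_vec eX = nX g" "dim_vec exi = ny g" by (simp_all add: eX_def exi mean_vec_def)
 qed (rule ewd exi prob indep ident gauss ewm V cov0 stationary stX stW innov Sc Vc hat_unique hat_carrier hat_bounded hat_affine rv eX_def; (assumption)?)+
 have hm: "!!t. h t \<in> (\<Pi>\<^sub>M k\<in>{..<t}. borel_vec (ny g)) \<rightarrow>\<^sub>M borel_vec (nX g)" using est by (simp add: cond_exp_map_def)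
 note tr = F.estimator_transfer[OF hm F.est_eq[OF aux_prob aux aux_law est], folded s]
 have filt': "filt = lti_filter g ew exi a b eX \<Sigma> V" by (simp add: filt eX_def)
 obtain B where B: "!!t k. k < ny g ==> (\<integral>om. (F.Y t om $ k)\<^sup>2 \<partial>M) \<le> B"
 proof -
  define C where "C = (SUP t. \<integral>\<^sup>+om. ennreal (env_process g x0 w xi s t om \<bullet> env_process g x0 w xi s t om) \<partial>M)"
  have C: "C < \<infinity>" unfolding C_def by (rule bounded)
  have "(\<integral>om. (F.Y t om $ k)\<^sup>2 \<partial>M) \<le> enn2real C" if k: "k < ny g" for t k
  proof -
   have i: "integrable M (\<lambda>om. (F.Y t om $ k)\<^sup>2)" using F.L2_Y[of t] k by (simp add: L2v_def L2_def)
   have "ennreal (\<integral>om. (F.Y t om $ k)\<^sup>2 \<partial>M) = (\<integral>\<^sup>+om. ennreal ((F.Y t om $ k)\<^sup>2) \<partial>M)" using i by (intro nn_integral_eq_integral[symmetric]) auto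
   also have "\<dots> \<le> (\<integral>\<^sup>+om. ennreal (F.Y t om \<bullet> F.Y t om) \<partial>M)"
    using F.Ydims(1) k by (intro nn_integral_mono ennreal_leI comp_le_sp_self) auto
   also have "\<dots> = (\<integral>\<^sup>+om. ennreal (env_process g x0 w xi s t om \<bullet> env_process g x0 w xi s t om) \<partial>M)"
    by (rule nn_integral_cong_AE) (use tr(1) in \<open>eventually_elim, simp\<close>)
   also have "\<dots> \<le> C" unfolding C_def by (rule SUP_upper) simp
   also have "C = ennreal (enn2real C)" using C by simp
   finally show ?thesis by (subst (asm) ennreal_le_iff) auto
  qed
  then show thesis by (rule that)
 qed
 have S: "sebeu g M x0 w xi (est_strategy g ew a b filt)" unfolding filt' by (rule F.filter_sebeu[OF B])
 have "AE Y in env_law g M x0 w xi s. \<forall>i\<in>{1..nDM g}. \<forall>t x u.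
   s i t (info t x u Y) = cF g i *\<^sub>v x t + lim_G g a i *\<^sub>v filt t Y + lim_H g ew b i"
  unfolding tr(2) using tr(3)
 proof eventually_elim
  case (elim z)
  then have H: "h t (restrict z {..<t}) = filt t z" for t unfolding filt' by blast
  show ?case by (auto simp only: s est_strategy_def info_def prod.case H restrict_apply atMost_iff order_refl if_True)
 qed
 then show ?thesis using tr(4)[OF S[unfolded filt']] S by blast
qed

end
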